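(* Let $S$ be a set of $4$-permutations. The set $S$ is $\Sigma$-forcing if and only if $S$ is one of the following five sets \begin{itemize} \item $\{1234,1243,2134,2143,3412,3421,4312,4321\}$, \item $\{1234,1432,2143,2341,3214,3412,4123,4321\}$, \item $\{1324,1342,2413,2431,3124,3142,4213,4231\}$, \item $\{1324,1423,2314,2413,3142,3241,4132,4231\}$, \item $\{1234,1243,1432,2134,2143,2341,3214,3412,3421,4123,4312,4321\}$, \end{itemize} or the complement of one of these five sets in the set of all $4$-permutations.
   Context: Write $[n]=\{1,\ldots,n\}$. A $k$-permutation (permutation of order $k$) is a bijection $\pi:[k]\to[k]$, written as the word $\pi(1)\pi(2)\ldots\pi(k)$; its order is $|\pi|=k$. If $A=\{a_1<\cdots<a_\ell\}\subseteq[k]$, the subpermutation of $\pi$ induced by $A$ is the unique permutation $\pi'$ of order $\ell$ such that $\pi'(i)<\pi'(j)$ if and only if $\pi(a_i)<\pi(a_j)$ for all $i,j\in[\ell]$. The pattern density $d(\pi,\Pi)$ of $\pi$ in a permutation $\Pi$ of order $n\ge|\pi|$ is the probability that the subpermutation of $\Pi$ induced by a uniformly random $|\pi|$-element subset of $[n]$ is $\pi$; if $|\Pi|<|\pi|$, then $d(\pi,\Pi)=0$. All sequences $\{\Pi_i\}_{i\in\mathbb{N}}$ of permutations considered satisfy $|\Pi_i|\to\infty$. Such a sequence is quasirandom if $\lim_{i\to\infty}d(\pi,\Pi_i)=\frac{1}{|\pi|!}$ for every permutation $\pi$. A set $S$ of $k$-permutations is $\Sigma$-forcing if the following holds: a sequence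 $\{\Pi_i\}_{i\in\mathbb{N}}$ of permutations (with $|\Pi_i|\to\infty$) is quasirandom if and only if $\lim_{i\to\infty}\sum_{\pi\in S}d(\pi,\Pi_i)=\frac{|S|}{k!}$. *)

theory Defs
  imports Complex_Main "HOL-Combinatorics.Multiset_Permutations"
begin

text \<open>
  A permutation \<pi> of order \<open>k\<close> is represented by its word \<open>[\<pi>(1), \<dots>, \<pi>(k)]\<close>; its order is the
  length of the list. Positions and values both range over \<open>{1..k}\<close>, so the value \<pi>(i) is
  entry \<open>i - 1\<close> of the list.
\<close>

definition perms :: "nat \<Rightarrow> nat list set" where
  "perms k = permutations_of_set {1..k}"

definition perm_app :: "nat list \<Rightarrow> nat \<Rightarrow> nat" where
  "perm_app w i = w ! (i - 1)"

lemma length_perms: "w \<in> perms k \<Longrightarrow> length w = k"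
  unfolding perms_def using length_finite_permutations_of_set by fastforce

lemma perms_iff_bij_betw:
  "w \<in> perms k \<longleftrightarrow> length w = k \<and> bij_betw (perm_app w) {1..k} {1..k}"
proof -
  have img: "perm_app w ` {1..length w} = set w"
  proof -
    have "perm_app w ` {1..length w} = perm_app w ` Suc ` {..<length w}"
      by (simp add: image_Suc_lessThan)
    also have "\<dots> = (!) w ` {..<length w}"
      by (simp add: image_image perm_app_def)
    finally show ?thesis
      by (auto simp: set_conv_nth)
  qed
  have inj: "inj_on (perm_app w) {1..length w} \<longleftrightarrow> distinct w"
    unfolding inj_on_iff_eq_card[OF finite_atLeastAtMost] img
    using card_distinct[of w] distinct_card[of w] by auto
  show ?thesis
  proof (cases "length w = k")
    case True
    then show ?thesis
      using img inj by (auto simp: perms_def permutations_of_set_def bij_betw_def)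
  next
    case False
    then show ?thesis
      using length_perms by blast
  qed
qed

text \<open>With \<open>A = {a\<^sub>1 < \<dots> < a\<^sub>l}\<close>, the list \<open>sorted_list_of_set A\<close> is \<open>[a\<^sub>1, \<dots>, a\<^sub>l]\<close>.\<close>

definition is_subperm :: "nat list \<Rightarrow> nat set \<Rightarrow> nat list \<Rightarrow> bool" where
  "is_subperm P A p \<longleftrightarrow> p \<in> perms (card A) \<and>
     (\<forall>i\<in>{1..card A}. \<forall>j\<in>{1..card A}.
        perm_app p i < perm_app p j \<longleftrightarrow>
        perm_app P (sorted_list_of_set A ! (i - 1)) < perm_app P (sorted_list_of_set A ! (j - 1)))"

definition subperm :: "nat list \<Rightarrow> nat set \<Rightarrow> nat list" where
  "subperm P A = (THE p. is_subperm P A p)"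

lemma ex1_is_subperm:
  assumes P: "P \<in> perms n" and A: "A \<subseteq> {1..n}"
  shows "\<exists>!p. is_subperm P A p"
proof -
  define l where "l = card A"
  define v where "v = (\<lambda>i. perm_app P (sorted_list_of_set A ! (i - 1)))"
  define r where "r = (\<lambda>i. card {j\<in>{1..l}. v j \<le> v i})"
  have fin: "finite A"
    using A finite_subset by blast
  have injP: "inj_on (perm_app P) {1..n}"
    using P by (simp add: perms_iff_bij_betw bij_betw_def)
  have mem: "sorted_list_of_set A ! (i - 1) \<in> A" if "i \<in> {1..l}" for i
  proof -
    have "sorted_list_of_set A ! (i - 1) \<in> set (sorted_list_of_set A)"
      using that by (intro nth_mem) (auto simp: l_def)
    then show ?thesis
      using fin by simp
  qed
  have injv: "inj_on v {1..l}"
  proof (rule inj_onI)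
    fix i j assume ij: "i \<in> {1..l}" "j \<in> {1..l}" "v i = v j"
    have "perm_app P (sorted_list_of_set A ! (i - 1)) = perm_app P (sorted_list_of_set A ! (j - 1))"
      using ij by (simp add: v_def)
    then have "sorted_list_of_set A ! (i - 1) = sorted_list_of_set A ! (j - 1)"
      by (rule inj_onD[OF injP]) (use ij mem A in blast)+
    then have "i - 1 = j - 1"
      using ij fin by (subst (asm) nth_eq_iff_index_eq) (auto simp: l_def)
    then show "i = j"
      using ij by auto
  qed
  have r_less: "r i < r j" if "i \<in> {1..l}" "j \<in> {1..l}" "v i < v j" for i j
  proof -
    have "{m\<in>{1..l}. v m \<le> v i} \<subseteq> {m\<in>{1..l}. v m \<le> v j}"
      using that by auto
    moreover have "j \<in> {m\<in>{1..l}. v m \<le> v j} - {m\<in>{1..l}. v m \<le> v i}"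
      using that by auto
    ultimately show ?thesis
      unfolding r_def by (intro psubset_card_mono) auto
  qed
  have r_iff: "r i < r j \<longleftrightarrow> v i < v j" if "i \<in> {1..l}" "j \<in> {1..l}" for i j
  proof (cases "v i" "v j" rule: linorder_cases)
    case equal
    then have "i = j"
      using inj_onD[OF injv] that by blast
    then show ?thesis
      by simp
  qed (use r_less[of i j] r_less[of j i] that in auto)
  have injr: "inj_on r {1..l}"
  proof (rule inj_onI)
    fix i j assume ij: "i \<in> {1..l}" "j \<in> {1..l}" "r i = r j"
    then have "v i = v j"
      using r_less[of i j] r_less[of j i] by (metis less_irrefl linorder_neqE_nat)
    then show "i = j"
      using inj_onD[OF injv] ij by blast
  qed
  have rng: "r ` {1..l} \<subseteq> {1..l}"
  proof clarify
    fix i assume i: "i \<in> {1..l}"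
    have "r i \<le> card {1..l}"
      unfolding r_def by (rule card_mono) auto
    moreover have "0 < r i"
      unfolding r_def by (subst card_gt_0_iff) (use i in auto)
    ultimately show "r i \<in> {1..l}"
      by simp
  qed
  have bij: "bij_betw r {1..l} {1..l}"
    using injr rng by (simp add: bij_betw_def endo_inj_surj)
  define p where "p = map r [1..<Suc l]"
  have p_app: "perm_app p i = r i" if "i \<in> {1..l}" for i
    using that unfolding p_def perm_app_def by (auto simp del: upt_Suc)
  have "p \<in> perms l"
    using bij bij_betw_cong[of "{1..l}" "perm_app p" r] p_app
    by (simp add: perms_iff_bij_betw p_def del: upt_Suc)
  then have ex: "is_subperm P A p"
    unfolding is_subperm_def l_def[symmetric]
    using r_iff unfolding v_def by (auto simp: p_app)
  have uniq: "q = p" if q: "is_subperm P A q" for q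
  proof -
    have qp: "q \<in> perms l"
      using q by (simp add: is_subperm_def l_def)
    then have qb: "bij_betw (perm_app q) {1..l} {1..l}" and ql: "length q = l"
      by (simp_all add: perms_iff_bij_betw)
    have q_app: "perm_app q i = r i" if i: "i \<in> {1..l}" for i
    proof -
      have le: "v j \<le> v i \<longleftrightarrow> perm_app q j \<le> perm_app q i" if "j \<in> {1..l}" for j
      proof -
        have "perm_app q i < perm_app q j \<longleftrightarrow> v i < v j"
          using q that i unfolding is_subperm_def l_def[symmetric] v_def by blast
        then show ?thesis
          by (simp add: linorder_not_less[symmetric])
      qed
      have im: "perm_app q ` {1..l} = {1..l}"
        using qb by (simp add: bij_betw_def)
      have "perm_app q i \<in> {1..l}"
        using i im by blast
      have "perm_app q ` {j\<in>{1..l}. perm_app q j \<le> perm_app q i} =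
          {y \<in> perm_app q ` {1..l}. y \<le> perm_app q i}"
        by blast
      also have "\<dots> = {1..perm_app q i}"
        unfolding im using \<open>perm_app q i \<in> {1..l}\<close> by auto
      finally have img:
        "perm_app q ` {j\<in>{1..l}. perm_app q j \<le> perm_app q i} = {1..perm_app q i}" .
      have "{j\<in>{1..l}. v j \<le> v i} = {j\<in>{1..l}. perm_app q j \<le> perm_app q i}"
        using le by auto
      then have "card {j\<in>{1..l}. v j \<le> v i} = card {j\<in>{1..l}. perm_app q j \<le> perm_app q i}"
        by (rule arg_cong)
      also have "\<dots> = card (perm_app q ` {j\<in>{1..l}. perm_app q j \<le> perm_app q i})"
        by (rule card_image[symmetric], rule inj_on_subset[OF bij_betw_imp_inj_on[OF qb]]) blast
      also have "\<dots> = perm_app q i"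
        unfolding img by simp
      finally show ?thesis
        unfolding r_def by simp
    qed
    show ?thesis
    proof (rule nth_equalityI)
      show "length q = length p"
        using ql by (simp add: p_def)
      show "q ! i = p ! i" if "i < length q" for i
        using q_app[of "Suc i"] p_app[of "Suc i"] that ql by (simp add: perm_app_def)
    qed
  qed
  show ?thesis
    using ex uniq by blast
qed

definition pattern_density :: "nat list \<Rightarrow> nat list \<Rightarrow> real" where
  "pattern_density p P =
     (if length P < length p then 0
      else real (card {A. A \<subseteq> {1..length P} \<and> card A = length p \<and> subperm P A = p})
           / real (card {A. A \<subseteq> {1..length P} \<and> card A = length p}))"

definition perm_seq :: "(nat \<Rightarrow> nat list) \<Rightarrow> bool" where
  "perm_seq X \<longleftrightarrow> (\<forall>i. X i \<in> perms (length (X i))) \<and>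
     filterlim (\<lambda>i. length (X i)) at_top sequentially"

definition quasirandom :: "(nat \<Rightarrow> nat list) \<Rightarrow> bool" where
  "quasirandom X \<longleftrightarrow>
     (\<forall>k. \<forall>p\<in>perms k. (\<lambda>i. pattern_density p (X i)) \<longlonglongrightarrow> 1 / fact k)"

definition Sigma_forcing :: "nat \<Rightarrow> nat list set \<Rightarrow> bool" where
  "Sigma_forcing k S \<longleftrightarrow>
     (\<forall>X. perm_seq X \<longrightarrow>
        (quasirandom X \<longleftrightarrow>
         (\<lambda>i. \<Sum>p\<in>S. pattern_density p (X i)) \<longlonglongrightarrow> real (card S) / fact k))"

end

theory Submission
  imports Defs "HOL-Library.FuncSet" "HOL-Combinatorics.Permutations"
begin

text \<open>
  For sufficiency, split the four points of a pattern into two pairs. The number of patterns in each of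
  the five sets is, up to lower order terms, a positive combination of sums of squares measuring the
  deviation of the counts of points in rectangles from their expected values, so that a limit density
  equal to that of a random permutation forces all deviations to vanish.

  For necessity, replace \<open>S\<close> by its complement if necessary, so that it contains the identity. A random
  permutation sampled from a weighted model (finitely many increasing, decreasing or random blobs)
  contains patterns of \<open>S\<close> with an expected density that is a polynomial in the weights. If this density
  is less than \<open>card S / 24\<close> for some model, then interpolating from a permutation sampled from the model to the
  identity, which has density 1, gives a sequence of non-quasirandom permutations whose density is
  exactly that of a random one. Blobs on the four sides of a random square show that the first, the last,
  the least and the greatest entries of the members of \<open>S\<close> are uniformly distributed, which leaves 653 sets;
  all but five of them are excluded by explicit models.
\<close>

text \<open>Two pairs of points on a line are separated, crossing or nested, and among the three
  splits of four points into pairs each kind occurs once. Each set of eight patterns requires a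
  common split that is separated or crossing in positions, and separated or crossing in values,
  which has probability 1/3 at random. Requiring the same kind in both orders raises the density,
  different kinds lower it, and each deviation dominates one mean square \<open>rho\<close>, built
  from a kernel centred in both arguments. The obstacle is the set of twelve patterns: its indicator
  combines the other four with the signature of the pattern, and the signature term is not a sum of
  squares. The squares of the other four absorb it (\<open>quadratic_form_bound\<close>). For
  necessity, the interpolants are direct sums whose cut stays away from both ends; such permutations
  have too many points in a corner to be quasirandom. A perturbation at the boundary yields a
  one-sided inequality for each height, and equality is extracted from the fact that the average
  over all heights is already tight.\<close>

section \<open>Standardization and counts of patterns\<close>

definition std :: "'a::linorder list \<Rightarrow> nat list" where
  "std vs = map (\<lambda>x. card {y \<in> set vs. y \<le> x}) vs"

lemma length_std [simp]: "length (std vs) = length vs"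
  by (simp add: std_def)

lemma std_nth_less_iff:
  assumes "i < length vs" "j < length vs"
  shows "std vs ! i < std vs ! j \<longleftrightarrow> vs ! i < vs ! j"
proof -
  have *: "card {y \<in> set vs. y \<le> a} < card {y \<in> set vs. y \<le> b}"
    if "a < b" "b \<in> set vs" for a b
  proof (rule psubset_card_mono)
    have "b \<in> {y \<in> set vs. y \<le> b}" "b \<notin> {y \<in> set vs. y \<le> a}" using that by auto
    then show "{y \<in> set vs. y \<le> a} \<subset> {y \<in> set vs. y \<le> b}" using that(1) by force
  qed simp
  show ?thesis
    using assms *[of "vs!i" "vs!j"] *[of "vs!j" "vs!i"]
    by (cases "vs!i" "vs!j" rule: linorder_cases) (auto simp: std_def)
qed

lemma std_in_perms:
  assumes "distinct vs"
  shows "std vs \<in> perms (length vs)"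
proof -
  let ?k = "length vs"
  have inj: "inj_on (\<lambda>x. card {y \<in> set vs. y \<le> x}) (set vs)"
  proof (rule inj_onI)
    fix a b assume "a \<in> set vs" "b \<in> set vs"
      and eq: "card {y \<in> set vs. y \<le> a} = card {y \<in> set vs. y \<le> b}"
    then obtain i j where ij: "i < ?k" "j < ?k" "a = vs ! i" "b = vs ! j"
      by (auto simp: in_set_conv_nth)
    then have "std vs ! i = std vs ! j" using eq by (simp add: std_def)
    then show "a = b" using std_nth_less_iff[of i vs j] std_nth_less_iff[of j vs i] ij
      by (metis less_irrefl linorder_neqE)
  qed
  have d: "distinct (std vs)" using assms inj by (simp add: std_def distinct_map)
  have sub: "set (std vs) \<subseteq> {1..?k}"
  proof
    fix r assume "r \<in> set (std vs)"
    then obtain x where x: "x \<in> set vs" "r = card {y \<in> set vs. y \<le> x}" by (auto simp: std_def)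
    have "r \<le> card (set vs)" unfolding x(2) by (rule card_mono) auto
    moreover have "0 < r" unfolding x(2) using x(1) by (subst card_gt_0_iff) auto
    ultimately show "r \<in> {1..?k}" using card_length[of vs] by auto
  qed
  have "set (std vs) = {1..?k}"
    by (rule card_subset_eq[OF _ sub]) (simp_all add: distinct_card[OF d])
  then show ?thesis using d by (simp add: perms_def permutations_of_set_def)
qed

text \<open>An entry of a permutation of \<open>{1..k}\<close> equals the number of entries that do
  not exceed it, so the comparisons between entries determine the word.\<close>

lemma perms_eqI:
  assumes "p \<in> perms k" "q \<in> perms k"
    and "\<And>i j. i < k \<Longrightarrow> j < k \<Longrightarrow> p ! i < p ! j \<longleftrightarrow> q ! i < q ! j"
  shows "p = q"
proof -
  have len: "length p = k" "length q = k" using assms length_perms by auto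
  have set: "set p = {1..k}" "distinct p" "set q = {1..k}" "distinct q"
    using assms by (auto simp: perms_def permutations_of_set_def)
  have val: "r ! i = card {j. j < k \<and> r ! j \<le> r ! i}"
    if "r \<in> perms k" "i < k" for r i
  proof -
    have r: "length r = k" "set r = {1..k}" "distinct r"
      using that length_perms by (auto simp: perms_def permutations_of_set_def)
    have "r ! i \<in> set r" using that r(1) by auto
    then have "1 \<le> r ! i" "r ! i \<le> k" using r(2) by auto
    have "(!) r ` {j. j < k \<and> r ! j \<le> r ! i} = {x \<in> set r. x \<le> r ! i}"
      using r(1) by (auto simp: in_set_conv_nth)
    also have "\<dots> = {1..r ! i}" using r(2) \<open>r ! i \<le> k\<close> by auto
    finally have "card ((!) r ` {j. j < k \<and> r ! j \<le> r ! i}) = r ! i" by simp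
    moreover have "inj_on ((!) r) {j. j < k \<and> r ! j \<le> r ! i}"
      using r by (auto simp: inj_on_def nth_eq_iff_index_eq)
    ultimately show ?thesis by (simp add: card_image)
  qed
  show ?thesis
  proof (rule nth_equalityI)
    show "length p = length q" by (simp add: len)
    fix i assume "i < length p"
    then have i: "i < k" by (simp add: len)
    have "{j. j < k \<and> p ! j \<le> p ! i} = {j. j < k \<and> q ! j \<le> q ! i}"
      using assms(3)[OF i] by (auto simp: not_less[symmetric])
    then show "p ! i = q ! i" using val[OF assms(1) i] val[OF assms(2) i] by simp
  qed
qed

lemma std_eqI:
  assumes "distinct vs" "p \<in> perms (length vs)"
    and "\<And>i j. i < length vs \<Longrightarrow> j < length vs \<Longrightarrow> p ! i < p ! j \<longleftrightarrow> vs ! i < vs ! j"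
  shows "std vs = p"
  by (rule perms_eqI[OF std_in_perms[OF assms(1)] assms(2)]) (simp add: std_nth_less_iff assms(3))

lemma std_cong:
  assumes "distinct vs" "distinct ws" "length vs = length ws"
    and "\<And>i j. i < length vs \<Longrightarrow> j < length vs \<Longrightarrow> vs ! i < vs ! j \<longleftrightarrow> ws ! i < ws ! j"
  shows "std vs = std ws"
  using std_in_perms[OF assms(2)] assms
  by (intro std_eqI) (auto simp: std_nth_less_iff)

lemma subperm_eq_std:
  assumes P: "P \<in> perms n" and A: "A \<subseteq> {1..n}"
  shows "subperm P A = std (map (perm_app P) (sorted_list_of_set A))"
proof -
  let ?vs = "map (perm_app P) (sorted_list_of_set A)"
  have fin: "finite A" using A finite_subset by blast
  have "inj_on (perm_app P) {1..n}" using P by (simp add: perms_iff_bij_betw bij_betw_def)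
  then have "inj_on (perm_app P) A" using A inj_on_subset by blast
  then have d: "distinct ?vs" using fin by (simp add: distinct_map)
  have len: "length ?vs = card A" using fin by simp
  have "is_subperm P A (std ?vs)"
    unfolding is_subperm_def
  proof (intro conjI ballI)
    show "std ?vs \<in> perms (card A)" using std_in_perms[OF d] len by simp
    fix i j assume ij: "i \<in> {1..card A}" "j \<in> {1..card A}"
    then have "i - 1 < length ?vs" "j - 1 < length ?vs" using len by auto
    then show "perm_app (std ?vs) i < perm_app (std ?vs) j \<longleftrightarrow>
        perm_app P (sorted_list_of_set A ! (i - 1)) < perm_app P (sorted_list_of_set A ! (j - 1))"
      using std_nth_less_iff[of "i - 1" ?vs "j - 1"] by (simp add: perm_app_def)
  qed
  then show ?thesis
    unfolding subperm_def using ex1_is_subperm[OF P A] by (intro the1_equality)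
qed

text \<open>Positions are zero-based and values lie in any linear order, so that interpolants and
  sampling keys can be used without being renumbered.\<close>

definition patt :: "(nat \<Rightarrow> 'a::linorder) \<Rightarrow> nat set \<Rightarrow> nat list" where
  "patt y B = std (map y (sorted_list_of_set B))"

definition pcount :: "nat \<Rightarrow> nat list set \<Rightarrow> (nat \<Rightarrow> 'a::linorder) \<Rightarrow> nat \<Rightarrow> nat" where
  "pcount k S y n = card {B. B \<subseteq> {..<n} \<and> card B = k \<and> patt y B \<in> S}"

lemma distinct_map_sorted_list_of_set:
  fixes y :: "nat \<Rightarrow> 'a"
  assumes "inj_on y {..<n}" "B \<subseteq> {..<n}"
  shows "distinct (map y (sorted_list_of_set B))"
proof -
  have "finite B" using assms(2) finite_subset by blast
  then show ?thesis using inj_on_subset[OF assms] by (simp add: distinct_map)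
qed

lemma patt_in_perms:
  assumes "inj_on y {..<n}" "B \<subseteq> {..<n}"
  shows "patt y B \<in> perms (card B)"
  using std_in_perms[OF distinct_map_sorted_list_of_set[OF assms]]
  by (simp add: patt_def)

lemma patt_cong:
  assumes "inj_on y {..<n}" "inj_on y' {..<n}" "B \<subseteq> {..<n}"
    and "\<And>i j. i \<in> B \<Longrightarrow> j \<in> B \<Longrightarrow> y i < y j \<longleftrightarrow> y' i < y' j"
  shows "patt y B = patt y' B"
  unfolding patt_def
proof (rule std_cong)
  show "distinct (map y (sorted_list_of_set B))" "distinct (map y' (sorted_list_of_set B))"
    by (rule distinct_map_sorted_list_of_set[OF assms(1,3)], rule distinct_map_sorted_list_of_set[OF assms(2,3)])
  have fin: "finite B" using assms(3) finite_subset by blast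
  fix i j assume "i < length (map y (sorted_list_of_set B))" "j < length (map y (sorted_list_of_set B))"
  then have "sorted_list_of_set B ! i \<in> B" "sorted_list_of_set B ! j \<in> B"
    using nth_mem[of _ "sorted_list_of_set B"] fin by auto
  then show "(map y (sorted_list_of_set B) ! i < map y (sorted_list_of_set B) ! j) =
      (map y' (sorted_list_of_set B) ! i < map y' (sorted_list_of_set B) ! j)"
    using assms(4) \<open>i < _\<close> \<open>j < _\<close> by simp
qed simp

lemma inj_on_nth_perms: "P \<in> perms n \<Longrightarrow> inj_on ((!) P) {..<n}"
  using length_perms[of P n] by (auto simp: perms_def permutations_of_set_def inj_on_def nth_eq_iff_index_eq)


lemma sorted_list_of_set_strict_mono_image:
  fixes f :: "'a::linorder \<Rightarrow> 'b::linorder"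
  assumes "finite A" "\<And>a b. a \<in> A \<Longrightarrow> b \<in> A \<Longrightarrow> a < b \<Longrightarrow> f a < f b"
  shows "sorted_list_of_set (f ` A) = map f (sorted_list_of_set A)"
proof (rule sorted_distinct_set_unique)
  have inj: "inj_on f A"
  proof (rule inj_onI)
    fix a b assume "a \<in> A" "b \<in> A" "f a = f b"
    then show "a = b" using assms(2)[of a b] assms(2)[of b a] by (cases a b rule: linorder_cases) auto
  qed
  show "distinct (map f (sorted_list_of_set A))"
    using inj assms(1) by (simp add: distinct_map)
  have mono: "f a \<le> f b" if "a \<in> A" "b \<in> A" "a \<le> b" for a b
    using assms(2)[OF that(1,2)] that(3) by (auto simp: le_less)
  have "sorted_wrt (\<lambda>x y. f x \<le> f y) (sorted_list_of_set A)"
    by (rule sorted_wrt_mono_rel[OF _ sorted_sorted_list_of_set]) (use assms(1) mono in auto)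
  then show "sorted (map f (sorted_list_of_set A))"
    by (simp add: sorted_wrt_map)
qed (use assms(1) in auto)

lemma card_subset_image_filter:
  fixes f :: "'a \<Rightarrow> 'b"
  assumes "bij_betw f X Y"
  shows "card {A. A \<subseteq> Y \<and> Q A} = card {B. B \<subseteq> X \<and> Q (f ` B)}"
proof (rule bij_betw_same_card[symmetric])
  have inj: "inj_on f X" and im: "f ` X = Y" using assms by (auto simp: bij_betw_def)
  show "bij_betw ((`) f) {B. B \<subseteq> X \<and> Q (f ` B)} {A. A \<subseteq> Y \<and> Q A}"
    unfolding bij_betw_def
  proof
    show "inj_on ((`) f) {B. B \<subseteq> X \<and> Q (f ` B)}"
      by (rule inj_onI) (use inj in \<open>auto simp: inj_on_image_eq_iff\<close>)
    show "(`) f ` {B. B \<subseteq> X \<and> Q (f ` B)} = {A. A \<subseteq> Y \<and> Q A}"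
    proof (intro equalityI subsetI)
      fix A assume "A \<in> {A. A \<subseteq> Y \<and> Q A}"
      then have A: "A \<subseteq> f ` X" "Q A" using im by simp_all
      from A(1) obtain B where B: "B \<subseteq> X" "A = f ` B" unfolding subset_image_iff by (elim exE conjE)
      have "B \<in> {B. B \<subseteq> X \<and> Q (f ` B)}" using A B by simp
      then show "A \<in> (`) f ` {B. B \<subseteq> X \<and> Q (f ` B)}" using B(2) by (intro image_eqI)
    next
      fix A assume "A \<in> (`) f ` {B. B \<subseteq> X \<and> Q (f ` B)}"
      then obtain B where "B \<subseteq> X" "Q (f ` B)" "A = f ` B" by (elim imageE CollectE conjE)
      then show "A \<in> {A. A \<subseteq> Y \<and> Q A}" using im image_mono[of B X f] by simp
    qed
  qed
qed

text \<open>Position sets inducing different patterns are different, so the densities of the members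
  of \<open>S\<close> add up to a single count; \<open>Suc\<close> translates between the two
  numberings of positions.\<close>

lemma sum_pattern_density:
  assumes P: "P \<in> perms n" and S: "S \<subseteq> perms k" and k: "k \<le> n"
  shows "(\<Sum>p\<in>S. pattern_density p P) = real (pcount k S ((!) P) n) / real (n choose k)"
proof -
  have len: "length P = n" using P length_perms by blast
  have finS: "finite S" using S by (rule finite_subset) (simp add: perms_def)
  let ?N = "\<lambda>p. {A. A \<subseteq> {1..n} \<and> card A = k \<and> subperm P A = p}"
  have fin: "finite (?N p)" for p
    by (rule finite_subset[of _ "Pow {1..n}"]) auto
  have "(\<Sum>p\<in>S. pattern_density p P) = (\<Sum>p\<in>S. real (card (?N p)) / real (n choose k))"
  proof (rule sum.cong[OF refl])
    fix p assume "p \<in> S"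
    then have "length p = k" using S length_perms by blast
    then show "pattern_density p P = real (card (?N p)) / real (n choose k)"
      using k n_subsets[of "{1..n}" k] by (simp add: pattern_density_def len)
  qed
  also have "\<dots> = real (\<Sum>p\<in>S. card (?N p)) / real (n choose k)"
    by (simp add: sum_divide_distrib)
  also have "(\<Sum>p\<in>S. card (?N p)) = card (\<Union>p\<in>S. ?N p)"
    by (rule card_UN_disjoint[symmetric]) (use finS fin in auto)
  also have "(\<Union>p\<in>S. ?N p) = {A. A \<subseteq> {1..n} \<and> (card A = k \<and> subperm P A \<in> S)}" by auto
  also have "card \<dots> = card {B. B \<subseteq> {..<n} \<and> (card (Suc ` B) = k \<and> subperm P (Suc ` B) \<in> S)}"
    by (rule card_subset_image_filter) (auto simp: bij_betw_def image_Suc_lessThan)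
  also have "{B. B \<subseteq> {..<n} \<and> (card (Suc ` B) = k \<and> subperm P (Suc ` B) \<in> S)} =
      {B. B \<subseteq> {..<n} \<and> card B = k \<and> patt ((!) P) B \<in> S}"
  proof (rule Collect_cong, rule conj_cong[OF refl])
    fix B assume B: "B \<subseteq> {..<n}"
    then have fin: "finite B" using finite_subset by blast
    have "Suc ` B \<subseteq> {1..n}" using B by auto
    then have "subperm P (Suc ` B) = patt ((!) P) B"
      using sorted_list_of_set_strict_mono_image[OF fin, of Suc]
      by (simp add: subperm_eq_std[OF P] patt_def perm_app_def comp_def)
    then show "(card (Suc ` B) = k \<and> subperm P (Suc ` B) \<in> S) = (card B = k \<and> patt ((!) P) B \<in> S)"
      by (simp add: card_image)
  qed
  finally show ?thesis by (simp add: pcount_def)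
qed

lemma pcount_le: "pcount k S y n \<le> n choose k"
proof -
  have "pcount k S y n \<le> card {B. B \<subseteq> {..<n} \<and> card B = k}"
    unfolding pcount_def by (rule card_mono[OF finite_subset[of _ "Pow {..<n}"]]) auto
  then show ?thesis using n_subsets[of "{..<n}" k] by simp
qed

lemma finite_perms [simp]: "finite (perms k)"
  by (simp add: perms_def)

lemma card_perms [simp]: "card (perms k) = fact k"
  by (simp add: perms_def)

lemma pcount_perms:
  assumes "inj_on y {..<n}"
  shows "pcount k (perms k) y n = n choose k"
proof -
  have "{B. B \<subseteq> {..<n} \<and> card B = k \<and> patt y B \<in> perms k} = {B. B \<subseteq> {..<n} \<and> card B = k}"
    using patt_in_perms[OF assms] by auto
  then show ?thesis using n_subsets[of "{..<n}" k] by (simp add: pcount_def)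
qed

section \<open>Averages over tuples of indices\<close>

text \<open>With averages instead of sums a dummy variable costs nothing, and iterated averages read
  as expectations over independent uniform indices.\<close>

definition avg :: "nat \<Rightarrow> (nat \<Rightarrow> real) \<Rightarrow> real" where
  "avg n f = (\<Sum>i<n. f i) / real n"

lemma avg_add: "avg n (\<lambda>i. f i + g i) = avg n f + avg n g"
  by (simp add: avg_def sum.distrib add_divide_distrib)

lemma avg_diff: "avg n (\<lambda>i. f i - g i) = avg n f - avg n g"
  by (simp add: avg_def sum_subtractf diff_divide_distrib)

lemma avg_minus: "avg n (\<lambda>i. - f i) = - avg n f"
  by (simp add: avg_def sum_negf)

lemma avg_mult_left: "avg n (\<lambda>i. c * f i) = c * avg n f"
  by (simp add: avg_def sum_distrib_left)

lemma avg_mult_right: "avg n (\<lambda>i. f i * c) = avg n f * c"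
  by (simp add: avg_def sum_distrib_right)

lemma avg_divide: "avg n (\<lambda>i. f i / c) = avg n f / c"
  by (simp add: avg_def sum_divide_distrib mult.commute)

lemma avg_const: "0 < n \<Longrightarrow> avg n (\<lambda>i. c) = c"
  by (simp add: avg_def)

lemma avg_0 [simp]: "avg n (\<lambda>i. 0) = 0"
  by (simp add: avg_def)

lemma avg_swap: "avg n (\<lambda>i. avg n (\<lambda>j. f i j)) = avg n (\<lambda>j. avg n (\<lambda>i. f i j))"
  unfolding avg_def using sum.swap[of f "{..<n}" "{..<n}"]
  by (simp add: sum_divide_distrib[symmetric])

lemma avg_cong: "(\<And>i. i < n \<Longrightarrow> f i = g i) \<Longrightarrow> avg n f = avg n g"
  by (simp add: avg_def)

lemma avg_mono: "(\<And>i. i < n \<Longrightarrow> f i \<le> g i) \<Longrightarrow> avg n f \<le> avg n g"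
  unfolding avg_def by (intro divide_right_mono sum_mono) auto

lemma avg_nonneg: "(\<And>i. i < n \<Longrightarrow> 0 \<le> f i) \<Longrightarrow> 0 \<le> avg n f"
  using avg_mono[of n "\<lambda>_. 0" f] by simp

lemma abs_avg_le: "\<bar>avg n f\<bar> \<le> avg n (\<lambda>i. \<bar>f i\<bar>)"
  by (simp add: avg_def abs_divide divide_right_mono sum_abs)

lemma abs_avg_bound:
  assumes "0 < n" "\<And>i. i < n \<Longrightarrow> \<bar>f i\<bar> \<le> c"
  shows "\<bar>avg n f\<bar> \<le> c"
  using order_trans[OF abs_avg_le avg_mono[of n "\<lambda>i. \<bar>f i\<bar>" "\<lambda>_. c"]] assms
  by (simp add: avg_const)

text \<open>The variance of \<open>f\<close> is nonnegative.\<close>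

lemma avg_power2_le: "(avg n f)\<^sup>2 \<le> avg n (\<lambda>i. (f i)\<^sup>2)"
proof (cases "n = 0")
  case False
  let ?m = "avg n f"
  have "0 \<le> avg n (\<lambda>i. (f i - ?m)\<^sup>2)" by (rule avg_nonneg) simp
  also have "avg n (\<lambda>i. (f i - ?m)\<^sup>2) = avg n (\<lambda>i. (f i)\<^sup>2 - 2 * ?m * f i + ?m\<^sup>2)"
    by (simp add: power2_diff algebra_simps)
  also have "\<dots> = avg n (\<lambda>i. (f i)\<^sup>2) - 2 * ?m * ?m + ?m\<^sup>2"
    using False by (simp add: avg_add avg_diff avg_mult_left avg_const)
  finally show ?thesis by (simp add: power2_eq_square)
qed (simp add: avg_def)

abbreviation avg2 :: "nat \<Rightarrow> (nat \<Rightarrow> nat \<Rightarrow> real) \<Rightarrow> real" where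
  "avg2 n f \<equiv> avg n (\<lambda>i. avg n (\<lambda>j. f i j))"

abbreviation avg3 :: "nat \<Rightarrow> (nat \<Rightarrow> nat \<Rightarrow> nat \<Rightarrow> real) \<Rightarrow> real" where
  "avg3 n f \<equiv> avg n (\<lambda>i. avg n (\<lambda>j. avg n (\<lambda>k. f i j k)))"

abbreviation avg4 :: "nat \<Rightarrow> (nat \<Rightarrow> nat \<Rightarrow> nat \<Rightarrow> nat \<Rightarrow> real) \<Rightarrow> real" where
  "avg4 n f \<equiv> avg n (\<lambda>i. avg n (\<lambda>j. avg n (\<lambda>k. avg n (\<lambda>l. f i j k l))))"

section \<open>Kernels and their correlations along a permutation\<close>

text \<open>The first argument of \<phi> is a threshold, the second a point; this is the covariance
  of two points once the threshold is averaged out.\<close>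

definition gram :: "nat \<Rightarrow> (nat \<Rightarrow> nat \<Rightarrow> real) \<Rightarrow> nat \<Rightarrow> nat \<Rightarrow> real" where
  "gram n \<phi> i j = avg n (\<lambda>u. \<phi> u i * \<phi> u j)"

text \<open>With \<phi> = \<open>si n\<close> this is the deviation of
  \<open>sg i k * sg j k * ksg n i j\<close> from its mean 1/3, up to O(1/n); see
  \<open>triple_approx\<close>.\<close>

definition triple :: "nat \<Rightarrow> (nat \<Rightarrow> nat \<Rightarrow> real) \<Rightarrow> nat \<Rightarrow> nat \<Rightarrow> nat \<Rightarrow> real" where
  "triple n \<phi> i j k = \<phi> k i * \<phi> k j + gram n \<phi> i j - gram n \<phi> i k - gram n \<phi> j k"

text \<open>With \<phi> = \<open>al n\<close> this is four times the deviation of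
  \<open>afun\<close>, the indicator of separated pairs, from its mean 1/3, up to O(1/n); see
  \<open>afun_approx\<close>.\<close>

definition quad :: "nat \<Rightarrow> (nat \<Rightarrow> nat \<Rightarrow> real) \<Rightarrow> nat \<Rightarrow> nat \<Rightarrow> nat \<Rightarrow> nat \<Rightarrow> real" where
  "quad n \<phi> i j k l = \<phi> k i * \<phi> k j + \<phi> l i * \<phi> l j + \<phi> i k * \<phi> i l + \<phi> j k * \<phi> j l
     - (gram n \<phi> i k + gram n \<phi> i l + gram n \<phi> j k + gram n \<phi> j l)"

lemma gram_commute: "gram n \<phi> i j = gram n \<phi> j i"
  by (simp add: gram_def mult.commute)

lemma avg_gram:
  assumes "\<And>u. u < n \<Longrightarrow> avg n (\<phi> u) = 0"
  shows "avg n (gram n \<phi> i) = 0" "avg n (\<lambda>j. gram n \<phi> j i) = 0"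
proof -
  have "avg n (\<lambda>j. gram n \<phi> i j) = avg n (\<lambda>u. avg n (\<lambda>j. \<phi> u i * \<phi> u j))"
    unfolding gram_def by (rule avg_swap)
  also have "\<dots> = avg n (\<lambda>u. 0)" using assms by (intro avg_cong) (simp add: avg_mult_left)
  finally show "avg n (gram n \<phi> i) = 0" by simp
  then show "avg n (\<lambda>j. gram n \<phi> j i) = 0" by (simp add: gram_commute[of n \<phi> _ i])
qed

lemma avg4_swap_pairs: "avg4 n F = avg4 n (\<lambda>k l i j. F i j k l)"
proof -
  have "avg4 n F = avg n (\<lambda>i. avg n (\<lambda>k. avg n (\<lambda>j. avg n (\<lambda>l. F i j k l))))"
    by (intro avg_cong avg_swap)
  also have "\<dots> = avg n (\<lambda>k. avg n (\<lambda>i. avg n (\<lambda>j. avg n (\<lambda>l. F i j k l))))"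
    by (rule avg_swap)
  also have "\<dots> = avg n (\<lambda>k. avg n (\<lambda>i. avg n (\<lambda>l. avg n (\<lambda>j. F i j k l))))"
    by (intro avg_cong avg_swap)
  also have "\<dots> = avg n (\<lambda>k. avg n (\<lambda>l. avg n (\<lambda>i. avg n (\<lambda>j. F i j k l))))"
    by (intro avg_cong avg_swap)
  finally show ?thesis .
qed

lemma avg4_swap34: "avg4 n F = avg4 n (\<lambda>i j l k. F i j k l)"
  by (intro avg_cong avg_swap)

lemma avg4_swap12: "avg4 n F = avg4 n (\<lambda>j i k l. F i j k l)"
  by (rule avg_swap)

lemma avg4_swap23: "avg4 n F = avg4 n (\<lambda>i k j l. F i j k l)"
  by (intro avg_cong avg_swap)

locale biperm =
  fixes n :: nat and p :: "nat \<Rightarrow> nat"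
  assumes n_pos: "0 < n" and bij: "bij_betw p {..<n} {..<n}"
begin

lemma p_less: "i < n \<Longrightarrow> p i < n"
  using bij by (auto simp: bij_betw_def)

lemma avg_p: "avg n (\<lambda>i. f (p i)) = avg n f"
  unfolding avg_def using sum.reindex_bij_betw[OF bij, of f] by simp

text \<open>With \<open>al n\<close> in both slots this is, up to O(1/n), four times the excess
  proportion of points in the rectangle cut off at \<open>(u, v)\<close>; see
  \<open>cnt_le_one\<close>.\<close>

definition corr :: "(nat \<Rightarrow> nat \<Rightarrow> real) \<Rightarrow> (nat \<Rightarrow> nat \<Rightarrow> real) \<Rightarrow> nat \<Rightarrow> nat \<Rightarrow> real" where
  "corr \<phi> \<psi> u v = avg n (\<lambda>i. \<phi> u i * \<psi> v (p i))"

text \<open>Thresholds range over the whole square here, but over the points \<open>(u, p u)\<close>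
  of the permutation in \<open>DD\<close>; expanding the four-point averages produces both.\<close>

definition RR :: "(nat \<Rightarrow> nat \<Rightarrow> real) \<Rightarrow> (nat \<Rightarrow> nat \<Rightarrow> real) \<Rightarrow> real" where
  "RR \<phi> \<psi> = avg2 n (\<lambda>u v. (corr \<phi> \<psi> u v)\<^sup>2)"

definition DD :: "(nat \<Rightarrow> nat \<Rightarrow> real) \<Rightarrow> (nat \<Rightarrow> nat \<Rightarrow> real) \<Rightarrow> real" where
  "DD \<phi> \<psi> = avg n (\<lambda>u. (corr \<phi> \<psi> u (p u))\<^sup>2)"

lemma RR_nonneg: "0 \<le> RR \<phi> \<psi>"
  unfolding RR_def by (intro avg_nonneg) simp

lemma DD_nonneg: "0 \<le> DD \<phi> \<psi>"
  unfolding DD_def by (intro avg_nonneg) simp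

lemma avg2_corr_square:
  "avg2 n (\<lambda>i j. (\<phi> u i * \<phi> u j) * (\<psi> v (p i) * \<psi> v (p j))) = (corr \<phi> \<psi> u v)\<^sup>2"
proof -
  have "avg2 n (\<lambda>i j. (\<phi> u i * \<phi> u j) * (\<psi> v (p i) * \<psi> v (p j))) =
      avg2 n (\<lambda>i j. (\<phi> u i * \<psi> v (p i)) * (\<phi> u j * \<psi> v (p j)))"
    by (simp add: mult_ac)
  then show ?thesis
    by (simp only: avg_mult_left avg_mult_right corr_def power2_eq_square)
qed

text \<open>With the averages over the thresholds moved outside, the average over \<open>i\<close>
  and \<open>j\<close> is a product of two equal averages.\<close>

lemma avg2_gram_gram: "avg2 n (\<lambda>i j. gram n \<phi> i j * gram n \<psi> (p i) (p j)) = RR \<phi> \<psi>"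
proof -
  have "avg2 n (\<lambda>i j. gram n \<phi> i j * gram n \<psi> (p i) (p j)) =
      avg n (\<lambda>i. avg n (\<lambda>j. avg n (\<lambda>u. avg n (\<lambda>v. (\<phi> u i * \<phi> u j) * (\<psi> v (p i) * \<psi> v (p j))))))"
    unfolding gram_def by (simp only: avg_mult_left avg_mult_right)
  also have "\<dots> = avg n (\<lambda>i. avg n (\<lambda>u. avg n (\<lambda>j. avg n (\<lambda>v. (\<phi> u i * \<phi> u j) * (\<psi> v (p i) * \<psi> v (p j))))))"
    by (subst avg_swap) (rule refl)
  also have "\<dots> = avg n (\<lambda>u. avg n (\<lambda>i. avg n (\<lambda>j. avg n (\<lambda>v. (\<phi> u i * \<phi> u j) * (\<psi> v (p i) * \<psi> v (p j))))))"
    by (rule avg_swap)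
  also have "\<dots> = avg n (\<lambda>u. avg n (\<lambda>i. avg n (\<lambda>v. avg n (\<lambda>j. (\<phi> u i * \<phi> u j) * (\<psi> v (p i) * \<psi> v (p j))))))"
    by (intro avg_cong avg_swap)
  also have "\<dots> = avg n (\<lambda>u. avg n (\<lambda>v. avg n (\<lambda>i. avg n (\<lambda>j. (\<phi> u i * \<phi> u j) * (\<psi> v (p i) * \<psi> v (p j))))))"
    by (intro avg_cong avg_swap)
  also have "\<dots> = RR \<phi> \<psi>"
    unfolding RR_def avg2_corr_square by simp
  finally show ?thesis .
qed

lemma avg3_prod_prod:
  "avg3 n (\<lambda>i j k. (\<phi> k i * \<phi> k j) * (\<psi> (p k) (p i) * \<psi> (p k) (p j))) = DD \<phi> \<psi>"
proof -
  have "avg3 n (\<lambda>i j k. (\<phi> k i * \<phi> k j) * (\<psi> (p k) (p i) * \<psi> (p k) (p j))) =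
     avg n (\<lambda>i. avg n (\<lambda>k. avg n (\<lambda>j. (\<phi> k i * \<phi> k j) * (\<psi> (p k) (p i) * \<psi> (p k) (p j)))))"
    by (intro avg_cong avg_swap)
  also have "\<dots> = avg n (\<lambda>k. avg n (\<lambda>i. avg n (\<lambda>j. (\<phi> k i * \<phi> k j) * (\<psi> (p k) (p i) * \<psi> (p k) (p j)))))"
    by (rule avg_swap)
  also have "\<dots> = DD \<phi> \<psi>"
    unfolding DD_def avg2_corr_square by simp
  finally show ?thesis .
qed

end

text \<open>Centring in the second argument kills every term of an expansion in which some point
  index occurs in a single factor.\<close>

locale biperm_kernels = biperm +
  fixes \<phi> \<psi> :: "nat \<Rightarrow> nat \<Rightarrow> real"
  assumes phi0: "\<And>u. u < n \<Longrightarrow> avg n (\<phi> u) = 0" and psi0: "\<And>u. u < n \<Longrightarrow> avg n (\<psi> u) = 0"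
begin

lemma gram_phi0: "avg n (gram n \<phi> i) = 0" "avg n (\<lambda>j. gram n \<phi> j i) = 0"
  by (rule avg_gram(1), erule phi0) (rule avg_gram(2), erule phi0)

lemma gram_psi0: "avg n (\<lambda>i. gram n \<psi> j (p i)) = 0" "avg n (\<lambda>i. gram n \<psi> (p i) j) = 0"
  using avg_p[of "gram n \<psi> j"] avg_p[of "\<lambda>i. gram n \<psi> i j"] avg_gram[OF psi0] by simp_all

lemma avg_triple: 
  assumes "i < n" "k < n"
  shows "avg n (\<lambda>j. triple n \<phi> i j k) = - gram n \<phi> i k" 
  using assms phi0 gram_phi0
  by (simp add: triple_def avg_add avg_diff avg_mult_left avg_const n_pos)

lemma avg_quad:
  assumes "i < n" "j < n" "k < n"
  shows "avg n (quad n \<psi> i j k) = triple n \<psi> i j k"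
proof -
  have "avg n (\<lambda>l. \<psi> l i * \<psi> l j) = gram n \<psi> i j" by (simp add: gram_def)
  then show ?thesis
    using assms psi0 avg_gram[OF psi0] 
    by (simp add: quad_def[abs_def] triple_def avg_add avg_diff avg_mult_left avg_mult_right avg_const n_pos)
qed

text \<open>In the two terms with \<open>gram\<close> at \<open>p k\<close>, one of \<open>i\<close>
  and \<open>j\<close> occurs in a single centred factor, so they vanish; the other two give
  \<open>DD\<close> and \<open>RR\<close>.\<close>

lemma avg3_prod_triple:
  "avg3 n (\<lambda>i j k. (\<phi> k i * \<phi> k j) * triple n \<psi> (p i) (p j) (p k)) = DD \<phi> \<psi> + RR \<phi> \<psi>"
proof -
  have 1: "avg3 n (\<lambda>i j k. (\<phi> k i * \<phi> k j) * gram n \<psi> (p i) (p j)) = RR \<phi> \<psi>"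
    unfolding avg_mult_right avg2_gram_gram[symmetric] by (simp add: gram_def)
  have 2: "avg3 n (\<lambda>i j k. (\<phi> k i * \<phi> k j) * gram n \<psi> (p i) (p k)) = 0"
  proof -
    have "avg3 n (\<lambda>i j k. (\<phi> k i * \<phi> k j) * gram n \<psi> (p i) (p k)) =
      avg n (\<lambda>i. avg n (\<lambda>k. avg n (\<lambda>j. (\<phi> k i * gram n \<psi> (p i) (p k)) * \<phi> k j)))"
      by (subst avg_swap) (simp add: mult_ac)
    also have "\<dots> = avg n (\<lambda>i. avg n (\<lambda>k. 0))"
      by (intro avg_cong) (simp add: avg_mult_left phi0)
    finally show ?thesis by simp
  qed
  have 3: "avg3 n (\<lambda>i j k. (\<phi> k i * \<phi> k j) * gram n \<psi> (p j) (p k)) = 0"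
    using 2 by (subst avg_swap) (simp add: mult_ac)
  show ?thesis
    using avg3_prod_prod[of \<phi> \<psi>] 1 2 3
    by (simp add: triple_def ring_distribs avg_add avg_diff)
qed

lemma avg3_gram_triple:
  "avg3 n (\<lambda>i j k. gram n \<phi> i k * triple n \<psi> (p i) (p j) (p k)) = - RR \<phi> \<psi>"
proof -
  have *: "avg n (\<lambda>j. triple n \<psi> (p i) (p j) (p k)) = - gram n \<psi> (p i) (p k)" if "i < n" "k < n" for i k
  proof -
    have "avg n (\<lambda>j. triple n \<psi> (p i) (p j) (p k)) = avg n (\<lambda>j. triple n \<psi> (p i) j (p k))"
      by (rule avg_p)
    also have "\<dots> = - gram n \<psi> (p i) (p k)"
      using p_less that psi0 avg_gram[OF psi0]
      by (simp add: triple_def avg_add avg_diff avg_mult_left avg_const n_pos)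
    finally show ?thesis .
  qed
  have "avg3 n (\<lambda>i j k. gram n \<phi> i k * triple n \<psi> (p i) (p j) (p k)) =
      avg n (\<lambda>i. avg n (\<lambda>k. avg n (\<lambda>j. gram n \<phi> i k * triple n \<psi> (p i) (p j) (p k))))"
    by (intro avg_cong avg_swap)
  also have "\<dots> = avg n (\<lambda>i. avg n (\<lambda>k. - (gram n \<phi> i k * gram n \<psi> (p i) (p k))))"
    by (intro avg_cong) (simp add: avg_mult_left *)
  finally show ?thesis using avg2_gram_gram[of \<phi> \<psi>] by (simp add: avg_minus)
qed

text \<open>The four terms of the first \<open>triple\<close> contribute \<open>DD + RR\<close>,
  \<open>2 * RR\<close>, \<open>RR\<close> and \<open>RR\<close>: the second \<open>triple\<close>
  averages to twice a \<open>gram\<close> over \<open>k\<close>, and to minus a \<open>gram\<close>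
  over \<open>i\<close> or \<open>j\<close>.\<close>

lemma avg3_triple_triple:
  "avg3 n (\<lambda>i j k. triple n \<phi> i j k * triple n \<psi> (p i) (p j) (p k)) = DD \<phi> \<psi> + 5 * RR \<phi> \<psi>"
proof -
  have 1: "avg3 n (\<lambda>i j k. gram n \<phi> i j * triple n \<psi> (p i) (p j) (p k)) = 2 * RR \<phi> \<psi>"
  proof -
    have *: "avg n (\<lambda>k. triple n \<psi> (p i) (p j) (p k)) = 2 * gram n \<psi> (p i) (p j)" if "i < n" "j < n" for i j
    proof -
      have "avg n (\<lambda>k. triple n \<psi> (p i) (p j) (p k)) = avg n (\<lambda>k. triple n \<psi> (p i) (p j) k)"
        by (rule avg_p)
      also have "\<dots> = 2 * gram n \<psi> (p i) (p j)"
        using avg_gram[OF psi0]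
        by (simp add: triple_def avg_add avg_diff avg_const n_pos) (simp add: gram_def)
      finally show ?thesis .
    qed
    have "avg3 n (\<lambda>i j k. gram n \<phi> i j * triple n \<psi> (p i) (p j) (p k)) =
        avg n (\<lambda>i. avg n (\<lambda>j. 2 * (gram n \<phi> i j * gram n \<psi> (p i) (p j))))"
      by (intro avg_cong) (simp add: avg_mult_left *)
    then show ?thesis using avg2_gram_gram[of \<phi> \<psi>] by (simp add: avg_mult_left)
  qed
  have 2: "avg3 n (\<lambda>i j k. gram n \<phi> j k * triple n \<psi> (p i) (p j) (p k)) = - RR \<phi> \<psi>"
  proof -
    have "triple n \<psi> (p i) (p j) (p k) = triple n \<psi> (p j) (p i) (p k)" for i j k
      by (simp add: triple_def gram_commute mult.commute)
    then show ?thesis using avg3_gram_triple by (subst avg_swap) simp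
  qed
  show ?thesis
    using avg3_prod_triple avg3_gram_triple 1 2
    by (simp add: triple_def[of n \<phi>] ring_distribs avg_add avg_diff)
qed

text \<open>The kernel \<open>quad\<close> has no component depending on all four variables, so it only
  sees the conditional averages of \<open>f\<close>.\<close>

lemma avg4_quad:
  assumes f: "\<And>i j k l. f i j l k = f i j k l" "\<And>i j k l. f k l i j = f i j k l"
  shows "avg4 n (\<lambda>i j k l. quad n \<phi> i j k l * f i j k l) =
    4 * avg3 n (\<lambda>i j k. (\<phi> k i * \<phi> k j) * avg n (f i j k)) -
    4 * avg3 n (\<lambda>i j k. gram n \<phi> i k * avg n (f i j k))"
proof -
  have f3: "f j i k l = f i j k l" for i j k l using f by metis
  let ?A = "avg4 n (\<lambda>i j k l. (\<phi> k i * \<phi> k j) * f i j k l)"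
  let ?B = "avg4 n (\<lambda>i j k l. gram n \<phi> i k * f i j k l)"
  have A2: "avg4 n (\<lambda>i j k l. (\<phi> l i * \<phi> l j) * f i j k l) = ?A"
    by (subst avg4_swap34) (simp add: f(1))
  have A3: "avg4 n (\<lambda>i j k l. (\<phi> i k * \<phi> i l) * f i j k l) = ?A"
    by (subst avg4_swap_pairs) (simp only: f(2))
  have A4: "avg4 n (\<lambda>i j k l. (\<phi> j k * \<phi> j l) * f i j k l) = ?A"
    by (subst avg4_swap12) (use A3 in \<open>simp only: f3\<close>)
  have B2: "avg4 n (\<lambda>i j k l. gram n \<phi> i l * f i j k l) = ?B"
    by (subst avg4_swap34) (simp add: f(1))
  have B3: "avg4 n (\<lambda>i j k l. gram n \<phi> j k * f i j k l) = ?B"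
    by (subst avg4_swap12) (simp only: f3)
  have B4: "avg4 n (\<lambda>i j k l. gram n \<phi> j l * f i j k l) = ?B"
    by (subst avg4_swap12) (use B2 in \<open>simp only: f3\<close>)
  have "avg4 n (\<lambda>i j k l. quad n \<phi> i j k l * f i j k l) = 4 * ?A - 4 * ?B"
    unfolding quad_def ring_distribs avg_add avg_diff A2 A3 A4 B2 B3 B4 by simp
  then show ?thesis by (simp add: avg_mult_left)
qed

lemma avg4_quad_0: "avg4 n (quad n \<phi>) = 0"
proof -
  have "avg3 n (\<lambda>i j k. \<phi> k i * \<phi> k j) = avg2 n (\<lambda>i j. gram n \<phi> i j)"
    by (simp add: gram_def)
  then show ?thesis
    using avg4_quad[of "\<lambda>i j k l. 1"] n_pos by (simp add: avg_const gram_phi0)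
qed

text \<open>By \<open>avg4_quad\<close> only the average of the second kernel over \<open>l\<close>
  matters, and that is a \<open>triple\<close>.\<close>

lemma avg4_quad_quad:
  "avg4 n (\<lambda>i j k l. quad n \<phi> i j k l * quad n \<psi> (p i) (p j) (p k) (p l)) = 4 * DD \<phi> \<psi> + 8 * RR \<phi> \<psi>"
proof -
  have *: "avg n (\<lambda>l. quad n \<psi> (p i) (p j) (p k) (p l)) = triple n \<psi> (p i) (p j) (p k)"
    if "i < n" "j < n" "k < n" for i j k
    using avg_p[of "quad n \<psi> (p i) (p j) (p k)"] avg_quad p_less that by simp
  have "avg4 n (\<lambda>i j k l. quad n \<phi> i j k l * quad n \<psi> (p i) (p j) (p k) (p l)) =
    4 * avg3 n (\<lambda>i j k. (\<phi> k i * \<phi> k j) * avg n (\<lambda>l. quad n \<psi> (p i) (p j) (p k) (p l))) -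
    4 * avg3 n (\<lambda>i j k. gram n \<phi> i k * avg n (\<lambda>l. quad n \<psi> (p i) (p j) (p k) (p l)))"
    by (rule avg4_quad) (simp_all add: quad_def gram_commute algebra_simps)
  also have "avg3 n (\<lambda>i j k. (\<phi> k i * \<phi> k j) * avg n (\<lambda>l. quad n \<psi> (p i) (p j) (p k) (p l))) =
      avg3 n (\<lambda>i j k. (\<phi> k i * \<phi> k j) * triple n \<psi> (p i) (p j) (p k))"
    by (intro avg_cong) (simp add: *)
  also have "avg3 n (\<lambda>i j k. gram n \<phi> i k * avg n (\<lambda>l. quad n \<psi> (p i) (p j) (p k) (p l))) =
      avg3 n (\<lambda>i j k. gram n \<phi> i k * triple n \<psi> (p i) (p j) (p k))"
    by (intro avg_cong) (simp add: *)
  finally show ?thesis using avg3_prod_triple avg3_gram_triple by simp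
qed

end

section \<open>Comparison of averages up to errors of order 1/n\<close>

lemma avg_of_bool_eq: "i < n \<Longrightarrow> avg n (\<lambda>j. of_bool (i = j)) = 1 / real n"
  "i < n \<Longrightarrow> avg n (\<lambda>j. of_bool (j = i)) = 1 / real n"
  by (simp_all add: avg_def of_bool_def sum.delta sum.delta')

text \<open>The kernel identities hold at distinct indices only. Each of the six possible
  coincidences has probability 1/n, which gives the second error term.\<close>

lemma avg4_near:
  assumes "0 < n"
    and "\<And>i j k l. i < n \<Longrightarrow> j < n \<Longrightarrow> k < n \<Longrightarrow> l < n \<Longrightarrow> \<bar>F i j k l - G i j k l\<bar> \<le> M"
    and "\<And>i j k l. i < n \<Longrightarrow> j < n \<Longrightarrow> k < n \<Longrightarrow> l < n \<Longrightarrow> distinct [i, j, k, l] \<Longrightarrow>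
      \<bar>F i j k l - G i j k l\<bar> \<le> e" and "0 \<le> e"
  shows "\<bar>avg4 n F - avg4 n G\<bar> \<le> e + 6 * M / real n"
proof -
  have M: "0 \<le> M" using assms(1) assms(2)[of 0 0 0 0] by simp
  let ?H = "\<lambda>i j k l. e + M * (of_bool (i = j) + of_bool (i = k) + of_bool (i = l) + of_bool (j = k)
    + of_bool (j = l) + of_bool (k = l))"
  have "\<bar>F i j k l - G i j k l\<bar> \<le> ?H i j k l" if "i < n" "j < n" "k < n" "l < n" for i j k l
  proof (cases "distinct [i, j, k, l]")
    case True
    then show ?thesis using assms(3)[OF that True] M by simp
  next
    case False
    then have "1 \<le> (of_bool (i = j) + of_bool (i = k) + of_bool (i = l) + of_bool (j = k)
      + of_bool (j = l) + of_bool (k = l) :: real)" by (auto simp: of_bool_def)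
    then have "M * 1 \<le> M * (of_bool (i = j) + of_bool (i = k) + of_bool (i = l) + of_bool (j = k)
      + of_bool (j = l) + of_bool (k = l))" using M by (intro mult_left_mono)
    then show ?thesis using assms(2)[OF that] \<open>0 \<le> e\<close> by linarith
  qed
  then have "avg4 n (\<lambda>i j k l. \<bar>F i j k l - G i j k l\<bar>) \<le> avg4 n ?H"
    by (intro avg_mono)
  also have "avg4 n ?H = e + 6 * M / real n"
  proof -
    have "avg4 n ?H = avg n (\<lambda>i. avg n (\<lambda>j. avg n (\<lambda>k. e + M * (of_bool (i = j) + of_bool (i = k) + 1 / n + of_bool (j = k)
    + 1 / n + 1 / n))))"
      using assms(1) by (intro avg_cong) (simp add: avg_add avg_mult_left avg_const avg_of_bool_eq)
    also have "\<dots> = avg n (\<lambda>i. avg n (\<lambda>j. e + M * (of_bool (i = j) + 1 / n + 1 / n + 1 / n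
    + 1 / n + 1 / n)))"
      using assms(1) by (intro avg_cong) (simp add: avg_add avg_mult_left avg_const avg_of_bool_eq)
    also have "\<dots> = avg n (\<lambda>i. e + M * (1 / n + 1 / n + 1 / n + 1 / n + 1 / n + 1 / n))"
      using assms(1) by (intro avg_cong) (simp add: avg_add avg_mult_left avg_const avg_of_bool_eq)
    finally show ?thesis using assms(1) by (simp add: avg_const)
  qed
  moreover have "\<bar>avg4 n F - avg4 n G\<bar> \<le> avg4 n (\<lambda>i j k l. \<bar>F i j k l - G i j k l\<bar>)"
  proof -
    have "\<bar>avg4 n (\<lambda>i j k l. F i j k l - G i j k l)\<bar> \<le> avg4 n (\<lambda>i j k l. \<bar>F i j k l - G i j k l\<bar>)"
      by (intro order_trans[OF abs_avg_le] avg_mono) simp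
    then show ?thesis by (simp add: avg_diff)
  qed
  ultimately show ?thesis by linarith
qed

lemma abs_mult_diff_le:
  fixes a b c d :: real
  assumes "\<bar>a\<bar> \<le> M" "\<bar>b\<bar> \<le> M" "\<bar>c\<bar> \<le> M" "\<bar>d\<bar> \<le> M"
  shows "\<bar>a * b - c * d\<bar> \<le> 2 * M\<^sup>2"
    and "\<bar>a - c\<bar> \<le> e \<Longrightarrow> \<bar>b - d\<bar> \<le> e \<Longrightarrow> \<bar>a * b - c * d\<bar> \<le> 2 * M * e"
proof -
  have ab: "\<bar>a * b\<bar> \<le> M * M" "\<bar>c * d\<bar> \<le> M * M"
    unfolding abs_mult using assms by (auto intro!: mult_mono)
  then show "\<bar>a * b - c * d\<bar> \<le> 2 * M\<^sup>2" by (simp add: power2_eq_square)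
  assume e: "\<bar>a - c\<bar> \<le> e" "\<bar>b - d\<bar> \<le> e"
  have "\<bar>(a - c) * b\<bar> \<le> e * M" "\<bar>c * (b - d)\<bar> \<le> M * e"
    unfolding abs_mult using assms e by (auto intro!: mult_mono)
  moreover have "a * b - c * d = (a - c) * b + c * (b - d)" by (simp add: algebra_simps)
  moreover have "e * M + M * e = 2 * M * e" by simp
  ultimately show "\<bar>a * b - c * d\<bar> \<le> 2 * M * e" by linarith
qed

text \<open>The identities used below are exact up to a constant over n^2, and
  \<open>2 / real n\<close> is a common bound for these errors; \<open>M\<close> takes care of
  coincident indices.\<close>

definition near4 :: "nat \<Rightarrow> real \<Rightarrow> (nat \<Rightarrow> nat \<Rightarrow> nat \<Rightarrow> nat \<Rightarrow> real) \<Rightarrow> (nat \<Rightarrow> nat \<Rightarrow> nat \<Rightarrow> nat \<Rightarrow> real) \<Rightarrow> bool" where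
  "near4 n M F G \<longleftrightarrow> (\<forall>i<n. \<forall>j<n. \<forall>k<n. \<forall>l<n. \<bar>F i j k l\<bar> \<le> M \<and> \<bar>G i j k l\<bar> \<le> M \<and>
     (distinct [i, j, k, l] \<longrightarrow> \<bar>F i j k l - G i j k l\<bar> \<le> 2 / real n))"

lemma near4_refl: "(\<And>i j k l. i < n \<Longrightarrow> j < n \<Longrightarrow> k < n \<Longrightarrow> l < n \<Longrightarrow> \<bar>F i j k l\<bar> \<le> M) \<Longrightarrow> near4 n M F F"
  by (simp add: near4_def)

lemma avg4_near_mult:
  assumes n: "0 < n" and "near4 n M F F'" "near4 n M G G'"
  shows "\<bar>avg4 n (\<lambda>i j k l. F i j k l * G i j k l) - avg4 n (\<lambda>i j k l. F' i j k l * G' i j k l)\<bar>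
     \<le> (4 * M + 12 * M\<^sup>2) / real n"
proof -
  have M: "0 \<le> M" using assms(1,2) unfolding near4_def by (meson abs_ge_zero order_trans)
  have "\<bar>avg4 n (\<lambda>i j k l. F i j k l * G i j k l) - avg4 n (\<lambda>i j k l. F' i j k l * G' i j k l)\<bar>
     \<le> 2 * M * (2 / real n) + 6 * (2 * M\<^sup>2) / real n"
  proof (rule avg4_near[OF n])
    fix i j k l assume ijkl: "i < n" "j < n" "k < n" "l < n"
    show "\<bar>F i j k l * G i j k l - F' i j k l * G' i j k l\<bar> \<le> 2 * M\<^sup>2"
      using assms ijkl unfolding near4_def by (intro abs_mult_diff_le) auto
    assume "distinct [i, j, k, l]"
    then show "\<bar>F i j k l * G i j k l - F' i j k l * G' i j k l\<bar> \<le> 2 * M * (2 / real n)"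
      using assms ijkl unfolding near4_def by (intro abs_mult_diff_le) auto
  qed (use M in simp)
  then show ?thesis by (simp add: add_divide_distrib)
qed

text \<open>Functions of two or three variables are compared by padding with dummy variables.\<close>

lemma avg3_near_mult:
  assumes n: "0 < n" and "near4 n M (\<lambda>i j k l. F i j k) (\<lambda>i j k l. F' i j k)"
    "near4 n M (\<lambda>i j k l. G i j k) (\<lambda>i j k l. G' i j k)"
  shows "\<bar>avg3 n (\<lambda>i j k. F i j k * G i j k) - avg3 n (\<lambda>i j k. F' i j k * G' i j k)\<bar>
     \<le> (4 * M + 12 * M\<^sup>2) / real n"
  using avg4_near_mult[OF assms] n by (simp add: avg_const)

lemma avg2_near_mult:
  assumes n: "0 < n" and "near4 n M (\<lambda>i j k l. F i j) (\<lambda>i j k l. F' i j)"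
    "near4 n M (\<lambda>i j k l. G i j) (\<lambda>i j k l. G' i j)"
  shows "\<bar>avg2 n (\<lambda>i j. F i j * G i j) - avg2 n (\<lambda>i j. F' i j * G' i j)\<bar>
     \<le> (4 * M + 12 * M\<^sup>2) / real n"
  using avg4_near_mult[OF assms] n by (simp add: avg_const)

section \<open>The sign kernel and its centred forms\<close>

definition sg :: "nat \<Rightarrow> nat \<Rightarrow> real" where
  "sg i j = sgn (real j - real i)"

text \<open>A centred coordinate, running down from near 1 to near -1: it is the average of
  \<open>sg i\<close>.\<close>

definition zc :: "nat \<Rightarrow> nat \<Rightarrow> real" where
  "zc n i = (real n - 1 - 2 * real i) / real n"

definition al :: "nat \<Rightarrow> nat \<Rightarrow> nat \<Rightarrow> real" where
  "al n u i = sg u i - zc n u"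

text \<open>Unlike \<open>al\<close>, which is centred in \<open>i\<close> only, this kernel is
  centred in both arguments and antisymmetric. It depends on i - u modulo n: a sawtooth that jumps
  at i = u.\<close>

definition si :: "nat \<Rightarrow> nat \<Rightarrow> nat \<Rightarrow> real" where
  "si n u i = sg u i - zc n u + zc n i"

lemma sg_swap: "sg i j = - sg j i"
  by (simp add: sg_def sgn_if)

lemma sum_sg_mult:
  assumes "i < n"
  shows "(\<Sum>u<n. sg u i * f u) = 2 * (\<Sum>u<i. f u) + f i - (\<Sum>u<n. f u)"
proof -
  have split: "(\<Sum>u<n. g u) = (\<Sum>u<i. g u) + g i + (\<Sum>u\<in>{Suc i..<n}. g u)" for g :: "nat \<Rightarrow> real"
  proof -
    have "{..<n} = insert i ({..<i} \<union> {Suc i..<n})" using assms by auto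
    then have "(\<Sum>u<n. g u) = g i + (\<Sum>u\<in>{..<i} \<union> {Suc i..<n}. g u)" by simp
    also have "(\<Sum>u\<in>{..<i} \<union> {Suc i..<n}. g u) = (\<Sum>u<i. g u) + (\<Sum>u\<in>{Suc i..<n}. g u)"
      by (rule sum.union_disjoint) auto
    finally show ?thesis by simp
  qed
  have "(\<Sum>u<i. sg u i * f u) = (\<Sum>u<i. f u)" by (rule sum.cong) (auto simp: sg_def)
  moreover have "(\<Sum>u\<in>{Suc i..<n}. sg u i * f u) = - (\<Sum>u\<in>{Suc i..<n}. f u)"
    unfolding sum_negf[symmetric] by (rule sum.cong) (auto simp: sg_def)
  ultimately show ?thesis
    unfolding split[of "\<lambda>u. sg u i * f u"] split[of f] by (simp add: sg_def)
qed

lemma avg_sg: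
  assumes "i < n"
  shows "avg n (\<lambda>u. sg u i) = - zc n i" "avg n (sg i) = zc n i"
proof -
  show 1: "avg n (\<lambda>u. sg u i) = - zc n i"
  proof -
    have "(\<Sum>u<n. sg u i) = - (real n - 1 - 2 * real i)"
      using sum_sg_mult[OF assms, of "\<lambda>_. 1"] by simp
    then show ?thesis unfolding avg_def zc_def by (metis minus_divide_left)
  qed
  have "avg n (sg i) = - avg n (\<lambda>u. sg u i)"
    unfolding avg_minus[symmetric] by (rule avg_cong) (rule sg_swap)
  then show "avg n (sg i) = zc n i" using 1 by simp
qed

lemma sum_zc: 
  assumes "0 < n" shows "(\<Sum>u<m. zc n u) = real m * (real n - real m) / real n"
  using assms by (induction m) (simp_all add: zc_def field_simps)

lemma avg_zc: "avg n (zc n) = 0"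
  using sum_zc[of n n] by (cases "n = 0") (simp_all add: avg_def)

lemma sum_zc_power2: 
  assumes "0 < n"
  shows "3 * (real n)\<^sup>2 * (\<Sum>u<m. (zc n u)\<^sup>2) = real m * (3 * (real n - real m)\<^sup>2 + (real m)\<^sup>2 - 1)"
proof -
  have "(real n)\<^sup>2 * (zc n u)\<^sup>2 = (real n - 1 - 2 * real u)\<^sup>2" for u
    using assms by (simp add: zc_def power_divide)
  then have "3 * (real n)\<^sup>2 * (\<Sum>u<m. (zc n u)\<^sup>2) = 3 * (\<Sum>u<m. (real n - 1 - 2 * real u)\<^sup>2)"
    by (simp add: sum_distrib_left mult.assoc)
  also have "\<dots> = real m * (3 * (real n - real m)\<^sup>2 + (real m)\<^sup>2 - 1)"
    by (induction m) (simp_all add: power2_eq_square algebra_simps)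
  finally show ?thesis .
qed

lemma avg_zc_power2: 
  assumes "0 < n" shows "avg n (\<lambda>u. (zc n u)\<^sup>2) = 1/3 - 1 / (3 * (real n)\<^sup>2)"
proof -
  have "3 * (real n)\<^sup>2 * (\<Sum>u<n. (zc n u)\<^sup>2) = real n * ((real n)\<^sup>2 - 1)"
    using sum_zc_power2[OF assms, of n] by simp
  then have "(\<Sum>u<n. (zc n u)\<^sup>2) = real n * ((real n)\<^sup>2 - 1) / (3 * (real n)\<^sup>2)"
    using assms by (simp add: field_simps)
  then show ?thesis using assms by (simp add: avg_def diff_divide_distrib)
qed

lemma avg_sg_zc:
  assumes "i < n"
  shows "avg n (\<lambda>u. sg u i * zc n u) = (1 - (zc n i)\<^sup>2) / 2 - 1 / (2 * (real n)\<^sup>2)"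
proof -
  have n: "0 < n" using assms by simp
  have 1: "(\<Sum>u<i. zc n u) = real i * (real n - real i) / real n"
    by (rule sum_zc[OF n])
  have 2: "(\<Sum>u<n. zc n u) = 0"
    using sum_zc[OF n, of n] by simp
  have "(\<Sum>u<n. sg u i * zc n u) = 2 * (real i * (real n - real i) / real n) + zc n i"
    unfolding sum_sg_mult[OF assms] 1 2 by simp
  then have "avg n (\<lambda>u. sg u i * zc n u) = (2 * (real i * (real n - real i) / real n) + zc n i) / real n"
    by (simp add: avg_def)
  also have "\<dots> = (1 - (zc n i)\<^sup>2) / 2 - 1 / (2 * (real n)\<^sup>2)"
    using n by (simp add: zc_def field_simps power2_eq_square)
  finally show ?thesis .
qed

lemma zc_diff: "\<bar>zc n i - zc n j\<bar> = 2 * \<bar>real i - real j\<bar> / real n"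
proof -
  have "zc n i - zc n j = 2 * (real j - real i) / real n"
    by (simp add: zc_def diff_divide_distrib[symmetric])
  then have "\<bar>zc n i - zc n j\<bar> = \<bar>2 * (real j - real i)\<bar> / real n" by (simp add: abs_divide)
  also have "\<bar>2 * (real j - real i)\<bar> = 2 * \<bar>real i - real j\<bar>" by (simp add: abs_mult abs_minus_commute del: right_diff_distrib_numeral)
  finally show ?thesis .
qed

text \<open>The product is -1 strictly between \<open>i\<close> and \<open>j\<close>, 0 at these two
  points and 1 elsewhere, so the sum is n - 2|i - j|.\<close>

lemma avg_sg_sg:
  assumes "i < n" "j < n" "i \<noteq> j"
  shows "avg n (\<lambda>u. sg u i * sg u j) = 1 - \<bar>zc n i - zc n j\<bar>"
proof -
  have *: "avg n (\<lambda>u. sg u i * sg u j) = 1 - 2 * (real j - real i) / real n" if "i < j" "j < n" for i j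
  proof -
    have i: "i < n" using that by simp
    have a: "(\<Sum>u<i. sg u j) = real i" using that by (simp add: sg_def)
    have "(\<Sum>u<n. sg u j) = 2 * real j + 1 - real n"
      using sum_sg_mult[OF that(2), of "\<lambda>_. 1"] by simp
    then have "(\<Sum>u<n. sg u i * sg u j) = 2 * real i + 1 - (2 * real j + 1 - real n)"
      unfolding sum_sg_mult[OF i, of "\<lambda>u. sg u j"] a using that by (simp add: sg_def)
    then show ?thesis using i by (simp add: avg_def field_simps)
  qed
  show ?thesis
  proof (cases "i < j")
    case True
    then show ?thesis using *[of i j] assms by (simp add: zc_diff)
  next
    case False
    then have "j < i" using assms by simp
    then show ?thesis using *[of j i] assms by (simp add: zc_diff mult.commute)
  qed
qed

lemma gram_al:
  assumes "i < n" "j < n" "i \<noteq> j"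
  shows "gram n (al n) i j = 1/3 - \<bar>zc n i - zc n j\<bar> + ((zc n i)\<^sup>2 + (zc n j)\<^sup>2) / 2 + 2 / (3 * (real n)\<^sup>2)"
proof -
  have n: "0 < n" using assms by simp
  have "gram n (al n) i j = avg n (\<lambda>u. sg u i * sg u j - sg u i * zc n u - sg u j * zc n u + (zc n u)\<^sup>2)"
    unfolding gram_def al_def by (simp add: algebra_simps power2_eq_square)
  also have "\<dots> = 1 - \<bar>zc n i - zc n j\<bar> - ((1 - (zc n i)\<^sup>2) / 2 - 1 / (2 * (real n)\<^sup>2))
     - ((1 - (zc n j)\<^sup>2) / 2 - 1 / (2 * (real n)\<^sup>2)) + (1/3 - 1 / (3 * (real n)\<^sup>2))"
    by (simp only: avg_add avg_diff avg_sg_sg[OF assms] avg_sg_zc[OF assms(1)] avg_sg_zc[OF assms(2)] avg_zc_power2[OF n])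
  finally show ?thesis by (simp add: field_simps)
qed

text \<open>Apart from the last term this is 2 B_2(d/2) with d =
  \<open>\<bar>zc n i - zc n j\<bar>\<close> and the Bernoulli polynomial B_2(x) = x^2 - x + 1/6,
  the autocorrelation of a sawtooth. Passing from \<open>al\<close> to \<open>si\<close> subtracts
  \<open>zc n i * zc n j\<close> from the Gram kernel.\<close>

lemma gram_si:
  assumes "i < n" "j < n" "i \<noteq> j"
  shows "gram n (si n) i j = 1/3 - \<bar>zc n i - zc n j\<bar> + (zc n i - zc n j)\<^sup>2 / 2 + 2 / (3 * (real n)\<^sup>2)"
proof -
  have n: "0 < n" using assms by simp
  have al0: "avg n (\<lambda>u. al n u i) = - zc n i" if "i < n" for i
    using that avg_zc[of n] by (simp add: al_def avg_diff avg_sg)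
  have "gram n (si n) i j = avg n (\<lambda>u. al n u i * al n u j + al n u i * zc n j + zc n i * al n u j + zc n i * zc n j)"
    unfolding gram_def si_def al_def by (simp add: algebra_simps)
  also have "\<dots> = gram n (al n) i j - zc n i * zc n j"
    using al0 assms n by (simp add: avg_add avg_mult_left avg_mult_right avg_const gram_def)
  finally show ?thesis unfolding gram_al[OF assms] by (simp add: power2_eq_square field_simps)
qed

lemma avg_al_0: "u < n \<Longrightarrow> avg n (al n u) = 0"
  unfolding al_def by (subst avg_diff) (simp add: avg_sg avg_const)

lemma avg_si_0: "u < n \<Longrightarrow> avg n (si n u) = 0"
  using avg_zc[of n] unfolding si_def by (simp add: avg_add avg_diff avg_sg avg_const)

lemma avg_si_0': "i < n \<Longrightarrow> avg n (\<lambda>u. si n u i) = 0"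
  using avg_zc[of n] unfolding si_def by (simp add: avg_add avg_diff avg_sg avg_const)

lemma si_swap: "si n i j = - si n j i"
  by (simp add: si_def sg_swap[of i j])

section \<open>The kernels of two pairs of points\<close>

definition ksg :: "nat \<Rightarrow> nat \<Rightarrow> nat \<Rightarrow> real" where
  "ksg n i j = avg n (\<lambda>u. sg i u * sg j u)"

text \<open>For distinct indices this is -1 exactly when one of \<open>k\<close>, \<open>l\<close>
  lies between \<open>i\<close> and \<open>j\<close> and the other does not, that is, when the pairs
  cross. Hence \<open>bfun\<close> is the indicator of crossing pairs.\<close>

definition rfun :: "nat \<Rightarrow> nat \<Rightarrow> nat \<Rightarrow> nat \<Rightarrow> real" where
  "rfun i j k l = sg i k * sg j k * (sg i l * sg j l)"

text \<open>For distinct indices the indicator that \<open>{i, j}\<close> and \<open>{k, l}\<close>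
  are separated: then all four terms are 1, whereas they cancel for crossing and for nested
  pairs.\<close>

definition afun :: "nat \<Rightarrow> nat \<Rightarrow> nat \<Rightarrow> nat \<Rightarrow> real" where
  "afun i j k l = (1 + rfun i j k l + sg i k * sg j l + sg i l * sg j k) / 4"

definition bfun :: "nat \<Rightarrow> nat \<Rightarrow> nat \<Rightarrow> nat \<Rightarrow> real" where
  "bfun i j k l = (1 - rfun i j k l) / 2"

text \<open>The Pfaffian of the skew-symmetric 4 by 4 matrix of signs. For distinct indices it is
  the signature of the order in which they appear.\<close>

definition vfun :: "nat \<Rightarrow> nat \<Rightarrow> nat \<Rightarrow> nat \<Rightarrow> real" where
  "vfun i j k l = sg i j * sg k l - sg i k * sg j l + sg i l * sg j k"

lemma abs_sg_le: "\<bar>sg i j\<bar> \<le> 1"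
  by (simp add: sg_def sgn_if)

lemma abs_mult_le: 
  fixes x y :: real
  assumes "\<bar>x\<bar> \<le> a" "\<bar>y\<bar> \<le> b" shows "\<bar>x * y\<bar> \<le> a * b"
  unfolding abs_mult using assms by (intro mult_mono) auto

lemma abs_rfun_le: "\<bar>rfun i j k l\<bar> \<le> 1"
proof -
  have "\<bar>rfun i j k l\<bar> \<le> 1 * 1 * (1 * 1)"
    unfolding rfun_def by (intro abs_mult_le abs_sg_le)
  then show ?thesis by simp
qed

lemma abs_sg_sg_le: "\<bar>sg i j * sg k l\<bar> \<le> 1"
  using abs_mult_le[OF abs_sg_le abs_sg_le] by simp

lemma abs_afun_le: "\<bar>afun i j k l\<bar> \<le> 1"
  using abs_rfun_le[of i j k l] abs_sg_sg_le[of i k j l] abs_sg_sg_le[of i l j k]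
  by (simp add: afun_def abs_divide)

lemma abs_ksg_le: "0 < n \<Longrightarrow> \<bar>ksg n i j\<bar> \<le> 1"
  unfolding ksg_def by (intro abs_avg_bound abs_sg_sg_le)

lemma sg_sq: "sg i j * sg i' j = sg j i * sg j i'"
  by (simp add: sg_swap[of j])

lemma ksg_eq: "i < n \<Longrightarrow> j < n \<Longrightarrow> i \<noteq> j \<Longrightarrow> ksg n i j = 1 - \<bar>zc n i - zc n j\<bar>"
  unfolding ksg_def sg_sq by (rule avg_sg_sg)

lemma avg_rfun: "avg n (rfun i j k) = sg i k * sg j k * ksg n i j"
  by (simp add: rfun_def[abs_def] ksg_def avg_mult_left)

lemma abs_zc_le: "i < n \<Longrightarrow> \<bar>zc n i\<bar> \<le> 1"
  by (simp add: zc_def abs_divide) 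

lemma abs_al_le: assumes "u < n" shows "\<bar>al n u i\<bar> \<le> 2"
  unfolding al_def using abs_sg_le[of u i] abs_zc_le[OF assms] by linarith

lemma abs_si_le: assumes "u < n" "i < n" shows "\<bar>si n u i\<bar> \<le> 3"
  unfolding si_def using abs_sg_le[of u i] abs_zc_le[OF assms(1)] abs_zc_le[OF assms(2)] by linarith

lemma abs_gram_le:
  assumes "\<And>u i. u < n \<Longrightarrow> i < n \<Longrightarrow> \<bar>\<phi> u i\<bar> \<le> 3" "i < n" "j < n"
  shows "\<bar>gram n \<phi> i j\<bar> \<le> 9"
  unfolding gram_def using assms abs_mult_le[of _ 3 _ 3] by (intro abs_avg_bound) auto

lemma abs_triple_le:
  assumes "\<And>u i. u < n \<Longrightarrow> i < n \<Longrightarrow> \<bar>\<phi> u i\<bar> \<le> 3" "i < n" "j < n" "k < n"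
  shows "\<bar>triple n \<phi> i j k\<bar> \<le> 36"
proof -
  have "\<bar>\<phi> k i * \<phi> k j\<bar> \<le> 3 * 3" using assms by (intro abs_mult_le) auto
  moreover have "\<bar>gram n \<phi> i j\<bar> \<le> 9" "\<bar>gram n \<phi> i k\<bar> \<le> 9" "\<bar>gram n \<phi> j k\<bar> \<le> 9"
    using assms by (auto intro!: abs_gram_le)
  ultimately show ?thesis unfolding triple_def by linarith
qed

lemma abs_quad_le:
  assumes b: "\<And>u i. u < n \<Longrightarrow> i < n \<Longrightarrow> \<bar>\<phi> u i\<bar> \<le> 3" and "i < n" "j < n" "k < n" "l < n"
  shows "\<bar>quad n \<phi> i j k l\<bar> \<le> 72"
proof -
  have "\<bar>\<phi> u v * \<phi> u w\<bar> \<le> 3 * 3" if "u < n" "v < n" "w < n" for u v w 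
    using b that by (intro abs_mult_le) auto
  from this[of k i j] this[of l i j] this[of i k l] this[of j k l]
  have "\<bar>\<phi> k i * \<phi> k j\<bar> \<le> 9" "\<bar>\<phi> l i * \<phi> l j\<bar> \<le> 9" "\<bar>\<phi> i k * \<phi> i l\<bar> \<le> 9" "\<bar>\<phi> j k * \<phi> j l\<bar> \<le> 9"
    using assms by auto
  moreover have "\<bar>gram n \<phi> i k\<bar> \<le> 9" "\<bar>gram n \<phi> i l\<bar> \<le> 9" "\<bar>gram n \<phi> j k\<bar> \<le> 9" "\<bar>gram n \<phi> j l\<bar> \<le> 9"
    using assms by (auto intro!: abs_gram_le)
  ultimately show ?thesis unfolding quad_def by linarith
qed

lemma sg_zc: "0 < n \<Longrightarrow> sg i j = sgn (zc n i - zc n j)"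
proof -
  assume "0 < n"
  moreover have "zc n i - zc n j = (2 / real n) * (real j - real i)"
    by (simp add: zc_def diff_divide_distrib[symmetric])
  ultimately show ?thesis by (simp only: sg_def sgn_mult) (simp add: sgn_divide)
qed

lemma abs_inv_square_le: 
  assumes "0 < n" "x = c * (1 / (real n)\<^sup>2)" "\<bar>c\<bar> \<le> 2" 
  shows "\<bar>x\<bar> \<le> 2 / real n"
proof -
  have "1 / (real n)\<^sup>2 \<le> 1 / real n" using assms(1) by (simp add: power2_eq_square frac_le)
  then have "\<bar>c * (1 / (real n)\<^sup>2)\<bar> \<le> 2 * (1 / real n)" using assms by (intro abs_mult_le) auto
  then show ?thesis using assms by simp
qed

lemma ksg_approx:
  assumes "i < n" "j < n" "i \<noteq> j"
  shows "\<bar>ksg n i j * ksg n i j - (1/3 + 2 * gram n (si n) i j)\<bar> \<le> 2 / real n"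
proof -
  have n: "0 < n" using assms by simp
  have "(1 - d) * (1 - d) - (1/3 + 2 * (1/3 - d + d\<^sup>2 / 2 + 2 / (3 * N))) = - (4/3) * (1 / N)" for d N :: real
    by (simp add: power2_eq_square field_simps)
  from this[of "\<bar>zc n i - zc n j\<bar>" "(real n)\<^sup>2"]
  have "ksg n i j * ksg n i j - (1/3 + 2 * gram n (si n) i j) = - (4/3) * (1 / (real n)\<^sup>2)"
    unfolding ksg_eq[OF assms] gram_si[OF assms] by simp
  then show ?thesis by (rule abs_inv_square_le[OF n]) simp
qed

text \<open>With a = x - z and b = y - z the quadratic terms cancel, as ab + (a - b)^2/2 = a^2/2 +
  b^2/2. What remains is linear in each ordering of the three numbers.\<close>

lemma sgn_triple_identity:
  fixes x y z c :: real
  assumes "x \<noteq> y" "x \<noteq> z" "y \<noteq> z"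
  shows "sgn (x - z) * sgn (y - z) * (1 - \<bar>x - y\<bar>) =
    1/3 + ((sgn (z - x) - z + x) * (sgn (z - y) - z + y)
      + (1/3 - \<bar>x - y\<bar> + (x - y)\<^sup>2 / 2) - (1/3 - \<bar>x - z\<bar> + (x - z)\<^sup>2 / 2)
      - (1/3 - \<bar>y - z\<bar> + (y - z)\<^sup>2 / 2))"
  using assms
  by (cases x y rule: linorder_cases; cases x z rule: linorder_cases; cases y z rule: linorder_cases)
    (simp_all add: abs_if power2_eq_square field_simps)

lemma triple_approx:
  assumes "i < n" "j < n" "k < n" "distinct [i, j, k]"
  shows "\<bar>sg i k * sg j k * ksg n i j - (1/3 + triple n (si n) i j k)\<bar> \<le> 2 / real n"
proof -
  have n: "0 < n" using assms by simp
  have d: "i \<noteq> j" "i \<noteq> k" "j \<noteq> k" using assms by auto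
  have dz: "zc n a \<noteq> zc n b" if "a \<noteq> b" for a b using that n by (simp add: zc_def)
  have "sg i k * sg j k * ksg n i j - (1/3 + triple n (si n) i j k) = (2/3) * (1 / (real n)\<^sup>2)"
    using sgn_triple_identity[OF dz[OF d(1)] dz[OF d(2)] dz[OF d(3)]]
    unfolding triple_def ksg_eq[OF assms(1,2) d(1)] gram_si[OF assms(1,2) d(1)] gram_si[OF assms(1,3) d(2)]
      gram_si[OF assms(2,3) d(3)] si_def sg_zc[OF n]
    by simp
  then show ?thesis by (rule abs_inv_square_le[OF n]) simp
qed

text \<open>The squares from the four products cancel those from the four Gram terms, so both sides
  are piecewise linear. The parameter c stands for the correction
  \<open>2 / (3 * (real n)\<^sup>2)\<close> of \<open>gram_al\<close>.\<close>

lemma sgn_quad_identity: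
  fixes x y z w c :: real
  assumes "x \<noteq> y" "x \<noteq> z" "y \<noteq> z" "x \<noteq> w" "y \<noteq> w" "z \<noteq> w"
  shows "1 + sgn (x - z) * sgn (y - z) * (sgn (x - w) * sgn (y - w)) + sgn (x - z) * sgn (y - w)
       + sgn (x - w) * sgn (y - z) =
    4/3 + ((sgn (z - x) - z) * (sgn (z - y) - z) + (sgn (w - x) - w) * (sgn (w - y) - w)
      + (sgn (x - z) - x) * (sgn (x - w) - x) + (sgn (y - z) - y) * (sgn (y - w) - y)
      - ((1/3 - \<bar>x - z\<bar> + (x\<^sup>2 + z\<^sup>2) / 2 + c) + (1/3 - \<bar>x - w\<bar> + (x\<^sup>2 + w\<^sup>2) / 2 + c)
        + (1/3 - \<bar>y - z\<bar> + (y\<^sup>2 + z\<^sup>2) / 2 + c) + (1/3 - \<bar>y - w\<bar> + (y\<^sup>2 + w\<^sup>2) / 2 + c))) + 4 * c"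
  using assms
  by (cases x z rule: linorder_cases; cases x w rule: linorder_cases; cases y z rule: linorder_cases;
      cases y w rule: linorder_cases)
    (simp_all add: abs_if power2_eq_square field_simps)

lemma afun_approx:
  assumes "i < n" "j < n" "k < n" "l < n" "distinct [i, j, k, l]"
  shows "\<bar>afun i j k l - (1/3 + quad n (al n) i j k l / 4)\<bar> \<le> 2 / real n"
proof -
  have n: "0 < n" using assms by simp
  have d: "i \<noteq> j" "i \<noteq> k" "j \<noteq> k" "i \<noteq> l" "j \<noteq> l" "k \<noteq> l" using assms by auto
  have dz: "zc n a \<noteq> zc n b" if "a \<noteq> b" for a b using that n by (simp add: zc_def)
  let ?c = "2 / (3 * (real n)\<^sup>2)"
  have "4 * afun i j k l = 1 + sgn (zc n i - zc n k) * sgn (zc n j - zc n k) * 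
      (sgn (zc n i - zc n l) * sgn (zc n j - zc n l)) +
      sgn (zc n i - zc n k) * sgn (zc n j - zc n l) + sgn (zc n i - zc n l) * sgn (zc n j - zc n k)"
    by (simp add: afun_def rfun_def sg_zc[OF n])
  also have "\<dots> = 4/3 + quad n (al n) i j k l + 4 * ?c"
    unfolding quad_def gram_al[OF assms(1,3) d(2)] gram_al[OF assms(1,4) d(4)]
      gram_al[OF assms(2,3) d(3)] gram_al[OF assms(2,4) d(5)] al_def sg_zc[OF n]
    by (rule sgn_quad_identity[OF dz[OF d(1)] dz[OF d(2)] dz[OF d(3)] dz[OF d(4)] dz[OF d(5)] dz[OF d(6)]])
  finally have "afun i j k l - (1/3 + quad n (al n) i j k l / 4) = ?c" by linarith
  also have "?c = (2/3) * (1 / (real n)\<^sup>2)" by simp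
  finally show ?thesis by (rule abs_inv_square_le[OF n]) simp
qed

context biperm
begin

lemma p_eq_iff: "i < n \<Longrightarrow> j < n \<Longrightarrow> p i = p j \<longleftrightarrow> i = j"
  using bij by (auto simp: bij_betw_def inj_on_def)

lemma near4_p:
  assumes "near4 n M F G"
  shows "near4 n M (\<lambda>i j k l. F (p i) (p j) (p k) (p l)) (\<lambda>i j k l. G (p i) (p j) (p k) (p l))"
  using assms p_less unfolding near4_def by (simp add: p_eq_iff)

lemma afun_near: "near4 n 100 afun (\<lambda>i j k l. 1/3 + quad n (al n) i j k l / 4)"
  unfolding near4_def
proof (intro allI impI conjI)
  fix i j k l assume ijkl: "i < n" "j < n" "k < n" "l < n"
  show "\<bar>afun i j k l\<bar> \<le> 100" using abs_afun_le[of i j k l] by linarith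
  have "\<bar>al n u v\<bar> \<le> 3" if "u < n" for u v using abs_al_le[OF that, of v] by linarith
  then have "\<bar>quad n (al n) i j k l\<bar> \<le> 72" using ijkl by (intro abs_quad_le)
  then show "\<bar>1/3 + quad n (al n) i j k l / 4\<bar> \<le> 100" by linarith
  show "\<bar>afun i j k l - (1/3 + quad n (al n) i j k l / 4)\<bar> \<le> 2 / real n" if "distinct [i, j, k, l]"
    using afun_approx[OF ijkl that] .
qed

lemma triple_near:
  "near4 n 100 (\<lambda>i j k l. sg i k * sg j k * ksg n i j) (\<lambda>i j k l. 1/3 + triple n (si n) i j k)"
  unfolding near4_def
proof (intro allI impI conjI)
  fix i j k l assume ijkl: "i < n" "j < n" "k < n" "l < n"
  have "\<bar>sg i k * sg j k * ksg n i j\<bar> \<le> 1 * 1"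
    by (intro abs_mult_le abs_sg_sg_le abs_ksg_le n_pos)
  then show "\<bar>sg i k * sg j k * ksg n i j\<bar> \<le> 100" by linarith
  have "\<bar>triple n (si n) i j k\<bar> \<le> 36" using ijkl abs_si_le by (intro abs_triple_le)
  then show "\<bar>1/3 + triple n (si n) i j k\<bar> \<le> 100" by linarith
  show "\<bar>sg i k * sg j k * ksg n i j - (1/3 + triple n (si n) i j k)\<bar> \<le> 2 / real n"
    if "distinct [i, j, k, l]" using triple_approx[OF ijkl(1-3)] that by simp
qed

lemma ksg_near:
  "near4 n 100 (\<lambda>i j k l. ksg n i j * ksg n i j) (\<lambda>i j k l. 1/3 + 2 * gram n (si n) i j)"
  unfolding near4_def
proof (intro allI impI conjI)
  fix i j k l assume ijkl: "i < n" "j < n" "k < n" "l < n"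
  have "\<bar>ksg n i j * ksg n i j\<bar> \<le> 1 * 1" by (intro abs_mult_le abs_ksg_le n_pos)
  then show "\<bar>ksg n i j * ksg n i j\<bar> \<le> 100" by linarith
  have "\<bar>gram n (si n) i j\<bar> \<le> 9" using ijkl abs_si_le by (intro abs_gram_le)
  then show "\<bar>1/3 + 2 * gram n (si n) i j\<bar> \<le> 100" by linarith
  show "\<bar>ksg n i j * ksg n i j - (1/3 + 2 * gram n (si n) i j)\<bar> \<le> 2 / real n"
    if "distinct [i, j, k, l]" using ksg_approx[OF ijkl(1-2)] that by simp
qed

text \<open>120400 is the value of \<open>4 * M + 12 * M\<^sup>2\<close> in
  \<open>avg4_near_mult\<close> at M = 100, which bounds all kernels in use.\<close>

abbreviation "err \<equiv> 120400 / real n"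

lemma near_mult4:
  "near4 n 100 F F' \<Longrightarrow> near4 n 100 G G' \<Longrightarrow>
   \<bar>avg4 n (\<lambda>i j k l. F i j k l * G i j k l) - avg4 n (\<lambda>i j k l. F' i j k l * G' i j k l)\<bar> \<le> err"
  using avg4_near_mult[OF n_pos, of 100 F F' G G'] by simp

lemma near_mult3:
  "near4 n 100 (\<lambda>i j k l. F i j k) (\<lambda>i j k l. F' i j k) \<Longrightarrow> near4 n 100 (\<lambda>i j k l. G i j k) (\<lambda>i j k l. G' i j k) \<Longrightarrow>
   \<bar>avg3 n (\<lambda>i j k. F i j k * G i j k) - avg3 n (\<lambda>i j k. F' i j k * G' i j k)\<bar> \<le> err"
  using avg3_near_mult[OF n_pos, of 100 F F' G G'] by simp

lemma near_mult2:
  "near4 n 100 (\<lambda>i j k l. F i j) (\<lambda>i j k l. F' i j) \<Longrightarrow> near4 n 100 (\<lambda>i j k l. G i j) (\<lambda>i j k l. G' i j) \<Longrightarrow>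
   \<bar>avg2 n (\<lambda>i j. F i j * G i j) - avg2 n (\<lambda>i j. F' i j * G' i j)\<bar> \<le> err"
  using avg2_near_mult[OF n_pos, of 100 F F' G G'] by simp

lemma near4_one: "near4 n 100 (\<lambda>i j k l. 1) (\<lambda>i j k l. 1)"
  by (rule near4_refl) simp

sublocale aa: biperm_kernels n p "al n" "al n"
  by unfold_locales (auto intro: avg_al_0)
sublocale as: biperm_kernels n p "al n" "si n"
  by unfold_locales (auto intro: avg_al_0 avg_si_0)
sublocale sa: biperm_kernels n p "si n" "al n"
  by unfold_locales (auto intro: avg_al_0 avg_si_0)
sublocale ss: biperm_kernels n p "si n" "si n"
  by unfold_locales (auto intro: avg_al_0 avg_si_0)

lemma avg4_p: "avg4 n (\<lambda>i j k l. F (p i) (p j) (p k) (p l)) = avg4 n F"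
  by (simp only: avg_p[of "\<lambda>l. F _ _ _ l"] avg_p[of "\<lambda>k. avg n (F _ _ k)"]
    avg_p[of "\<lambda>j. avg2 n (F _ j)"] avg_p[of "\<lambda>i. avg3 n (F i)"])

text \<open>The cross terms vanish because \<open>quad\<close> has average 0; the coefficients are
  those of \<open>avg4_quad_quad\<close> divided by 16.\<close>

lemma avg4_afun_afun:
  "\<bar>avg4 n (\<lambda>i j k l. afun i j k l * afun (p i) (p j) (p k) (p l)) -
    (1/9 + DD (al n) (al n) / 4 + RR (al n) (al n) / 2)\<bar> \<le> err"
proof -
  let ?Q = "quad n (al n)"
  have q: "avg4 n (\<lambda>i j k l. ?Q (p i) (p j) (p k) (p l)) = 0"
    by (simp only: avg4_p[of ?Q] aa.avg4_quad_0)
  have "avg4 n (\<lambda>i j k l. (1/3 + ?Q i j k l / 4) * (1/3 + ?Q (p i) (p j) (p k) (p l) / 4)) =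
     avg4 n (\<lambda>i j k l. 1/9 + (1/12) * ?Q i j k l + (1/12) * ?Q (p i) (p j) (p k) (p l) +
       (1/16) * (?Q i j k l * ?Q (p i) (p j) (p k) (p l)))"
    by (simp add: algebra_simps)
  also have "\<dots> = 1/9 + DD (al n) (al n) / 4 + RR (al n) (al n) / 2"
    using q aa.avg4_quad_0 aa.avg4_quad_quad n_pos by (simp only: avg_add avg_mult_left avg_const) simp
  finally show ?thesis
    using near_mult4[OF afun_near near4_p[OF afun_near]] by simp
qed

lemma avg2_ksg: "\<bar>avg2 n (\<lambda>i j. ksg n i j * ksg n i j) - 1/3\<bar> \<le> err"
proof -
  have "avg2 n (\<lambda>i j. 1/3 + 2 * gram n (si n) i j) = 1/3"
    using n_pos ss.gram_phi0 by (simp add: avg_add avg_mult_left avg_const)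
  then show ?thesis
    using near_mult2[OF ksg_near near4_one] by simp
qed

lemma avg4_rfun: "avg4 n rfun = avg2 n (\<lambda>i j. ksg n i j * ksg n i j)"
  by (simp add: avg_rfun avg_mult_right) (simp add: ksg_def)

lemma avg4_rfun_near: "\<bar>avg4 n rfun - 1/3\<bar> \<le> err"
  unfolding avg4_rfun by (rule avg2_ksg)

lemma avg4_afun_near: "\<bar>avg4 n afun - 1/3\<bar> \<le> err"
proof -
  have "avg4 n (\<lambda>i j k l. 1/3 + (1/4) * quad n (al n) i j k l) = 1/3"
    using n_pos aa.avg4_quad_0 by (simp only: avg_add avg_mult_left avg_const)
  then show ?thesis
    using near_mult4[OF afun_near near4_one] by simp
qed

lemma rfun_swap: "rfun i j l k = rfun i j k l" "rfun k l i j = rfun i j k l"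
proof -
  show "rfun i j l k = rfun i j k l" by (simp add: rfun_def)
  have "rfun k l i j = (- sg i k) * (- sg i l) * ((- sg j k) * (- sg j l))"
    unfolding rfun_def by (simp only: sg_swap[of k] sg_swap[of l])
  then show "rfun k l i j = rfun i j k l" by (simp add: rfun_def)
qed

text \<open>By \<open>avg4_quad\<close> only the average of \<open>rfun\<close> over its last index
  enters, and up to its mean that is a \<open>triple\<close> of \<open>si\<close>. This is how
  \<open>al\<close> gets paired with \<open>si\<close>.\<close>

lemma avg4_afun_rfun:
  "\<bar>avg4 n (\<lambda>i j k l. afun i j k l * rfun (p i) (p j) (p k) (p l)) -
    (1/9 + DD (al n) (si n) + 2 * RR (al n) (si n))\<bar> \<le> 4 * err"
proof -
  let ?Q = "quad n (al n)" and ?r = "\<lambda>i j k l. rfun (p i) (p j) (p k) (p l)"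
  let ?r3 = "\<lambda>i j k. sg (p i) (p k) * sg (p j) (p k) * ksg n (p i) (p j)"
  let ?t = "\<lambda>i j k. triple n (si n) (p i) (p j) (p k)"
  have r: "near4 n 100 ?r ?r" using abs_rfun_le by (intro near4_refl) (meson order_trans one_le_numeral)
  have r3: "avg n (?r i j k) = ?r3 i j k" for i j k
    using avg_p[of "rfun (p i) (p j) (p k)"] by (simp add: avg_rfun)
  have q0: "\<bar>avg4 n (\<lambda>i j k l. afun i j k l * ?r i j k l) - avg4 n (\<lambda>i j k l. (1/3 + ?Q i j k l / 4) * ?r i j k l)\<bar> \<le> err"
    by (rule near_mult4[OF afun_near r])
  have "avg4 n (\<lambda>i j k l. (1/3 + ?Q i j k l / 4) * ?r i j k l) =
     (1/3) * avg4 n ?r + (1/4) * avg4 n (\<lambda>i j k l. ?Q i j k l * ?r i j k l)"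
    unfolding avg_mult_left[symmetric] avg_add[symmetric] by (simp add: algebra_simps)
  also have "avg4 n ?r = avg4 n rfun" by (rule avg4_p)
  also have "avg4 n (\<lambda>i j k l. ?Q i j k l * ?r i j k l) =
    4 * avg3 n (\<lambda>i j k. (al n k i * al n k j) * ?r3 i j k) - 4 * avg3 n (\<lambda>i j k. gram n (al n) i k * ?r3 i j k)"
    unfolding r3[symmetric]
    by (rule aa.avg4_quad) (rule rfun_swap)+
  finally have eq: "avg4 n (\<lambda>i j k l. (1/3 + ?Q i j k l / 4) * ?r i j k l) = (1/3) * avg4 n rfun +
    avg3 n (\<lambda>i j k. (al n k i * al n k j) * ?r3 i j k) - avg3 n (\<lambda>i j k. gram n (al n) i k * ?r3 i j k)"
    by simp
  have r3near: "near4 n 100 (\<lambda>i j k l. ?r3 i j k) (\<lambda>i j k l. 1/3 + ?t i j k)"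
    using near4_p[OF triple_near] .
  have 1: "\<bar>avg3 n (\<lambda>i j k. (al n k i * al n k j) * ?r3 i j k) - (DD (al n) (si n) + RR (al n) (si n))\<bar> \<le> err"
  proof -
    have "near4 n 100 (\<lambda>i j k l. al n k i * al n k j) (\<lambda>i j k l. al n k i * al n k j)"
    proof (rule near4_refl)
      fix i j k l assume "k < n"
      then have "\<bar>al n k i * al n k j\<bar> \<le> 2 * 2" by (intro abs_mult_le abs_al_le)
      then show "\<bar>al n k i * al n k j\<bar> \<le> 100" by linarith
    qed
    from near_mult3[OF this r3near]
    have "\<bar>avg3 n (\<lambda>i j k. (al n k i * al n k j) * ?r3 i j k) -
      avg3 n (\<lambda>i j k. (al n k i * al n k j) * (1/3 + ?t i j k))\<bar> \<le> err" .
    moreover have "avg3 n (\<lambda>i j k. (al n k i * al n k j) * (1/3 + ?t i j k)) =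
       avg2 n (gram n (al n)) * (1/3) + avg3 n (\<lambda>i j k. (al n k i * al n k j) * ?t i j k)"
      unfolding gram_def avg_mult_right[symmetric] avg_add[symmetric] by (simp add: algebra_simps)
    ultimately show ?thesis
      using as.avg3_prod_triple as.gram_phi0 by simp
  qed
  have 2: "\<bar>avg3 n (\<lambda>i j k. gram n (al n) i k * ?r3 i j k) - (- RR (al n) (si n))\<bar> \<le> err"
  proof -
    have "near4 n 100 (\<lambda>i j k l. gram n (al n) i k) (\<lambda>i j k l. gram n (al n) i k)"
    proof (rule near4_refl)
      fix i j k l assume "i < n" "k < n"
      moreover have "\<bar>al n u v\<bar> \<le> 3" if "u < n" for u v using abs_al_le[OF that, of v] by linarith
      ultimately have "\<bar>gram n (al n) i k\<bar> \<le> 9" by (intro abs_gram_le)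
      then show "\<bar>gram n (al n) i k\<bar> \<le> 100" by linarith
    qed
    from near_mult3[OF this r3near]
    have "\<bar>avg3 n (\<lambda>i j k. gram n (al n) i k * ?r3 i j k) -
      avg3 n (\<lambda>i j k. gram n (al n) i k * (1/3 + ?t i j k))\<bar> \<le> err" .
    moreover have "avg3 n (\<lambda>i j k. gram n (al n) i k * (1/3 + ?t i j k)) =
       avg3 n (\<lambda>i j k. gram n (al n) i k) * (1/3) + avg3 n (\<lambda>i j k. gram n (al n) i k * ?t i j k)"
      unfolding avg_mult_right[symmetric] avg_add[symmetric] by (simp add: algebra_simps)
    moreover have "avg3 n (\<lambda>i j k. gram n (al n) i k) = 0" using as.gram_phi0 by simp
    ultimately show ?thesis
      using as.avg3_gram_triple by simp
  qed
  show ?thesis using q0 eq 1 2 avg4_rfun_near by linarith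
qed

lemma avg4_afun_bfun:
  "\<bar>avg4 n (\<lambda>i j k l. afun i j k l * bfun (p i) (p j) (p k) (p l)) -
    (1/9 - DD (al n) (si n) / 2 - RR (al n) (si n))\<bar> \<le> 3 * err"
proof -
  have "avg4 n (\<lambda>i j k l. afun i j k l * bfun (p i) (p j) (p k) (p l)) =
    (1/2) * avg4 n afun - (1/2) * avg4 n (\<lambda>i j k l. afun i j k l * rfun (p i) (p j) (p k) (p l))"
    unfolding avg_mult_left[symmetric] avg_diff[symmetric] by (simp add: bfun_def algebra_simps diff_divide_distrib)
  then show ?thesis using avg4_afun_near avg4_afun_rfun by linarith
qed

text \<open>With \<open>w\<close> the conditional average of one factor and \<open>z\<close> its value for independent
  coordinates, \<open>w\<^sup>2 \<ge> 2wz - z\<^sup>2\<close> reduces the fourth moment to kernels of three variables.\<close>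

lemma avg4_bfun_bfun:
  "avg4 n (\<lambda>i j k l. bfun i j k l * bfun (p i) (p j) (p k) (p l)) \<ge>
    1/9 + DD (si n) (si n) / 2 + 3 * RR (si n) (si n) / 2 - 2 * err"
proof -
  let ?r' = "\<lambda>i j k l. rfun (p i) (p j) (p k) (p l)"
  define w where "w i j = avg n (\<lambda>k. (sg i k * sg j k) * (sg (p i) (p k) * sg (p j) (p k)))" for i j
  define z where "z i j = ksg n i j * ksg n (p i) (p j)" for i j
  \<comment> \<open>Given \<open>i\<close> and \<open>j\<close>, the indices \<open>k\<close> and
    \<open>l\<close> are independent and play the same role, so the average is a mean
    square.\<close>
  have rr: "avg4 n (\<lambda>i j k l. rfun i j k l * ?r' i j k l) = avg2 n (\<lambda>i j. w i j * w i j)"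
  proof -
    have "avg4 n (\<lambda>i j k l. rfun i j k l * ?r' i j k l) = avg4 n (\<lambda>i j k l.
      ((sg i k * sg j k) * (sg (p i) (p k) * sg (p j) (p k))) * ((sg i l * sg j l) * (sg (p i) (p l) * sg (p j) (p l))))"
      by (simp add: rfun_def mult_ac)
    then show ?thesis by (simp only: avg_mult_left avg_mult_right w_def)
  qed
  have "avg2 n (\<lambda>i j. 2 * (w i j * z i j) - z i j * z i j) \<le> avg2 n (\<lambda>i j. w i j * w i j)"
  proof (intro avg_mono)
    fix i j
    have "0 \<le> (w i j - z i j)\<^sup>2" by simp
    then show "2 * (w i j * z i j) - z i j * z i j \<le> w i j * w i j"
      by (simp add: power2_eq_square algebra_simps)
  qed
  then have le: "2 * avg2 n (\<lambda>i j. w i j * z i j) - avg2 n (\<lambda>i j. z i j * z i j) \<le> avg2 n (\<lambda>i j. w i j * w i j)"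
    by (simp only: avg_diff avg_mult_left)
  let ?t = "\<lambda>i j k. triple n (si n) i j k"
  have wz: "\<bar>avg2 n (\<lambda>i j. w i j * z i j) - (1/9 + DD (si n) (si n) + 5 * RR (si n) (si n))\<bar> \<le> err"
  proof -
    have "avg2 n (\<lambda>i j. w i j * z i j) = avg3 n (\<lambda>i j k. (sg i k * sg j k * ksg n i j) *
       (sg (p i) (p k) * sg (p j) (p k) * ksg n (p i) (p j)))"
      unfolding w_def avg_mult_right[symmetric] z_def by (simp add: mult_ac)
    moreover have "\<bar>avg3 n (\<lambda>i j k. (sg i k * sg j k * ksg n i j) * (sg (p i) (p k) * sg (p j) (p k) * ksg n (p i) (p j))) -
      avg3 n (\<lambda>i j k. (1/3 + ?t i j k) * (1/3 + ?t (p i) (p j) (p k)))\<bar> \<le> err"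
      by (rule near_mult3[OF triple_near near4_p[OF triple_near]])
    moreover have "avg3 n (\<lambda>i j k. (1/3 + ?t i j k) * (1/3 + ?t (p i) (p j) (p k))) =
       avg3 n (\<lambda>i j k. 1/9 + (1/3) * ?t i j k + (1/3) * ?t (p i) (p j) (p k) + ?t i j k * ?t (p i) (p j) (p k))"
      by (simp add: algebra_simps)
    moreover have t0: "avg3 n ?t = 0"
    proof -
      have "avg3 n ?t = avg n (\<lambda>i. avg n (\<lambda>k. avg n (\<lambda>j. ?t i j k)))" by (intro avg_cong avg_swap)
      also have "\<dots> = avg n (\<lambda>i. avg n (\<lambda>k. - gram n (si n) i k))"
        by (intro avg_cong) (simp add: ss.avg_triple)
      finally show ?thesis using ss.gram_phi0 by (simp add: avg_minus)
    qed
    moreover have "avg3 n (\<lambda>i j k. ?t (p i) (p j) (p k)) = avg3 n ?t"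
      using avg4_p[of "\<lambda>i j k l. ?t i j k"] n_pos by (simp only: avg_const)
    ultimately show ?thesis
      using n_pos ss.avg3_triple_triple by (simp only: avg_add avg_mult_left avg_const)
  qed
  have zz: "\<bar>avg2 n (\<lambda>i j. z i j * z i j) - (1/9 + 4 * RR (si n) (si n))\<bar> \<le> err"
  proof -
    let ?g = "gram n (si n)"
    have "avg2 n (\<lambda>i j. z i j * z i j) = avg2 n (\<lambda>i j. (ksg n i j * ksg n i j) * (ksg n (p i) (p j) * ksg n (p i) (p j)))"
      by (simp add: z_def mult_ac)
    moreover have "\<bar>avg2 n (\<lambda>i j. (ksg n i j * ksg n i j) * (ksg n (p i) (p j) * ksg n (p i) (p j))) -
      avg2 n (\<lambda>i j. (1/3 + 2 * ?g i j) * (1/3 + 2 * ?g (p i) (p j)))\<bar> \<le> err"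
      by (rule near_mult2[OF ksg_near near4_p[OF ksg_near]])
    moreover have "avg2 n (\<lambda>i j. (1/3 + 2 * ?g i j) * (1/3 + 2 * ?g (p i) (p j))) =
       avg2 n (\<lambda>i j. 1/9 + (2/3) * ?g i j + (2/3) * ?g (p i) (p j) + 4 * (?g i j * ?g (p i) (p j)))"
      by (simp add: algebra_simps)
    moreover have "avg2 n ?g = 0" using ss.gram_phi0 by simp
    moreover have "avg2 n (\<lambda>i j. ?g (p i) (p j)) = 0" using ss.gram_psi0 by simp
    ultimately show ?thesis
      using n_pos avg2_gram_gram[of "si n" "si n"]
      by (simp only: avg_add avg_mult_left avg_const)
  qed
  have "avg4 n (\<lambda>i j k l. bfun i j k l * bfun (p i) (p j) (p k) (p l)) =
    avg4 n (\<lambda>i j k l. 1/4 - (1/4) * rfun i j k l - (1/4) * ?r' i j k l + (1/4) * (rfun i j k l * ?r' i j k l))"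
    by (intro avg_cong) (simp add: bfun_def field_simps)
  also have "\<dots> = 1/4 - (1/4) * avg4 n rfun - (1/4) * avg4 n ?r' + (1/4) * avg4 n (\<lambda>i j k l. rfun i j k l * ?r' i j k l)"
    using n_pos by (simp only: avg_add avg_diff avg_mult_left avg_const)
  also have "avg4 n ?r' = avg4 n rfun" by (rule avg4_p)
  finally show ?thesis using rr le wz zz avg4_rfun_near by linarith
qed

end

section \<open>The signature kernel and the decomposition of correlations\<close>

context biperm
begin

definition mm :: "nat \<Rightarrow> nat \<Rightarrow> real" where
  "mm u v = avg n (\<lambda>i. sg u i * sg v (p i))"

text \<open>Kendall's rank correlation, taken over ordered pairs with the vanishing diagonal
  included.\<close>

definition tau :: real where "tau = avg n (\<lambda>i. mm i (p i))"

definition ww :: real where "ww = avg2 n (\<lambda>i j. mm i (p j) * mm j (p i))"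

lemma avg4_sg_square:
  "avg4 n (\<lambda>i j k l. (sg i j * sg k l) * (sg (p i) (p j) * sg (p k) (p l))) = tau\<^sup>2"
proof -
  have "avg4 n (\<lambda>i j k l. (sg i j * sg k l) * (sg (p i) (p j) * sg (p k) (p l))) =
    avg4 n (\<lambda>i j k l. (sg i j * sg (p i) (p j)) * (sg k l * sg (p k) (p l)))"
    by (simp add: mult_ac)
  then show ?thesis
    by (simp only: avg_mult_left avg_mult_right tau_def mm_def power2_eq_square)
qed

lemma avg4_sg_cross:
  "avg4 n (\<lambda>i j k l. (sg i k * sg j l) * (sg (p i) (p l) * sg (p j) (p k))) = ww"
proof -
  have "avg4 n (\<lambda>i j k l. (sg i k * sg j l) * (sg (p i) (p l) * sg (p j) (p k))) =
    avg4 n (\<lambda>i j k l. (sg i k * sg (p j) (p k)) * (sg j l * sg (p i) (p l)))"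
    by (simp add: mult_ac)
  then show ?thesis
    by (simp only: avg_mult_left avg_mult_right ww_def mm_def)
qed

text \<open>Each kernel has one term per perfect matching of the four indices. Equal matchings
  factor into \<open>tau\<^sup>2\<close>; the six pairs of different matchings can be relabelled to
  \<open>ww\<close> up to sign, and each of them contributes \<open>- ww\<close>.\<close>

lemma avg4_vfun_vfun:
  "avg4 n (\<lambda>i j k l. vfun i j k l * vfun (p i) (p j) (p k) (p l)) = 3 * tau\<^sup>2 - 6 * ww"
proof -
  let ?a = "\<lambda>i j k l. sg i j * sg k l" and ?b = "\<lambda>i j k l. sg i k * sg j l" and ?c = "\<lambda>i j k l. sg i l * sg j k"
  define X where "X F G = avg4 n (\<lambda>i j k l. F i j k l * G (p i) (p j) (p k) (p l))"
    for F G :: "nat \<Rightarrow> nat \<Rightarrow> nat \<Rightarrow> nat \<Rightarrow> real"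
  have aa: "X ?a ?a = tau\<^sup>2" unfolding X_def by (rule avg4_sg_square)
  have bb: "X ?b ?b = tau\<^sup>2" unfolding X_def avg4_sg_square[symmetric] by (rule avg4_swap23)
  have cc: "X ?c ?c = tau\<^sup>2"
    unfolding bb[symmetric] unfolding X_def by (subst avg4_swap34) simp
  have bc: "X ?b ?c = ww" unfolding X_def by (rule avg4_sg_cross)
  have cb: "X ?c ?b = ww"
    unfolding bc[symmetric] unfolding X_def by (subst avg4_swap34) simp
  have ac: "X ?a ?c = - ww"
  proof -
    have "X ?a ?c = avg4 n (\<lambda>i j k l. - (?b i j k l * ?c (p i) (p j) (p k) (p l)))"
      unfolding X_def by (subst avg4_swap23, intro avg_cong) (subst (5) sg_swap, simp)
    then show ?thesis unfolding avg_minus using bc by (simp add: X_def)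
  qed
  have ca: "X ?c ?a = - ww"
  proof -
    have "X ?c ?a = avg4 n (\<lambda>i j k l. - (?c i j k l * ?b (p i) (p j) (p k) (p l)))"
      unfolding X_def by (subst avg4_swap23, intro avg_cong) (subst (2) sg_swap, simp)
    then show ?thesis unfolding avg_minus using cb by (simp add: X_def)
  qed
  have ab: "X ?a ?b = ww"
  proof -
    have "X ?a ?b = avg4 n (\<lambda>i j k l. - (?a i j k l * ?c (p i) (p j) (p k) (p l)))"
      unfolding X_def by (subst avg4_swap34, intro avg_cong) (subst (2) sg_swap, simp)
    then show ?thesis unfolding avg_minus using ac by (simp add: X_def)
  qed
  have ba: "X ?b ?a = ww"
  proof -
    have "X ?b ?a = avg4 n (\<lambda>i j k l. - (?c i j k l * ?a (p i) (p j) (p k) (p l)))"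
      unfolding X_def by (subst avg4_swap34, intro avg_cong) (subst (6) sg_swap, simp)
    then show ?thesis unfolding avg_minus using ca by (simp add: X_def)
  qed
  have "avg4 n (\<lambda>i j k l. vfun i j k l * vfun (p i) (p j) (p k) (p l)) =
     X ?a ?a - X ?a ?b + X ?a ?c - X ?b ?a + X ?b ?b - X ?b ?c + X ?c ?a - X ?c ?b + X ?c ?c"
    unfolding X_def avg_add[symmetric] avg_diff[symmetric] by (simp add: vfun_def algebra_simps)
  then show ?thesis using aa ab ac ba bb bc ca cb cc by simp
qed

text \<open>The four parts of \<open>corr (al n) (al n)\<close>, as in an analysis of variance:
  \<open>AA\<close> averages to 0 in each argument, \<open>BB\<close> and \<open>CC\<close> depend
  on one threshold and average to 0, and \<open>zeta\<close> is constant.\<close>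

definition AA :: "nat \<Rightarrow> nat \<Rightarrow> real" where "AA = corr (si n) (si n)"
definition BB :: "nat \<Rightarrow> real" where "BB v = - avg n (\<lambda>i. zc n i * si n v (p i))"
definition CC :: "nat \<Rightarrow> real" where "CC u = - avg n (\<lambda>i. si n u i * zc n (p i))"
definition zeta :: real where "zeta = avg n (\<lambda>i. zc n i * zc n (p i))"

lemma al_si: "al n u i = si n u i - zc n i"
  by (simp add: al_def si_def)

lemma corr_decomp:
  "corr (al n) (si n) u v = AA u v + BB v"
  "corr (si n) (al n) u v = AA u v + CC u"
  "corr (al n) (al n) u v = AA u v + BB v + CC u + zeta"
  by (simp_all add: corr_def AA_def BB_def CC_def zeta_def al_si algebra_simps avg_add avg_diff)

lemma mm_decomp: 
  assumes "u < n" "v < n"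
  shows "mm u v = zc n u * zc n v + AA u v + BB v + CC u + zeta"
proof -
  have "corr (al n) (al n) u v = avg n (\<lambda>i. sg u i * sg v (p i) - sg u i * zc n v - zc n u * sg v (p i) + zc n u * zc n v)"
    by (simp add: corr_def al_def algebra_simps)
  also have "\<dots> = mm u v - zc n u * zc n v"
    using avg_sg[OF assms(1)] avg_sg[OF assms(2)] avg_p[of "sg v"] n_pos
    by (simp add: avg_add avg_diff avg_mult_left avg_mult_right avg_const mm_def)
  finally show ?thesis using corr_decomp(3)[of u v] by simp
qed

lemma avg_AA: "avg n (\<lambda>u. AA u v) = 0" "avg n (AA u) = 0" "avg n (\<lambda>v. AA u (p v)) = 0"
proof -
  have "avg n (\<lambda>u. AA u v) = avg n (\<lambda>i. avg n (\<lambda>u. si n u i * si n v (p i)))"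
    unfolding AA_def corr_def by (rule avg_swap)
  also have "\<dots> = avg n (\<lambda>i. 0)" by (intro avg_cong) (simp add: avg_mult_right avg_si_0')
  finally show "avg n (\<lambda>u. AA u v) = 0" by simp
  have "avg n (\<lambda>v. AA u v) = avg n (\<lambda>i. avg n (\<lambda>v. si n u i * si n v (p i)))"
    unfolding AA_def corr_def by (rule avg_swap)
  also have "\<dots> = avg n (\<lambda>i. 0)" by (intro avg_cong) (simp add: avg_mult_left avg_si_0' p_less)
  finally show "avg n (AA u) = 0" by simp
  then show "avg n (\<lambda>v. AA u (p v)) = 0" by (simp only: avg_p)
qed

lemma avg_BB: "avg n BB = 0" "avg n (\<lambda>i. BB (p i)) = 0"
proof -
  have "avg n (\<lambda>v. avg n (\<lambda>i. zc n i * si n v (p i))) = avg n (\<lambda>i. avg n (\<lambda>v. zc n i * si n v (p i)))"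
    by (rule avg_swap)
  also have "\<dots> = avg n (\<lambda>i. 0)" by (intro avg_cong) (simp add: avg_mult_left avg_si_0' p_less)
  finally show "avg n BB = 0" by (simp add: BB_def[abs_def] avg_minus)
  then show "avg n (\<lambda>i. BB (p i)) = 0" by (simp only: avg_p)
qed

lemma avg_CC: "avg n CC = 0"
proof -
  have "avg n (\<lambda>u. avg n (\<lambda>i. si n u i * zc n (p i))) = avg n (\<lambda>i. avg n (\<lambda>u. si n u i * zc n (p i)))"
    by (rule avg_swap)
  also have "\<dots> = avg n (\<lambda>i. 0)" by (intro avg_cong) (simp add: avg_mult_right avg_si_0')
  finally show "avg n CC = 0" by (simp add: CC_def[abs_def] avg_minus)
qed

definition bc :: real where "bc = avg n (\<lambda>i. BB (p i) * CC i)"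
definition qq :: real where "qq = avg2 n (\<lambda>i j. AA i (p j) * AA j (p i))"
definition ad :: real where "ad = avg n (\<lambda>i. AA i (p i))"

lemma tau_eq: "tau = 2 * zeta + ad"
proof -
  have "tau = avg n (\<lambda>i. zc n i * zc n (p i) + AA i (p i) + BB (p i) + CC i + zeta)"
    unfolding tau_def by (intro avg_cong) (simp add: mm_decomp p_less)
  also have "\<dots> = zeta + ad + zeta"
    using n_pos avg_BB avg_CC by (simp add: avg_add avg_const zeta_def ad_def)
  finally show ?thesis by simp
qed

text \<open>By the antisymmetry \<open>si_swap\<close> a threshold and a point can trade places, so
  weighting \<open>AA\<close> by coordinates of points of the permutation produces \<open>BB\<close>
  and \<open>CC\<close> at a common point.\<close>

lemma avg2_zz_AA: "avg2 n (\<lambda>i j. (zc n i * zc n (p j)) * AA j (p i)) = bc"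
proof -
  have "avg2 n (\<lambda>i j. (zc n i * zc n (p j)) * AA j (p i)) =
     avg n (\<lambda>i. avg n (\<lambda>j. avg n (\<lambda>k. (zc n i * si n (p i) (p k)) * (si n j k * zc n (p j)))))"
    unfolding AA_def corr_def avg_mult_left[symmetric] by (simp add: mult_ac)
  also have "\<dots> = avg n (\<lambda>i. avg n (\<lambda>k. avg n (\<lambda>j. (zc n i * si n (p i) (p k)) * (si n j k * zc n (p j)))))"
    by (intro avg_cong avg_swap)
  also have "\<dots> = avg n (\<lambda>k. avg n (\<lambda>i. avg n (\<lambda>j. (zc n i * si n (p i) (p k)) * (si n j k * zc n (p j)))))"
    by (rule avg_swap)
  also have "\<dots> = avg n (\<lambda>k. avg n (\<lambda>i. zc n i * si n (p i) (p k)) * avg n (\<lambda>j. si n j k * zc n (p j)))"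
    by (simp only: avg_mult_left avg_mult_right)
  also have "\<dots> = avg n (\<lambda>k. BB (p k) * CC k)"
  proof (intro avg_cong)
    fix k
    have "avg n (\<lambda>i. zc n i * si n (p i) (p k)) = BB (p k)"
      unfolding BB_def avg_minus[symmetric] by (subst si_swap) simp
    moreover have "avg n (\<lambda>j. si n j k * zc n (p j)) = CC k"
      unfolding CC_def avg_minus[symmetric] by (subst si_swap) simp
    ultimately show "avg n (\<lambda>i. zc n i * si n (p i) (p k)) * avg n (\<lambda>j. si n j k * zc n (p j)) = BB (p k) * CC k"
      by simp
  qed
  finally show ?thesis by (simp add: bc_def)
qed

text \<open>Of the 25 products all but seven contain a factor that averages to 0: two give
  \<open>zeta\<^sup>2\<close>, four give \<open>bc\<close> and one gives \<open>qq\<close>.\<close>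

lemma ww_eq: "ww = 2 * zeta\<^sup>2 + 4 * bc + qq"
proof -
  let ?m = "\<lambda>i j. zc n i * zc n (p j) + AA i (p j) + BB (p j) + CC i + zeta"
  let ?z = "\<lambda>i. zc n i" and ?y = "\<lambda>i. zc n (p i)" and ?b = "\<lambda>i. BB (p i)"
  have zy: "avg n ?z = 0" "avg n ?y = 0" using avg_zc[of n] avg_p[of "zc n"] by simp_all
  have "ww = avg2 n (\<lambda>i j. ?m i j * ?m j i)"
    unfolding ww_def by (intro avg_cong) (simp add: mm_decomp p_less)
  also have "\<dots> = avg2 n (\<lambda>i j.
      (?z i * ?y i) * (?z j * ?y j) + (?z i * ?y j) * AA j (p i) + (?z i * ?b i) * ?y j + ?z i * (?y j * CC j) + (zeta * ?z i) * ?y j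
    + (?z j * ?y i) * AA i (p j) + AA i (p j) * AA j (p i) + ?b i * AA i (p j) + AA i (p j) * CC j + zeta * AA i (p j)
    + ?y i * (?b j * ?z j) + ?b j * AA j (p i) + ?b i * ?b j + ?b j * CC j + zeta * ?b j
    + (CC i * ?y i) * ?z j + CC i * AA j (p i) + CC i * ?b i + CC i * CC j + zeta * CC i
    + (zeta * ?y i) * ?z j + zeta * AA j (p i) + zeta * ?b i + zeta * CC j + zeta * zeta)"
    by (intro avg_cong) (simp add: algebra_simps)
  also have "\<dots> = zeta * zeta + bc + 0 + 0 + 0 + bc + qq + 0 + 0 + 0 + 0 + 0 + 0 + bc + 0 + 0 + 0 + bc + 0 + 0 + 0 + 0 + 0 + 0 + zeta * zeta"
  proof -
    have 1: "avg2 n (\<lambda>i j. (?z j * ?y i) * AA i (p j)) = bc"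
      unfolding avg2_zz_AA[symmetric] by (rule avg_swap)
    have 2: "avg2 n (\<lambda>i j. ?b i * AA i (p j)) = 0" by (simp add: avg_mult_left avg_AA)
    have 3: "avg2 n (\<lambda>i j. AA i (p j) * CC j) = 0"
      by (subst avg_swap) (simp add: avg_mult_right avg_AA)
    have 4: "avg2 n (\<lambda>i j. AA i (p j)) = 0" by (simp add: avg_AA)
    have 5: "avg2 n (\<lambda>i j. ?b j * AA j (p i)) = 0"
      by (subst avg_swap) (simp add: avg_mult_left avg_AA)
    have 6: "avg2 n (\<lambda>i j. CC i * AA j (p i)) = 0"
      by (simp add: avg_mult_left avg_AA)
    have 7: "avg2 n (\<lambda>i j. AA j (p i)) = 0" by (subst avg_swap) (simp add: avg_AA)
    have 8: "avg n (\<lambda>i. CC i * ?b i) = bc" by (simp add: bc_def mult.commute)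
    show ?thesis
      unfolding avg_add
      by (simp only: 1 2 3 4 5 6 7 avg2_zz_AA avg_AA qq_def[symmetric] avg_mult_left avg_mult_right zy avg_BB avg_CC
          avg_const[OF n_pos] bc_def[symmetric] 8 zeta_def[symmetric] mult_zero_right mult_zero_left avg_0)
  qed
  finally show ?thesis by (simp add: power2_eq_square)
qed

end

section \<open>Combining the four-point estimates\<close>

context biperm
begin

text \<open>Inverting the permutation exchanges positions and values, and with them the two slots of
  \<open>corr\<close>, so this is \<open>avg4_afun_bfun\<close> for the inverse.\<close>

lemma avg4_bfun_afun:
  "\<bar>avg4 n (\<lambda>i j k l. bfun i j k l * afun (p i) (p j) (p k) (p l)) -
    (1/9 - DD (si n) (al n) / 2 - RR (si n) (al n))\<bar> \<le> 3 * err"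
proof -
  define q where "q = the_inv_into {..<n} p"
  have q: "bij_betw q {..<n} {..<n}" unfolding q_def by (rule bij_betw_the_inv_into[OF bij])
  have pq: "p (q i) = i" if "i < n" for i
    using that bij unfolding q_def by (simp add: bij_betw_def f_the_inv_into_f)
  have qp: "q (p i) = i" if "i < n" for i
    using that bij unfolding q_def by (simp add: bij_betw_def the_inv_into_f_f)
  interpret Q: biperm n q using n_pos q by unfold_locales
  have corr: "Q.corr \<phi> \<psi> u v = corr \<psi> \<phi> v u" for \<phi> \<psi> u v
  proof -
    have "Q.corr \<phi> \<psi> u v = avg n (\<lambda>i. \<phi> u (p i) * \<psi> v (q (p i)))"
      unfolding Q.corr_def by (rule avg_p[symmetric])
    also have "\<dots> = avg n (\<lambda>i. \<psi> v i * \<phi> u (p i))" by (intro avg_cong) (simp add: qp)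
    finally show ?thesis by (simp add: corr_def)
  qed
  have R: "Q.RR \<phi> \<psi> = RR \<psi> \<phi>" for \<phi> \<psi>
    unfolding Q.RR_def RR_def corr by (rule avg_swap)
  have D: "Q.DD \<phi> \<psi> = DD \<psi> \<phi>" for \<phi> \<psi>
  proof -
    have "Q.DD \<phi> \<psi> = avg n (\<lambda>i. (corr \<psi> \<phi> (q (p i)) (p i))\<^sup>2)"
      unfolding Q.DD_def corr by (rule avg_p[symmetric])
    also have "\<dots> = DD \<psi> \<phi>" unfolding DD_def by (intro avg_cong) (simp add: qp)
    finally show ?thesis .
  qed
  have "avg4 n (\<lambda>i j k l. bfun i j k l * afun (p i) (p j) (p k) (p l)) =
     avg4 n (\<lambda>i j k l. bfun (q i) (q j) (q k) (q l) * afun (p (q i)) (p (q j)) (p (q k)) (p (q l)))"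
    by (rule Q.avg4_p[symmetric])
  also have "\<dots> = avg4 n (\<lambda>i j k l. afun i j k l * bfun (q i) (q j) (q k) (q l))"
    by (intro avg_cong) (simp add: pq)
  finally show ?thesis using Q.avg4_afun_bfun by (simp add: R D)
qed

abbreviation "rho \<equiv> RR (si n) (si n)"

text \<open>The four parts are orthogonal, so their mean squares add.\<close>

lemma RR_decomp:
  "RR (al n) (si n) = rho + avg n (\<lambda>v. (BB v)\<^sup>2)"
  "RR (si n) (al n) = rho + avg n (\<lambda>u. (CC u)\<^sup>2)"
  "RR (al n) (al n) = rho + avg n (\<lambda>v. (BB v)\<^sup>2) + avg n (\<lambda>u. (CC u)\<^sup>2) + zeta\<^sup>2"
proof -
  have rho: "rho = avg2 n (\<lambda>u v. (AA u v)\<^sup>2)" by (simp add: RR_def AA_def)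
  have AB: "avg2 n (\<lambda>u v. AA u v * BB v) = 0"
    by (subst avg_swap) (simp add: avg_mult_right avg_AA)
  have AC: "avg2 n (\<lambda>u v. AA u v * CC u) = 0"
    by (simp add: avg_mult_right avg_AA)
  have A: "avg2 n AA = 0" by (simp add: avg_AA)
  have "RR (al n) (si n) = avg2 n (\<lambda>u v. (AA u v)\<^sup>2 + 2 * (AA u v * BB v) + (BB v)\<^sup>2)"
    unfolding RR_def corr_decomp by (simp add: power2_sum algebra_simps)
  then show "RR (al n) (si n) = rho + avg n (\<lambda>v. (BB v)\<^sup>2)"
    using n_pos AB by (simp only: avg_add avg_mult_left avg_const rho)
  have "RR (si n) (al n) = avg2 n (\<lambda>u v. (AA u v)\<^sup>2 + 2 * (AA u v * CC u) + (CC u)\<^sup>2)"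
    unfolding RR_def corr_decomp by (simp add: power2_sum algebra_simps)
  then show "RR (si n) (al n) = rho + avg n (\<lambda>u. (CC u)\<^sup>2)"
    using n_pos AC by (simp only: avg_add avg_mult_left avg_const rho)
  have "RR (al n) (al n) = avg2 n (\<lambda>u v. (AA u v)\<^sup>2 + (BB v)\<^sup>2 + (CC u)\<^sup>2 + zeta\<^sup>2 +
     2 * (AA u v * BB v) + 2 * (AA u v * CC u) + (2 * zeta) * AA u v + (2 * CC u) * BB v + (2 * zeta) * BB v + (2 * zeta) * CC u)"
    unfolding RR_def corr_decomp by (simp add: power2_eq_square algebra_simps)
  then show "RR (al n) (al n) = rho + avg n (\<lambda>v. (BB v)\<^sup>2) + avg n (\<lambda>u. (CC u)\<^sup>2) + zeta\<^sup>2"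
    using n_pos AB AC A by (simp only: avg_add avg_mult_left avg_const rho avg_BB avg_CC) simp
qed

lemma rho_le: "rho \<le> RR (al n) (si n)" "rho \<le> RR (si n) (al n)" "rho \<le> RR (al n) (al n)"
proof -
  have "0 \<le> avg n (\<lambda>v. (BB v)\<^sup>2)" "0 \<le> avg n (\<lambda>v. (CC v)\<^sup>2)" "0 \<le> zeta\<^sup>2"
    by (auto intro: avg_nonneg)
  then show "rho \<le> RR (al n) (si n)" "rho \<le> RR (si n) (al n)" "rho \<le> RR (al n) (al n)"
    unfolding RR_decomp by linarith+
qed

text \<open>Both factors have mean square \<open>rho\<close>, and 2xy \<ge> -(x^2 + y^2).\<close>

lemma qq_ge: "- rho \<le> qq"
proof -
  have "avg2 n (\<lambda>i j. - ((AA i (p j))\<^sup>2 + (AA j (p i))\<^sup>2) / 2) \<le> qq"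
    unfolding qq_def
  proof (intro avg_mono)
    fix i j
    have "0 \<le> (AA i (p j) + AA j (p i))\<^sup>2" by simp
    then show "- ((AA i (p j))\<^sup>2 + (AA j (p i))\<^sup>2) / 2 \<le> AA i (p j) * AA j (p i)"
      by (simp add: power2_sum)
  qed
  moreover have 1: "avg2 n (\<lambda>i j. (AA i (p j))\<^sup>2) = rho"
    unfolding RR_def AA_def[symmetric] by (rule avg_cong) (rule avg_p)
  moreover have "avg2 n (\<lambda>i j. (AA j (p i))\<^sup>2) = rho"
    unfolding 1[symmetric] by (rule avg_swap)
  ultimately show ?thesis
    by (simp add: avg_divide avg_minus avg_add avg_diff)
qed

text \<open>The left side is the signature average plus \<open>18 * rho\<close>, the right side six
  times the combined deviation of the four pair averages. So the squares pay for a sixth of the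
  signature and leave \<open>3 * rho\<close>.\<close>

lemma quadratic_form_bound:
  "12 * zeta * ad + 3 * ad\<^sup>2 - 24 * bc - 6 * qq + 18 * rho \<le>
   3/2 * DD (al n) (al n) + 3 * RR (al n) (al n) + 3 * DD (si n) (si n) + 9 * rho
   + 3 * DD (al n) (si n) + 6 * RR (al n) (si n) + 3 * DD (si n) (al n) + 6 * RR (si n) (al n)"
proof -
  define A where "A i = AA i (p i)" for i
  define B where "B i = BB (p i)" for i
  have b: "avg n (\<lambda>i. (B i)\<^sup>2) = avg n (\<lambda>v. (BB v)\<^sup>2)"
    unfolding B_def by (rule avg_p)
  have Dss: "DD (si n) (si n) = avg n (\<lambda>i. (A i)\<^sup>2)" by (simp add: DD_def A_def AA_def)
  have ad2: "ad\<^sup>2 \<le> avg n (\<lambda>i. (A i)\<^sup>2)" unfolding ad_def A_def by (rule avg_power2_le)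
  have Das: "DD (al n) (si n) = avg n (\<lambda>i. (A i + B i)\<^sup>2)" by (simp add: DD_def A_def B_def corr_decomp)
  have Dsa: "DD (si n) (al n) = avg n (\<lambda>i. (A i + CC i)\<^sup>2)" by (simp add: DD_def A_def corr_decomp)
  have Daa: "DD (al n) (al n) = avg n (\<lambda>i. (A i + B i + CC i + zeta)\<^sup>2)"
    by (simp add: DD_def A_def B_def corr_decomp)
  \<comment> \<open>The square is completed at each point of the permutation. The coefficients are
    chosen to produce \<open>12 * zeta * ad\<close> and \<open>24 * bc\<close>; the terms linear in
    \<open>B i\<close> and \<open>CC i\<close> average to 0.\<close>
  have "0 \<le> avg n (\<lambda>i. 3/2 * ((3 * (B i + CC i) + A i)\<^sup>2 + 3 * (zeta - A i)\<^sup>2 + (A i)\<^sup>2))"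
    by (intro avg_nonneg) simp
  also have "\<dots> = avg n (\<lambda>i. 3/2 * (A i + B i + CC i + zeta)\<^sup>2 + 3 * (A i + B i)\<^sup>2 + 3 * (A i + CC i)\<^sup>2
     + 9 * (B i)\<^sup>2 + 9 * (CC i)\<^sup>2 + 3 * zeta\<^sup>2 - (12 * zeta) * A i + 24 * (B i * CC i)
     - (3 * zeta) * B i - (3 * zeta) * CC i)"
    by (intro avg_cong) (simp add: power2_eq_square algebra_simps)
  also have "\<dots> = 3/2 * DD (al n) (al n) + 3 * DD (al n) (si n) + 3 * DD (si n) (al n)
     + 9 * avg n (\<lambda>v. (BB v)\<^sup>2) + 9 * avg n (\<lambda>i. (CC i)\<^sup>2) + 3 * zeta\<^sup>2 - (12 * zeta) * ad + 24 * bc"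
    using n_pos avg_BB(2) avg_CC 
    by (simp only: avg_add avg_diff avg_mult_left avg_const Das Dsa Daa b B_def[symmetric])
      (simp add: ad_def bc_def A_def B_def)
  finally show ?thesis
    using qq_ge ad2 unfolding RR_decomp Dss by (simp add: algebra_simps)
qed

definition ffun :: "(nat \<Rightarrow> nat \<Rightarrow> nat \<Rightarrow> nat \<Rightarrow> real) \<Rightarrow> (nat \<Rightarrow> nat \<Rightarrow> nat \<Rightarrow> nat \<Rightarrow> real) \<Rightarrow> real" where
  "ffun F G = avg4 n (\<lambda>i j k l. F i j k l * G (p i) (p j) (p k) (p l))"

text \<open>All \<open>DD\<close> and \<open>RR\<close> are nonnegative, so equal kinds lie above
  1/9 and different kinds below, up to O(1/n). In the last combination the constants 1/9
  cancel.\<close>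

lemma ffun_bounds:
  "ffun afun afun \<ge> 1/9 + rho / 2 - err"
  "ffun bfun bfun \<ge> 1/9 + rho - 2 * err"
  "ffun afun bfun \<le> 1/9 - rho + 3 * err"
  "ffun bfun afun \<le> 1/9 - rho + 3 * err"
  "ffun afun afun + ffun bfun bfun - ffun afun bfun - ffun bfun afun - ffun vfun vfun / 6 \<ge> 3 * rho - 9 * err"
proof -
  note nn = DD_nonneg[of "al n" "al n"] DD_nonneg[of "al n" "si n"] DD_nonneg[of "si n" "al n"]
    DD_nonneg[of "si n" "si n"] RR_nonneg[of "si n" "si n"]
  note est = avg4_afun_afun avg4_bfun_bfun avg4_afun_bfun avg4_bfun_afun
  show "ffun afun afun \<ge> 1/9 + rho / 2 - err" "ffun bfun bfun \<ge> 1/9 + rho - 2 * err"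
    "ffun afun bfun \<le> 1/9 - rho + 3 * err" "ffun bfun afun \<le> 1/9 - rho + 3 * err"
    using nn est rho_le unfolding ffun_def by linarith+
  have "ffun vfun vfun = 12 * zeta * ad + 3 * ad\<^sup>2 - 24 * bc - 6 * qq"
    unfolding ffun_def avg4_vfun_vfun tau_eq ww_eq by (simp add: power2_eq_square algebra_simps)
  then show "ffun afun afun + ffun bfun bfun - ffun afun bfun - ffun bfun afun - ffun vfun vfun / 6 \<ge> 3 * rho - 9 * err"
    using est quadratic_form_bound unfolding ffun_def by linarith
qed

end

section \<open>From averages over tuples to pattern counts\<close>

lemma permutations_of_set_eq_image:
  assumes "finite (B :: nat set)" "card B = k"
  shows "permutations_of_set B = map (\<lambda>r. sorted_list_of_set B ! (r - 1)) ` perms k"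
    and "inj_on (map (\<lambda>r. sorted_list_of_set B ! (r - 1))) (perms k)"
proof -
  let ?f = "\<lambda>r. sorted_list_of_set B ! (r - 1)"
  have len: "length (sorted_list_of_set B) = k" using assms by simp
  have inj: "inj_on ?f {1..k}"
    by (rule inj_onI) (use len in \<open>auto simp: nth_eq_iff_index_eq\<close>)
  have "?f ` {1..k} = ?f ` Suc ` {..<k}" by (simp add: image_Suc_lessThan)
  also have "\<dots> = (!) (sorted_list_of_set B) ` {..<k}" by (simp add: image_image)
  also have "\<dots> = set (sorted_list_of_set B)" using len by (auto simp: set_conv_nth)
  finally have im: "?f ` {1..k} = B" using assms by simp
  show "permutations_of_set B = map ?f ` perms k"
    unfolding perms_def using permutations_of_set_image_inj[OF inj] im by simp
  show "inj_on (map ?f) (perms k)"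
  proof (rule inj_onI)
    fix x y assume "x \<in> perms k" "y \<in> perms k" "map ?f x = map ?f y"
    then show "x = y"
      using inj by (auto simp: perms_def permutations_of_set_def intro: map_inj_on)
  qed
qed

text \<open>A list of distinct numbers is determined by its set of entries together with its order
  type, a permutation of the ranks.\<close>

lemma sum_distinct_lists:
  fixes f :: "nat list \<Rightarrow> real"
  shows "(\<Sum>xs | length xs = k \<and> distinct xs \<and> set xs \<subseteq> {..<n}. f xs) =
    (\<Sum>B | B \<subseteq> {..<n} \<and> card B = k. \<Sum>q\<in>perms k. f (map (\<lambda>r. sorted_list_of_set B ! (r - 1)) q))"
proof -
  let ?X = "{xs. length xs = k \<and> distinct xs \<and> set xs \<subseteq> {..<n}}"
  let ?\<B> = "{B. B \<subseteq> {..<n} \<and> card B = k}"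
  have fin: "finite ?X"
    by (rule finite_subset[OF _ finite_lists_length_eq[of "{..<n}" k]]) auto
  have "(\<Sum>xs\<in>?X. f xs) = (\<Sum>B\<in>?\<B>. \<Sum>xs | xs \<in> ?X \<and> set xs = B. f xs)"
    by (rule sum.group[symmetric]) (use fin in \<open>auto simp: distinct_card\<close>)
  also have "\<dots> = (\<Sum>B\<in>?\<B>. \<Sum>q\<in>perms k. f (map (\<lambda>r. sorted_list_of_set B ! (r - 1)) q))"
  proof (rule sum.cong[OF refl])
    fix B assume "B \<in> ?\<B>"
    then have B: "B \<subseteq> {..<n}" "card B = k" "finite B" by (auto intro: finite_subset)
    have "{xs. xs \<in> ?X \<and> set xs = B} = permutations_of_set B"
      using B by (auto simp: permutations_of_set_def distinct_card)
    then show "(\<Sum>xs | xs \<in> ?X \<and> set xs = B. f xs) =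
        (\<Sum>q\<in>perms k. f (map (\<lambda>r. sorted_list_of_set B ! (r - 1)) q))"
      using permutations_of_set_eq_image[OF B(3,2)] by (simp add: sum.reindex)
  qed
  finally show ?thesis .
qed

lemma sum4_lists:
  fixes f :: "nat \<Rightarrow> nat \<Rightarrow> nat \<Rightarrow> nat \<Rightarrow> real"
  shows "(\<Sum>i<n. \<Sum>j<n. \<Sum>k<n. \<Sum>l<n. of_bool (distinct [i, j, k, l]) * f i j k l) =
    (\<Sum>xs | length xs = 4 \<and> distinct xs \<and> set xs \<subseteq> {..<n}. f (xs ! 0) (xs ! 1) (xs ! 2) (xs ! 3))"
proof -
  let ?X = "{xs. length xs = 4 \<and> distinct xs \<and> set xs \<subseteq> {..<n}}"
  let ?T = "{..<n} \<times> {..<n} \<times> {..<n} \<times> {..<n}"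
  let ?T' = "{(i, j, k, l). (i, j, k, l) \<in> ?T \<and> distinct [i, j, k, l]}"
  have "(\<Sum>i<n. \<Sum>j<n. \<Sum>k<n. \<Sum>l<n. of_bool (distinct [i, j, k, l]) * f i j k l) =
     (\<Sum>(i, j, k, l)\<in>?T. of_bool (distinct [i, j, k, l]) * f i j k l)"
    by (simp add: sum.cartesian_product[symmetric])
  also have "\<dots> = (\<Sum>(i, j, k, l)\<in>?T'. f i j k l)"
    by (rule sum.mono_neutral_cong_right) auto
  also have "\<dots> = (\<Sum>xs\<in>?X. f (xs ! 0) (xs ! 1) (xs ! 2) (xs ! 3))"
  proof (rule sum.reindex_bij_witness[where i = "\<lambda>xs. (xs ! 0, xs ! 1, xs ! 2, xs ! 3)" and
      j = "\<lambda>(i, j, k, l). [i, j, k, l]"])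
    fix xs assume "xs \<in> ?X"
    then obtain a b c d where xs: "xs = [a, b, c, d]"
      by (auto simp: numeral_eq_Suc length_Suc_conv)
    show "(case (xs ! 0, xs ! 1, xs ! 2, xs ! 3) of (i, j, k, l) \<Rightarrow> [i, j, k, l]) = xs"
      by (simp add: xs)
    show "(xs ! 0, xs ! 1, xs ! 2, xs ! 3) \<in> ?T'"
      using \<open>xs \<in> ?X\<close> by (simp add: xs)
  qed auto
  finally show ?thesis .
qed

definition sg_inv :: "(nat \<Rightarrow> nat \<Rightarrow> nat \<Rightarrow> nat \<Rightarrow> real) \<Rightarrow> bool" where
  "sg_inv F \<longleftrightarrow> (\<forall>i j k l i' j' k' l'. sg i j = sg i' j' \<longrightarrow> sg i k = sg i' k' \<longrightarrow> sg i l = sg i' l' \<longrightarrow>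
     sg j k = sg j' k' \<longrightarrow> sg j l = sg j' l' \<longrightarrow> sg k l = sg k' l' \<longrightarrow> F i j k l = F i' j' k' l')"

lemma sg_inv_fun: "sg_inv afun" "sg_inv bfun" "sg_inv vfun"
  by (auto simp: sg_inv_def afun_def bfun_def vfun_def rfun_def)

lemma sg_invD:
  assumes "sg_inv F" "\<And>a b. a < 4 \<Longrightarrow> b < 4 \<Longrightarrow> sg (xs ! a) (xs ! b) = sg (ys ! a) (ys ! b)"
  shows "F (xs ! 0) (xs ! 1) (xs ! 2) (xs ! 3) = F (ys ! 0) (ys ! 1) (ys ! 2) (ys ! 3)"
  by (rule assms(1)[unfolded sg_inv_def, rule_format]) (rule assms(2); simp)+

text \<open>The sum over all 24 labellings of the points of \<open>w\<close> by four indices: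
  \<open>q\<close> lists their positions, counted from 1, and the corresponding entries of
  \<open>w\<close> are their values.\<close>

definition orbit_sum :: "(nat \<Rightarrow> nat \<Rightarrow> nat \<Rightarrow> nat \<Rightarrow> real) \<Rightarrow> (nat \<Rightarrow> nat \<Rightarrow> nat \<Rightarrow> nat \<Rightarrow> real) \<Rightarrow> nat list \<Rightarrow> real" where
  "orbit_sum F G w = (\<Sum>q\<in>perms 4. F (q ! 0) (q ! 1) (q ! 2) (q ! 3) *
     G (w ! (q ! 0 - 1)) (w ! (q ! 1 - 1)) (w ! (q ! 2 - 1)) (w ! (q ! 3 - 1)))"

lemma sg_cong:
  assumes "i < j \<longleftrightarrow> i' < j'" "j < i \<longleftrightarrow> j' < i'"
  shows "sg i j = sg i' j'"
  using assms by (cases i j rule: linorder_cases) (auto simp: sg_def)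

context biperm
begin

lemma inj_p: "inj_on p {..<n}"
  using bij by (simp add: bij_betw_def)

lemma sum_distinct_orbit:
  assumes F: "sg_inv F" and G: "sg_inv G"
  shows "(\<Sum>i<n. \<Sum>j<n. \<Sum>k<n. \<Sum>l<n. of_bool (distinct [i, j, k, l]) * (F i j k l * G (p i) (p j) (p k) (p l))) =
    (\<Sum>B | B \<subseteq> {..<n} \<and> card B = 4. orbit_sum F G (patt p B))"
  unfolding sum4_lists sum_distinct_lists orbit_sum_def
proof (intro sum.cong refl)
  fix B q assume "B \<in> {B. B \<subseteq> {..<n} \<and> card B = 4}" and q: "q \<in> perms 4"
  then have B: "B \<subseteq> {..<n}" "card B = 4" "finite B" by (auto intro: finite_subset)
  let ?b = "sorted_list_of_set B" and ?w = "patt p B"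
  let ?xs = "map (\<lambda>r. ?b ! (r - 1)) q"
  have lq: "length q = 4" "set q = {1..4}"
    using q length_perms by (auto simp: perms_def permutations_of_set_def)
  have lb: "length ?b = 4" using B by simp
  have qa: "q ! a \<in> {1..4}" if "a < 4" for a using lq nth_mem[of a q] that by auto
  have bs: "sorted_wrt (<) ?b" by (rule strict_sorted_list_of_set)
  have b_less: "?b ! s < ?b ! t \<longleftrightarrow> s < t" if "s < 4" "t < 4" for s t
    using sorted_wrt_nth_less[OF bs, of s t] sorted_wrt_nth_less[OF bs, of t s] that lb
    by (cases s t rule: linorder_cases) auto
  have 1: "sg (?xs ! a) (?xs ! b) = sg (q ! a) (q ! b)" if "a < 4" "b < 4" for a b
  proof (rule sg_cong)
    have "q ! a - 1 < 4" "q ! b - 1 < 4" "1 \<le> q ! a" "1 \<le> q ! b" using qa[OF that(1)] qa[OF that(2)] by auto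
    then show "(?xs ! a < ?xs ! b) = (q ! a < q ! b)" "(?xs ! b < ?xs ! a) = (q ! b < q ! a)"
      using that lq b_less by auto
  qed
  let ?ys = "map (\<lambda>r. ?w ! (r - 1)) q" and ?ps = "map p ?xs"
  have 2: "sg (?ps ! a) (?ps ! b) = sg (?ys ! a) (?ys ! b)" if "a < 4" "b < 4" for a b
  proof (rule sg_cong)
    have ab: "q ! a - 1 < 4" "q ! b - 1 < 4" using qa[OF that(1)] qa[OF that(2)] by auto
    have "?w ! s < ?w ! t \<longleftrightarrow> p (?b ! s) < p (?b ! t)" if "s < 4" "t < 4" for s t
      using std_nth_less_iff[of s "map p ?b" t] that lb by (simp add: patt_def)
    then show "(?ps ! a < ?ps ! b) = (?ys ! a < ?ys ! b)" "(?ps ! b < ?ps ! a) = (?ys ! b < ?ys ! a)"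
      using that lq ab by auto
  qed
  have "F (?xs ! 0) (?xs ! 1) (?xs ! 2) (?xs ! 3) = F (q ! 0) (q ! 1) (q ! 2) (q ! 3)"
    by (rule sg_invD[OF F 1])
  moreover have "G (?ps ! 0) (?ps ! 1) (?ps ! 2) (?ps ! 3) = G (?ys ! 0) (?ys ! 1) (?ys ! 2) (?ys ! 3)"
    by (rule sg_invD[OF G 2])
  ultimately show "F (?xs ! 0) (?xs ! 1) (?xs ! 2) (?xs ! 3) *
      G (p (?xs ! 0)) (p (?xs ! 1)) (p (?xs ! 2)) (p (?xs ! 3)) =
      F (q ! 0) (q ! 1) (q ! 2) (q ! 3) *
      G (?w ! (q ! 0 - 1)) (?w ! (q ! 1 - 1)) (?w ! (q ! 2 - 1)) (?w ! (q ! 3 - 1))"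
    using lq by simp
qed

text \<open>Grouping tuples of distinct indices by their set gives orbit sums; tuples with a
  coincidence account for the error 6 * 9 / n.\<close>

lemma ffun_orbit:
  assumes F: "sg_inv F" "\<And>i j k l. \<bar>F i j k l\<bar> \<le> 3" and G: "sg_inv G" "\<And>i j k l. \<bar>G i j k l\<bar> \<le> 3"
  shows "\<bar>ffun F G - (\<Sum>B | B \<subseteq> {..<n} \<and> card B = 4. orbit_sum F G (patt p B)) / real n ^ 4\<bar> \<le> 54 / real n"
proof -
  let ?H = "\<lambda>i j k l. F i j k l * G (p i) (p j) (p k) (p l)"
  have H: "\<bar>?H i j k l\<bar> \<le> 9" for i j k l
    using abs_mult_le[OF F(2) G(2)] by simp
  have "\<bar>avg4 n ?H - avg4 n (\<lambda>i j k l. of_bool (distinct [i, j, k, l]) * ?H i j k l)\<bar> \<le> 0 + 6 * 9 / real n"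
    by (rule avg4_near[OF n_pos]) (use H in \<open>auto simp: of_bool_def\<close>)
  moreover have "avg4 n (\<lambda>i j k l. of_bool (distinct [i, j, k, l]) * ?H i j k l) =
    (\<Sum>i<n. \<Sum>j<n. \<Sum>k<n. \<Sum>l<n. of_bool (distinct [i, j, k, l]) * ?H i j k l) / real n ^ 4"
    by (simp add: avg_def sum_divide_distrib[symmetric] power4_eq_xxxx)
  ultimately show ?thesis
    unfolding sum_distinct_orbit[OF F(1) G(1)] ffun_def by simp
qed

end

section \<open>The twenty-four patterns and the five sets\<close>

text \<open>Later computations rely on the lexicographic order: the certificate lists its rows in
  the same order, and patterns with equal first entry are consecutive.\<close>

definition perms4 :: "nat list list" where
  "perms4 = [[1,2,3,4], [1,2,4,3], [1,3,2,4], [1,3,4,2], [1,4,2,3], [1,4,3,2],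
    [2,1,3,4], [2,1,4,3], [2,3,1,4], [2,3,4,1], [2,4,1,3], [2,4,3,1],
    [3,1,2,4], [3,1,4,2], [3,2,1,4], [3,2,4,1], [3,4,1,2], [3,4,2,1],
    [4,1,2,3], [4,1,3,2], [4,2,1,3], [4,2,3,1], [4,3,1,2], [4,3,2,1]]"

lemma perms_4: "perms 4 = set perms4"
proof (rule sym, rule card_subset_eq)
  have "distinct perms4" by (simp add: perms4_def)
  from distinct_card[OF this] show "card (set perms4) = card (perms 4)"
    by (simp add: perms4_def fact_numeral)
  have "{1..4} = {1, 2, 3, 4 :: nat}" by auto
  then show "set perms4 \<subseteq> perms 4"
    by (simp add: perms4_def perms_def permutations_of_set_def insert_commute)
qed simp

lemma sum_perms4: "sum f (perms 4) = sum_list (map f perms4)"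
proof -
  have "distinct perms4" by (simp add: perms4_def)
  then show ?thesis unfolding perms_4 by (simp add: sum_list_distinct_conv_sum_set)
qed

lemma afun_values:
  "afun 1 2 3 4 = 1"
  "afun 1 2 4 3 = 1"
  "afun 1 3 2 4 = 0"
  "afun 1 3 4 2 = 0"
  "afun 1 4 2 3 = 0"
  "afun 1 4 3 2 = 0"
  "afun 2 1 3 4 = 1"
  "afun 2 1 4 3 = 1"
  "afun 2 3 1 4 = 0"
  "afun 2 3 4 1 = 0"
  "afun 2 4 1 3 = 0"
  "afun 2 4 3 1 = 0"
  "afun 3 1 2 4 = 0"
  "afun 3 1 4 2 = 0"
  "afun 3 2 1 4 = 0"
  "afun 3 2 4 1 = 0"
  "afun 3 4 1 2 = 1"
  "afun 3 4 2 1 = 1"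
  "afun 4 1 2 3 = 0"
  "afun 4 1 3 2 = 0"
  "afun 4 2 1 3 = 0"
  "afun 4 2 3 1 = 0"
  "afun 4 3 1 2 = 1"
  "afun 4 3 2 1 = 1"
  by (simp_all add: afun_def rfun_def sg_def)

lemma bfun_values:
  "bfun 1 2 3 4 = 0"
  "bfun 1 2 4 3 = 0"
  "bfun 1 3 2 4 = 1"
  "bfun 1 3 4 2 = 1"
  "bfun 1 4 2 3 = 0"
  "bfun 1 4 3 2 = 0"
  "bfun 2 1 3 4 = 0"
  "bfun 2 1 4 3 = 0"
  "bfun 2 3 1 4 = 0"
  "bfun 2 3 4 1 = 0"
  "bfun 2 4 1 3 = 1"
  "bfun 2 4 3 1 = 1"
  "bfun 3 1 2 4 = 1"
  "bfun 3 1 4 2 = 1"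
  "bfun 3 2 1 4 = 0"
  "bfun 3 2 4 1 = 0"
  "bfun 3 4 1 2 = 0"
  "bfun 3 4 2 1 = 0"
  "bfun 4 1 2 3 = 0"
  "bfun 4 1 3 2 = 0"
  "bfun 4 2 1 3 = 1"
  "bfun 4 2 3 1 = 1"
  "bfun 4 3 1 2 = 0"
  "bfun 4 3 2 1 = 0"
  by (simp_all add: bfun_def rfun_def sg_def)

lemma vfun_values:
  "vfun 1 2 3 4 = 1"
  "vfun 1 2 4 3 = - 1"
  "vfun 1 3 2 4 = - 1"
  "vfun 1 3 4 2 = 1"
  "vfun 1 4 2 3 = 1"
  "vfun 1 4 3 2 = - 1"
  "vfun 2 1 3 4 = - 1"
  "vfun 2 1 4 3 = 1"
  "vfun 2 3 1 4 = 1"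
  "vfun 2 3 4 1 = - 1"
  "vfun 2 4 1 3 = - 1"
  "vfun 2 4 3 1 = 1"
  "vfun 3 1 2 4 = 1"
  "vfun 3 1 4 2 = - 1"
  "vfun 3 2 1 4 = - 1"
  "vfun 3 2 4 1 = 1"
  "vfun 3 4 1 2 = 1"
  "vfun 3 4 2 1 = - 1"
  "vfun 4 1 2 3 = - 1"
  "vfun 4 1 3 2 = 1"
  "vfun 4 2 1 3 = 1"
  "vfun 4 2 3 1 = - 1"
  "vfun 4 3 1 2 = - 1"
  "vfun 4 3 2 1 = 1"
  by (simp_all add: vfun_def rfun_def sg_def)

text \<open>The two letters in these names give the kind of the common split in positions and in
  values: a for separated, b for crossing.\<close>

definition S_aa :: "nat list set" where
  "S_aa = {[1,2,3,4], [1,2,4,3], [2,1,3,4], [2,1,4,3], [3,4,1,2], [3,4,2,1], [4,3,1,2], [4,3,2,1]}"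

definition S_bb :: "nat list set" where
  "S_bb = {[1,2,3,4], [1,4,3,2], [2,1,4,3], [2,3,4,1], [3,2,1,4], [3,4,1,2], [4,1,2,3], [4,3,2,1]}"

definition S_ab :: "nat list set" where
  "S_ab = {[1,3,2,4], [1,3,4,2], [2,4,1,3], [2,4,3,1], [3,1,2,4], [3,1,4,2], [4,2,1,3], [4,2,3,1]}"

definition S_ba :: "nat list set" where
  "S_ba = {[1,3,2,4], [1,4,2,3], [2,3,1,4], [2,4,1,3], [3,1,4,2], [3,2,4,1], [4,1,3,2], [4,2,3,1]}"

lemma orbit_sum_expand:
  "orbit_sum F G [a, b, c, d] =
    F 1 2 3 4 * G a b c d +
    F 1 2 4 3 * G a b d c +
    F 1 3 2 4 * G a c b d +
    F 1 3 4 2 * G a c d b +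
    F 1 4 2 3 * G a d b c +
    F 1 4 3 2 * G a d c b +
    F 2 1 3 4 * G b a c d +
    F 2 1 4 3 * G b a d c +
    F 2 3 1 4 * G b c a d +
    F 2 3 4 1 * G b c d a +
    F 2 4 1 3 * G b d a c +
    F 2 4 3 1 * G b d c a +
    F 3 1 2 4 * G c a b d +
    F 3 1 4 2 * G c a d b +
    F 3 2 1 4 * G c b a d +
    F 3 2 4 1 * G c b d a +
    F 3 4 1 2 * G c d a b +
    F 3 4 2 1 * G c d b a +
    F 4 1 2 3 * G d a b c +
    F 4 1 3 2 * G d a c b +
    F 4 2 1 3 * G d b a c +
    F 4 2 3 1 * G d b c a +
    F 4 3 1 2 * G d c a b +
    F 4 3 2 1 * G d c b a"
  unfolding orbit_sum_def sum_perms4 perms4_def by simp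

lemmas orbit_sum_kernels =
  orbit_sum_expand[of afun, unfolded afun_values mult_1 mult_zero_left add_0 add_0_right]
  orbit_sum_expand[of bfun, unfolded bfun_values mult_1 mult_zero_left add_0 add_0_right]
  orbit_sum_expand[of vfun, unfolded vfun_values]

lemmas kernel_values = afun_values[simplified] bfun_values[simplified] vfun_values[simplified]

text \<open>In a given pattern exactly one split is separated in positions, and it has 8 labellings;
  all of them or none are separated in values too.\<close>

lemma orbit_sum_afun_afun: "\<forall>w\<in>set perms4. orbit_sum afun afun w = 8 * of_bool (w \<in> S_aa)"
  unfolding S_aa_def perms4_def list.set ball_simps orbit_sum_kernels
  by (intro conjI TrueI; simp add: kernel_values)

lemma orbit_sum_bfun_bfun: "\<forall>w\<in>set perms4. orbit_sum bfun bfun w = 8 * of_bool (w \<in> S_bb)"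
  unfolding S_bb_def perms4_def list.set ball_simps orbit_sum_kernels
  by (intro conjI TrueI; simp add: kernel_values)

lemma orbit_sum_afun_bfun: "\<forall>w\<in>set perms4. orbit_sum afun bfun w = 8 * of_bool (w \<in> S_ab)"
  unfolding S_ab_def perms4_def list.set ball_simps orbit_sum_kernels
  by (intro conjI TrueI; simp add: kernel_values)

lemma orbit_sum_bfun_afun: "\<forall>w\<in>set perms4. orbit_sum bfun afun w = 8 * of_bool (w \<in> S_ba)"
  unfolding S_ba_def perms4_def list.set ball_simps orbit_sum_kernels
  by (intro conjI TrueI; simp add: kernel_values)

definition S_odd :: "nat list set" where
  "S_odd = {[1,2,4,3], [1,3,2,4], [1,4,3,2], [2,1,3,4], [2,3,4,1], [2,4,1,3], [3,1,4,2], [3,2,1,4], [3,4,2,1], [4,1,2,3], [4,2,3,1], [4,3,1,2]}"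

text \<open>Since \<open>vfun\<close> is the signature, each of the 24 products equals the sign of
  \<open>w\<close>.\<close>

lemma orbit_sum_vfun_vfun: "\<forall>w\<in>set perms4. orbit_sum vfun vfun w = 24 - 48 * of_bool (w \<in> S_odd)"
  unfolding S_odd_def perms4_def list.set ball_simps orbit_sum_kernels
  by (intro conjI TrueI; simp add: kernel_values)

text \<open>This identity makes the fifth set accessible. The quotient by 6 is four times the sign
  of the pattern, and the last term is 12 on the set and -12 off it.\<close>

lemma mixed_indicator: "\<forall>w\<in>set perms4.
   8 * of_bool (w \<in> S_aa) + 8 * of_bool (w \<in> S_bb) - 8 * of_bool (w \<in> S_ab) - 8 * of_bool (w \<in> S_ba)
     - (24 - 48 * of_bool (w \<in> S_odd)) / 6 = 24 * (of_bool (w \<in> S_aa \<union> S_bb) :: real) - 12"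
  unfolding S_aa_def S_bb_def S_ab_def S_ba_def S_odd_def perms4_def list.set ball_simps
  by (intro conjI TrueI; simp)

lemma fact_times_choose_bounds:
  assumes "4 \<le> n"
  shows "real n ^ 4 - 6 * real n ^ 3 \<le> 24 * real (n choose 4)" "24 * real (n choose 4) \<le> real n ^ 4"
proof -
  have "real (n choose 4) * fact 4 = (\<Prod>i = 0..<4. real n - real i)"
    using binomial_gbinomial[of n 4, where ?'a = real] gbinomial_prod_rev[of "real n" 4] by simp
  then have eq: "24 * real (n choose 4) = real n * (real n - 1) * (real n - 2) * (real n - 3)"
    by (simp add: fact_numeral numeral_eq_Suc prod.atLeast0_lessThan_Suc algebra_simps)
  have "0 \<le> real n * (11 * real n - 6)" using assms by simp
  then show "real n ^ 4 - 6 * real n ^ 3 \<le> 24 * real (n choose 4)"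
    unfolding eq by (simp add: algebra_simps power4_eq_xxxx power3_eq_cube)
  have "(real n * (real n - 1)) * ((real n - 2) * (real n - 3)) \<le> (real n * real n) * (real n * real n)"
    using assms by (intro mult_mono) auto
  then show "24 * real (n choose 4) \<le> real n ^ 4"
    unfolding eq by (simp add: power4_eq_xxxx mult.assoc)
qed

lemma choose_ratio_bounds:
  assumes "4 \<le> n"
  shows "1 - 6 / real n \<le> 24 * real (n choose 4) / real n ^ 4" "24 * real (n choose 4) / real n ^ 4 \<le> 1"
proof -
  have n: "0 < real n" using assms by simp
  have "1 - 6 / real n = (real n ^ 4 - 6 * real n ^ 3) / real n ^ 4"
    using n by (simp add: diff_divide_distrib power4_eq_xxxx power3_eq_cube)
  also have "\<dots> \<le> 24 * real (n choose 4) / real n ^ 4"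
    using fact_times_choose_bounds(1)[OF assms] by (intro divide_right_mono) auto
  finally show "1 - 6 / real n \<le> 24 * real (n choose 4) / real n ^ 4" .
  show "24 * real (n choose 4) / real n ^ 4 \<le> 1"
    using fact_times_choose_bounds(2)[OF assms] n by (simp add: divide_le_eq_1)
qed

context biperm
begin

definition dens :: "nat list set \<Rightarrow> real" where
  "dens S = real (pcount 4 S p n) / real (n choose 4)"

lemma dens_bounds:
  assumes "4 \<le> n"
  shows "0 \<le> dens S" "dens S \<le> 1" "\<bar>24 * real (pcount 4 S p n) / real n ^ 4 - dens S\<bar> \<le> 6 / real n"
proof -
  let ?C = "real (n choose 4)"
  have C: "0 < ?C" using assms by simp
  show 0: "0 \<le> dens S" by (simp add: dens_def)
  show 1: "dens S \<le> 1" using C pcount_le[of 4 S p n] by (simp add: dens_def)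
  have eq: "real (pcount 4 S p n) = dens S * ?C" using C by (simp add: dens_def)
  define q where "q = 24 * ?C / real n ^ 4"
  have q: "1 - 6 / real n \<le> q" "q \<le> 1"
    using choose_ratio_bounds[OF assms] by (auto simp: q_def)
  have "24 * real (pcount 4 S p n) / real n ^ 4 - dens S = dens S * (q - 1)"
    unfolding eq q_def using n_pos by (simp add: field_simps)
  moreover have "\<bar>dens S * (q - 1)\<bar> \<le> 1 * (6 / real n)"
    using 0 1 q by (intro abs_mult_le) auto
  ultimately show "\<bar>24 * real (pcount 4 S p n) / real n ^ 4 - dens S\<bar> \<le> 6 / real n" by simp
qed

lemma sum_of_bool_patt:
  "(\<Sum>B | B \<subseteq> {..<n} \<and> card B = 4. of_bool (patt p B \<in> S)) = real (pcount 4 S p n)"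
proof -
  have fin: "finite {B. B \<subseteq> {..<n} \<and> card B = 4}" by simp
  have "{B. B \<subseteq> {..<n} \<and> card B = 4} \<inter> {B. patt p B \<in> S} = {B. B \<subseteq> {..<n} \<and> card B = 4 \<and> patt p B \<in> S}"
    by auto
  then show ?thesis using sum_of_bool_eq[OF fin, of "\<lambda>B. patt p B \<in> S"] by (simp add: pcount_def)
qed

lemma patt_in_perms4: "B \<subseteq> {..<n} \<Longrightarrow> card B = 4 \<Longrightarrow> patt p B \<in> set perms4"
  using patt_in_perms[OF inj_p, of B] by (simp add: perms_4)

lemma abs_fun_le3: "\<bar>afun i j k l\<bar> \<le> 3" "\<bar>bfun i j k l\<bar> \<le> 3" "\<bar>vfun i j k l\<bar> \<le> 3"
  using abs_afun_le[of i j k l] abs_rfun_le[of i j k l] abs_sg_sg_le[of i j k l] abs_sg_sg_le[of i k j l]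
    abs_sg_sg_le[of i l j k]
  by (auto simp: bfun_def vfun_def)

text \<open>Coincident indices cost 54/n, and replacing n^4 by \<open>24 * (n choose 4)\<close>
  costs at most 12/n in each of the two terms.\<close>

lemma ffun_dens:
  assumes n: "4 \<le> n" and F: "F \<in> {afun, bfun, vfun}" and G: "G \<in> {afun, bfun, vfun}"
    and c: "\<bar>c\<bar> \<le> 2" and d: "\<bar>d\<bar> \<le> 2"
    and o: "\<And>w. w \<in> set perms4 \<Longrightarrow> orbit_sum F G w = 24 * (c * of_bool (w \<in> S) + d)"
  shows "\<bar>ffun F G - (c * dens S + d)\<bar> \<le> 100 / real n"
proof -
  let ?X = "\<Sum>B | B \<subseteq> {..<n} \<and> card B = 4. orbit_sum F G (patt p B)"
  have "?X = (\<Sum>B | B \<subseteq> {..<n} \<and> card B = 4. 24 * (c * of_bool (patt p B \<in> S) + d))"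
    by (rule sum.cong) (use o patt_in_perms4 in auto)
  also have "\<dots> = 24 * (c * real (pcount 4 S p n) + d * real (n choose 4))"
    using n_subsets[of "{..<n}" 4]
    by (simp add: sum_distrib_left[symmetric] sum.distrib sum_of_bool_patt)
  finally have X: "?X / real n ^ 4 = c * (24 * real (pcount 4 S p n) / real n ^ 4) + d * (24 * real (n choose 4) / real n ^ 4)"
    by (simp add: algebra_simps add_divide_distrib)
  have "24 * real (n choose 4) / real n ^ 4 \<le> 1" "1 - 6 / real n \<le> 24 * real (n choose 4) / real n ^ 4"
    using choose_ratio_bounds[OF n] by auto
  then have "\<bar>d * (24 * real (n choose 4) / real n ^ 4 - 1)\<bar> \<le> 2 * (6 / real n)"
    using d by (intro abs_mult_le) auto
  moreover have "\<bar>c * (24 * real (pcount 4 S p n) / real n ^ 4 - dens S)\<bar> \<le> 2 * (6 / real n)"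
    using c dens_bounds(3)[OF n] by (intro abs_mult_le)
  moreover have "\<bar>ffun F G - ?X / real n ^ 4\<bar> \<le> 54 / real n"
    by (rule ffun_orbit) (use F G sg_inv_fun abs_fun_le3 in auto)
  ultimately show ?thesis unfolding X by (simp add: algebra_simps)
qed

text \<open>The constant 10000000 only has to exceed the accumulated multiples of \<open>err\<close>
  and of the error in \<open>ffun_dens\<close>.\<close>

lemma dens_estimates:
  assumes n: "4 \<le> n"
  shows "rho - 10000000 / real n \<le> dens S_aa - 1/3"
    and "rho - 10000000 / real n \<le> dens S_bb - 1/3"
    and "rho - 10000000 / real n \<le> 1/3 - dens S_ab"
    and "rho - 10000000 / real n \<le> 1/3 - dens S_ba"
    and "rho - 10000000 / real n \<le> dens (S_aa \<union> S_bb) - 1/2"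
proof -
  define e where "e = 1 / real n"
  have e: "0 < e" "x / real n = x * e" for x using n_pos by (auto simp: e_def)
  have aa: "\<bar>ffun afun afun - ((1/3) * dens S_aa + 0)\<bar> \<le> 100 / real n"
    by (rule ffun_dens[OF n]) (use orbit_sum_afun_afun in auto)
  have bb: "\<bar>ffun bfun bfun - ((1/3) * dens S_bb + 0)\<bar> \<le> 100 / real n"
    by (rule ffun_dens[OF n]) (use orbit_sum_bfun_bfun in auto)
  have ab: "\<bar>ffun afun bfun - ((1/3) * dens S_ab + 0)\<bar> \<le> 100 / real n"
    by (rule ffun_dens[OF n]) (use orbit_sum_afun_bfun in auto)
  have ba: "\<bar>ffun bfun afun - ((1/3) * dens S_ba + 0)\<bar> \<le> 100 / real n"
    by (rule ffun_dens[OF n]) (use orbit_sum_bfun_afun in auto)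
  have vv: "\<bar>ffun vfun vfun - ((- 2) * dens S_odd + 1)\<bar> \<le> 100 / real n"
    by (rule ffun_dens[OF n]) (use orbit_sum_vfun_vfun in auto)
  note b = ffun_bounds[unfolded e(2)] RR_nonneg[of "si n" "si n"]
  note est = aa[unfolded e(2)] bb[unfolded e(2)] ab[unfolded e(2)] ba[unfolded e(2)] vv[unfolded e(2)]
  show "rho - 10000000 / real n \<le> dens S_aa - 1/3" "rho - 10000000 / real n \<le> dens S_bb - 1/3"
    "rho - 10000000 / real n \<le> 1/3 - dens S_ab" "rho - 10000000 / real n \<le> 1/3 - dens S_ba"
    unfolding e(2) using b est e(1) by linarith+
  \<comment> \<open>This is \<open>mixed_indicator\<close> summed over all sets of four
    positions.\<close>
  have "8 * real (pcount 4 S_aa p n) + 8 * real (pcount 4 S_bb p n) - 8 * real (pcount 4 S_ab p n)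
     - 8 * real (pcount 4 S_ba p n) - (24 * real (n choose 4) - 48 * real (pcount 4 S_odd p n)) / 6 =
     24 * real (pcount 4 (S_aa \<union> S_bb) p n) - 12 * real (n choose 4)"
  proof -
    have N: "real (n choose 4) = (\<Sum>B | B \<subseteq> {..<n} \<and> card B = 4. 1)" using n_subsets[of "{..<n}" 4] by simp
    show ?thesis
      unfolding sum_of_bool_patt[symmetric] N sum_distrib_left sum.distrib[symmetric] sum_subtractf[symmetric] sum_divide_distrib
      by (rule sum.cong[OF refl]) (use mixed_indicator patt_in_perms4 in auto)
  qed
  then have "(8 * real (pcount 4 S_aa p n) + 8 * real (pcount 4 S_bb p n) - 8 * real (pcount 4 S_ab p n)
     - 8 * real (pcount 4 S_ba p n) - (24 * real (n choose 4) - 48 * real (pcount 4 S_odd p n)) / 6) / real (n choose 4) =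
     (24 * real (pcount 4 (S_aa \<union> S_bb) p n) - 12 * real (n choose 4)) / real (n choose 4)" by simp
  then have "8 * dens S_aa + 8 * dens S_bb - 8 * dens S_ab - 8 * dens S_ba - (24 - 48 * dens S_odd) / 6 =
     24 * dens (S_aa \<union> S_bb) - 12"
    using n unfolding dens_def by (simp add: add_divide_distrib diff_divide_distrib)
  then have "dens (S_aa \<union> S_bb) - 1/2 = dens S_aa / 3 + dens S_bb / 3 - dens S_ab / 3 - dens S_ba / 3 - 1/6 + dens S_odd / 3"
    by (simp add: field_simps)
  moreover have "3 * rho - 1083600 * e \<le> dens S_aa / 3 + dens S_bb / 3 - dens S_ab / 3 - dens S_ba / 3 - 1/6 + dens S_odd / 3 + 500 * e"
    using b(5) est(1,2)[THEN abs_le_D1] est(3,4)[THEN abs_le_D2] est(5)[THEN abs_le_D2] e(1) by linarith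
  ultimately show "rho - 10000000 / real n \<le> dens (S_aa \<union> S_bb) - 1/2"
    unfolding e(2) using b(6) e(1) by linarith
qed

end

section \<open>From a small mean square to uniform rectangles\<close>

context biperm
begin

lemma abs_AA_le: "u < n \<Longrightarrow> v < n \<Longrightarrow> \<bar>AA u v\<bar> \<le> 9"
  unfolding AA_def corr_def using abs_mult_le[of _ 3 _ 3] abs_si_le p_less
  by (intro abs_avg_bound n_pos) fastforce

lemma avg_abs_si_diff:
  assumes "u \<le> u'" "u' < n"
  shows "avg n (\<lambda>i. \<bar>si n u i - si n u' i\<bar>) \<le> 6 * \<bar>real u - real u'\<bar> / real n"
proof (cases "u = u'")
  case False
  have pw: "\<bar>si n u i - si n u' i\<bar> \<le> 2 * of_bool (i \<in> {u..u'}) + 2 * \<bar>real u - real u'\<bar> / real n" for i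
  proof -
    have "\<bar>sg u i - sg u' i\<bar> \<le> 2 * of_bool (i \<in> {u..u'})"
      using assms(1) by (auto simp: sg_def sgn_if)
    moreover have "si n u i - si n u' i = (sg u i - sg u' i) - (zc n u - zc n u')"
      by (simp add: si_def)
    ultimately show ?thesis using zc_diff[of n u u'] by linarith
  qed
  have "{..<n} \<inter> {i. u \<le> i \<and> i \<le> u'} = {u..u'}" using assms by auto
  then have "avg n (\<lambda>i. of_bool (i \<in> {u..u'})) = (real u' - real u + 1) / real n"
    using assms by (simp add: avg_def sum_of_bool_eq of_nat_diff Suc_diff_le)
  then have "avg n (\<lambda>i. 2 * of_bool (i \<in> {u..u'}) + 2 * \<bar>real u - real u'\<bar> / real n) =
      (2 * (real u' - real u + 1) + 2 * \<bar>real u - real u'\<bar>) / real n"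
    using n_pos by (simp add: avg_add avg_mult_left avg_const add_divide_distrib)
  \<comment> \<open>With d = u' - u the numerator is 4d + 2, and 2 \<le> 2d because d = 0 has been
    excluded.\<close>
  also have "\<dots> \<le> 6 * \<bar>real u - real u'\<bar> / real n"
    using assms False by (intro divide_right_mono) auto
  finally show ?thesis by (rule order_trans[OF avg_mono[OF pw]])
qed simp

lemma avg_abs_si_diff':
  assumes "u < n" "u' < n"
  shows "avg n (\<lambda>i. \<bar>si n u i - si n u' i\<bar>) \<le> 6 * \<bar>real u - real u'\<bar> / real n"
proof (cases "u \<le> u'")
  case True
  then show ?thesis using avg_abs_si_diff assms by simp
next
  case False
  then show ?thesis using avg_abs_si_diff[of u' u] assms by (simp add: abs_minus_commute)
qed

lemma AA_lipschitz:
  assumes "u < n" "u' < n" "v < n" "v' < n"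
  shows "\<bar>AA u v - AA u' v'\<bar> \<le> 18 * (\<bar>real u - real u'\<bar> + \<bar>real v - real v'\<bar>) / real n"
proof -
  have "AA u v - AA u' v = avg n (\<lambda>i. (si n u i - si n u' i) * si n v (p i))"
    by (simp add: AA_def corr_def avg_diff left_diff_distrib)
  also have "\<bar>\<dots>\<bar> \<le> avg n (\<lambda>i. \<bar>si n u i - si n u' i\<bar> * 3)"
    by (intro order_trans[OF abs_avg_le] avg_mono)
      (use assms abs_si_le p_less in \<open>auto simp: abs_mult intro!: mult_left_mono\<close>)
  also have "\<dots> \<le> 6 * \<bar>real u - real u'\<bar> / real n * 3"
    unfolding avg_mult_right using avg_abs_si_diff'[OF assms(1,2)] by (intro mult_right_mono) auto
  finally have 1: "\<bar>AA u v - AA u' v\<bar> \<le> 18 * \<bar>real u - real u'\<bar> / real n" by simp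
  have "AA u' v - AA u' v' = avg n (\<lambda>i. si n u' i * (si n v (p i) - si n v' (p i)))"
    by (simp add: AA_def corr_def avg_diff right_diff_distrib)
  also have "\<bar>\<dots>\<bar> \<le> avg n (\<lambda>i. 3 * \<bar>si n v (p i) - si n v' (p i)\<bar>)"
    by (intro order_trans[OF abs_avg_le] avg_mono)
      (use assms abs_si_le p_less in \<open>auto simp: abs_mult intro!: mult_right_mono\<close>)
  also have "\<dots> \<le> 3 * (6 * \<bar>real v - real v'\<bar> / real n)"
    unfolding avg_mult_left avg_p[of "\<lambda>i. \<bar>si n v i - si n v' i\<bar>"]
    using avg_abs_si_diff'[OF assms(3,4)] by (intro mult_left_mono) auto
  finally have 2: "\<bar>AA u' v - AA u' v'\<bar> \<le> 18 * \<bar>real v - real v'\<bar> / real n" by simp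
  have "\<bar>AA u v - AA u' v'\<bar> \<le> 18 * \<bar>real u - real u'\<bar> / real n + 18 * \<bar>real v - real v'\<bar> / real n"
    using 1 2 by linarith
  then show ?thesis by (simp add: add_divide_distrib distrib_left)
qed

text \<open>Near the ends only one side of the interval may fit into \<open>{..<n}\<close>; as
  \<open>r\<close> is at most n/2, at least one side always does, and it contains more than
  \<open>r\<close> integers.\<close>

lemma card_close_ge:
  assumes "u0 < n" "0 \<le> r" "r \<le> real n / 2"
  shows "r \<le> real (card {u. u < n \<and> \<bar>real u - real u0\<bar> \<le> r})"
proof -
  define K where "K = nat \<lfloor>r\<rfloor>"
  have K: "real K \<le> r" "r < real K + 1" using assms by (auto simp: K_def)
  let ?U = "{u. u < n \<and> \<bar>real u - real u0\<bar> \<le> r}"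
  have "K + 1 \<le> card ?U"
  proof (cases "u0 + K < n")
    case True
    then have "{u0..u0 + K} \<subseteq> ?U" using K by auto
    then have "card {u0..u0 + K} \<le> card ?U" by (intro card_mono) auto
    then show ?thesis by simp
  next
    case False
    then have le: "K \<le> u0" using K assms by linarith
    then have "{u0 - K..u0} \<subseteq> ?U" using K assms by (auto simp: of_nat_diff)
    then have "card {u0 - K..u0} \<le> card ?U" by (intro card_mono) auto
    then show ?thesis using le by simp
  qed
  then show ?thesis using K by linarith
qed

text \<open>By the Lipschitz bound a value of size m persists at size m/2 on a box of side
  \<open>m * n / 72\<close>. Its share of the square is at least (m/72)^2, so \<open>rho\<close> is
  at least (m/2)^2 (m/72)^2 = m^4 / 20736.\<close>

lemma AA_sup:
  assumes "u0 < n" "v0 < n"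
  shows "\<bar>AA u0 v0\<bar> ^ 4 \<le> 20736 * rho"
proof -
  define m where "m = \<bar>AA u0 v0\<bar>"
  define r where "r = m * real n / 72"
  have m: "0 \<le> m" "m \<le> 9" using abs_AA_le[OF assms] by (auto simp: m_def)
  have "m * real n \<le> 9 * real n" using m by (intro mult_right_mono) auto
  then have r: "0 \<le> r" "r \<le> real n / 2" using m by (auto simp: r_def)
  define U where "U w = {u. u < n \<and> \<bar>real u - real w\<bar> \<le> r}" for w
  have low: "(m / 2)\<^sup>2 \<le> (AA u v)\<^sup>2" if "u \<in> U u0" "v \<in> U v0" for u v
  proof -
    have uv: "u < n" "v < n" "\<bar>real u0 - real u\<bar> \<le> r" "\<bar>real v0 - real v\<bar> \<le> r"
      using that by (auto simp: U_def)
    have "\<bar>AA u0 v0 - AA u v\<bar> \<le> 18 * (r + r) / real n"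
      using uv by (intro order_trans[OF AA_lipschitz[OF assms(1) uv(1) assms(2) uv(2)]] divide_right_mono) auto
    also have "\<dots> = m / 2" using n_pos by (simp add: r_def)
    finally have "m / 2 \<le> \<bar>AA u v\<bar>" unfolding m_def by linarith
    then show ?thesis using m(1) power_mono[of "m / 2" "\<bar>AA u v\<bar>" 2] by simp
  qed
  have avgU: "m / 72 \<le> avg n (\<lambda>u. of_bool (u \<in> U w))" if "w < n" for w
  proof -
    have "{..<n} \<inter> U w = U w" by (auto simp: U_def)
    then have "avg n (\<lambda>u. of_bool (u \<in> U w)) = real (card (U w)) / real n"
      by (simp add: avg_def sum_of_bool_eq Int_def)
    moreover have "r / real n \<le> real (card (U w)) / real n"
      unfolding U_def using card_close_ge[OF that r] by (intro divide_right_mono) auto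
    ultimately show ?thesis using n_pos by (simp add: r_def)
  qed
  have "(m / 2)\<^sup>2 * (m / 72 * (m / 72)) \<le>
      (m / 2)\<^sup>2 * (avg n (\<lambda>u. of_bool (u \<in> U u0)) * avg n (\<lambda>u. of_bool (u \<in> U v0)))"
    using m avgU[OF assms(1)] avgU[OF assms(2)] by (intro mult_left_mono mult_mono) auto
  also have "\<dots> = avg2 n (\<lambda>u v. (m / 2)\<^sup>2 * (of_bool (u \<in> U u0) * of_bool (v \<in> U v0)))"
    by (simp only: avg_mult_left avg_mult_right)
  also have "\<dots> \<le> avg2 n (\<lambda>u v. (AA u v)\<^sup>2)"
    by (intro avg_mono) (use low in auto)
  also have "\<dots> = rho" by (simp add: RR_def AA_def)
  finally show ?thesis unfolding m_def[symmetric]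
    by (simp add: power2_eq_square power4_eq_xxxx)
qed

lemma avg_abs_al_0: "avg n (\<lambda>i. \<bar>al n 0 i\<bar>) \<le> 2 / real n"
proof -
  have "\<bar>al n 0 i\<bar> \<le> 1 / real n + of_bool (0 = i)" for i
    using n_pos by (auto simp: al_def sg_def zc_def field_simps)
  then have "avg n (\<lambda>i. \<bar>al n 0 i\<bar>) \<le> avg n (\<lambda>i. 1 / real n + of_bool (0 = i))"
    by (intro avg_mono)
  also have "\<dots> = 2 / real n" unfolding avg_add avg_of_bool_eq(1)[OF n_pos] avg_const[OF n_pos] by simp
  finally show ?thesis .
qed

text \<open>\<open>AA\<close> differs from the correlation of \<open>al\<close> by a function of
  \<open>u\<close> plus a function of \<open>v\<close>, which cancels in the mixed difference with
  base point (0, 0). On the axes the correlation of \<open>al\<close> is O(1/n), because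
  \<open>al n 0\<close> is tiny except at 0.\<close>

lemma abs_corr_al_le:
  assumes e: "\<And>u v. u < n \<Longrightarrow> v < n \<Longrightarrow> \<bar>AA u v\<bar> \<le> e" and uv: "u < n" "v < n"
  shows "\<bar>corr (al n) (al n) u v\<bar> \<le> 4 * e + 12 / real n"
proof -
  have 1: "\<bar>corr (al n) (al n) 0 v\<bar> \<le> 4 / real n" if "v < n" for v
  proof -
    have "\<bar>corr (al n) (al n) 0 v\<bar> \<le> avg n (\<lambda>i. \<bar>al n 0 i\<bar> * 2)"
      unfolding corr_def by (intro order_trans[OF abs_avg_le] avg_mono)
        (use that abs_al_le in \<open>auto simp: abs_mult intro!: mult_left_mono\<close>)
    then show ?thesis using avg_abs_al_0 by (simp add: avg_mult_right)
  qed
  have 2: "\<bar>corr (al n) (al n) u 0\<bar> \<le> 4 / real n" if "u < n" for u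
  proof -
    have "\<bar>corr (al n) (al n) u 0\<bar> \<le> avg n (\<lambda>i. 2 * \<bar>al n 0 (p i)\<bar>)"
      unfolding corr_def by (intro order_trans[OF abs_avg_le] avg_mono)
        (use that abs_al_le in \<open>auto simp: abs_mult intro!: mult_right_mono\<close>)
    then show ?thesis using avg_abs_al_0 avg_p[of "\<lambda>i. \<bar>al n 0 i\<bar>"] by (simp add: avg_mult_left)
  qed
  have "corr (al n) (al n) u v = AA u v - AA 0 v - AA u 0 + AA 0 0 + corr (al n) (al n) 0 v
     + corr (al n) (al n) u 0 - corr (al n) (al n) 0 0"
    by (simp add: corr_decomp)
  then show ?thesis
    using 1[OF uv(2)] 1[OF n_pos] 2[OF uv(1)] e[OF uv] e[OF n_pos uv(2)] e[OF uv(1) n_pos] e[OF n_pos n_pos]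
    by linarith
qed

definition cnt :: "nat \<Rightarrow> nat \<Rightarrow> nat" where
  "cnt a c = card {i. i < n \<and> i < a \<and> p i < c}"

text \<open>The bracket corrects the point \<open>i = a\<close>, where the sign is 0, and the half
  unit in \<open>zc\<close>; the mean of its absolute value is O(1/n).\<close>

lemma of_bool_less_al:
  "of_bool (i < a) = real a / real n + (1 / (2 * real n) - of_bool (i = a) / 2) - al n a i / 2"
  using n_pos by (cases i a rule: linorder_cases) (auto simp: al_def sg_def zc_def field_simps)

text \<open>The left side is the covariance of two threshold indicators, which is a quarter of the
  correlation of \<open>al\<close> up to the corrections in \<open>of_bool_less_al\<close>.\<close>

lemma cnt_le_one: 
  assumes e: "\<And>u v. u < n \<Longrightarrow> v < n \<Longrightarrow> \<bar>AA u v\<bar> \<le> e" and ac: "a \<le> n" "c \<le> n"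
  shows "\<bar>real (cnt a c) / real n - real a / real n * (real c / real n)\<bar> \<le> e + 6 / real n"
proof -
  have e0: "0 \<le> e" using e[OF n_pos n_pos] by simp
  have sub: "{..<n} \<inter> {i. i < a} = {..<a}" if "a \<le> n" for a using that by auto
  have avg_a: "avg n (\<lambda>i. of_bool (i < a)) = real a / real n" if "a \<le> n" for a
    using sub[OF that] by (simp add: avg_def sum_of_bool_eq)
  have avg_c: "avg n (\<lambda>i. of_bool (p i < c)) = real c / real n"
    using avg_p[of "\<lambda>i. of_bool (i < c)"] avg_a[OF ac(2)] by simp
  have "{i. i < n \<and> i < a \<and> p i < c} = {..<n} \<inter> {i. i < a \<and> p i < c}" by auto
  then have cnt: "real (cnt a c) / real n = avg n (\<lambda>i. of_bool (i < a) * of_bool (p i < c))"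
    by (simp add: avg_def cnt_def sum_of_bool_eq of_bool_conj[symmetric])
  \<comment> \<open>For \<open>a = n\<close> or \<open>c = n\<close> the count is exact; otherwise
    both are thresholds below n, as \<open>abs_corr_al_le\<close> requires.\<close>
  consider "a = n" | "c = n" | "a < n" "c < n" using ac by linarith
  then show ?thesis
  proof cases
    case 1
    have "real (cnt a c) / real n = real c / real n"
      unfolding cnt avg_c[symmetric] by (rule avg_cong) (simp add: 1)
    then show ?thesis using 1 n_pos e0 by simp
  next
    case 2
    have "real (cnt a c) / real n = real a / real n"
      unfolding cnt avg_a[OF ac(1), symmetric] by (rule avg_cong) (simp add: 2 p_less)
    then show ?thesis using 2 n_pos e0 by simp
  next
    case 3
    define E where "E a i = 1 / (2 * real n) - of_bool (i = a) / (2::real)" for a i :: nat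
    have Eb: "\<bar>E a i\<bar> \<le> (1 / 2) * (1 / real n) + (1 / 2) * of_bool (i = a)" "\<bar>E a i\<bar> \<le> 1" for a i
      using n_pos by (auto simp: E_def of_bool_def abs_if field_simps)
    have Ea: "avg n (\<lambda>i. \<bar>E a i\<bar>) \<le> 1 / real n" if "a < n" for a
    proof -
      have "avg n (\<lambda>i. \<bar>E a i\<bar>) \<le> avg n (\<lambda>i. (1 / 2) * (1 / real n) + (1 / 2) * of_bool (i = a))"
        by (intro avg_mono Eb)
      also have "\<dots> = 1 / real n"
        unfolding avg_add avg_mult_left avg_const[OF n_pos] avg_of_bool_eq(2)[OF that] by simp
      finally show ?thesis .
    qed
    have half: "\<bar>al n a i / 2\<bar> \<le> 1" if "a < n" for a i using abs_al_le[OF that, of i] by simp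
    have "real (cnt a c) / real n - real a / real n * (real c / real n) =
      avg n (\<lambda>i. (of_bool (i < a) - real a / real n) * (of_bool (p i < c) - real c / real n))"
    proof -
      have "avg n (\<lambda>i. (f i - A) * (g i - C)) = avg n (\<lambda>i. f i * g i) - A * avg n g - C * avg n f + A * C"
        for f g :: "nat \<Rightarrow> real" and A C
        unfolding avg_mult_left[symmetric] avg_diff[symmetric]
        using n_pos by (subst avg_const[symmetric, of n "A * C"], simp, unfold avg_add[symmetric]) (simp add: algebra_simps)
      then show ?thesis unfolding cnt by (simp add: avg_a[OF ac(1)] avg_c)
    qed
    also have "\<dots> = avg n (\<lambda>i. (E a i - al n a i / 2) * (E c (p i) - al n c (p i) / 2))"
      unfolding of_bool_less_al E_def by (simp add: algebra_simps)
    also have "\<dots> = avg n (\<lambda>i. (1/4) * (al n a i * al n c (p i)) + (E a i * (E c (p i) - al n c (p i) / 2) - al n a i / 2 * E c (p i)))"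
      by (simp add: algebra_simps)
    also have "\<dots> = (1/4) * corr (al n) (al n) a c + avg n (\<lambda>i. E a i * (E c (p i) - al n c (p i) / 2) - al n a i / 2 * E c (p i))"
      unfolding avg_add avg_mult_left corr_def ..
    finally have eq: "real (cnt a c) / real n - real a / real n * (real c / real n) = \<dots>" .
    have "\<bar>avg n (\<lambda>i. E a i * (E c (p i) - al n c (p i) / 2) - al n a i / 2 * E c (p i))\<bar> \<le>
      avg n (\<lambda>i. \<bar>E a i\<bar> * 2 + \<bar>E c (p i)\<bar>)"
    proof (intro order_trans[OF abs_avg_le] avg_mono)
      fix i
      have "\<bar>E c (p i) - al n c (p i) / 2\<bar> \<le> 2" using Eb(2)[of c "p i"] half[OF 3(2), of "p i"] by linarith
      then have "\<bar>E a i * (E c (p i) - al n c (p i) / 2)\<bar> \<le> \<bar>E a i\<bar> * 2"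
        by (intro abs_mult_le) auto
      moreover have "\<bar>al n a i / 2 * E c (p i)\<bar> \<le> 1 * \<bar>E c (p i)\<bar>" using half[OF 3(1)] by (intro abs_mult_le) auto
      ultimately show "\<bar>E a i * (E c (p i) - al n c (p i) / 2) - al n a i / 2 * E c (p i)\<bar> \<le> \<bar>E a i\<bar> * 2 + \<bar>E c (p i)\<bar>"
        by linarith
    qed
    also have "\<dots> \<le> 3 / real n"
      using Ea[OF 3(1)] Ea[OF 3(2)] avg_p[of "\<lambda>i. \<bar>E c i\<bar>"] by (simp add: avg_add avg_mult_right)
    finally show ?thesis
      unfolding eq using abs_corr_al_le[OF e 3] by linarith
  qed
qed

end

section \<open>Finding patterns in a grid of cells\<close>

lemma sorted_list_of_set_image_lessThan:
  fixes f :: "nat \<Rightarrow> nat"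
  assumes "\<And>i j. i < j \<Longrightarrow> j < k \<Longrightarrow> f i < f j"
  shows "sorted_list_of_set (f ` {..<k}) = map f [0..<k]"
  using sorted_list_of_set_strict_mono_image[of "{..<k}" f] assms
  by (simp add: lessThan_atLeast0)

lemma sorted_list_of_set_nth_less:
  assumes "finite C" "i < j" "j < card C"
  shows "sorted_list_of_set C ! i < sorted_list_of_set C ! j"
  using sorted_wrt_nth_less[OF strict_sorted_list_of_set[of C] assms(2)] assms by simp

lemma sorted_list_of_set_nth_mem:
  assumes "finite C" "i < card C"
  shows "sorted_list_of_set C ! i \<in> C"
  using nth_mem[of i "sorted_list_of_set C"] assms by simp

context biperm
begin

text \<open>The square is cut into an m by m grid; n need not be divisible by m, so blocks may
  differ in size by rounding.\<close>

definition cell :: "nat \<Rightarrow> nat \<Rightarrow> nat \<Rightarrow> nat set" where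
  "cell m j j' = {i. i < n \<and> i * m div n = j \<and> p i * m div n = j'}"

lemma block_less: "a * m div n < b * m div n \<Longrightarrow> a < b"
proof (rule ccontr)
  assume *: "a * m div n < b * m div n" and "\<not> a < b"
  then have "b * m div n \<le> a * m div n" by (intro div_le_mono mult_le_mono1) simp
  then show False using * by simp
qed

text \<open>\<open>C\<close> is the set of columns, \<open>R\<close> the set of rows, and
  \<open>w\<close> matches them; the order of the blocks then forces the pattern. The last two
  claims recover \<open>C\<close> and \<open>R\<close> from the chosen points, which prevents double
  counting.\<close>

lemma cell_transversal:
  fixes w :: "nat list" and m k :: nat and f :: "nat \<Rightarrow> nat"
  assumes w: "w \<in> perms k" and C: "finite C" "card C = k" and R: "finite R" "card R = k"
    and f: "\<And>j. j < k \<Longrightarrow> f j \<in> cell m (sorted_list_of_set C ! j) (sorted_list_of_set R ! (w ! j - 1))"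
  shows "\<And>i j. i < j \<Longrightarrow> j < k \<Longrightarrow> f i < f j" and "f ` {..<k} \<subseteq> {..<n}"
    and "inj_on f {..<k}" and "patt p (f ` {..<k}) = w"
    and "C = (\<lambda>i. i * m div n) ` f ` {..<k}" and "R = (\<lambda>i. p i * m div n) ` f ` {..<k}"
proof -
  let ?sl = "sorted_list_of_set :: nat set \<Rightarrow> nat list"
  have lw: "length w = k" using w length_perms by blast
  have sw: "set w = {1..k}" using w by (auto simp: perms_def permutations_of_set_def)
  have wk: "w ! i - 1 < k" "1 \<le> w ! i" if "i < k" for i
  proof -
    have "w ! i \<in> {1..k}" using that lw sw nth_mem[of i w] by simp
    then show "w ! i - 1 < k" "1 \<le> w ! i" by auto
  qed
  have fn: "f j < n" and fC: "f j * m div n = ?sl C ! j" and fR: "p (f j) * m div n = ?sl R ! (w ! j - 1)"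
    if "j < k" for j using f[OF that] by (auto simp: cell_def)
  have inc: "f i < f j" if "i < j" "j < k" for i j
  proof (rule block_less)
    show "f i * m div n < f j * m div n"
      using that fC[of i] fC[of j] sorted_list_of_set_nth_less[of C i j] C by simp
  qed
  have sl: "?sl (f ` {..<k}) = map f [0..<k]" by (rule sorted_list_of_set_image_lessThan) (rule inc)
  have finj: "inj_on f {..<k}" proof (rule linorder_inj_onI')
    fix i j assume "i \<in> {..<k}" "j \<in> {..<k}" "i < j"
    then show "f i \<noteq> f j" using inc[of i j] by simp
  qed
  have sub: "f ` {..<k} \<subseteq> {..<n}" using fn by auto
  have pinc: "p (f i) < p (f j)" if "w ! i < w ! j" "i < k" "j < k" for i j
  proof (rule block_less)
    have "w ! i - 1 < w ! j - 1" using that wk(2)[of i] by linarith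
    then show "p (f i) * m div n < p (f j) * m div n"
      using that fR[of i] fR[of j] sorted_list_of_set_nth_less[of R "w ! i - 1" "w ! j - 1"] R wk(1)[of j] by simp
  qed
  have dw: "distinct w" using w by (auto simp: perms_def permutations_of_set_def)
  show "patt p (f ` {..<k}) = w"
    unfolding patt_def sl
  proof (rule std_eqI)
    show "distinct (map p (map f [0..<k]))"
      using distinct_map_sorted_list_of_set[OF inj_p sub] sl by simp
    show "w \<in> perms (length (map p (map f [0..<k])))" using w by simp
    fix i j assume "i < length (map p (map f [0..<k]))" "j < length (map p (map f [0..<k]))"
    then have ij: "i < k" "j < k" by simp_all
    show "(w ! i < w ! j) = (map p (map f [0..<k]) ! i < map p (map f [0..<k]) ! j)"
    proof (cases "w ! i" "w ! j" rule: linorder_cases)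
      case equal
      then have "i = j" using dw ij lw by (simp add: nth_eq_iff_index_eq)
      then show ?thesis by simp
    qed (use pinc[of i j] pinc[of j i] ij in auto)
  qed
  show "C = (\<lambda>i. i * m div n) ` f ` {..<k}"
  proof -
    have "C = set (?sl C)" using C by simp
    also have "\<dots> = (!) (?sl C) ` {..<k}" using C by (auto simp: set_conv_nth)
    also have "\<dots> = (\<lambda>i. i * m div n) ` f ` {..<k}" unfolding image_image by (rule image_cong) (auto simp: fC)
    finally show ?thesis .
  qed
  show "R = (\<lambda>i. p i * m div n) ` f ` {..<k}"
  proof -
    have "set w = {1..k}" using w by (auto simp: perms_def permutations_of_set_def)
    then have "(!) w ` {..<k} = {1..k}" using lw by (auto simp: set_conv_nth)
    moreover have "(\<lambda>j. w ! j - 1) ` {..<k} = (\<lambda>x. x - 1) ` (!) w ` {..<k}" by (simp add: image_image)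
    ultimately have "(\<lambda>j. w ! j - 1) ` {..<k} = (\<lambda>x. x - 1) ` {1..k}" by simp
    also have "\<dots> = (\<lambda>x. x - 1) ` Suc ` {..<k}" by (simp add: image_Suc_lessThan)
    also have "\<dots> = {..<k}" by (simp add: image_image)
    finally have wim: "(\<lambda>j. w ! j - 1) ` {..<k} = {..<k}" .
    have "R = set (?sl R)" using R by simp
    also have "\<dots> = (!) (?sl R) ` (\<lambda>j. w ! j - 1) ` {..<k}" unfolding wim using R by (auto simp: set_conv_nth)
    also have "\<dots> = (\<lambda>i. p i * m div n) ` f ` {..<k}" unfolding image_image by (rule image_cong) (auto simp: fR)
    finally show ?thesis .
  qed
  show "\<And>i j. i < j \<Longrightarrow> j < k \<Longrightarrow> f i < f j" by (rule inc)
  show "f ` {..<k} \<subseteq> {..<n}" by (rule sub)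
  show "inj_on f {..<k}" by (rule finj)
qed

text \<open>There are \<open>(m choose k)\<^sup>2\<close> choices of columns and rows, at least
  \<open>L\<close> choices of a point in each of the k cells selected by \<open>w\<close>, and no
  set of positions arises twice.\<close>

lemma pcount_ge_cells:
  fixes w :: "nat list" and m k L :: nat
  assumes w: "w \<in> perms k" and L: "\<And>j j'. j < m \<Longrightarrow> j' < m \<Longrightarrow> L \<le> card (cell m j j')"
  shows "(m choose k)\<^sup>2 * L ^ k \<le> pcount k {w} p n"
proof -
  let ?sl = "sorted_list_of_set :: nat set \<Rightarrow> nat list"
  have lw: "length w = k" using w length_perms by blast
  have wk: "w ! i - 1 < k" "1 \<le> w ! i" if "i < k" for i
  proof -
    have "w ! i \<in> set w" using that lw by simp
    then have "w ! i \<in> {1..k}" using w by (auto simp: perms_def permutations_of_set_def)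
    then show "w ! i - 1 < k" "1 \<le> w ! i" by auto
  qed
  define \<C> where "\<C> = {C. C \<subseteq> {..<m} \<and> card C = k}"
  have fin\<C>: "finite \<C>" and card\<C>: "card \<C> = m choose k"
    unfolding \<C>_def using n_subsets[of "{..<m}" k] by auto
  have C_props: "finite C" "card C = k" "C \<subseteq> {..<m}" if "C \<in> \<C>" for C
    using that finite_subset[of C "{..<m}"] unfolding \<C>_def by simp_all
  define T where "T x = (\<lambda>j. cell m (?sl (fst x) ! j) (?sl (snd x) ! (w ! j - 1)))" for x
  define \<D> where "\<D> = (SIGMA x:\<C> \<times> \<C>. PiE {..<k} (T x))"
  have key: "f ` {..<k} \<subseteq> {..<n}" "inj_on f {..<k}" "patt p (f ` {..<k}) = w"
      "fst x = (\<lambda>i. i * m div n) ` f ` {..<k}" "snd x = (\<lambda>i. p i * m div n) ` f ` {..<k}"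
      "\<And>i j. i < j \<Longrightarrow> j < k \<Longrightarrow> f i < f j"
    if "(x, f) \<in> \<D>" for x f
  proof -
    have x: "fst x \<in> \<C>" "snd x \<in> \<C>" and f: "f \<in> PiE {..<k} (T x)"
      using that unfolding \<D>_def by (simp_all add: mem_Times_iff)
    have "f j \<in> cell m (?sl (fst x) ! j) (?sl (snd x) ! (w ! j - 1))" if "j < k" for j
      using PiE_mem[OF f, of j] that by (simp add: T_def)
    note t = cell_transversal[OF w C_props(1,2)[OF x(1)] C_props(1,2)[OF x(2)] this]
    show "f ` {..<k} \<subseteq> {..<n}" "inj_on f {..<k}" "patt p (f ` {..<k}) = w"
      "fst x = (\<lambda>i. i * m div n) ` f ` {..<k}" "snd x = (\<lambda>i. p i * m div n) ` f ` {..<k}"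
      "\<And>i j. i < j \<Longrightarrow> j < k \<Longrightarrow> f i < f j"
      by (rule t; assumption)+
  qed
  have fin_cell: "finite (cell m j j')" for j j' by (simp add: cell_def)
  have "(m choose k)\<^sup>2 * L ^ k = (\<Sum>x\<in>\<C> \<times> \<C>. \<Prod>j<k. L)"
    by (simp add: card\<C> power2_eq_square card_cartesian_product)
  also have "\<dots> \<le> (\<Sum>x\<in>\<C> \<times> \<C>. \<Prod>j<k. card (T x j))"
  proof (intro sum_mono prod_mono conjI)
    fix x j assume x: "x \<in> \<C> \<times> \<C>" and j: "j \<in> {..<k}"
    have C: "fst x \<in> \<C>" and R: "snd x \<in> \<C>" using x by (simp_all add: mem_Times_iff)
    have "?sl (fst x) ! j \<in> fst x"
      using C_props(1,2)[OF C] j by (intro sorted_list_of_set_nth_mem) simp_all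
    then have "?sl (fst x) ! j < m" using C_props(3)[OF C] by (simp add: subset_eq)
    moreover have "?sl (snd x) ! (w ! j - 1) \<in> snd x"
      using C_props(1,2)[OF R] j wk(1)[of j] by (intro sorted_list_of_set_nth_mem) simp_all
    then have "?sl (snd x) ! (w ! j - 1) < m" using C_props(3)[OF R] by (simp add: subset_eq)
    ultimately show "L \<le> card (T x j)"
      unfolding T_def by (rule L)
  qed simp
  also have "\<dots> = card \<D>"
  proof -
    have "\<forall>x\<in>\<C> \<times> \<C>. finite (PiE {..<k} (T x))"
      unfolding T_def using fin_cell by (intro ballI finite_PiE) simp_all
    then have "card \<D> = (\<Sum>x\<in>\<C> \<times> \<C>. card (PiE {..<k} (T x)))"
      unfolding \<D>_def using fin\<C> by (intro card_SigmaI) simp_all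
    then show ?thesis by (simp add: card_PiE)
  qed
  also have "\<dots> = card ((\<lambda>(x, f). f ` {..<k}) ` \<D>)"
  proof (rule card_image[symmetric], rule inj_onI)
    fix a b assume a: "a \<in> \<D>" and b: "b \<in> \<D>"
      and eq: "(case a of (x, f) \<Rightarrow> f ` {..<k}) = (case b of (x, f) \<Rightarrow> f ` {..<k})"
    obtain x f where aa: "a = (x, f)" by (cases a)
    obtain x' f' where bb: "b = (x', f')" by (cases b)
    have im: "f ` {..<k} = f' ` {..<k}" using eq by (simp add: aa bb)
    note K = key[OF a[unfolded aa]] and K' = key[OF b[unfolded bb]]
    have x: "x = x'" using K(4,5) K'(4,5) unfolding im by (simp add: prod_eq_iff)
    have "sorted_list_of_set (f ` {..<k}) = map f [0..<k]"
      by (rule sorted_list_of_set_image_lessThan) (rule K(6))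
    moreover have "sorted_list_of_set (f' ` {..<k}) = map f' [0..<k]"
      by (rule sorted_list_of_set_image_lessThan) (rule K'(6))
    ultimately have mapf: "map f [0..<k] = map f' [0..<k]" by (simp only: im)
    have "f = f'"
    proof (rule PiE_ext)
      show "f \<in> PiE {..<k} (T x)" "f' \<in> PiE {..<k} (T x)"
        using a b unfolding aa bb x \<D>_def by (simp_all only: mem_Sigma_iff)
      show "f i = f' i" if "i \<in> {..<k}" for i
        using mapf that by simp
    qed
    then show "a = b" by (simp add: aa bb x)
  qed
  also have "\<dots> \<le> pcount k {w} p n"
    unfolding pcount_def
  proof (rule card_mono)
    show "finite {B. B \<subseteq> {..<n} \<and> card B = k \<and> patt p B \<in> {w}}"
      by (rule finite_subset[of _ "Pow {..<n}"]) auto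
    show "(\<lambda>(x, f). f ` {..<k}) ` \<D> \<subseteq> {B. B \<subseteq> {..<n} \<and> card B = k \<and> patt p B \<in> {w}}"
    proof
      fix B assume "B \<in> (\<lambda>(x, f). f ` {..<k}) ` \<D>"
      then obtain x f where f: "(x, f) \<in> \<D>" "B = f ` {..<k}" by auto
      show "B \<in> {B. B \<subseteq> {..<n} \<and> card B = k \<and> patt p B \<in> {w}}"
        using key(1-3)[OF f(1)] unfolding f(2) by (simp add: card_image)
    qed
  qed
  finally show ?thesis .
qed

end

context biperm
begin

lemma cnt_eq_sum: "cnt a c = (\<Sum>i<n. of_bool (i < a \<and> p i < c))"
proof -
  have "{i. i < n \<and> i < a \<and> p i < c} = {..<n} \<inter> {i. i < a \<and> p i < c}" by auto
  then show ?thesis by (simp add: cnt_def sum_of_bool_eq)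
qed

text \<open>Inclusion and exclusion for a cell, written additively to avoid subtraction of natural
  numbers. The side lengths of the cell fall short of n/m by at most 1.\<close>

lemma cnt_cell:
  assumes "0 < m" and that: "j < m" "j' < m"
  shows "\<exists>a b c d. a \<le> b \<and> b \<le> n \<and> c \<le> d \<and> d \<le> n \<and>
     real a / real n + 1 / real m - 1 / real n \<le> real b / real n \<and>
     real c / real n + 1 / real m - 1 / real n \<le> real d / real n \<and>
     card (cell m j j') + cnt a d + cnt b c = cnt b d + cnt a c"
proof -
  \<comment> \<open>The ceiling of jn/m, which is the least index in block \<open>j\<close>.\<close>
  define t where "t j = (j * n + (m - 1)) div m" for j
  have blk: "i * m div n < j \<longleftrightarrow> i < t j" for i j
  proof -
    have "i < t j \<longleftrightarrow> Suc i * m \<le> j * n + (m - 1)"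
      unfolding t_def using assms by (simp add: less_eq_div_iff_mult_less_eq Suc_le_eq[symmetric] del: mult_Suc)
    also have "\<dots> \<longleftrightarrow> i * m < j * n" using assms by auto
    also have "\<dots> \<longleftrightarrow> i * m div n < j" using n_pos by (simp add: div_less_iff_less_mult)
    finally show ?thesis ..
  qed
  have mono: "t j \<le> t (Suc j)" for j unfolding t_def by (intro div_le_mono) simp
  have tn: "t j \<le> n" if "j \<le> m" for j
  proof -
    have "t j \<le> (m * n + (m - 1)) div m" unfolding t_def using that by (intro div_le_mono) simp
    also have "\<dots> = n" by (rule div_nat_eqI) (use assms in auto)
    finally show ?thesis .
  qed
  have tb: "real j * real n \<le> real m * real (t j)" "real m * real (t j) \<le> real j * real n + (real m - 1)" for j
  proof -
    have "t j * m \<le> j * n + (m - 1)" unfolding t_def by (rule div_times_less_eq_dividend)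
    then have "real (t j * m) \<le> real (j * n + (m - 1))" by linarith
    then show "real m * real (t j) \<le> real j * real n + (real m - 1)" using assms by (simp add: of_nat_diff mult.commute)
    have "j * n + (m - 1) < m + t j * m"
      unfolding t_def using assms dividend_less_div_times[of m "j * n + (m - 1)"] by (simp add: mult.commute)
    then have "real (j * n) \<le> real (t j * m)" by linarith
    then show "real j * real n \<le> real m * real (t j)" by (simp add: mult.commute)
  qed
  have gap: "real (t j) / real n + 1 / real m - 1 / real n \<le> real (t (Suc j)) / real n" for j
  proof -
    have "real m * real (t j) + real n - real m \<le> real m * real (t (Suc j))"
      using tb(2)[of j] tb(1)[of "Suc j"] by (simp add: algebra_simps)
    then have "(real m * real (t j) + real n - real m) / (real m * real n) \<le> (real m * real (t (Suc j))) / (real m * real n)"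
      by (intro divide_right_mono) auto
    then show ?thesis using assms n_pos by (simp add: add_divide_distrib diff_divide_distrib)
  qed
  have "card (cell m j j') = (\<Sum>i<n. of_bool (t j \<le> i \<and> i < t (Suc j) \<and> t j' \<le> p i \<and> p i < t (Suc j')))"
  proof -
    have eq: "i * m div n = j \<longleftrightarrow> t j \<le> i \<and> i < t (Suc j)" for i j
      using blk[of i j] blk[of i "Suc j"] by auto
    have "cell m j j' = {..<n} \<inter> {i. t j \<le> i \<and> i < t (Suc j) \<and> t j' \<le> p i \<and> p i < t (Suc j')}"
      unfolding cell_def eq by auto
    then show ?thesis by (simp add: sum_of_bool_eq)
  qed
  then have "card (cell m j j') + cnt (t j) (t (Suc j')) + cnt (t (Suc j)) (t j') =
    (\<Sum>i<n. of_bool (t j \<le> i \<and> i < t (Suc j) \<and> t j' \<le> p i \<and> p i < t (Suc j'))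
      + of_bool (i < t j \<and> p i < t (Suc j')) + of_bool (i < t (Suc j) \<and> p i < t j'))"
    unfolding cnt_eq_sum sum.distrib by (simp only:)
  also have "\<dots> = (\<Sum>i<n. of_bool (i < t (Suc j) \<and> p i < t (Suc j')) + of_bool (i < t j \<and> p i < t j'))"
    using mono[of j] mono[of j'] by (intro sum.cong refl) (auto simp: of_bool_def)
  also have "\<dots> = cnt (t (Suc j)) (t (Suc j')) + cnt (t j) (t j')"
    unfolding cnt_eq_sum sum.distrib ..
  finally have "card (cell m j j') + cnt (t j) (t (Suc j')) + cnt (t (Suc j)) (t j') =
    cnt (t (Suc j)) (t (Suc j')) + cnt (t j) (t j')" .
  then show ?thesis using mono tn that gap by (intro exI[of _ "t j"] exI[of _ "t (Suc j)"] exI[of _ "t j'"] exI[of _ "t (Suc j')"]) auto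
qed

text \<open>Four rectangle counts, each within \<open>e + 6 / n\<close>, account for
  \<open>4 * e + 24 / n\<close>; rounding of the sides adds \<open>2 / n\<close>.\<close>

lemma card_cell_ge:
  assumes e: "\<And>u v. u < n \<Longrightarrow> v < n \<Longrightarrow> \<bar>AA u v\<bar> \<le> e" and m: "0 < m" "m \<le> n" and j: "j < m" "j' < m"
  shows "real n * (1 / (real m)\<^sup>2 - 4 * e - 26 / real n) \<le> real (card (cell m j j'))"
proof -
  obtain a b c d where *: "a \<le> b" "b \<le> n" "c \<le> d" "d \<le> n"
     "real a / real n + 1 / real m - 1 / real n \<le> real b / real n"
     "real c / real n + 1 / real m - 1 / real n \<le> real d / real n"
     "card (cell m j j') + cnt a d + cnt b c = cnt b d + cnt a c"
    using cnt_cell[OF m(1) j] by blast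
  have ac: "a \<le> n" "c \<le> n" using * by linarith+
  have "real (card (cell m j j')) + real (cnt a d) + real (cnt b c) = real (cnt b d) + real (cnt a c)"
    using *(7) by linarith
  then have "(real (card (cell m j j')) + real (cnt a d) + real (cnt b c)) / real n = (real (cnt b d) + real (cnt a c)) / real n"
    by simp
  then have 1: "real (card (cell m j j')) / real n = real (cnt b d) / real n - real (cnt b c) / real n - real (cnt a d) / real n + real (cnt a c) / real n"
    by (simp add: add_divide_distrib)
  define A B C D where "A = real a / real n" and "B = real b / real n" and "C = real c / real n" and "D = real d / real n"
  have nm: "1 / real n \<le> 1 / real m" using m by (simp add: frac_le)
  have "1 / (real m)\<^sup>2 - 2 / real n \<le> (1 / real m - 1 / real n) * (1 / real m - 1 / real n)"
  proof -
    have "(1 / real m) * (1 / real n) \<le> 1 * (1 / real n)" using m by (intro mult_right_mono) auto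
    moreover have "0 \<le> (1 / real n) * (1 / real n)" by simp
    moreover have "(1 / real m - 1 / real n) * (1 / real m - 1 / real n) =
       1 / (real m)\<^sup>2 - 2 * ((1 / real m) * (1 / real n)) + (1 / real n) * (1 / real n)"
      by (simp add: power2_eq_square algebra_simps)
    ultimately show ?thesis by linarith
  qed
  also have "\<dots> \<le> (B - A) * (D - C)"
    unfolding A_def B_def C_def D_def using *(5,6) nm by (intro mult_mono) linarith+
  finally have 2: "1 / (real m)\<^sup>2 - 2 / real n \<le> B * D - B * C - A * D + A * C" by (simp add: algebra_simps)
  have 3: "1 / (real m)\<^sup>2 - 4 * e - 26 / real n \<le> real (card (cell m j j')) / real n"
    using cnt_le_one[OF e *(2,4)] cnt_le_one[OF e *(2) ac(2)] cnt_le_one[OF e ac(1) *(4)] cnt_le_one[OF e ac]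
      2 1 unfolding A_def[symmetric] B_def[symmetric] C_def[symmetric] D_def[symmetric]
    by (simp add: abs_le_iff)
  then show ?thesis using n_pos by (simp add: pos_le_divide_eq mult.commute)
qed

text \<open>\<open>q\<close> is the guaranteed share of points in a cell; the factor
  \<open>fact k\<close> comes from bounding \<open>n choose k\<close> by n^k / k!.\<close>

lemma pcount_lower_bound:
  assumes e: "\<And>u v. u < n \<Longrightarrow> v < n \<Longrightarrow> \<bar>AA u v\<bar> \<le> e" and m: "0 < m" "m \<le> n" and k: "k \<le> n"
    and w: "w \<in> perms k" and q: "q = 1 / (real m)\<^sup>2 - 4 * e - 26 / real n" "0 \<le> q"
  shows "(real (m choose k))\<^sup>2 * q ^ k * fact k \<le> real (pcount k {w} p n) / real (n choose k)"
proof -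
  define L where "L = nat \<lceil>real n * q\<rceil>"
  have L: "real n * q \<le> real L" by (simp add: L_def real_nat_ceiling_ge)
  have "L \<le> card (cell m j j')" if "j < m" "j' < m" for j j'
    using card_cell_ge[OF e m that] unfolding L_def q(1) by (simp add: nat_le_iff ceiling_le_iff)
  from pcount_ge_cells[OF w this] have "real ((m choose k)\<^sup>2 * L ^ k) \<le> real (pcount k {w} p n)"
    by (simp only: of_nat_le_iff)
  then have 1: "(real (m choose k))\<^sup>2 * real L ^ k \<le> real (pcount k {w} p n)" by simp
  have C: "0 < real (n choose k)" using k by simp
  have "(n choose k) * fact k \<le> n ^ k" by (rule binomial_fact_pow)
  then have "real ((n choose k) * fact k) \<le> real (n ^ k)" by (simp only: of_nat_le_iff)
  then have 2: "fact k * real (n choose k) \<le> real n ^ k" by (simp add: mult.commute)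
  have "(real (m choose k))\<^sup>2 * q ^ k * fact k * real (n choose k) = (real (m choose k))\<^sup>2 * (q ^ k * (fact k * real (n choose k)))"
    by (simp add: mult.assoc)
  also have "\<dots> \<le> (real (m choose k))\<^sup>2 * (q ^ k * real n ^ k)"
    using 2 q(2) by (intro mult_left_mono) auto
  also have "\<dots> = (real (m choose k))\<^sup>2 * (real n * q) ^ k" by (simp add: power_mult_distrib mult.commute)
  also have "\<dots> \<le> (real (m choose k))\<^sup>2 * real L ^ k"
    using L q(2) by (intro mult_left_mono power_mono) auto
  also note 1
  finally show ?thesis using C by (simp add: pos_le_divide_eq)
qed

end

section \<open>Quasirandomness from vanishing mean squares\<close>

definition zperm :: "nat list \<Rightarrow> nat \<Rightarrow> nat" where
  "zperm P i = P ! i - 1"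

definition rho_of :: "nat list \<Rightarrow> real" where
  "rho_of P = biperm.RR (length P) (zperm P) (si (length P)) (si (length P))"

lemma nth_perms: "P \<in> perms n \<Longrightarrow> i < n \<Longrightarrow> 1 \<le> P ! i \<and> P ! i \<le> n"
  using nth_mem[of i P] length_perms[of P n] by (auto simp: perms_def permutations_of_set_def)

lemma biperm_zperm:
  assumes P: "P \<in> perms n" and n: "0 < n"
  shows "biperm n (zperm P)"
proof
  have inj: "inj_on (zperm P) {..<n}"
  proof (rule inj_onI)
    fix i j assume ij: "i \<in> {..<n}" "j \<in> {..<n}" "zperm P i = zperm P j"
    then have "P ! i = P ! j" using nth_perms[OF P, of i] nth_perms[OF P, of j] by (auto simp: zperm_def)
    then show "i = j" using inj_on_nth_perms[OF P] ij by (auto simp: inj_on_def)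
  qed
  moreover have "zperm P ` {..<n} \<subseteq> {..<n}"
  proof
    fix x assume "x \<in> zperm P ` {..<n}"
    then obtain i where i: "i < n" "x = P ! i - 1" by (auto simp: zperm_def)
    then show "x \<in> {..<n}" using nth_perms[OF P i(1)] by auto
  qed
  ultimately show "bij_betw (zperm P) {..<n} {..<n}"
    by (simp add: bij_betw_def endo_inj_surj)
qed (rule n)

lemma pcount_zperm:
  assumes P: "P \<in> perms n"
  shows "pcount k S ((!) P) n = pcount k S (zperm P) n"
proof (cases "n = 0")
  case False
  interpret biperm n "zperm P" using biperm_zperm[OF P] False by simp
  have "patt ((!) P) B = patt (zperm P) B" if "B \<subseteq> {..<n}" for B
  proof (rule patt_cong[OF inj_on_nth_perms[OF P] inj_p that])
    fix i j assume "i \<in> B" "j \<in> B"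
    then have "1 \<le> P ! i" "1 \<le> P ! j" using nth_perms[OF P] that by auto
    then show "(P ! i < P ! j) = (zperm P i < zperm P j)" by (auto simp: zperm_def)
  qed
  then have "{B. B \<subseteq> {..<n} \<and> card B = k \<and> patt ((!) P) B \<in> S} = {B. B \<subseteq> {..<n} \<and> card B = k \<and> patt (zperm P) B \<in> S}"
    by auto
  then show ?thesis by (simp add: pcount_def)
next
  case True
  then have "patt ((!) P) B = patt (zperm P) B" if "B \<subseteq> {..<n}" for B using that by (simp add: patt_def std_def)
  then have "{B. B \<subseteq> {..<n} \<and> card B = k \<and> patt ((!) P) B \<in> S} = {B. B \<subseteq> {..<n} \<and> card B = k \<and> patt (zperm P) B \<in> S}"
    by auto
  then show ?thesis by (simp add: pcount_def)
qed

lemma choose_over_power_tendsto: "(\<lambda>m. real (m choose k) / real m ^ k) \<longlonglongrightarrow> 1 / fact k"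
proof -
  have "(\<lambda>m. \<Prod>i = 0..<k. 1 - real i * inverse (real m)) \<longlonglongrightarrow> (\<Prod>i = 0..<k. 1 - real i * 0)"
    by (intro tendsto_intros LIMSEQ_inverse_real_of_nat lim_inverse_n)
  then have "(\<lambda>m. (\<Prod>i = 0..<k. 1 - real i * inverse (real m)) / fact k) \<longlonglongrightarrow> 1 / fact k"
    by (intro tendsto_divide) auto
  then show ?thesis
  proof (rule Lim_transform_eventually)
    show "\<forall>\<^sub>F m in sequentially. (\<Prod>i = 0..<k. 1 - real i * inverse (real m)) / fact k = real (m choose k) / real m ^ k"
      using eventually_gt_at_top[of 0]
    proof eventually_elim
      case (elim m)
      have "fact k * real (m choose k) = (\<Prod>i = 0..<k. real m - real i)"
        using gbinomial_mult_fact[of k "real m"] by (simp add: binomial_gbinomial)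
      moreover have "(\<Prod>i = 0..<k. 1 - real i * inverse (real m)) = (\<Prod>i = 0..<k. (real m - real i) / real m)"
        using elim by (intro prod.cong) (auto simp: field_simps)
      then have "(\<Prod>i = 0..<k. 1 - real i * inverse (real m)) = (\<Prod>i = 0..<k. real m - real i) / real m ^ k"
        by (simp add: prod_dividef)
      ultimately have "(\<Prod>i = 0..<k. 1 - real i * inverse (real m)) = fact k * real (m choose k) / real m ^ k" by simp
      then show ?case by simp
    qed
  qed
qed

text \<open>The grid only bounds densities from below. That suffices, since the lower bounds hold
  for all patterns of order k, add up to nearly 1, and so do the densities.\<close>

lemma quasirandom_if_rho_tendsto_0:
  assumes X: "perm_seq X" and rho: "(\<lambda>i. rho_of (X i)) \<longlonglongrightarrow> 0"
  shows "quasirandom X"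
  unfolding quasirandom_def
proof (intro allI ballI)
  fix k w assume w: "w \<in> perms k"
  define n where "n i = length (X i)" for i
  have Xp: "X i \<in> perms (n i)" for i using X by (simp add: perm_seq_def n_def)
  have nlim: "filterlim n at_top sequentially" using X unfolding perm_seq_def n_def by blast
  have ninv: "(\<lambda>i. 26 / real (n i)) \<longlonglongrightarrow> 0"
    by (rule real_tendsto_divide_at_top[OF tendsto_const])
      (rule filterlim_compose[OF filterlim_real_sequentially nlim])
  define e where "e i = root 4 (20736 * rho_of (X i))" for i
  have elim0: "e \<longlonglongrightarrow> 0"
  proof -
    have "(\<lambda>i. root 4 (20736 * rho_of (X i))) \<longlonglongrightarrow> root 4 (20736 * 0)"
      by (intro tendsto_real_root tendsto_mult tendsto_const rho)
    then show ?thesis by (simp add: e_def[abs_def])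
  qed
  have lower: "\<forall>\<^sub>F i in sequentially. 1 / fact k - \<theta> < pattern_density v (X i)" if v: "v \<in> perms k" and \<theta>: "0 < \<theta>" for v \<theta>
  proof -
    have "(\<lambda>m. (real (m choose k) / real m ^ k)\<^sup>2 * fact k) \<longlonglongrightarrow> (1 / fact k)\<^sup>2 * fact k"
      by (intro tendsto_intros choose_over_power_tendsto)
    moreover have "(1 / fact k)\<^sup>2 * fact k = (1 / fact k :: real)" by (simp add: power2_eq_square)
    ultimately have "\<forall>\<^sub>F m in sequentially. 1 / fact k - \<theta> < (real (m choose k) / real m ^ k)\<^sup>2 * fact k"
      using \<theta> by (intro order_tendstoD(1)) auto
    then have "\<forall>\<^sub>F m in sequentially. 1 / fact k - \<theta> < (real (m choose k) / real m ^ k)\<^sup>2 * fact k \<and> 0 < m"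
      using eventually_gt_at_top[of 0] by eventually_elim simp
    \<comment> \<open>The grid size is fixed before the index of the sequence grows: m controls the
      loss from patterns with two points in a common row or column.\<close>
    from eventually_happens'[OF sequentially_bot this]
    obtain m where m: "1 / fact k - \<theta> < (real (m choose k) / real m ^ k)\<^sup>2 * fact k" "0 < m"
      by (elim exE conjE)
    define q where "q i = 1 / (real m)\<^sup>2 - 4 * e i - 26 / real (n i)" for i
    have "(\<lambda>i. 1 / (real m)\<^sup>2 - 4 * e i - 26 / real (n i)) \<longlonglongrightarrow> 1 / (real m)\<^sup>2 - 4 * 0 - 0"
      by (intro tendsto_intros elim0 ninv)
    then have qlim: "q \<longlonglongrightarrow> 1 / (real m)\<^sup>2" by (simp add: q_def[abs_def])
    have "(\<lambda>i. (real (m choose k))\<^sup>2 * q i ^ k * fact k) \<longlonglongrightarrow> (real (m choose k))\<^sup>2 * (1 / (real m)\<^sup>2) ^ k * fact k"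
      by (intro tendsto_intros qlim)
    moreover have "(real (m choose k))\<^sup>2 * (1 / (real m)\<^sup>2) ^ k * fact k = (real (m choose k) / real m ^ k)\<^sup>2 * fact k"
      by (simp add: power_divide power_mult[symmetric] mult.commute)
    ultimately have "\<forall>\<^sub>F i in sequentially. 1 / fact k - \<theta> < (real (m choose k))\<^sup>2 * q i ^ k * fact k"
      using m(1) by (intro order_tendstoD(1)) auto
    moreover have "\<forall>\<^sub>F i in sequentially. 0 < q i" using qlim m(2) by (intro order_tendstoD(1)) auto
    moreover have "\<forall>\<^sub>F i in sequentially. max m k \<le> n i" using nlim unfolding filterlim_at_top by (rule spec)
    ultimately show ?thesis
    proof eventually_elim
      case (elim i)
      then have n0: "0 < n i" "m \<le> n i" "k \<le> n i" using m(2) by auto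
      interpret biperm "n i" "zperm (X i)" using biperm_zperm[OF Xp n0(1)] .
      have rho: "rho_of (X i) = rho" by (simp add: rho_of_def n_def)
      have AAe: "\<bar>AA u v\<bar> \<le> e i" if "u < n i" "v < n i" for u v
      proof -
        have "root 4 (\<bar>AA u v\<bar> ^ 4) \<le> e i"
          unfolding e_def rho using AA_sup[OF that] by (intro real_root_le_mono) auto
        moreover have "root 4 (\<bar>AA u v\<bar> ^ 4) = \<bar>AA u v\<bar>" by (rule real_root_power_cancel) auto
        ultimately show ?thesis by linarith
      qed
      have "1 / fact k - \<theta> < real (pcount k {v} (zperm (X i)) (n i)) / real (n i choose k)"
        using pcount_lower_bound[OF AAe m(2) n0(2,3) v q_def[of i]] elim by simp
      also have "\<dots> = (\<Sum>p\<in>{v}. pattern_density p (X i))"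
        using sum_pattern_density[OF Xp _ n0(3), of "{v}"] v pcount_zperm[OF Xp] by simp
      finally show ?case by simp
    qed
  qed
  show "(\<lambda>i. pattern_density w (X i)) \<longlonglongrightarrow> 1 / fact k"
  proof (rule order_tendstoI)
    fix a :: real assume "a < 1 / fact k"
    then show "\<forall>\<^sub>F i in sequentially. a < pattern_density w (X i)"
      using lower[OF w, of "1 / fact k - a"] by simp
  next
    fix a :: real assume a: "1 / fact k < a"
    \<comment> \<open>The other patterns number \<open>fact k - 1\<close>, and each may fall short
      by \<theta>.\<close>
    define \<theta> where "\<theta> = (a - 1 / fact k) / fact k"
    have \<theta>: "0 < \<theta>" using a by (simp add: \<theta>_def)
    have "\<forall>\<^sub>F i in sequentially. \<forall>v\<in>perms k. 1 / fact k - \<theta> < pattern_density v (X i)"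
      using lower[OF _ \<theta>] by (intro eventually_ball_finite) auto
    moreover have "\<forall>\<^sub>F i in sequentially. k \<le> n i" using nlim unfolding filterlim_at_top by (rule spec)
    ultimately show "\<forall>\<^sub>F i in sequentially. pattern_density w (X i) < a"
    proof eventually_elim
      case (elim i)
      have "(\<Sum>v\<in>perms k. pattern_density v (X i)) = 1"
        using sum_pattern_density[OF Xp order_refl elim(2)] pcount_perms[OF inj_on_nth_perms[OF Xp]] elim(2) by simp
      then have "pattern_density w (X i) = 1 - (\<Sum>v\<in>perms k - {w}. pattern_density v (X i))"
        using w by (simp add: sum.remove[of "perms k" w])
      also have "\<dots> \<le> 1 - (\<Sum>v\<in>perms k - {w}. 1 / fact k - \<theta>)"
        using elim(1) by (intro diff_left_mono sum_mono) (auto intro: less_imp_le)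
      also have "\<dots> = 1 - (fact k - 1) * (1 / fact k - \<theta>)"
        using w by (simp add: card_Diff_singleton of_nat_diff)
      also have "\<dots> = 1 / fact k + (fact k - 1) * \<theta>"
        by (simp add: field_simps)
      also have "\<dots> < 1 / fact k + fact k * \<theta>" using \<theta> by (simp add: algebra_simps)
      also have "\<dots> = a" by (simp add: \<theta>_def)
      finally show ?case .
    qed
  qed
qed

section \<open>Sufficiency\<close>

lemma sum_pattern_density_eq_dens:
  assumes P: "P \<in> perms n" and n: "4 \<le> n" and S: "S \<subseteq> perms 4"
  shows "(\<Sum>p\<in>S. pattern_density p P) = biperm.dens n (zperm P) S"
proof -
  interpret biperm n "zperm P" using biperm_zperm[OF P] n by simp
  show ?thesis unfolding sum_pattern_density[OF P S n] dens_def pcount_zperm[OF P] ..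
qed

lemma perm_seqD:
  assumes "perm_seq X"
  shows "X i \<in> perms (length (X i))" "filterlim (\<lambda>i. length (X i)) at_top sequentially"
  using assms unfolding perm_seq_def by blast+

lemma perm_seq_eventually_ge:
  assumes "perm_seq X"
  shows "\<forall>\<^sub>F i in sequentially. N \<le> length (X i)"
  using perm_seqD(2)[OF assms] unfolding filterlim_at_top by (rule spec)

lemma perm_seq_inverse_tendsto_0:
  assumes "perm_seq X"
  shows "(\<lambda>i. c / real (length (X i))) \<longlonglongrightarrow> 0"
  by (rule real_tendsto_divide_at_top[OF tendsto_const])
    (rule filterlim_compose[OF filterlim_real_sequentially perm_seqD(2)[OF assms]])

text \<open>The factor \<open>s\<close> is 1 for sets whose density asymptotically cannot fall below
  its random value, and -1 for sets whose density cannot exceed it.\<close>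

lemma rho_tendsto_0:
  assumes X: "perm_seq X" and S: "S \<subseteq> perms 4"
    and lim: "(\<lambda>i. \<Sum>p\<in>S. pattern_density p (X i)) \<longlonglongrightarrow> c"
    and est: "\<And>n p. biperm n p \<Longrightarrow> 4 \<le> n \<Longrightarrow>
      biperm.RR n p (si n) (si n) - 10000000 / real n \<le> s * (biperm.dens n p S - c)"
  shows "(\<lambda>i. rho_of (X i)) \<longlonglongrightarrow> 0"
proof (rule tendsto_sandwich[OF _ _ tendsto_const])
  have "(\<lambda>i. s * ((\<Sum>p\<in>S. pattern_density p (X i)) - c) + 10000000 / real (length (X i))) \<longlonglongrightarrow> s * (c - c) + 0"
    by (intro tendsto_intros lim perm_seq_inverse_tendsto_0[OF X])
  then show "(\<lambda>i. s * ((\<Sum>p\<in>S. pattern_density p (X i)) - c) + 10000000 / real (length (X i))) \<longlonglongrightarrow> 0"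
    by simp
  show "\<forall>\<^sub>F i in sequentially. 0 \<le> rho_of (X i)"
    using perm_seq_eventually_ge[OF X, of 4]
  proof eventually_elim
    case (elim i)
    then have "0 < length (X i)" by linarith
    then interpret biperm "length (X i)" "zperm (X i)" by (rule biperm_zperm[OF perm_seqD(1)[OF X]])
    show ?case unfolding rho_of_def by (rule RR_nonneg)
  qed
  show "\<forall>\<^sub>F i in sequentially. rho_of (X i) \<le> s * ((\<Sum>p\<in>S. pattern_density p (X i)) - c) + 10000000 / real (length (X i))"
    using perm_seq_eventually_ge[OF X, of 4]
  proof eventually_elim
    case (elim i)
    then have "0 < length (X i)" by linarith
    then have "biperm (length (X i)) (zperm (X i))" by (rule biperm_zperm[OF perm_seqD(1)[OF X]])
    from est[OF this elim] show ?case
      unfolding rho_of_def sum_pattern_density_eq_dens[OF perm_seqD(1)[OF X] elim S] by linarith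
  qed
qed

lemma quasirandom_sum_tendsto:
  assumes "quasirandom X" "S \<subseteq> perms k"
  shows "(\<lambda>i. \<Sum>p\<in>S. pattern_density p (X i)) \<longlonglongrightarrow> real (card S) / fact k"
proof -
  have "(\<lambda>i. \<Sum>p\<in>S. pattern_density p (X i)) \<longlonglongrightarrow> (\<Sum>p\<in>S. 1 / fact k)"
    using assms unfolding quasirandom_def by (intro tendsto_sum) auto
  then show ?thesis by simp
qed

lemma Sigma_forcingI:
  assumes S: "S \<subseteq> perms 4" and c: "real (card S) / 24 = c"
    and est: "\<And>n p. biperm n p \<Longrightarrow> 4 \<le> n \<Longrightarrow>
      biperm.RR n p (si n) (si n) - 10000000 / real n \<le> s * (biperm.dens n p S - c)"
  shows "Sigma_forcing 4 S"
  unfolding Sigma_forcing_def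
proof (intro allI impI iffI)
  fix X assume X: "perm_seq X"
  show "(\<lambda>i. \<Sum>p\<in>S. pattern_density p (X i)) \<longlonglongrightarrow> real (card S) / fact 4" if "quasirandom X"
    using that S by (rule quasirandom_sum_tendsto)
  assume "(\<lambda>i. \<Sum>p\<in>S. pattern_density p (X i)) \<longlonglongrightarrow> real (card S) / fact 4"
  then have "(\<lambda>i. \<Sum>p\<in>S. pattern_density p (X i)) \<longlonglongrightarrow> c" using c by (simp add: fact_numeral)
  from quasirandom_if_rho_tendsto_0[OF X rho_tendsto_0[OF X S this est]] show "quasirandom X" .
qed

lemma S_subset_perms4: "S_aa \<subseteq> perms 4" "S_bb \<subseteq> perms 4" "S_ab \<subseteq> perms 4" "S_ba \<subseteq> perms 4"
  unfolding perms_4 S_aa_def S_bb_def S_ab_def S_ba_def perms4_def by simp_all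

lemma Sigma_forcing_sets:
  "Sigma_forcing 4 S_aa" "Sigma_forcing 4 S_bb" "Sigma_forcing 4 S_ab" "Sigma_forcing 4 S_ba"
  "Sigma_forcing 4 (S_aa \<union> S_bb)"
proof -
  note est = biperm.dens_estimates
  show "Sigma_forcing 4 S_aa"
  proof (rule Sigma_forcingI[where c = "1/3" and s = 1, OF S_subset_perms4(1)])
    show "real (card S_aa) / 24 = 1/3" by (simp add: S_aa_def)
  qed (use est(1) in simp)
  show "Sigma_forcing 4 S_bb"
  proof (rule Sigma_forcingI[where c = "1/3" and s = 1, OF S_subset_perms4(2)])
    show "real (card S_bb) / 24 = 1/3" by (simp add: S_bb_def)
  qed (use est(2) in simp)
  show "Sigma_forcing 4 S_ab"
  proof (rule Sigma_forcingI[where c = "1/3" and s = "-1", OF S_subset_perms4(3)])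
    show "real (card S_ab) / 24 = 1/3" by (simp add: S_ab_def)
  qed (use est(3) in simp)
  show "Sigma_forcing 4 S_ba"
  proof (rule Sigma_forcingI[where c = "1/3" and s = "-1", OF S_subset_perms4(4)])
    show "real (card S_ba) / 24 = 1/3" by (simp add: S_ba_def)
  qed (use est(4) in simp)
  show "Sigma_forcing 4 (S_aa \<union> S_bb)"
  proof (rule Sigma_forcingI[where c = "1/2" and s = 1])
    show "S_aa \<union> S_bb \<subseteq> perms 4" using S_subset_perms4 by blast
    show "real (card (S_aa \<union> S_bb)) / 24 = 1/2" by (simp add: S_aa_def S_bb_def card_insert_if)
  qed (use est(5) in simp)
qed

lemma sum_pattern_density_complement:
  assumes X: "perm_seq X" and S: "S \<subseteq> perms k"
  shows "\<forall>\<^sub>F i in sequentially. (\<Sum>p\<in>perms k - S. pattern_density p (X i)) = 1 - (\<Sum>p\<in>S. pattern_density p (X i))"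
  using perm_seq_eventually_ge[OF X, of k]
proof eventually_elim
  case (elim i)
  note P = perm_seqD(1)[OF X, of i]
  have "(\<Sum>p\<in>perms k. pattern_density p (X i)) = 1"
    using sum_pattern_density[OF P order_refl elim] pcount_perms[OF inj_on_nth_perms[OF P]] elim by simp
  then show ?case using S by (simp add: sum_diff)
qed

lemma Sigma_forcing_complement:
  assumes S: "S \<subseteq> perms k" and f: "Sigma_forcing k S"
  shows "Sigma_forcing k (perms k - S)"
  unfolding Sigma_forcing_def
proof (intro allI impI)
  fix X assume X: "perm_seq X"
  let ?c = "real (card S) / fact k"
  have card: "real (card (perms k - S)) / fact k = 1 - ?c"
    using S card_mono[OF finite_perms S] 
    by (simp add: card_Diff_subset finite_subset[OF S] of_nat_diff diff_divide_distrib)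
  note ev = sum_pattern_density_complement[OF X S]
  have "(\<lambda>i. \<Sum>p\<in>perms k - S. pattern_density p (X i)) \<longlonglongrightarrow> 1 - ?c \<longleftrightarrow>
    (\<lambda>i. 1 - (\<Sum>p\<in>S. pattern_density p (X i))) \<longlonglongrightarrow> 1 - ?c"
    by (rule tendsto_cong[OF ev])
  also have "\<dots> \<longleftrightarrow> (\<lambda>i. \<Sum>p\<in>S. pattern_density p (X i)) \<longlonglongrightarrow> ?c"
  proof
    assume "(\<lambda>i. 1 - (\<Sum>p\<in>S. pattern_density p (X i))) \<longlonglongrightarrow> 1 - ?c"
    from tendsto_diff[OF tendsto_const[of 1] this] show "(\<lambda>i. \<Sum>p\<in>S. pattern_density p (X i)) \<longlonglongrightarrow> ?c" by simp
  qed (intro tendsto_intros)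
  also have "\<dots> \<longleftrightarrow> quasirandom X" using f X unfolding Sigma_forcing_def by blast
  finally show "quasirandom X \<longleftrightarrow> (\<lambda>i. \<Sum>p\<in>perms k - S. pattern_density p (X i)) \<longlonglongrightarrow> real (card (perms k - S)) / fact k"
    unfolding card by blast
qed

text \<open>If the first \<open>a\<close> entries are at most \<open>a\<close>, the square of side a
  contains a points instead of the expected a^2/n. The estimate for \<open>S_aa\<close> turns
  quasirandomness into small \<open>rho\<close>, which rules out such an excess.\<close>

lemma quasirandom_corner:
  assumes X: "perm_seq X" and qr: "quasirandom X" and \<epsilon>: "0 < \<epsilon>"
  shows "\<forall>\<^sub>F i in sequentially. \<forall>a\<le>length (X i). (\<forall>j<a. X i ! j \<le> a) \<longrightarrow>
    real a / real (length (X i)) * (1 - real a / real (length (X i))) \<le> \<epsilon>"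
proof -
  have "(\<lambda>i. \<Sum>p\<in>S_aa. pattern_density p (X i)) \<longlonglongrightarrow> 1/3"
    using quasirandom_sum_tendsto[OF qr S_subset_perms4(1)] by (simp add: S_aa_def fact_numeral)
  then have rho0: "(\<lambda>i. rho_of (X i)) \<longlonglongrightarrow> 0"
    by (rule rho_tendsto_0[OF X S_subset_perms4(1), where s = 1]) (use biperm.dens_estimates(1) in simp)
  define e where "e i = root 4 (20736 * rho_of (X i))" for i
  have "(\<lambda>i. root 4 (20736 * rho_of (X i)) + 6 / real (length (X i))) \<longlonglongrightarrow> root 4 (20736 * 0) + 0"
    by (intro tendsto_add tendsto_real_root tendsto_mult tendsto_const rho0 perm_seq_inverse_tendsto_0[OF X])
  then have "(\<lambda>i. e i + 6 / real (length (X i))) \<longlonglongrightarrow> 0" by (simp add: e_def[abs_def])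
  then have "\<forall>\<^sub>F i in sequentially. e i + 6 / real (length (X i)) < \<epsilon>"
    using \<epsilon> by (rule order_tendstoD(2))
  then show ?thesis using perm_seq_eventually_ge[OF X, of 1]
  proof eventually_elim
    case (elim i)
    define n where "n = length (X i)"
    have P: "X i \<in> perms n" using perm_seqD(1)[OF X] by (simp add: n_def)
    have "0 < n" using elim(2) unfolding n_def by linarith
    then interpret biperm n "zperm (X i)" by (rule biperm_zperm[OF P])
    have AAe: "\<bar>AA u v\<bar> \<le> e i" if "u < n" "v < n" for u v
    proof -
      have "root 4 (\<bar>AA u v\<bar> ^ 4) \<le> e i"
        unfolding e_def rho_of_def n_def[symmetric] using AA_sup[OF that] by (intro real_root_le_mono) auto
      moreover have "root 4 (\<bar>AA u v\<bar> ^ 4) = \<bar>AA u v\<bar>" by (rule real_root_power_cancel) auto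
      ultimately show ?thesis by linarith
    qed
    show ?case unfolding n_def[symmetric]
    proof (intro allI impI)
      fix a assume a: "a \<le> n" "\<forall>j<a. X i ! j \<le> a"
      have "zperm (X i) j < a" if "j < a" for j
      proof -
        have "1 \<le> X i ! j" using nth_perms[OF P, of j] that a by simp
        then show ?thesis using a(2) that by (auto simp: zperm_def)
      qed
      then have "{j. j < n \<and> j < a \<and> zperm (X i) j < a} = {..<a}" using a(1) by auto
      then have "cnt a a = a" by (simp add: cnt_def)
      then have "real a / real n - real a / real n * (real a / real n) \<le> e i + 6 / real n"
      proof -
        have "\<bar>real (cnt a a) / real n - real a / real n * (real a / real n)\<bar> \<le> e i + 6 / real n"
          by (rule cnt_le_one[OF _ a(1) a(1)]) (rule AAe)
        then show ?thesis using \<open>cnt a a = a\<close> by simp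
      qed
      also have "\<dots> < \<epsilon>" using elim by (simp add: n_def)
      finally show "real a / real n * (1 - real a / real n) \<le> \<epsilon>" by (simp add: algebra_simps)
    qed
  qed
qed

subsection \<open>Interpolation between permutations\<close>

text \<open>Only the sets that contain \<open>v\<close> can change their pattern.\<close>

lemma pcount_change_one:
  assumes inj: "inj_on y {..<n}" "inj_on y' {..<n}" and v: "v < n" and k: "0 < k"
    and eq: "\<And>i. i < n \<Longrightarrow> i \<noteq> v \<Longrightarrow> y i = y' i"
  shows "pcount k S y n \<le> pcount k S y' n + ((n - 1) choose (k - 1))"
proof -
  let ?D = "{B. B \<subseteq> {..<n} \<and> card B = k \<and> v \<in> B}"
  have "?D \<subseteq> insert v ` {B. B \<subseteq> {..<n} - {v} \<and> card B = k - 1}"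
  proof
    fix B assume B: "B \<in> ?D"
    then have "finite B" using finite_subset by blast
    then have "card (B - {v}) = k - 1" using B by simp
    then have "B - {v} \<in> {B. B \<subseteq> {..<n} - {v} \<and> card B = k - 1}" using B by auto
    moreover have "B = insert v (B - {v})" using B by auto
    ultimately show "B \<in> insert v ` {B. B \<subseteq> {..<n} - {v} \<and> card B = k - 1}" by blast
  qed
  then have "card ?D \<le> card {B. B \<subseteq> {..<n} - {v} \<and> card B = k - 1}"
    by (rule surj_card_le[rotated]) simp
  also have "\<dots> = (n - 1) choose (k - 1)" using v by (subst n_subsets) simp_all
  finally have D: "card ?D \<le> (n - 1) choose (k - 1)" .
  have "{B. B \<subseteq> {..<n} \<and> card B = k \<and> patt y B \<in> S} \<subseteq> {B. B \<subseteq> {..<n} \<and> card B = k \<and> patt y' B \<in> S} \<union> ?D"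
  proof
    fix B assume B: "B \<in> {B. B \<subseteq> {..<n} \<and> card B = k \<and> patt y B \<in> S}"
    show "B \<in> {B. B \<subseteq> {..<n} \<and> card B = k \<and> patt y' B \<in> S} \<union> ?D"
    proof (cases "v \<in> B")
      case False
      have "patt y B = patt y' B"
      proof (rule patt_cong[OF inj])
        fix i j assume "i \<in> B" "j \<in> B"
        then have "y i = y' i" "y j = y' j" using B False by (auto intro!: eq)
        then show "(y i < y j) = (y' i < y' j)" by simp
      qed (use B in simp)
      then show ?thesis using B by simp
    qed (use B in simp)
  qed
  then have "pcount k S y n \<le> card ({B. B \<subseteq> {..<n} \<and> card B = k \<and> patt y' B \<in> S} \<union> ?D)"
    unfolding pcount_def by (intro card_mono) auto
  also have "\<dots> \<le> pcount k S y' n + card ?D" unfolding pcount_def by (rule card_Un_le)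
  finally show ?thesis using D by linarith
qed

lemma pcount_cong:
  assumes "inj_on y {..<n}" "inj_on y' {..<n}"
    and "\<And>i j. i < n \<Longrightarrow> j < n \<Longrightarrow> y i < y j \<longleftrightarrow> y' i < y' j"
  shows "pcount k S y n = pcount k S y' n"
proof -
  have "patt y B = patt y' B" if "B \<subseteq> {..<n}" for B
    by (rule patt_cong[OF assms(1,2) that]) (use that assms(3) in auto)
  then show ?thesis unfolding pcount_def by (intro arg_cong[where f = card]) auto
qed

lemma pcount_std:
  fixes y :: "nat \<Rightarrow> 'a::linorder"
  assumes "inj_on y {..<n}"
  shows "std (map y [0..<n]) \<in> perms n" "pcount k S ((!) (std (map y [0..<n]))) n = pcount k S y n"
proof -
  have "distinct (map y [0..<n])" using assms by (simp add: distinct_map lessThan_atLeast0)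
  from std_in_perms[OF this] show P: "std (map y [0..<n]) \<in> perms n" by simp
  show "pcount k S ((!) (std (map y [0..<n]))) n = pcount k S y n"
    by (rule pcount_cong[OF inj_on_nth_perms[OF P] assms]) (simp add: std_nth_less_iff)
qed

text \<open>A discrete intermediate value argument along direct sums: an initial part of
  \<open>P\<close> lies below and to the left of a final part of \<open>Q\<close>. One step alters
  the density by at most 4/n, so \<open>Z\<close> is nearly exact, and the gap \<open>c\<close> at
  both ends keeps the cut away from them.\<close>

lemma interpolation:
  assumes P: "P \<in> perms n" and Q: "Q \<in> perms n" and n: "4 \<le> n" "8 / c \<le> real n" and c: "0 < c"
    and Pc: "(s + c) * real (n choose 4) \<le> real (pcount 4 S ((!) P) n)"
    and Qc: "real (pcount 4 S ((!) Q) n) \<le> (s - c) * real (n choose 4)"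
  obtains Z a where "Z \<in> perms n" "a \<le> n" "\<forall>j<a. Z ! j \<le> a"
    "c\<^sup>2 / 64 \<le> real a / real n * (1 - real a / real n)"
    "\<bar>real (pcount 4 S ((!) Z) n) / real (n choose 4) - s\<bar> \<le> 4 / real n"
proof -
  let ?C = "real (n choose 4)"
  have C: "0 < ?C" using n by simp
  \<comment> \<open>Adding \<open>n\<close> lifts the entries taken from \<open>Q\<close> above all
    entries of \<open>P\<close>. At t = 0 the order is that of \<open>P\<close>, at t = n that of
    \<open>Q\<close>.\<close>
  define Y where "Y t i = (if i < n - t then P ! i else n + Q ! i)" for t i
  have PQ: "1 \<le> P ! i" "P ! i \<le> n" "1 \<le> Q ! i" "Q ! i \<le> n" if "i < n" for i
    using nth_perms[OF P that] nth_perms[OF Q that] by auto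
  have inj: "inj_on (Y t) {..<n}" for t
  proof (rule inj_onI)
    fix i j assume ij: "i \<in> {..<n}" "j \<in> {..<n}" "Y t i = Y t j"
    then have "P ! i = P ! j \<or> Q ! i = Q ! j"
      using PQ[of i] PQ[of j] by (auto simp: Y_def split: if_splits)
    then show "i = j" using inj_on_nth_perms[OF P] inj_on_nth_perms[OF Q] ij by (auto simp: inj_on_def)
  qed
  define g where "g t = real (pcount 4 S (Y t) n) / ?C - s" for t
  have "pcount 4 S (Y 0) n = pcount 4 S ((!) P) n"
    by (rule pcount_cong[OF inj inj_on_nth_perms[OF P]]) (simp add: Y_def)
  then have g0: "c \<le> g 0" using Pc C by (simp add: g_def field_simps)
  have "pcount 4 S (Y n) n = pcount 4 S ((!) Q) n"
    by (rule pcount_cong[OF inj inj_on_nth_perms[OF Q]]) (simp add: Y_def)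
  then have gn: "g n \<le> - c" using Qc C by (simp add: g_def field_simps)
  have "n * ((n - 1) choose 3) = 4 * (n choose 4)"
    using binomial_absorption[of 3 n] by simp
  then have "real (n * ((n - 1) choose 3)) = real (4 * (n choose 4))" by simp
  then have C3: "real ((n - 1) choose 3) / ?C = 4 / real n" using C n by (simp add: field_simps)
  have step: "\<bar>g (Suc t) - g t\<bar> \<le> 4 / real n" if "t < n" for t
  proof -
    have eq: "Y t i = Y (Suc t) i" if "i < n" "i \<noteq> n - Suc t" for i
      using that \<open>t < n\<close> by (auto simp: Y_def)
    have "pcount 4 S (Y t) n \<le> pcount 4 S (Y (Suc t)) n + ((n - 1) choose (4 - 1))"
      by (rule pcount_change_one[OF inj inj, where v = "n - Suc t"]) (use that eq in auto)
    moreover have "pcount 4 S (Y (Suc t)) n \<le> pcount 4 S (Y t) n + ((n - 1) choose (4 - 1))"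
      by (rule pcount_change_one[OF inj inj, where v = "n - Suc t"]) (use that eq in auto)
    ultimately have "\<bar>real (pcount 4 S (Y (Suc t)) n) - real (pcount 4 S (Y t) n)\<bar> \<le> real ((n - 1) choose 3)"
      by simp
    then have "\<bar>real (pcount 4 S (Y (Suc t)) n) - real (pcount 4 S (Y t) n)\<bar> / ?C \<le> real ((n - 1) choose 3) / ?C"
      using C by (intro divide_right_mono) auto
    then show ?thesis unfolding C3 g_def using C by (simp add: diff_divide_distrib[symmetric] abs_divide)
  qed
  have walk: "\<bar>g (t + r) - g t\<bar> \<le> real r * (4 / real n)" if "t + r \<le> n" for t r
    using that
  proof (induction r)
    case (Suc r)
    then have "\<bar>g (t + r) - g t\<bar> \<le> real r * (4 / real n)" "\<bar>g (Suc (t + r)) - g (t + r)\<bar> \<le> 4 / real n"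
      using step[of "t + r"] by auto
    then show ?case by (simp add: algebra_simps add_divide_distrib)
  qed simp
  define t where "t = (LEAST t. g t \<le> 0)"
  have gt: "g t \<le> 0" unfolding t_def by (rule LeastI[of _ n]) (use gn c in simp)
  have tn: "t \<le> n" unfolding t_def by (rule Least_le) (use gn c in simp)
  have t0: "t \<noteq> 0"
  proof
    assume "t = 0"
    then show False using gt g0 c by simp
  qed
  then obtain r where r: "t = Suc r" by (cases t) auto
  have "\<not> g r \<le> 0" using not_less_Least[of r "\<lambda>t. g t \<le> 0"] r by (simp add: t_def)
  then have gabs: "\<bar>g t\<bar> \<le> 4 / real n" using step[of r] gt r tn by auto
  have t1: "c / 4 \<le> real t / real n" using walk[of 0 t] tn g0 gt by simp
  have "8 / real n \<le> c" using n c by (simp add: field_simps)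
  \<comment> \<open>The current value may already be as low as -4/n, so half of the gap is given up
    before the remaining n - t steps are counted.\<close>
  then have "c / 2 \<le> c - 4 / real n" by simp
  also have "\<dots> \<le> real (n - t) * (4 / real n)" using walk[of t "n - t"] tn gn gabs by simp
  finally have a1: "c / 8 \<le> real (n - t) / real n" by (simp add: mult.commute)
  define Z where "Z = std (map (Y t) [0..<n])"
  note Z = pcount_std[OF inj[of t], folded Z_def]
  show thesis
  proof (rule that)
    show "Z \<in> perms n" "n - t \<le> n" using Z by auto
    show "\<forall>j<n - t. Z ! j \<le> n - t"
    proof (intro allI impI)
      fix j assume j: "j < n - t"
      then have jn: "j < n" by simp
      have "{v \<in> set (map (Y t) [0..<n]). v \<le> Y t j} \<subseteq> Y t ` {..<n - t}"
      proof
        fix v assume "v \<in> {v \<in> set (map (Y t) [0..<n]). v \<le> Y t j}"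
        then obtain i where i: "i < n" "v = Y t i" "Y t i \<le> Y t j" by auto
        have "Y t j \<le> n" using j PQ[OF jn] by (simp add: Y_def)
        then have "i < n - t" using i PQ[OF i(1)] by (auto simp: Y_def split: if_splits)
        then show "v \<in> Y t ` {..<n - t}" using i by simp
      qed
      then have "card {v \<in> set (map (Y t) [0..<n]). v \<le> Y t j} \<le> card {..<n - t}"
        by (rule surj_card_le[rotated]) simp
      then show "Z ! j \<le> n - t" using jn by (simp add: Z_def std_def)
    qed
    have "1 - real (n - t) / real n = real t / real n" using tn n by (simp add: of_nat_diff field_simps)
    moreover have "c / 8 * (c / 8) \<le> real (n - t) / real n * (real t / real n)"
    proof (rule mult_mono[OF a1])
      show "c / 8 \<le> real t / real n" using t1 c by linarith
    qed (use c in auto)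
    ultimately show "c\<^sup>2 / 64 \<le> real (n - t) / real n * (1 - real (n - t) / real n)"
      by (simp add: power2_eq_square)
    show "\<bar>real (pcount 4 S ((!) Z) n) / ?C - s\<bar> \<le> 4 / real n"
      using gabs Z(2) by (simp add: g_def)
  qed
qed

text \<open>The interpolants have the limit density of a random permutation, but their corner excess
  stays above a positive constant, against \<open>quasirandom_corner\<close>.\<close>

lemma not_Sigma_forcingI:
  assumes S: "S \<subseteq> perms 4" and c: "0 < c"
    and P: "\<And>n. 4 \<le> n \<Longrightarrow> \<exists>P\<in>perms n. (real (card S) / 24 + c) * real (n choose 4) \<le> real (pcount 4 S ((!) P) n)"
    and Q: "\<And>n. 4 \<le> n \<Longrightarrow> \<exists>Q\<in>perms n. real (pcount 4 S ((!) Q) n) \<le> (real (card S) / 24 - c) * real (n choose 4)"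
  shows "\<not> Sigma_forcing 4 S"
proof
  assume forcing: "Sigma_forcing 4 S"
  define s where "s = real (card S) / 24"
  obtain N where N: "4 \<le> N" "8 / c \<le> real N"
    using real_arch_simple[of "8 / c"] by (metis le_add1 le_add2 of_nat_mono order_trans)
  have "\<exists>Z a. Z \<in> perms (i + N) \<and> a \<le> i + N \<and> (\<forall>j<a. Z ! j \<le> a) \<and>
    c\<^sup>2 / 64 \<le> real a / real (i + N) * (1 - real a / real (i + N)) \<and>
    \<bar>real (pcount 4 S ((!) Z) (i + N)) / real ((i + N) choose 4) - s\<bar> \<le> 4 / real (i + N)" for i
  proof -
    have n: "4 \<le> i + N" "8 / c \<le> real (i + N)" using N by auto
    obtain P' Q' where "P' \<in> perms (i + N)" "(s + c) * real ((i + N) choose 4) \<le> real (pcount 4 S ((!) P') (i + N))"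
      "Q' \<in> perms (i + N)" "real (pcount 4 S ((!) Q') (i + N)) \<le> (s - c) * real ((i + N) choose 4)"
      using P[OF n(1)] Q[OF n(1)] unfolding s_def by blast
    from interpolation[OF this(1,3) n c this(2,4)] show ?thesis by metis
  qed
  then obtain X a where X: "\<And>i. X i \<in> perms (i + N)" and a: "\<And>i. a i \<le> i + N" "\<And>i. \<forall>j<a i. X i ! j \<le> a i"
    and ac: "\<And>i. c\<^sup>2 / 64 \<le> real (a i) / real (i + N) * (1 - real (a i) / real (i + N))"
    and Xs: "\<And>i. \<bar>real (pcount 4 S ((!) (X i)) (i + N)) / real ((i + N) choose 4) - s\<bar> \<le> 4 / real (i + N)"
    by metis
  have len: "length (X i) = i + N" for i using X length_perms by blast
  have "filterlim (\<lambda>i. i + N) at_top sequentially"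
    unfolding filterlim_at_top by (auto intro: eventually_sequentiallyI[of "Z" for Z] simp: trans_le_add1)
  then have seq: "perm_seq X" unfolding perm_seq_def len using X by blast
  have "(\<lambda>i. (\<Sum>p\<in>S. pattern_density p (X i)) - s) \<longlonglongrightarrow> 0"
  proof (rule tendsto_0_le[where K = 1])
    show "(\<lambda>i. 4 / real (length (X i))) \<longlonglongrightarrow> 0" by (rule perm_seq_inverse_tendsto_0[OF seq])
    show "\<forall>\<^sub>F i in sequentially. norm ((\<Sum>p\<in>S. pattern_density p (X i)) - s) \<le> norm (4 / real (length (X i))) * 1"
    proof (rule always_eventually, rule allI)
      fix i
      have "4 \<le> i + N" using N by simp
      from sum_pattern_density[OF X S this]
      show "norm ((\<Sum>p\<in>S. pattern_density p (X i)) - s) \<le> norm (4 / real (length (X i))) * 1"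
        using Xs[of i] by (simp add: len)
    qed
  qed
  from tendsto_add[OF this tendsto_const[of s]]
  have "(\<lambda>i. \<Sum>p\<in>S. pattern_density p (X i)) \<longlonglongrightarrow> real (card S) / fact 4"
    by (simp add: s_def fact_numeral)
  then have "quasirandom X" using forcing seq unfolding Sigma_forcing_def by blast
  \<comment> \<open>Any bound below the excess c^2/64 of the interpolants would do.\<close>
  moreover have "0 < c\<^sup>2 / 128" using c by simp
  ultimately have "\<forall>\<^sub>F i in sequentially. \<forall>b\<le>length (X i). (\<forall>j<b. X i ! j \<le> b) \<longrightarrow>
    real b / real (length (X i)) * (1 - real b / real (length (X i))) \<le> c\<^sup>2 / 128"
    by (rule quasirandom_corner[OF seq])
  from eventually_happens'[OF sequentially_bot this] obtain i where
    "real (a i) / real (i + N) * (1 - real (a i) / real (i + N)) \<le> c\<^sup>2 / 128"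
    using a unfolding len by blast
  then have "c\<^sup>2 / 64 \<le> c\<^sup>2 / 128" using ac[of i] by linarith
  then show False using c by simp
qed

section \<open>Permutations given by two linear orders\<close>

lemma mult_add_less_iff:
  fixes a b i j n :: nat
  assumes "i < n" "j < n"
  shows "a * n + i < b * n + j \<longleftrightarrow> a < b \<or> a = b \<and> i < j"
proof -
  have *: "a * n + i < b * n + j" if "a < b" "i < n" for a b i j
  proof -
    have "Suc a * n \<le> b * n" using that by (intro mult_le_mono1) simp
    then show ?thesis using that by simp
  qed
  show ?thesis using *[of a b i j] *[of b a j i] assms by (cases a b rule: linorder_cases) auto
qed

lemma sort_key_eqI:
  fixes f :: "'a \<Rightarrow> 'b::linorder"
  assumes "inj_on f (set xs)" "set ys = set xs" "distinct xs" "distinct ys" "sorted (map f ys)"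
  shows "sort_key f xs = ys"
proof -
  have "map f (sort_key f xs) = map f ys"
  proof (rule sorted_distinct_set_unique)
    show "distinct (map f (sort_key f xs))" "distinct (map f ys)"
      using assms by (simp_all add: distinct_map)
  qed (use assms in simp_all)
  moreover have "inj_on f (set (sort_key f xs) \<union> set ys)" using assms by simp
  ultimately show ?thesis by (rule map_inj_on)
qed

lemma sort_key_map_iso:
  fixes f :: "'a \<Rightarrow> 'b::linorder" and f' :: "'c \<Rightarrow> 'd::linorder"
  assumes "inj_on g (set l)" "inj_on f (g ` set l)" "inj_on f' (set l)" "distinct l"
    and iso: "\<And>x y. x \<in> set l \<Longrightarrow> y \<in> set l \<Longrightarrow> f' x \<le> f' y \<Longrightarrow> f (g x) \<le> f (g y)"
  shows "sort_key f (map g l) = map g (sort_key f' l)"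
proof (rule sort_key_eqI)
  have "sorted_wrt (\<lambda>x y. f' x \<le> f' y) (sort_key f' l)"
    unfolding sorted_wrt_map[of "(\<le>)" f' "sort_key f' l", symmetric] by simp
  then have "sorted_wrt (\<lambda>x y. f (g x) \<le> f (g y)) (sort_key f' l)"
    by (rule sorted_wrt_mono_rel[rotated]) (use iso in simp)
  then show "sorted (map f (map g (sort_key f' l)))"
    by (simp add: sorted_wrt_map)
qed (use assms in \<open>simp_all add: distinct_map\<close>)

definition patt2 :: "(nat \<Rightarrow> nat) \<Rightarrow> (nat \<Rightarrow> nat) \<Rightarrow> nat set \<Rightarrow> nat list" where
  "patt2 kx ky B = std (map ky (sort_key kx (sorted_list_of_set B)))"

text \<open>Sorting the indices by \<open>kx\<close> gives the positions and \<open>ky\<close> the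
  values; the resulting relabelling of index sets is a bijection that carries \<open>patt2\<close>
  to \<open>patt\<close>.\<close>

lemma perm_of_two_orders:
  assumes kx: "inj_on kx {..<n}" and ky: "inj_on ky {..<n}"
  obtains Z where "Z \<in> perms n"
    "\<And>k S. pcount k S ((!) Z) n = card {B. B \<subseteq> {..<n} \<and> card B = k \<and> patt2 kx ky B \<in> S}"
proof -
  define xs where "xs = sort_key kx [0..<n]"
  have xs: "length xs = n" "distinct xs" "set xs = {..<n}" by (auto simp: xs_def)
  have bij: "bij_betw ((!) xs) {..<n} {..<n}"
    by (rule bij_betw_nth) (use xs in auto)
  have inj_xs: "inj_on ((!) xs) {..<n}" using bij by (simp add: bij_betw_def)
  define y where "y r = ky (xs ! r)" for r
  have inj: "inj_on y {..<n}"
  proof -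
    have "inj_on (ky \<circ> (!) xs) {..<n}"
      by (rule comp_inj_on[OF inj_xs]) (use ky bij in \<open>simp add: bij_betw_def\<close>)
    then show ?thesis by (simp add: y_def[abs_def] comp_def)
  qed
  have srt: "kx (xs ! i) < kx (xs ! j)" if "i < j" "j < n" for i j
  proof -
    have "sorted (map kx xs)" by (simp add: xs_def)
    moreover have "distinct (map kx xs)" using kx xs by (simp add: distinct_map)
    ultimately have "sorted_wrt (<) (map kx xs)" by (simp add: strict_sorted_iff)
    then show ?thesis using sorted_wrt_nth_less[of "(<)" "map kx xs" i j] that xs by simp
  qed
  have patt: "patt2 kx ky ((!) xs ` B) = patt y B" if B: "B \<subseteq> {..<n}" for B
  proof -
    have fin: "finite B" using B finite_subset by blast
    have im: "(!) xs ` B \<subseteq> {..<n}" using B bij by (auto simp: bij_betw_def)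
    have "sort_key kx (sorted_list_of_set ((!) xs ` B)) = map ((!) xs) (sorted_list_of_set B)"
    proof (rule sort_key_eqI)
      show "inj_on kx (set (sorted_list_of_set ((!) xs ` B)))"
        using kx im fin by (auto intro: inj_on_subset)
      show "distinct (map ((!) xs) (sorted_list_of_set B))"
        using inj_on_subset[OF inj_xs B] fin by (simp add: distinct_map)
      have "sorted_wrt (\<lambda>i j. kx (xs ! i) \<le> kx (xs ! j)) (sorted_list_of_set B)"
        by (rule sorted_wrt_mono_rel[OF _ strict_sorted_list_of_set])
          (use srt B fin in \<open>auto intro: less_imp_le\<close>)
      then show "sorted (map kx (map ((!) xs) (sorted_list_of_set B)))" by (simp add: sorted_wrt_map)
    qed (use fin in simp_all)
    moreover have "map ky (map ((!) xs) l) = map y l" for l by (simp add: y_def)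
    ultimately show ?thesis unfolding patt2_def patt_def by (simp only:)
  qed
  show thesis
  proof (rule that)
    show "std (map y [0..<n]) \<in> perms n" by (rule pcount_std[OF inj])
    fix k S
    have "pcount k S ((!) (std (map y [0..<n]))) n = card {B. B \<subseteq> {..<n} \<and> card B = k \<and> patt y B \<in> S}"
      using pcount_std(2)[OF inj, of k S] by (simp only: pcount_def)
    also have "\<dots> = card {B. B \<subseteq> {..<n} \<and> (card ((!) xs ` B) = k \<and> patt2 kx ky ((!) xs ` B) \<in> S)}"
    proof -
      have "card ((!) xs ` B) = card B" if "B \<subseteq> {..<n}" for B
        using inj_on_subset[OF inj_xs that] by (rule card_image)
      then show ?thesis using patt by (intro arg_cong[where f = card]) auto
    qed
    also have "\<dots> = card {B. B \<subseteq> {..<n} \<and> (card B = k \<and> patt2 kx ky B \<in> S)}"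
      by (rule card_subset_image_filter[OF bij, symmetric])
    finally show "pcount k S ((!) (std (map y [0..<n]))) n = card {B. B \<subseteq> {..<n} \<and> card B = k \<and> patt2 kx ky B \<in> S}" .
  qed
qed

subsection \<open>Equidistribution of patterns\<close>

text \<open>A rearrangement of \<open>B\<close> that turns \<open>r\<close> into \<open>r'\<close>
  acts injectively by composition on the right. Exchanging \<open>r\<close> and \<open>r'\<close>
  gives equality.\<close>

lemma card_permutes_patt_le:
  assumes B: "B \<subseteq> {..<n}" "card B = k" and r: "r \<in> perms k" and r': "r' \<in> perms k"
  shows "card {\<tau>. \<tau> permutes {..<n} \<and> patt \<tau> B = r} \<le> card {\<tau>. \<tau> permutes {..<n} \<and> patt \<tau> B = r'}"
proof -
  let ?L = "sorted_list_of_set B"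
  have fin: "finite B" using B finite_subset by blast
  have L: "length ?L = k" "distinct ?L" "set ?L = B" using B fin by simp_all
  have lr: "length r = k" "distinct r" "set r = {1..k}" "length r' = k" "distinct r'" "set r' = {1..k}"
    using r r' length_perms by (auto simp: perms_def permutations_of_set_def)
  have bij_r: "bij_betw ((!) r) {..<k} {1..k}" "bij_betw ((!) r') {..<k} {1..k}"
    using lr by (auto intro!: bij_betw_nth)
  define h where "h j = inv_into {..<k} ((!) r) (r' ! j)" for j
  have "bij_betw (inv_into {..<k} ((!) r) \<circ> (!) r') {..<k} {..<k}"
    by (rule bij_betw_trans[OF bij_r(2) bij_betw_inv_into[OF bij_r(1)]])
  then have bij_h: "bij_betw h {..<k} {..<k}" by (simp add: h_def[abs_def] comp_def)
  have h: "r ! h j = r' ! j" if "j < k" for j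
  proof -
    have "r' ! j \<in> (!) r ` {..<k}" using bij_r that by (auto simp: bij_betw_def)
    then show ?thesis unfolding h_def by (rule f_inv_into_f)
  qed
  have hk: "h j < k" if "j < k" for j using bij_h that by (auto simp: bij_betw_def)
  have bij_L: "bij_betw ((!) ?L) {..<k} B" using L by (auto intro!: bij_betw_nth)
  define q where "q i = (if i \<in> B then ?L ! h (inv_into {..<k} ((!) ?L) i) else i)" for i
  have qL: "q (?L ! j) = ?L ! h j" if "j < k" for j
    using that bij_L L nth_mem[of j ?L] by (simp add: q_def bij_betw_inv_into_left)
  have "bij_betw ((!) ?L \<circ> h \<circ> inv_into {..<k} ((!) ?L)) B B"
    by (intro bij_betw_trans[OF bij_betw_inv_into[OF bij_L]] bij_betw_trans[OF bij_h bij_L])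
  then have "bij_betw q B B"
    by (rule bij_betw_cong[THEN iffD1, rotated]) (simp add: q_def)
  then have "q permutes B" by (rule bij_imp_permutes) (simp add: q_def)
  then have q: "q permutes {..<n}" using B(1) by (rule permutes_subset)
  have "patt (\<tau> \<circ> q) B = r'" if \<tau>: "\<tau> permutes {..<n}" "patt \<tau> B = r" for \<tau>
    unfolding patt_def
  proof (rule std_eqI)
    have "inj_on (\<tau> \<circ> q) B" using permutes_inj[OF permutes_compose[OF q \<tau>(1)]] by (rule inj_on_subset) simp
    then show "distinct (map (\<tau> \<circ> q) ?L)" using L by (simp add: distinct_map)
    show "r' \<in> perms (length (map (\<tau> \<circ> q) ?L))" using r' L by simp
    fix i j assume "i < length (map (\<tau> \<circ> q) ?L)" "j < length (map (\<tau> \<circ> q) ?L)"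
    then have ij: "i < k" "j < k" using L by simp_all
    have "r ! h i < r ! h j \<longleftrightarrow> \<tau> (?L ! h i) < \<tau> (?L ! h j)"
      using std_nth_less_iff[of "h i" "map \<tau> ?L" "h j"] hk ij L \<tau>(2) by (simp add: patt_def)
    then show "(r' ! i < r' ! j) = (map (\<tau> \<circ> q) ?L ! i < map (\<tau> \<circ> q) ?L ! j)"
      using ij L by (simp add: h qL)
  qed
  then have "(\<lambda>\<tau>. \<tau> \<circ> q) ` {\<tau>. \<tau> permutes {..<n} \<and> patt \<tau> B = r} \<subseteq> {\<tau>. \<tau> permutes {..<n} \<and> patt \<tau> B = r'}"
    using q permutes_compose by blast
  moreover have "inj_on (\<lambda>\<tau>. \<tau> \<circ> q) {\<tau>. \<tau> permutes {..<n} \<and> patt \<tau> B = r}"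
  proof (rule inj_onI)
    fix s t assume "s \<circ> q = t \<circ> q"
    then show "s = t" using permutes_surj[OF q] by (simp add: surj_fun_eq)
  qed
  moreover have "finite {\<tau>. \<tau> permutes {..<n} \<and> patt \<tau> B = r'}"
    by (rule finite_subset[OF _ finite_permutations[of "{..<n}"]]) auto
  ultimately show ?thesis by (intro card_inj_on_le)
qed

lemma sum_permutes_patt:
  fixes H :: "nat list \<Rightarrow> real"
  assumes B: "B \<subseteq> {..<n}" "card B = k"
  shows "(\<Sum>\<tau> | \<tau> permutes {..<n}. H (patt \<tau> B)) = fact n / fact k * (\<Sum>r\<in>perms k. H r)"
proof -
  let ?T = "{\<tau>. \<tau> permutes {..<n}}"
  define N where "N r = card {\<tau>. \<tau> permutes {..<n} \<and> patt \<tau> B = r}" for r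
  have fin: "finite ?T" by (simp add: finite_permutations)
  have grp: "(\<Sum>\<tau>\<in>?T. F (patt \<tau> B)) = (\<Sum>r\<in>perms k. real (N r) * F r)" for F :: "nat list \<Rightarrow> real"
  proof -
    have "(\<lambda>\<tau>. patt \<tau> B) ` ?T \<subseteq> perms k"
    proof
      fix r assume "r \<in> (\<lambda>\<tau>. patt \<tau> B) ` ?T"
      then obtain \<tau> where \<tau>: "\<tau> permutes {..<n}" "r = patt \<tau> B" by auto
      have "inj_on \<tau> {..<n}" using permutes_inj_on[OF \<tau>(1)] .
      from patt_in_perms[OF this B(1)] show "r \<in> perms k" using B(2) \<tau>(2) by simp
    qed
    then have "(\<Sum>\<tau>\<in>?T. F (patt \<tau> B)) = (\<Sum>r\<in>perms k. \<Sum>\<tau> | \<tau> \<in> ?T \<and> patt \<tau> B = r. F (patt \<tau> B))"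
      using fin by (intro sum.group[symmetric]) auto
    also have "\<dots> = (\<Sum>r\<in>perms k. real (N r) * F r)"
      by (intro sum.cong refl) (simp add: N_def)
    finally show ?thesis .
  qed
  have eq: "N r = N r'" if "r \<in> perms k" "r' \<in> perms k" for r r'
    unfolding N_def using card_permutes_patt_le[OF B that] card_permutes_patt_le[OF B that(2,1)] by simp
  have N: "real (N r) = fact n / fact k" if "r \<in> perms k" for r
  proof -
    have "real (card ?T) = (\<Sum>r'\<in>perms k. real (N r'))" using grp[of "\<lambda>_. 1"] by simp
    also have "\<dots> = (\<Sum>r'\<in>perms k. real (N r))"
    proof (rule sum.cong[OF refl])
      fix r' assume "r' \<in> perms k"
      then show "real (N r') = real (N r)" using eq[of r' r] that by simp
    qed
    also have "\<dots> = fact k * real (N r)" by simp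
    finally have "real (card ?T) = fact k * real (N r)" .
    moreover have "card ?T = fact n" by (rule card_permutations) simp_all
    ultimately have "fact n = fact k * real (N r)" by (simp only: of_nat_fact)
    then show ?thesis by simp
  qed
  show ?thesis unfolding grp[of H] sum_distrib_left by (rule sum.cong[OF refl]) (simp add: N)
qed

section \<open>Random weighted models\<close>

text \<open>Independent letters with distribution \<open>w\<close>: the coordinates listed in
  \<open>L\<close> are again independent with distribution \<open>w\<close>, and the others
  integrate to 1.\<close>

lemma sum_PiE_marginal:
  fixes w :: "nat \<Rightarrow> real" and F :: "(nat \<Rightarrow> nat) \<Rightarrow> real" and L :: "nat list"
  assumes w: "(\<Sum>c<m. w c) = 1" and L: "distinct L" "length L = k" "set L \<subseteq> {..<n}"
  shows "(\<Sum>b\<in>PiE {..<n} (\<lambda>_. {..<m}). (\<Prod>i<n. w (b i)) * F (restrict (\<lambda>j. b (L ! j)) {..<k})) =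
    (\<Sum>c\<in>PiE {..<k} (\<lambda>_. {..<m}). (\<Prod>j<k. w (c j)) * F c)"
proof -
  let ?E = "PiE {..<n} (\<lambda>_. {..<m})" and ?D = "PiE {..<k} (\<lambda>_. {..<m})"
  define r where "r b = restrict (\<lambda>j. b (L ! j)) {..<k}" for b :: "nat \<Rightarrow> nat"
  have Lk: "L ! j < n" if "j < k" for j
  proof -
    have "L ! j \<in> set L" using L(2) that by simp
    then show ?thesis using L(3) by auto
  qed
  have rD: "r b \<in> ?D" if "b \<in> ?E" for b
    unfolding r_def using that Lk by (auto simp: PiE_def Pi_def)
  have bijL: "bij_betw ((!) L) {..<k} (set L)" using L by (auto intro!: bij_betw_nth)
  have finE: "finite ?E" "finite ?D" by (auto intro!: finite_PiE)
  have inner: "(\<Sum>b | b \<in> ?E \<and> r b = c. \<Prod>i<n. w (b i)) = (\<Prod>j<k. w (c j))" if c: "c \<in> ?D" for c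
  proof -
    define d where "d i = c (inv_into {..<k} ((!) L) i)" for i
    have dL: "d (L ! j) = c j" if "j < k" for j
      using that bijL by (simp add: d_def bij_betw_inv_into_left)
    \<comment> \<open>The fibre over \<open>c\<close> is itself a product set, with singletons at
      the coordinates in \<open>L\<close>.\<close>
    define U where "U i = (if i \<in> set L then {d i} else {..<m})" for i
    have "{b. b \<in> ?E \<and> r b = c} = PiE {..<n} U"
    proof (intro equalityI subsetI)
      fix b assume "b \<in> {b. b \<in> ?E \<and> r b = c}"
      then have b: "b \<in> ?E" "r b = c" by auto
      have "b i = d i" if "i \<in> set L" for i
      proof -
        from that obtain j where j: "j < k" "i = L ! j" unfolding in_set_conv_nth L(2) by blast
        have "b (L ! j) = r b j" using j by (simp add: r_def)
        then show ?thesis using b(2) dL[OF j(1)] j(2) by simp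
      qed
      then show "b \<in> PiE {..<n} U" using b(1) by (auto simp: PiE_def Pi_def U_def)
    next
      fix b assume b: "b \<in> PiE {..<n} U"
      have bL: "b (L ! j) = c j" if "j < k" for j
        using PiE_mem[OF b, of "L ! j"] Lk[OF that] that L nth_mem[of j L] dL[OF that] by (simp add: U_def)
      have cm: "c j < m" if "j < k" for j using PiE_mem[OF c, of j] that by simp
      have dm: "d i < m" if "i \<in> set L" for i
      proof -
        from that obtain j where "j < k" "i = L ! j" unfolding in_set_conv_nth L(2) by blast
        then show ?thesis using dL cm by simp
      qed
      have "r b = c"
      proof (rule PiE_ext[of _ "{..<k}" "\<lambda>_. UNIV"])
        show "c \<in> PiE {..<k} (\<lambda>_. UNIV)" using c by (auto simp: PiE_def)
      qed (auto simp: r_def bL)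
      moreover have "b \<in> ?E" using b dm by (auto simp: PiE_def Pi_def U_def split: if_splits)
      ultimately show "b \<in> {b. b \<in> ?E \<and> r b = c}" by simp
    qed
    then have "(\<Sum>b | b \<in> ?E \<and> r b = c. \<Prod>i<n. w (b i)) = (\<Sum>b\<in>PiE {..<n} U. \<Prod>i<n. w (b i))" by simp
    also have "\<dots> = (\<Prod>i<n. \<Sum>x\<in>U i. w x)"
      by (rule prod_sum_PiE[symmetric]) (auto simp: U_def)
    also have "\<dots> = (\<Prod>i<n. if i \<in> set L then w (d i) else 1)"
      by (rule prod.cong) (auto simp: U_def w)
    also have "\<dots> = (\<Prod>i\<in>set L. w (d i))"
      using L(3) by (simp add: prod.If_cases Int_absorb1 Int_absorb2)
    also have "\<dots> = (\<Prod>j<k. w (d (L ! j)))"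
      by (rule prod.reindex_bij_betw[OF bijL, symmetric])
    also have "\<dots> = (\<Prod>j<k. w (c j))" by (rule prod.cong) (simp_all add: dL)
    finally show ?thesis .
  qed
  have "(\<Sum>b\<in>?E. (\<Prod>i<n. w (b i)) * F (r b)) = (\<Sum>c\<in>?D. \<Sum>b | b \<in> ?E \<and> r b = c. (\<Prod>i<n. w (b i)) * F (r b))"
    by (rule sum.group[symmetric]) (use finE rD in auto)
  also have "\<dots> = (\<Sum>c\<in>?D. (\<Prod>j<k. w (c j)) * F c)"
  proof (rule sum.cong[OF refl])
    fix c assume "c \<in> ?D"
    have "(\<Sum>b | b \<in> ?E \<and> r b = c. (\<Prod>i<n. w (b i)) * F (r b)) = (\<Sum>b | b \<in> ?E \<and> r b = c. \<Prod>i<n. w (b i)) * F c"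
      unfolding sum_distrib_right by (rule sum.cong) auto
    then show "(\<Sum>b | b \<in> ?E \<and> r b = c. (\<Prod>i<n. w (b i)) * F (r b)) = (\<Prod>j<k. w (c j)) * F c"
      using inner[OF \<open>c \<in> ?D\<close>] by simp
  qed
  finally show ?thesis by (simp add: r_def)
qed

text \<open>Ties between equal keys are broken by the index (kind 0), by the reversed index (kind 1) or
  by a random permutation (any other kind). Equal keys always have equal kinds.\<close>

definition tie :: "nat \<Rightarrow> nat \<Rightarrow> nat \<Rightarrow> nat \<Rightarrow> nat" where
  "tie N kd i t = (if kd = 0 then i else if kd = 1 then N - 1 - i else t)"

text \<open>The lexicographic order of (key of the letter, tie) encoded as a number in base
  \<open>N\<close>, since every tie is below \<open>N\<close>.\<close>

definition key :: "nat \<Rightarrow> (nat \<Rightarrow> nat) \<Rightarrow> (nat \<Rightarrow> nat) \<Rightarrow> (nat \<Rightarrow> nat) \<Rightarrow> (nat \<Rightarrow> nat) \<Rightarrow> nat \<Rightarrow> nat" where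
  "key N K kd b \<tau> i = K (b i) * N + tie N (kd (K (b i))) i (\<tau> i)"

lemma tie_less: "i < N \<Longrightarrow> t < N \<Longrightarrow> tie N kd i t < N"
  by (auto simp: tie_def)

lemma key_less_iff:
  assumes "i < N" "j < N" "\<tau> i < N" "\<tau> j < N"
  shows "key N K kd b \<tau> i < key N K kd b \<tau> j \<longleftrightarrow> K (b i) < K (b j) \<or> K (b i) = K (b j) \<and>
    (if kd (K (b i)) = 0 then i < j else if kd (K (b i)) = 1 then j < i else \<tau> i < \<tau> j)"
proof -
  have "key N K kd b \<tau> i < key N K kd b \<tau> j \<longleftrightarrow> K (b i) < K (b j) \<or> K (b i) = K (b j) \<and>
     tie N (kd (K (b i))) i (\<tau> i) < tie N (kd (K (b j))) j (\<tau> j)"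
    unfolding key_def using assms by (intro mult_add_less_iff tie_less)
  then show ?thesis using assms by (auto simp: tie_def)
qed

lemma inj_on_key:
  assumes "inj_on \<tau> {..<N}" "\<tau> ` {..<N} \<subseteq> {..<N}"
  shows "inj_on (key N K kd b \<tau>) {..<N}"
proof (rule inj_onI)
  fix i j assume ij: "i \<in> {..<N}" "j \<in> {..<N}" and eq: "key N K kd b \<tau> i = key N K kd b \<tau> j"
  have t: "\<tau> i < N" "\<tau> j < N" using assms(2) ij by auto
  have i: "i < N" "j < N" using ij by auto
  note less = key_less_iff[OF i t, of K kd b] key_less_iff[OF i(2,1) t(2,1), of K kd b]
  have neq: "\<not> key N K kd b \<tau> i < key N K kd b \<tau> j" "\<not> key N K kd b \<tau> j < key N K kd b \<tau> i"
    using eq by simp_all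
  have K: "K (b i) = K (b j)" using neq unfolding less by (meson linorder_neqE_nat)
  have "\<not> \<tau> i < \<tau> j \<and> \<not> \<tau> j < \<tau> i \<or> \<not> i < j \<and> \<not> j < i"
    using neq unfolding less K by (auto split: if_splits)
  then have "\<tau> i = \<tau> j \<or> i = j" by (auto simp: neq_iff not_less)
  then show "i = j" using inj_onD[OF assms(1) _ ij] by blast
qed

text \<open>The pattern of four points with letters \<open>c\<close> whose random tie-breakers are
  ordered like \<open>r\<close>. Base 5 leaves room for the ranks 1 to 4.\<close>

definition spat :: "(nat \<Rightarrow> nat) \<Rightarrow> (nat \<Rightarrow> nat) \<Rightarrow> (nat \<Rightarrow> nat) \<Rightarrow> (nat \<Rightarrow> nat) \<Rightarrow> nat list \<Rightarrow> nat list \<Rightarrow> nat list" where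
  "spat X kx Y ky c r = std (map (key 5 Y ky ((!) c) ((!) r)) (sort_key (key 5 X kx ((!) c) ((!) r)) [0..<4]))"

text \<open>Comparisons of keys depend only on the letters, the order of the indices and the order
  of the values of \<tau>. Hence four points of a large sample can be replaced by the indices 0 to
  3.\<close>

lemma patt2_eq_spat:
  assumes B: "B \<subseteq> {..<n}" "card B = 4" and \<tau>: "\<tau> permutes {..<n}"
  shows "patt2 (key n X kx b \<tau>) (key n Y ky b \<tau>) B =
    spat X kx Y ky (map (\<lambda>j. b (sorted_list_of_set B ! j)) [0..<4]) (patt \<tau> B)"
proof -
  let ?L = "sorted_list_of_set B"
  let ?c = "map (\<lambda>j. b (?L ! j)) [0..<4]" and ?r = "patt \<tau> B"
  have fin: "finite B" using B finite_subset by blast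
  have L: "length ?L = 4" "distinct ?L" "set ?L = B" using B fin by simp_all
  have Ln: "?L ! j < n" if "j < 4" for j
  proof -
    have "?L ! j \<in> set ?L" using L(1) that by simp
    then show ?thesis using L(3) B(1) by auto
  qed
  have \<tau>inj: "inj_on \<tau> {..<n}" and \<tau>im: "\<tau> ` {..<n} \<subseteq> {..<n}"
    using permutes_inj_on[OF \<tau>] permutes_image[OF \<tau>] by simp_all
  have \<tau>n: "\<tau> i < n" if "i < n" for i using \<tau>im that by auto
  have r: "?r \<in> perms 4" using patt_in_perms[OF \<tau>inj B(1)] B(2) by simp
  have r5: "?r ! j < 5" if "j < 4" for j using nth_perms[OF r that] by simp
  have rinj: "inj_on ((!) ?r) {..<4}" by (rule inj_on_nth_perms[OF r])
  have less: "key n K kd b \<tau> (?L ! i) < key n K kd b \<tau> (?L ! j) \<longleftrightarrow>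
      key 5 K kd ((!) ?c) ((!) ?r) i < key 5 K kd ((!) ?c) ((!) ?r) j" if ij: "i < 4" "j < 4" for K kd i j
  proof -
    have Lless: "?L ! i < ?L ! j \<longleftrightarrow> i < j" if "i < 4" "j < 4" for i j
      using that sorted_list_of_set_nth_less[OF fin, of i j] sorted_list_of_set_nth_less[OF fin, of j i] B(2)
      by (cases i j rule: linorder_cases) auto
    have "?r ! i < ?r ! j \<longleftrightarrow> \<tau> (?L ! i) < \<tau> (?L ! j)"
      using std_nth_less_iff[of i "map \<tau> ?L" j] ij L by (simp add: patt_def)
    moreover have "i < 5" "j < 5" using ij by simp_all
    ultimately show ?thesis
      using key_less_iff[of "?L ! i" n "?L ! j" \<tau> K kd b] key_less_iff[of i 5 j "(!) ?r" K kd "(!) ?c"]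
        ij Ln \<tau>n r5 Lless by simp
  qed
  have inj5: "inj_on (key 5 K kd ((!) ?c) ((!) ?r)) {..<4}" for K kd
  proof (rule linorder_inj_onI')
    fix i j :: nat assume ij: "i \<in> {..<4}" "j \<in> {..<4}" "i < j"
    have "?L ! i \<noteq> ?L ! j" using ij L by (simp add: nth_eq_iff_index_eq)
    moreover have "?L ! i \<in> {..<n}" "?L ! j \<in> {..<n}" using Ln ij by auto
    ultimately have "key n K kd b \<tau> (?L ! i) \<noteq> key n K kd b \<tau> (?L ! j)"
      using inj_on_key[OF \<tau>inj \<tau>im, of K kd b] unfolding inj_on_def by blast
    then show "key 5 K kd ((!) ?c) ((!) ?r) i \<noteq> key 5 K kd ((!) ?c) ((!) ?r) j"
      using less[of i j K kd] less[of j i K kd] ij by (auto simp: neq_iff)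
  qed
  have s04: "set [0..<4] = {..<4::nat}" by (rule set_eqI) simp
  have injL: "inj_on ((!) ?L) (set [0..<4])" using L by (auto simp: inj_on_def nth_eq_iff_index_eq)
  have imL: "(!) ?L ` set [0..<4] \<subseteq> {..<n}" using Ln by auto
  have mapL: "map ((!) ?L) [0..<4] = ?L" using L(1) by (simp add: map_nth[of ?L, unfolded L(1)])
  have "sort_key (key n X kx b \<tau>) ?L = map ((!) ?L) (sort_key (key 5 X kx ((!) ?c) ((!) ?r)) [0..<4])"
    (is "_ = map _ ?o")
  proof -
    have "sort_key (key n X kx b \<tau>) (map ((!) ?L) [0..<4]) = map ((!) ?L) ?o"
    proof (rule sort_key_map_iso)
      show "inj_on (key n X kx b \<tau>) ((!) ?L ` set [0..<4])"
        using inj_on_key[OF \<tau>inj \<tau>im] imL by (rule inj_on_subset)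
      show "inj_on (key 5 X kx ((!) ?c) ((!) ?r)) (set [0..<4])" unfolding s04 by (rule inj5)
      fix x y assume "x \<in> set [0..<4]" "y \<in> set [0..<4]"
        and le: "key 5 X kx ((!) ?c) ((!) ?r) x \<le> key 5 X kx ((!) ?c) ((!) ?r) y"
      then have "x < 4" "y < 4" by auto
      then show "key n X kx b \<tau> (?L ! x) \<le> key n X kx b \<tau> (?L ! y)"
        using less[of y x X kx] le by (simp add: not_less[symmetric])
    qed (use injL in simp_all)
    then show ?thesis by (simp only: mapL)
  qed
  moreover have "std (map (key n Y ky b \<tau>) (map ((!) ?L) ?o)) = std (map (key 5 Y ky ((!) ?c) ((!) ?r)) ?o)"
  proof (rule std_cong)
    have o: "distinct ?o" "set ?o = {..<4}" by (simp_all add: atLeast0LessThan)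
    have "inj_on ((!) ?L) (set ?o)" using injL by simp
    then have d: "distinct (map ((!) ?L) ?o)" using o by (simp add: distinct_map)
    have "set (map ((!) ?L) ?o) \<subseteq> {..<n}" using Ln by auto
    then have "inj_on (key n Y ky b \<tau>) (set (map ((!) ?L) ?o))"
      by (rule inj_on_subset[OF inj_on_key[OF \<tau>inj \<tau>im]])
    then show "distinct (map (key n Y ky b \<tau>) (map ((!) ?L) ?o))" using d by (simp only: distinct_map)
    show "distinct (map (key 5 Y ky ((!) ?c) ((!) ?r)) ?o)" using o inj5 by (simp add: distinct_map)
    fix i j assume "i < length (map (key n Y ky b \<tau>) (map ((!) ?L) ?o))" "j < length (map (key n Y ky b \<tau>) (map ((!) ?L) ?o))"
    then have ij: "i < length ?o" "j < length ?o" by simp_all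
    then have "?o ! i < 4" "?o ! j < 4" using o(2) nth_mem[of i ?o] nth_mem[of j ?o] by auto
    then show "(map (key n Y ky b \<tau>) (map ((!) ?L) ?o) ! i < map (key n Y ky b \<tau>) (map ((!) ?L) ?o) ! j) =
      (map (key 5 Y ky ((!) ?c) ((!) ?r)) ?o ! i < map (key 5 Y ky ((!) ?c) ((!) ?r)) ?o ! j)"
      using ij less by simp
  qed simp
  ultimately show ?thesis by (simp only: patt2_def spat_def)
qed

text \<open>The sum over \<open>r\<close> is not divided by 24, so this is 24 times the expected
  density, to be compared with \<open>card S\<close>.\<close>

definition model_value :: "nat \<Rightarrow> (nat \<Rightarrow> real) \<Rightarrow> (nat list \<Rightarrow> nat list \<Rightarrow> nat list) \<Rightarrow> nat list set \<Rightarrow> real" where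
  "model_value m w P S = (\<Sum>a<m. \<Sum>b<m. \<Sum>c<m. \<Sum>d<m. w a * w b * w c * w d *
     (\<Sum>r\<in>perms 4. of_bool (P [a, b, c, d] r \<in> S)))"

lemma sum_PiE4:
  fixes F :: "nat \<Rightarrow> nat \<Rightarrow> nat \<Rightarrow> nat \<Rightarrow> real"
  shows "(\<Sum>c\<in>PiE {..<4::nat} (\<lambda>_. {..<m}). F (c 0) (c 1) (c 2) (c 3)) = (\<Sum>a<m. \<Sum>b<m. \<Sum>c<m. \<Sum>d<m. F a b c d)"
proof -
  have "(\<Sum>c\<in>PiE {..<4::nat} (\<lambda>_. {..<m}). F (c 0) (c 1) (c 2) (c 3)) =
    (\<Sum>(a, b, c, d)\<in>{..<m} \<times> {..<m} \<times> {..<m} \<times> {..<m}. F a b c d)"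
  proof (rule sum.reindex_bij_witness[where j = "\<lambda>c. (c 0, c 1, c 2, c 3)" and
      i = "\<lambda>(a, b, c, d). restrict (\<lambda>j. [a, b, c, d] ! j) {..<4}"])
    fix c assume c: "c \<in> PiE {..<4::nat} (\<lambda>_. {..<m})"
    show "(case (c 0, c 1, c 2, c 3) of (a, b, c, d) \<Rightarrow> restrict (\<lambda>j. [a, b, c, d] ! j) {..<4}) = c"
    proof (rule ext)
      fix j show "(case (c 0, c 1, c 2, c 3) of (a, b, c, d) \<Rightarrow> restrict (\<lambda>j. [a, b, c, d] ! j) {..<4}) j = c j"
      proof (cases "j < 4")
        case True
        then have "j = 0 \<or> j = 1 \<or> j = 2 \<or> j = 3" by auto
        then show ?thesis by auto
      next
        case False
        then show ?thesis using PiE_arb[OF c, of j] by simp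
      qed
    qed
    show "(c 0, c 1, c 2, c 3) \<in> {..<m} \<times> {..<m} \<times> {..<m} \<times> {..<m}"
      using PiE_mem[OF c] by simp
  next
    fix x assume x: "x \<in> {..<m} \<times> {..<m} \<times> {..<m} \<times> {..<m}"
    obtain a b c d where abcd: "x = (a, b, c, d)" by (cases x) auto
    show "(case x of (a, b, c, d) \<Rightarrow> restrict (\<lambda>j. [a, b, c, d] ! j) {..<4}) \<in> PiE {..<4::nat} (\<lambda>_. {..<m})"
    proof -
      have "[a, b, c, d] ! j < m" if "j < 4" for j
        using x that nth_mem[of j "[a, b, c, d]"] by (auto simp: abcd)
      then show ?thesis unfolding abcd prod.case by (intro restrict_PiE_iff[THEN iffD2] ballI) simp
    qed
    show "(\<lambda>c. (c 0, c 1, c 2, c 3)) (case x of (a, b, c, d) \<Rightarrow> restrict (\<lambda>j. [a, b, c, d] ! j) {..<4}) = x"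
      by (simp add: abcd)
  qed simp
  then show ?thesis by (simp add: sum.cartesian_product[symmetric])
qed

text \<open>A first moment argument: some choice of letters and tie-breakers does not exceed the
  expectation. Any four points see independent letters and a uniform order of tie-breakers, so the
  expectation is the same for every position set.\<close>

lemma sampling:
  assumes w: "(\<Sum>c<m. w c) = 1" and w0: "\<And>c. c < m \<Longrightarrow> 0 \<le> w c"
  shows "\<exists>Q\<in>perms n. real (pcount 4 S ((!) Q) n) \<le> model_value m w (spat X kx Y ky) S / 24 * real (n choose 4)"
proof (rule ccontr)
  assume "\<not> ?thesis"
  then have neg: "model_value m w (spat X kx Y ky) S / 24 * real (n choose 4) < real (pcount 4 S ((!) Q) n)"
    if "Q \<in> perms n" for Q using that by (auto simp: not_le)
  let ?v = "model_value m w (spat X kx Y ky) S / 24"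
  let ?E = "PiE {..<n} (\<lambda>_. {..<m})" and ?T = "{\<tau>. \<tau> permutes {..<n}}" and ?\<B> = "{B. B \<subseteq> {..<n} \<and> card B = 4}"
  define I where "I b \<tau> B = (of_bool (patt2 (key n X kx b \<tau>) (key n Y ky b \<tau>) B \<in> S) :: real)" for b \<tau> B
  define W where "W b = (\<Prod>i<n. w (b i))" for b :: "nat \<Rightarrow> nat"
  have finE: "finite ?E" by (auto intro!: finite_PiE)
  have finT: "finite ?T" by (simp add: finite_permutations)
  have finB: "finite ?\<B>" by (rule finite_subset[of _ "Pow {..<n}"]) auto
  have W0: "0 \<le> W b" if "b \<in> ?E" for b
    unfolding W_def by (rule prod_nonneg) (use that w0 in \<open>auto simp: PiE_def Pi_def\<close>)
  have W1: "(\<Sum>b\<in>?E. W b) = 1"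
  proof -
    have "(\<Sum>b\<in>?E. W b) = (\<Prod>i<n. \<Sum>x<m. w x)" unfolding W_def by (rule prod_sum_PiE[symmetric]) auto
    then show ?thesis by (simp add: w)
  qed
  have ge: "?v * real (n choose 4) < (\<Sum>B\<in>?\<B>. I b \<tau> B)" if "\<tau> \<in> ?T" for b \<tau>
  proof -
    have "inj_on \<tau> {..<n}" "\<tau> ` {..<n} \<subseteq> {..<n}"
      using that permutes_inj_on[of \<tau>] permutes_image[of \<tau> "{..<n}"] by auto
    note inj = inj_on_key[OF this]
    obtain Z where Z: "Z \<in> perms n" "\<And>k S. pcount k S ((!) Z) n = card {B. B \<subseteq> {..<n} \<and> card B = k \<and>
      patt2 (key n X kx b \<tau>) (key n Y ky b \<tau>) B \<in> S}"
      using perm_of_two_orders[OF inj inj, of X kx b Y ky b] by blast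
    have "?\<B> \<inter> {B. patt2 (key n X kx b \<tau>) (key n Y ky b \<tau>) B \<in> S} = {B. B \<subseteq> {..<n} \<and> card B = 4 \<and>
      patt2 (key n X kx b \<tau>) (key n Y ky b \<tau>) B \<in> S}" by auto
    then have "(\<Sum>B\<in>?\<B>. I b \<tau> B) = real (pcount 4 S ((!) Z) n)"
      unfolding I_def Z(2) using finB by (simp add: sum_of_bool_eq)
    then show ?thesis using neg[OF Z(1)] by simp
  qed
  have inner: "(\<Sum>b\<in>?E. W b * (\<Sum>\<tau>\<in>?T. I b \<tau> B)) = fact n * ?v" if B: "B \<in> ?\<B>" for B
  proof -
    let ?L = "sorted_list_of_set B"
    have B': "B \<subseteq> {..<n}" "card B = 4" "finite B" using B finite_subset[of B "{..<n}"] by auto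
    define G where "G c = (\<Sum>r\<in>perms 4. of_bool (spat X kx Y ky (map c [0..<4]) r \<in> S) :: real)" for c
    have "(\<Sum>\<tau>\<in>?T. I b \<tau> B) = fact n / 24 * G (restrict (\<lambda>j. b (?L ! j)) {..<4})" for b
    proof -
      let ?H = "\<lambda>r. of_bool (spat X kx Y ky (map (\<lambda>j. b (?L ! j)) [0..<4]) r \<in> S) :: real"
      have "(\<Sum>\<tau>\<in>?T. I b \<tau> B) = (\<Sum>\<tau>\<in>?T. ?H (patt \<tau> B))"
        unfolding I_def by (rule sum.cong[OF refl]) (simp only: mem_Collect_eq patt2_eq_spat[OF B'(1,2)])
      also have "\<dots> = fact n / fact 4 * (\<Sum>r\<in>perms 4. ?H r)" by (rule sum_permutes_patt[OF B'(1,2)])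
      also have "map (\<lambda>j. b (?L ! j)) [0..<4] = map (restrict (\<lambda>j. b (?L ! j)) {..<4}) [0..<4]"
        by (rule map_cong) auto
      finally show ?thesis by (simp add: G_def fact_numeral)
    qed
    then have "(\<Sum>b\<in>?E. W b * (\<Sum>\<tau>\<in>?T. I b \<tau> B)) =
      (\<Sum>b\<in>?E. W b * (fact n / 24 * G (restrict (\<lambda>j. b (?L ! j)) {..<4})))" by (simp only:)
    also have "\<dots> = fact n / 24 * (\<Sum>b\<in>?E. (\<Prod>i<n. w (b i)) * G (restrict (\<lambda>j. b (?L ! j)) {..<4}))"
      unfolding sum_distrib_left W_def by (rule sum.cong[OF refl]) (simp only: mult_ac)
    also have "(\<Sum>b\<in>?E. (\<Prod>i<n. w (b i)) * G (restrict (\<lambda>j. b (?L ! j)) {..<4})) =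
      (\<Sum>c\<in>PiE {..<4::nat} (\<lambda>_. {..<m}). (\<Prod>j<4. w (c j)) * G c)"
      by (rule sum_PiE_marginal[OF w]) (use B' in simp_all)
    also have "\<dots> = (\<Sum>c\<in>PiE {..<4::nat} (\<lambda>_. {..<m}). w (c 0) * w (c 1) * w (c 2) * w (c 3) *
       (\<Sum>r\<in>perms 4. of_bool (spat X kx Y ky [c 0, c 1, c 2, c 3] r \<in> S)))"
      by (rule sum.cong[OF refl]) (simp add: G_def numeral_eq_Suc lessThan_Suc upt_rec mult_ac)
    also have "\<dots> = model_value m w (spat X kx Y ky) S"
      unfolding model_value_def by (rule sum_PiE4)
    finally show ?thesis by simp
  qed
  have "(\<Sum>b\<in>?E. W b * (\<Sum>\<tau>\<in>?T. \<Sum>B\<in>?\<B>. I b \<tau> B)) = (\<Sum>B\<in>?\<B>. \<Sum>b\<in>?E. W b * (\<Sum>\<tau>\<in>?T. I b \<tau> B))"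
  proof -
    have "(\<Sum>\<tau>\<in>?T. \<Sum>B\<in>?\<B>. I b \<tau> B) = (\<Sum>B\<in>?\<B>. \<Sum>\<tau>\<in>?T. I b \<tau> B)" for b by (rule sum.swap)
    then have "(\<Sum>b\<in>?E. W b * (\<Sum>\<tau>\<in>?T. \<Sum>B\<in>?\<B>. I b \<tau> B)) = (\<Sum>b\<in>?E. \<Sum>B\<in>?\<B>. W b * (\<Sum>\<tau>\<in>?T. I b \<tau> B))"
      by (simp add: sum_distrib_left)
    also have "\<dots> = (\<Sum>B\<in>?\<B>. \<Sum>b\<in>?E. W b * (\<Sum>\<tau>\<in>?T. I b \<tau> B))" by (rule sum.swap)
    finally show ?thesis .
  qed
  also have "\<dots> = (\<Sum>B\<in>?\<B>. fact n * ?v)" by (rule sum.cong[OF refl]) (rule inner)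
  also have "\<dots> = real (n choose 4) * (fact n * ?v)" using n_subsets[of "{..<n}" 4] by simp
  finally have total: "(\<Sum>b\<in>?E. W b * (\<Sum>\<tau>\<in>?T. \<Sum>B\<in>?\<B>. I b \<tau> B)) = real (n choose 4) * (fact n * ?v)" .
  have cT: "card ?T = fact n" by (rule card_permutations) simp_all
  \<comment> \<open>If every sample exceeded the bound, \<open>h\<close> would be positive
    everywhere, yet its weighted mean is 0; then all weights vanish, although they sum to 1.\<close>
  define h where "h b = (\<Sum>\<tau>\<in>?T. (\<Sum>B\<in>?\<B>. I b \<tau> B) - ?v * real (n choose 4))" for b
  have h0: "0 < h b" for b
  proof -
    have "?T \<noteq> {}" using permutes_id by blast
    then show ?thesis unfolding h_def by (intro sum_pos finT) (use ge in \<open>simp_all only: diff_gt_0_iff_gt not_False_eq_True\<close>)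
  qed
  have "(\<Sum>b\<in>?E. W b * h b) = (\<Sum>b\<in>?E. W b * (\<Sum>\<tau>\<in>?T. \<Sum>B\<in>?\<B>. I b \<tau> B)) - (\<Sum>b\<in>?E. W b) * (fact n * (?v * real (n choose 4)))"
    by (simp add: h_def sum_subtractf cT right_diff_distrib sum_distrib_right)
  then have z: "(\<Sum>b\<in>?E. W b * h b) = 0" unfolding total W1 by simp
  have "W b * h b = 0" if "b \<in> ?E" for b
    using z W0 h0 sum_nonneg_eq_0_iff[OF finE, of "\<lambda>b. W b * h b"] that by (simp add: less_imp_le)
  then have "W b = 0" if "b \<in> ?E" for b using h0[of b] that by fastforce
  then have "(\<Sum>b\<in>?E. W b) = 0" by simp
  then show False using W1 by simp
qed

text \<open>Otherwise samples of the model lie below the random density and the identity, all of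
  whose patterns are in \<open>S\<close>, lies above it, so interpolation refutes forcing.\<close>

lemma forcing_model_value_ge:
  assumes S: "S \<subseteq> perms 4" "[1, 2, 3, 4] \<in> S" "S \<noteq> perms 4" and forcing: "Sigma_forcing 4 S"
    and w: "(\<Sum>c<m. w c) = 1" "\<And>c. c < m \<Longrightarrow> 0 \<le> w c"
  shows "real (card S) \<le> model_value m w (spat X kx Y ky) S"
proof (rule ccontr)
  let ?v = "model_value m w (spat X kx Y ky) S"
  assume "\<not> ?thesis"
  then have v: "?v < real (card S)" by simp
  have "card S < card (perms 4)" using S by (intro psubset_card_mono) auto
  then have s: "card S < 24" by (simp add: fact_numeral)
  \<comment> \<open>The smaller of the margins of the model below and of the identity above
    \<open>card S / 24\<close>.\<close>
  define c where "c = min ((real (card S) - ?v) / 24) (1 - real (card S) / 24)"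
  have "real (card S) < 24" using s by simp
  then have c: "0 < c" using v by (simp add: c_def)
  have c1: "real (card S) / 24 + c \<le> 1" "?v / 24 \<le> real (card S) / 24 - c"
    by (auto simp: c_def min_def field_simps)
  have "\<not> Sigma_forcing 4 S"
  proof (rule not_Sigma_forcingI[OF S(1) c])
    fix n :: nat assume n: "4 \<le> n"
    obtain Q where "Q \<in> perms n" "real (pcount 4 S ((!) Q) n) \<le> ?v / 24 * real (n choose 4)"
      using sampling[OF w, of n S X kx Y ky] by blast
    moreover have "?v / 24 * real (n choose 4) \<le> (real (card S) / 24 - c) * real (n choose 4)"
      using c1 by (intro mult_right_mono) auto
    ultimately show "\<exists>Q\<in>perms n. real (pcount 4 S ((!) Q) n) \<le> (real (card S) / 24 - c) * real (n choose 4)"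
      by (meson order_trans)
    have inj: "inj_on id {..<n}" by simp
    let ?P = "std (map id [0..<n])"
    have "patt id B = [1, 2, 3, 4]" if B: "B \<subseteq> {..<n}" "card B = 4" for B :: "nat set"
    proof -
      have fin: "finite B" using B finite_subset by blast
      have "[1, 2, 3, 4] \<in> perms 4" using S by auto
      then have p4: "[1, 2, 3, 4] \<in> perms (length (sorted_list_of_set B))" using B by simp
      have "std (sorted_list_of_set B) = [1, 2, 3, 4]"
      proof (rule std_eqI[OF _ p4])
        fix i j assume "i < length (sorted_list_of_set B)" "j < length (sorted_list_of_set B)"
        then have ij: "i < 4" "j < 4" using B by simp_all
        have nth: "[1, 2, 3, 4] ! i = Suc i" if "i < 4" for i
          using that by (auto simp: less_Suc_eq numeral_eq_Suc)
        have "sorted_list_of_set B ! i < sorted_list_of_set B ! j \<longleftrightarrow> i < j"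
          using ij sorted_list_of_set_nth_less[OF fin, of i j] sorted_list_of_set_nth_less[OF fin, of j i] B(2)
          by (cases i j rule: linorder_cases) auto
        then show "([1, 2, 3, 4] ! i < [1, 2, 3, 4 :: nat] ! j) = (sorted_list_of_set B ! i < sorted_list_of_set B ! j)"
          unfolding nth[OF ij(1)] nth[OF ij(2)] by simp
      qed simp
      then show ?thesis by (simp add: patt_def)
    qed
    then have "{B. B \<subseteq> {..<n} \<and> card B = 4 \<and> patt id B \<in> S} = {B. B \<subseteq> {..<n} \<and> card B = 4}"
      using S(2) by auto
    then have "pcount 4 S id n = n choose 4" using n_subsets[of "{..<n}" 4] by (simp add: pcount_def)
    then have "real (pcount 4 S ((!) ?P) n) = real (n choose 4)" using pcount_std(2)[OF inj, of 4 S] by simp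
    moreover have "(real (card S) / 24 + c) * real (n choose 4) \<le> 1 * real (n choose 4)"
      using c1 by (intro mult_right_mono) auto
    ultimately show "\<exists>P\<in>perms n. (real (card S) / 24 + c) * real (n choose 4) \<le> real (pcount 4 S ((!) P) n)"
      using pcount_std(1)[OF inj] by (intro bexI[of _ ?P]) auto
  qed
  then show False using forcing by simp
qed

section \<open>An executable form of model patterns\<close>

text \<open>Ranks are counted by comparing letters and ties directly, which spares the evaluator the
  numerical keys and the cardinalities in \<open>std\<close>.\<close>

definition kle :: "(nat \<Rightarrow> nat) \<Rightarrow> (nat \<Rightarrow> nat) \<Rightarrow> nat list \<Rightarrow> nat list \<Rightarrow> nat \<Rightarrow> nat \<Rightarrow> bool" where
  "kle K kd c r i j = (K (c ! i) < K (c ! j) \<or> K (c ! i) = K (c ! j) \<and>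
     (if kd (K (c ! i)) = 0 then i \<le> j else if kd (K (c ! i)) = 1 then j \<le> i else r ! i \<le> r ! j))"

definition krank :: "(nat \<Rightarrow> nat) \<Rightarrow> (nat \<Rightarrow> nat) \<Rightarrow> nat list \<Rightarrow> nat list \<Rightarrow> nat \<Rightarrow> nat" where
  "krank K kd c r j = length (filter (\<lambda>i. kle K kd c r i j) [0, 1, 2, 3])"

definition xpat :: "(nat \<Rightarrow> nat) \<Rightarrow> (nat \<Rightarrow> nat) \<Rightarrow> (nat \<Rightarrow> nat) \<Rightarrow> (nat \<Rightarrow> nat) \<Rightarrow> nat list \<Rightarrow> nat list \<Rightarrow> nat list" where
  "xpat X kx Y ky c r = map (krank Y ky c r) (sort_key (krank X kx c r) [0, 1, 2, 3])"

lemma inj_on_key_perms: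
  assumes r: "r \<in> perms n" and n: "n < N"
  shows "inj_on (key N K kd ((!) c) ((!) r)) {..<n}"
proof (rule inj_onI)
  fix i j assume "i \<in> {..<n}" "j \<in> {..<n}" and eq: "key N K kd ((!) c) ((!) r) i = key N K kd ((!) c) ((!) r) j"
  then have ij: "i < n" "j < n" by auto
  have rN: "r ! i < N" "r ! j < N" using nth_perms[OF r ij(1)] nth_perms[OF r ij(2)] n by auto
  have ijN: "i < N" "j < N" using ij n by auto
  note less = key_less_iff[of i N j "(!) r" K kd "(!) c", OF ijN rN]
    key_less_iff[of j N i "(!) r" K kd "(!) c", OF ijN(2,1) rN(2,1)]
  have neq: "\<not> key N K kd ((!) c) ((!) r) i < key N K kd ((!) c) ((!) r) j"
    "\<not> key N K kd ((!) c) ((!) r) j < key N K kd ((!) c) ((!) r) i"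
    using eq by simp_all
  have K: "K (c ! i) = K (c ! j)" using neq unfolding less by (meson linorder_neqE_nat)
  have "\<not> r ! i < r ! j \<and> \<not> r ! j < r ! i \<or> \<not> i < j \<and> \<not> j < i"
    using neq unfolding less K by (auto split: if_splits)
  then have "r ! i = r ! j \<or> i = j" by (auto simp: neq_iff not_less)
  then show "i = j" using inj_onD[OF inj_on_nth_perms[OF r]] ij by blast
qed

lemma spat_in_perms:
  assumes r: "r \<in> perms 4"
  shows "spat X kx Y ky c r \<in> perms 4"
proof -
  have "inj_on (key 5 Y ky ((!) c) ((!) r)) {..<4}" by (rule inj_on_key_perms[OF r]) simp
  then have "distinct (map (key 5 Y ky ((!) c) ((!) r)) (sort_key (key 5 X kx ((!) c) ((!) r)) [0..<4]))"
    by (simp add: distinct_map atLeast0LessThan)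
  from std_in_perms[OF this] show ?thesis by (simp add: spat_def)
qed

lemma spat_eq_xpat:
  assumes r: "r \<in> perms 4"
  shows "spat X kx Y ky c r = xpat X kx Y ky c r"
proof -
  have r5: "r ! j < 5" if "j < 4" for j using nth_perms[OF r that] by linarith
  have kle: "kle K kd c r i j \<longleftrightarrow> key 5 K kd ((!) c) ((!) r) i \<le> key 5 K kd ((!) c) ((!) r) j"
    if ij: "i < 4" "j < 4" for K kd i j
  proof -
    have ij5: "j < 5" "i < 5" using ij by simp_all
    have "kle K kd c r i j \<longleftrightarrow> \<not> key 5 K kd ((!) c) ((!) r) j < key 5 K kd ((!) c) ((!) r) i"
      unfolding key_less_iff[of j 5 i "(!) r" K kd "(!) c", OF ij5 r5[OF ij(2)] r5[OF ij(1)]] kle_def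
      by (cases "K (c ! i)" "K (c ! j)" rule: linorder_cases) (auto simp: not_less)
    then show ?thesis by (simp add: not_less)
  qed
  have inj: "inj_on (key 5 K kd ((!) c) ((!) r)) {..<4}" for K kd
    by (rule inj_on_key_perms[OF r]) simp
  have s: "[0, 1, 2, 3] = [0..<4::nat]" by (simp add: upt_rec numeral_eq_Suc)
  have s4: "set [0..<4] = {..<4::nat}" by (rule set_eqI) simp
  have rank: "krank K kd c r j = card {y \<in> key 5 K kd ((!) c) ((!) r) ` {..<4}. y \<le> key 5 K kd ((!) c) ((!) r) j}" 
    (is "_ = card {y \<in> ?k ` _. _}") if "j < 4" for K kd j
  proof -
    have "krank K kd c r j = card {i. i < 4 \<and> kle K kd c r i j}"
      unfolding krank_def s by (simp add: distinct_length_filter set_upt Int_def conj_commute)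
    also have "{i. i < 4 \<and> kle K kd c r i j} = {i \<in> {..<4}. ?k i \<le> ?k j}" using kle that by auto
    also have "card \<dots> = card (?k ` {i \<in> {..<4}. ?k i \<le> ?k j})"
      by (rule card_image[symmetric], rule inj_on_subset[OF inj]) auto
    also have "?k ` {i \<in> {..<4}. ?k i \<le> ?k j} = {y \<in> ?k ` {..<4}. y \<le> ?k j}" by auto
    finally show ?thesis .
  qed
  have mono: "krank K kd c r i \<le> krank K kd c r j" if "key 5 K kd ((!) c) ((!) r) i \<le> key 5 K kd ((!) c) ((!) r) j" "i < 4" "j < 4" for K kd i j
    unfolding rank[OF that(2)] rank[OF that(3)] by (rule card_mono) (use that in auto)
  have smono: "krank K kd c r i < krank K kd c r j" if "key 5 K kd ((!) c) ((!) r) i < key 5 K kd ((!) c) ((!) r) j" "i < 4" "j < 4" for K kd i j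
    unfolding rank[OF that(2)] rank[OF that(3)]
  proof (rule psubset_card_mono)
    let ?k = "key 5 K kd ((!) c) ((!) r)"
    have "?k j \<in> {y \<in> ?k ` {..<4}. y \<le> ?k j}" "?k j \<notin> {y \<in> ?k ` {..<4}. y \<le> ?k i}" using that by auto
    moreover have "{y \<in> ?k ` {..<4}. y \<le> ?k i} \<subseteq> {y \<in> ?k ` {..<4}. y \<le> ?k j}" using that by auto
    ultimately show "{y \<in> ?k ` {..<4}. y \<le> ?k i} \<subset> {y \<in> ?k ` {..<4}. y \<le> ?k j}" by blast
  qed simp
  have "sort_key (key 5 X kx ((!) c) ((!) r)) (map id [0..<4]) = map id (sort_key (krank X kx c r) [0..<4])"
  proof (rule sort_key_map_iso)
    show "inj_on (key 5 X kx ((!) c) ((!) r)) (id ` set [0..<4])" unfolding s4 using inj by simp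
    show "inj_on (krank X kx c r) (set [0..<4])" unfolding s4
    proof (rule inj_onI)
      fix i j assume ij: "i \<in> {..<4::nat}" "j \<in> {..<4::nat}" "krank X kx c r i = krank X kx c r j"
      then have "key 5 X kx ((!) c) ((!) r) i = key 5 X kx ((!) c) ((!) r) j"
        using smono[of X kx i j] smono[of X kx j i] by (cases "key 5 X kx ((!) c) ((!) r) i" "key 5 X kx ((!) c) ((!) r) j" rule: linorder_cases) auto
      then show "i = j" using inj ij by (auto simp: inj_on_def)
    qed
    fix i j assume "i \<in> set [0..<4::nat]" "j \<in> set [0..<4::nat]" "krank X kx c r i \<le> krank X kx c r j"
    then show "key 5 X kx ((!) c) ((!) r) (id i) \<le> key 5 X kx ((!) c) ((!) r) (id j)"
      using smono[of X kx j i] by (auto simp: not_le[symmetric])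
  qed simp_all
  then have o: "sort_key (key 5 X kx ((!) c) ((!) r)) [0..<4] = sort_key (krank X kx c r) [0..<4]" by simp
  define L where "L = sort_key (krank X kx c r) [0..<4]"
  have L: "set L = {..<4}" unfolding L_def set_sort s4 ..
  have "std (map (key 5 Y ky ((!) c) ((!) r)) L) = map (krank Y ky c r) L"
    unfolding std_def map_map
  proof (rule map_cong[OF refl])
    fix x assume "x \<in> set L"
    then have "x < 4" using L by simp
    show "((\<lambda>v. card {u \<in> set (map (key 5 Y ky ((!) c) ((!) r)) L). u \<le> v}) \<circ> key 5 Y ky ((!) c) ((!) r)) x = krank Y ky c r x"
      unfolding rank[OF \<open>x < 4\<close>] by (simp add: L)
  qed
  then show ?thesis unfolding spat_def xpat_def s o L_def .
qed

lemma perms4_in: "r \<in> set perms4 \<Longrightarrow> r \<in> perms 4"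
  by (simp add: perms_4)

definition xcount :: "(nat list \<Rightarrow> nat list) \<Rightarrow> nat list \<Rightarrow> nat" where
  "xcount P q = length (filter (\<lambda>x. x = q) (map P perms4))"

lemma sum_of_bool_xcount:
  assumes "\<And>r. r \<in> set perms4 \<Longrightarrow> P r \<in> set perms4"
  shows "(\<Sum>r\<in>perms 4. of_bool (P r \<in> S)) = (\<Sum>q\<in>perms 4. real (xcount P q) * of_bool (q \<in> S))"
proof -
  have "distinct perms4" by (simp add: perms4_def)
  then have cnt: "real (xcount P q) = (\<Sum>r\<in>perms 4. of_bool (P r = q))" for q
    unfolding xcount_def perms_4 by (simp add: filter_map o_def distinct_length_filter sum_of_bool_eq Int_def conj_commute)
  have "(\<Sum>q\<in>perms 4. real (xcount P q) * of_bool (q \<in> S)) = (\<Sum>q\<in>perms 4. \<Sum>r\<in>perms 4. of_bool (P r = q) * of_bool (q \<in> S))"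
    unfolding cnt sum_distrib_right ..
  also have "\<dots> = (\<Sum>r\<in>perms 4. \<Sum>q\<in>perms 4. of_bool (P r = q) * of_bool (q \<in> S))" by (rule sum.swap)
  also have "\<dots> = (\<Sum>r\<in>perms 4. of_bool (P r \<in> S))"
  proof (rule sum.cong[OF refl])
    fix r assume "r \<in> perms 4"
    then have "P r \<in> perms 4" using assms by (simp add: perms_4)
    then show "(\<Sum>q\<in>perms 4. of_bool (P r = q) * of_bool (q \<in> S)) = (of_bool (P r \<in> S) :: real)"
      by (subst sum.remove[of _ "P r"]) (auto intro!: sum.neutral)
  qed
  finally show ?thesis ..
qed

subsection \<open>Perturbations of the uniform distribution along the boundary\<close>

text \<open>Letters 0 and 1 are uniform points below and above the height \<open>y\<close> of the perturbing letter 2,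
  which sits on one of the four sides of the unit square. The predicate \<open>D l q\<close> says that, with
  \<open>l\<close> of the other three points below, the entry of \<open>q\<close> contributed by letter 2 lies on this side.\<close>

definition edge_ok :: "(nat list \<Rightarrow> nat list \<Rightarrow> nat list) \<Rightarrow> (nat \<Rightarrow> nat list \<Rightarrow> bool) \<Rightarrow> bool" where
  "edge_ok P D = (\<forall>a\<in>set [0, 1, 2]. \<forall>b\<in>set [0, 1, 2]. \<forall>c\<in>set [0, 1, 2]. \<forall>d\<in>set [0, 1, 2].
     (let t = [a, b, c, d]; k = length (filter (\<lambda>x. x = 2) t); l = length (filter (\<lambda>x. x = 0) t) in
      if k < 2 then (let ps = map (P t) perms4 in
        \<forall>q\<in>set perms4. length (filter (\<lambda>x. x = q) ps) = (if k = 0 then 1 else if D l q then 4 else 0))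
      else True))"

definition edge_count :: "(nat \<Rightarrow> nat list \<Rightarrow> bool) \<Rightarrow> nat list set \<Rightarrow> nat \<Rightarrow> real" where
  "edge_count D S l = (\<Sum>q\<in>perms 4. of_bool (D l q) * of_bool (q \<in> S))"

text \<open>Compare first-order terms in the weight \<epsilon> of the boundary letter: without it
  the value is exactly \<open>s\<close>, with one such point it is the right side, and the perturbed
  value must not drop below \<open>s\<close>.\<close>

lemma edge_inequality:
  fixes D :: "nat \<Rightarrow> nat list \<Rightarrow> bool" and \<epsilon> y :: real
  assumes S: "S \<subseteq> perms 4" "[1, 2, 3, 4] \<in> S" "S \<noteq> perms 4" and forcing: "Sigma_forcing 4 S"
    and ok: "edge_ok (xpat X kx Y ky) D" and y: "0 \<le> y" "y \<le> 1"
  defines "N \<equiv> edge_count D S" and "s \<equiv> real (card S)"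
  shows "s \<le> 4 * (y ^ 3 * N 3 + 3 * y\<^sup>2 * (1 - y) * N 2 + 3 * y * (1 - y)\<^sup>2 * N 1 + (1 - y) ^ 3 * N 0)"
proof (rule ccontr)
  define H where "H = 4 * (y ^ 3 * N 3 + 3 * y\<^sup>2 * (1 - y) * N 2 + 3 * y * (1 - y)\<^sup>2 * N 1 + (1 - y) ^ 3 * N 0)"
  assume "\<not> ?thesis"
  then have Hs: "H < s" by (simp add: H_def)
  have N0: "0 \<le> N l" for l unfolding N_def edge_count_def by (rule sum_nonneg) simp
  have H0: "0 \<le> H" unfolding H_def using N0 y by (intro mult_nonneg_nonneg add_nonneg_nonneg) auto
  have sum_S: "(\<Sum>q\<in>perms 4. of_bool (q \<in> S)) = s"
    using S(1) by (simp add: sum_of_bool_eq Int_absorb1 s_def)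
  have "card S \<le> card (perms 4)" using S by (intro card_mono) auto
  then have s24: "s \<le> 24" by (simp add: fact_numeral s_def)
  \<comment> \<open>The second-order terms amount to at most 408 \<epsilon>^2, that is 6 * 24 from
    the power of \<open>1 - \<epsilon>\<close> and 24 * 11 from tuples with several boundary
    letters. As 408 < 4 * 200, the denominator 200 is large enough.\<close>
  define \<epsilon> where "\<epsilon> = (s - H) / 200"
  have \<epsilon>: "0 < \<epsilon>" "\<epsilon> \<le> 1" using Hs H0 s24 by (auto simp: \<epsilon>_def)
  define w where "w c = (if c = 0 then (1 - \<epsilon>) * y else if c = 1 then (1 - \<epsilon>) * (1 - y) else \<epsilon>)" for c :: nat
  define T where "T t = (\<Sum>r\<in>perms 4. of_bool (spat X kx Y ky t r \<in> S) :: real)" for t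
  have T24: "T t \<le> 24" for t
  proof -
    have "T t \<le> (\<Sum>r\<in>perms 4. 1)" unfolding T_def by (rule sum_mono) simp
    then show ?thesis by (simp add: fact_numeral)
  qed
  have Tx: "T t = (\<Sum>q\<in>perms 4. real (xcount (xpat X kx Y ky t) q) * of_bool (q \<in> S))" for t
  proof -
    have "T t = (\<Sum>r\<in>perms 4. of_bool (xpat X kx Y ky t r \<in> S))"
      unfolding T_def by (rule sum.cong) (simp_all add: spat_eq_xpat)
    also have "\<dots> = (\<Sum>q\<in>perms 4. real (xcount (xpat X kx Y ky t) q) * of_bool (q \<in> S))"
      by (rule sum_of_bool_xcount) (metis spat_eq_xpat spat_in_perms perms4_in perms_4)
    finally show ?thesis .
  qed
  have sumD: "(\<Sum>q\<in>perms 4. real (if D l q then 4 else 0) * of_bool (q \<in> S)) = 4 * N l" for l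
    unfolding N_def edge_count_def sum_distrib_left by (rule sum.cong) auto
  define p q where "p = w 0" and "q = w 1"
  have pq: "p = (1 - \<epsilon>) * y" "q = (1 - \<epsilon>) * (1 - y)" "w 2 = \<epsilon>" "0 \<le> p" "0 \<le> q"
    using y \<epsilon> by (auto simp: p_def q_def w_def)
  \<comment> \<open>Tuples with at least two boundary letters are bounded trivially by 24.\<close>
  define T' where "T' t = (let k = length (filter (\<lambda>x. x = 2) t); l = length (filter (\<lambda>x. x = 0) t) in
    if k = 0 then s else if k = 1 then 4 * N l else 24)" for t :: "nat list"
  have TT': "T [a, b, c, d] \<le> T' [a, b, c, d]" if "a < 3" "b < 3" "c < 3" "d < 3" for a b c d
  proof -
    let ?t = "[a, b, c, d]"
    let ?k = "length (filter (\<lambda>x. x = 2) ?t)" and ?l = "length (filter (\<lambda>x. x = 0) ?t)"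
    have in3: "x < 3 \<Longrightarrow> x \<in> set [0, 1, 2]" for x :: nat by (simp add: less_Suc_eq numeral_eq_Suc)
    have e: "if ?k < 2 then (\<forall>q\<in>set perms4. xcount (xpat X kx Y ky ?t) q = (if ?k = 0 then 1 else if D ?l q then 4 else 0))
        else True"
      unfolding xcount_def
      using ok[unfolded edge_ok_def Let_def, THEN bspec, OF in3[OF that(1)], THEN bspec, OF in3[OF that(2)],
        THEN bspec, OF in3[OF that(3)], THEN bspec, OF in3[OF that(4)]] .
    consider "?k = 0" | "?k = 1" | "?k \<noteq> 0" "?k \<noteq> 1" by blast
    then show ?thesis
    proof cases
      case 1
      then have "T ?t = (\<Sum>q\<in>perms 4. of_bool (q \<in> S))"
        unfolding Tx by (intro sum.cong refl) (use e[unfolded 1] in \<open>simp add: perms_4\<close>)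
      then show ?thesis using 1 sum_S unfolding T'_def Let_def by simp
    next
      case 2
      then have "T ?t = (\<Sum>q\<in>perms 4. real (if D ?l q then 4 else 0) * of_bool (q \<in> S))"
        unfolding Tx by (intro sum.cong refl) (use e[unfolded 2] in \<open>simp add: perms_4\<close>)
      then show ?thesis using 2 sumD[of ?l] unfolding T'_def Let_def by simp
    next
      case 3
      then show ?thesis using T24[of ?t] unfolding T'_def Let_def by simp
    qed
  qed
  have "s \<le> model_value 3 w (spat X kx Y ky) S"
    unfolding s_def
  proof (rule forcing_model_value_ge[OF S forcing])
    show "(\<Sum>c<3. w c) = 1" by (simp add: w_def numeral_3_eq_3 algebra_simps)
    show "0 \<le> w c" if "c < 3" for c using y \<epsilon> by (auto simp: w_def)
  qed
  also have "\<dots> \<le> (\<Sum>a<3. \<Sum>b<3. \<Sum>c<3. \<Sum>d<3. w a * w b * w c * w d * T' [a, b, c, d])"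
    unfolding model_value_def T_def[symmetric]
    by (intro sum_mono mult_left_mono TT') (use y \<epsilon> in \<open>auto simp: w_def\<close>)
  also have "\<dots> = (p + q) ^ 4 * s + 4 * \<epsilon> * (4 * (p ^ 3 * N 3 + 3 * p\<^sup>2 * q * N 2 + 3 * p * q\<^sup>2 * N 1 + q ^ 3 * N 0))
     + 24 * (6 * \<epsilon>\<^sup>2 * (p + q)\<^sup>2 + 4 * \<epsilon> ^ 3 * (p + q) + \<epsilon> ^ 4)"
  proof -
    have s3: "(\<Sum>a<3. f a) = f 0 + f 1 + f 2" for f :: "nat \<Rightarrow> real" by (simp add: numeral_3_eq_3 numeral_2_eq_2)
    have w': "w 0 = p" "w 1 = q" "w 2 = \<epsilon>" using pq by (simp_all add: p_def q_def)
    have N': "N (Suc (Suc 0)) = N 2" "N (Suc (Suc (Suc 0))) = N 3"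
      by (simp_all add: numeral_eq_Suc)
    show ?thesis unfolding s3 w' T'_def Let_def
      by (simp add: N') (simp add: algebra_simps power2_eq_square power3_eq_cube power4_eq_xxxx)
  qed
  also have "p + q = 1 - \<epsilon>" unfolding pq by (simp add: algebra_simps)
  also have "4 * (p ^ 3 * N 3 + 3 * p\<^sup>2 * q * N 2 + 3 * p * q\<^sup>2 * N 1 + q ^ 3 * N 0) = (1 - \<epsilon>) ^ 3 * H"
    unfolding pq H_def by (simp add: algebra_simps power2_eq_square power3_eq_cube)
  finally have main: "s \<le> (1 - \<epsilon>) ^ 4 * s + 4 * \<epsilon> * ((1 - \<epsilon>) ^ 3 * H) +
    24 * (6 * \<epsilon>\<^sup>2 * (1 - \<epsilon>)\<^sup>2 + 4 * \<epsilon> ^ 3 * (1 - \<epsilon>) + \<epsilon> ^ 4)" .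
  have e34: "\<epsilon> ^ 3 \<le> \<epsilon>\<^sup>2" "\<epsilon> ^ 4 \<le> \<epsilon> ^ 3" using \<epsilon> by (simp_all add: power_decreasing)
  have e0: "0 \<le> \<epsilon> ^ 3" "0 \<le> \<epsilon> ^ 4" using \<epsilon> by simp_all
  have "(1 - \<epsilon>) ^ 4 = 1 - 4 * \<epsilon> + 6 * \<epsilon>\<^sup>2 - 4 * \<epsilon> ^ 3 + \<epsilon> ^ 4"
    by (simp add: algebra_simps power2_eq_square power3_eq_cube power4_eq_xxxx)
  then have "(1 - \<epsilon>) ^ 4 \<le> 1 - 4 * \<epsilon> + 6 * \<epsilon>\<^sup>2" using e34 e0 by linarith
  then have b1: "(1 - \<epsilon>) ^ 4 * s \<le> (1 - 4 * \<epsilon> + 6 * \<epsilon>\<^sup>2) * s" by (rule mult_right_mono) (simp add: s_def)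
  have s6: "6 * \<epsilon>\<^sup>2 * s \<le> 6 * \<epsilon>\<^sup>2 * 24" using s24 by (intro mult_left_mono) auto
  have "(1 - \<epsilon>) ^ 3 \<le> 1" using \<epsilon> by (simp add: power_le_one)
  then have "(1 - \<epsilon>) ^ 3 * H \<le> 1 * H" using H0 by (rule mult_right_mono)
  then have b2: "4 * \<epsilon> * ((1 - \<epsilon>) ^ 3 * H) \<le> 4 * \<epsilon> * H" using \<epsilon> by simp
  have "(1 - \<epsilon>)\<^sup>2 \<le> 1" using \<epsilon> by (simp add: power_le_one)
  then have b3: "6 * \<epsilon>\<^sup>2 * (1 - \<epsilon>)\<^sup>2 \<le> 6 * \<epsilon>\<^sup>2 * 1" by (rule mult_left_mono) simp
  have b4: "4 * \<epsilon> ^ 3 * (1 - \<epsilon>) \<le> 4 * \<epsilon> ^ 3 * 1" by (rule mult_left_mono) (use \<epsilon> in auto)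
  have "(1 - 4 * \<epsilon> + 6 * \<epsilon>\<^sup>2) * s = s - 4 * \<epsilon> * s + 6 * \<epsilon>\<^sup>2 * s" by (simp add: algebra_simps)
  then have "4 * \<epsilon> * s - 4 * \<epsilon> * H \<le> 408 * \<epsilon>\<^sup>2"
    using main b1 b2 b3 b4 e34 s6 by argo
  then have "\<epsilon> * (4 * (s - H)) \<le> \<epsilon> * (408 * \<epsilon>)" by (simp add: algebra_simps power2_eq_square)
  then have "4 * (s - H) \<le> 408 * \<epsilon>" using \<epsilon>(1) by simp
  then show False using Hs by (simp add: \<epsilon>_def)
qed

text \<open>The bound in \<open>edge_inequality\<close> is a cubic in y in Bernstein form with
  integral \<open>card S\<close> over [0, 1]. Simpson's 3/8 rule with nodes 0, 1/3, 2/3, 1 is exact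
  for cubics and has positive weights, so the inequalities at the nodes are equalities, the cubic is
  constant and its coefficients agree.\<close>

lemma edge_counts_eq:
  fixes D :: "nat \<Rightarrow> nat list \<Rightarrow> bool"
  assumes S: "S \<subseteq> perms 4" "[1, 2, 3, 4] \<in> S" "S \<noteq> perms 4" and forcing: "Sigma_forcing 4 S"
    and ok: "edge_ok (xpat X kx Y ky) D"
    and D: "\<And>q. q \<in> perms 4 \<Longrightarrow> (\<Sum>l<4. of_bool (D l q)) = (1 :: real)"
    and l: "l < 4"
  shows "edge_count D S l = real (card S) / 4"
proof -
  let ?N = "edge_count D S"
  note ineq = edge_inequality[OF S forcing ok]
  have s4: "(\<Sum>l<4. f l) = f 0 + f 1 + f 2 + f 3" for f :: "nat \<Rightarrow> real" by (simp add: eval_nat_numeral)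
  have "(\<Sum>l<4. ?N l) = (\<Sum>q\<in>perms 4. \<Sum>l<4. of_bool (D l q) * of_bool (q \<in> S))"
    unfolding edge_count_def by (rule sum.swap)
  also have "\<dots> = (\<Sum>q\<in>perms 4. of_bool (q \<in> S))"
    by (rule sum.cong[OF refl]) (simp only: sum_distrib_right[symmetric] D mult_1)
  also have "\<dots> = real (card S)" using S(1) by (simp add: sum_of_bool_eq Int_absorb1)
  finally have sum: "?N 0 + ?N 1 + ?N 2 + ?N 3 = real (card S)" unfolding s4 .
  have "real (card S) \<le> 4 * ?N 0" using ineq[of 0] by simp
  moreover have "real (card S) \<le> 4 * ?N 3" using ineq[of 1] by simp
  moreover have "27 * real (card S) \<le> 4 * (?N 3 + 6 * ?N 2 + 12 * ?N 1 + 8 * ?N 0)"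
    using ineq[of "1 / 3"] by (simp add: field_simps power2_eq_square power3_eq_cube)
  moreover have "27 * real (card S) \<le> 4 * (8 * ?N 3 + 12 * ?N 2 + 6 * ?N 1 + ?N 0)"
    using ineq[of "2 / 3"] by (simp add: field_simps power2_eq_square power3_eq_cube)
  ultimately have "?N 0 = real (card S) / 4 \<and> ?N 1 = real (card S) / 4 \<and> ?N 2 = real (card S) / 4 \<and> ?N 3 = real (card S) / 4"
    using sum by argo
  moreover have "l = 0 \<or> l = 1 \<or> l = 2 \<or> l = 3" using l by auto
  ultimately show ?thesis by auto
qed

subsection \<open>Certificates\<close>

text \<open>Letters 0 and 1 share their key in one direction, with random ties, and lie below and
  above letter 2 in the other. The third entry of the list with the repeated key puts letter 2
  beyond all points on one side.\<close>

lemma edge_ok_sides: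
  shows edge_ok_left: "edge_ok (xpat ((!) [1, 1, 0]) (\<lambda>_. 2) ((!) [0, 2, 1]) (\<lambda>_. 0)) (\<lambda>l q. q ! 0 = l + 1)"
    and edge_ok_right: "edge_ok (xpat ((!) [1, 1, 2]) (\<lambda>_. 2) ((!) [0, 2, 1]) (\<lambda>_. 0)) (\<lambda>l q. q ! 3 = l + 1)"
    and edge_ok_bottom: "edge_ok (xpat ((!) [0, 2, 1]) (\<lambda>_. 0) ((!) [1, 1, 0]) (\<lambda>_. 2)) (\<lambda>l q. q ! l = 1)"
    and edge_ok_top: "edge_ok (xpat ((!) [0, 2, 1]) (\<lambda>_. 0) ((!) [1, 1, 2]) (\<lambda>_. 2)) (\<lambda>l q. q ! l = 4)"
  by code_simp+

text \<open>A test is a weighted permutation with signs: \<open>(ys, ks, ws)\<close> describes a model whose letters,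
  from left to right, have heights \<open>ys\<close> and integral weights \<open>ws\<close>; the points of the letter at height
  \<open>v\<close> are increasing if \<open>ks ! v = 0\<close> and decreasing if \<open>ks ! v = 1\<close>.\<close>

type_synonym test = "nat list \<times> nat list \<times> int list"

text \<open>The index \<open>i\<close> is the place of the point from left to right, which breaks
  ties upwards or downwards; heights are spaced by 5 so that ties cannot interfere.\<close>

definition test_key :: "nat list \<Rightarrow> nat list \<Rightarrow> nat \<Rightarrow> nat \<Rightarrow> int" where
  "test_key ys ks i a = (let y = ys ! a in int y * 5 + (if ks ! y = 0 then int i else 4 - int i))"

definition ranks :: "int list \<Rightarrow> nat list" where
  "ranks vs = map (\<lambda>x. length (filter (\<lambda>y. y \<le> x) vs)) vs"

fun test_pattern :: "test \<Rightarrow> nat list \<Rightarrow> nat list" where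
  "test_pattern (ys, ks, ws) c = ranks (map2 (test_key ys ks) [0, 1, 2, 3] (sort c))"

fun test_tuples :: "test \<Rightarrow> (nat list \<times> int) list" where
  "test_tuples (ys, ks, ws) = (let m = [0..<length ws] in
     concat (map (\<lambda>a. concat (map (\<lambda>b. concat (map (\<lambda>c. map (\<lambda>d.
       (test_pattern (ys, ks, ws) [a, b, c, d], ws ! a * ws ! b * ws ! c * ws ! d)) m) m)) m)) m))"

fun bump :: "nat list \<Rightarrow> int \<Rightarrow> (nat list \<times> int) list \<Rightarrow> (nat list \<times> int) list" where
  "bump p w [] = []"
| "bump p w ((q, v) # xs) = (if p = q then (q, v + w) # xs else (q, v) # bump p w xs)"

fun tally :: "(nat list \<times> int) list \<Rightarrow> (nat list \<times> int) list" where
  "tally [] = map (\<lambda>q. (q, 0)) perms4"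
| "tally ((p, w) # xs) = bump p w (tally xs)"

text \<open>With \<open>W\<close> the fourth power of the total weight, these are the excesses over
  the random density, scaled to integers. The sum of the entries of the members of \<open>S\<close>
  is negative exactly when the model refutes \<open>S\<close>.\<close>

definition test_column :: "test \<Rightarrow> int list" where
  "test_column T = (let W = sum_list (snd (snd T)) ^ 4 in map (\<lambda>(q, v). 24 * v - W) (tally (test_tuples T)))"

definition tests :: "test list" where
  "tests = [
    ([0, 1, 2], [0, 1, 1], [1, 3, 2]),
    ([0, 3, 2, 1], [1, 0, 0, 0], [1, 2, 2, 2]),
    ([1, 0], [0, 1], [2, 3]),
    ([3, 0, 1, 2], [1, 1, 1, 0], [2, 3, 3, 1]),
    ([1, 0], [1, 0], [3, 2]),
    ([0, 1, 2, 3], [1, 1, 1, 0], [2, 2, 2, 1]),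
    ([1, 0, 3, 2], [0, 0, 1, 0], [3, 3, 2, 1]),
    ([0, 2, 4, 3, 1], [1, 0, 1, 0, 1], [2, 3, 2, 1, 3]),
    ([2, 3, 0, 1], [1, 1, 1, 1], [1, 1, 1, 1]),
    ([1, 2, 0, 3], [1, 1, 1, 0], [2, 2, 2, 1]),
    ([3, 1, 0, 2], [0, 0, 0, 1], [2, 3, 3, 2]),
    ([0, 3, 1, 2], [1, 1, 1, 1], [1, 1, 2, 2]),
    ([1, 3, 2, 0], [1, 0, 0, 0], [2, 3, 3, 2]),
    ([3, 1, 2, 4, 0], [1, 1, 1, 0, 0], [3, 3, 2, 2, 3]),
    ([4, 2, 0, 3, 1], [0, 0, 0, 1, 1], [3, 2, 3, 3, 3]),
    ([0, 3, 1, 4, 2], [0, 1, 1, 0, 1], [3, 3, 3, 3, 2]),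
    ([2, 4, 0, 3, 1], [1, 0, 1, 0, 1], [2, 3, 2, 3, 2])]"

text \<open>The Klein four-group passes all other tests.\<close>

definition klein :: "nat list set" where
  "klein = {[1, 2, 3, 4], [2, 1, 4, 3], [3, 4, 1, 2], [4, 3, 2, 1]}"

definition klein_test :: test where
  "klein_test = ([3, 7, 2, 0, 4, 8, 6, 1, 5], [0, 1, 0, 0, 1, 0, 0, 1, 0], [3, 4, 3, 3, 4, 3, 3, 4, 3])"

text \<open>The first entry of a row packs the last entry and the positions of the least and of the
  greatest entry into one number; the other ones are the excesses in \<open>tests\<close>.\<close>

definition certificate :: "(nat list \<times> int list) list" where
  "certificate = [
    ([1, 2, 3, 4], [8589939200, 936, 1055, 1319, -6177, 1319, 6263, 28239, -5281, -256, -649, 19616, -1296, 19616, -2809, 3152, 106736, -6504]),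
    ([1, 2, 4, 3], [1073745984, 4032, -2401, -625, -3969, -625, 2207, 6399, -817, -256, -2401, -10000, 1008, 368, -28561, 1760, 144320, -20736]),
    ([1, 3, 2, 4], [8589939200, 3888, -2401, -625, 1215, -625, 9119, -6561, 911, -256, -97, -10000, 1008, -10000, -21649, -38416, 47120, -20736]),
    ([1, 3, 4, 2], [1073745928, -1296, 4511, -625, -6561, -625, -2401, 351, 18191, -256, -2401, -10000, -1296, 5552, -28561, -38416, 31568, -10368]),
    ([1, 4, 2, 3], [134221888, -1296, 4511, -625, -6561, -625, -2401, -6561, 19343, -256, -2401, -10000, 1008, 5552, -28561, -15088, -7312, 1728]),
    ([1, 4, 3, 2], [134221832, 4368, 2207, -625, 1791, -625, 2207, -2529, 29519, -64, -865, -10000, 5328, -10000, -26257, -2128, 82832, 0]),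
    ([2, 1, 3, 4], [8589967872, -1296, -673, -625, 1215, -625, 10847, 3807, 2783, -256, 3935, 368, -144, -10000, 6575, -38416, -38416, 2304]),
    ([2, 1, 4, 3], [1073774656, 3888, 1055, -625, 7695, -625, 4511, 6399, 26255, 32, -97, -10000, 3456, -10000, -23377, -22864, 17312, 1728]),
    ([2, 3, 1, 4], [8590197248, -1296, -2401, -625, -6561, -625, -2401, 16767, -14641, -256, 2207, 5552, -1296, -10000, -2641, -28048, -15088, -20736]),
    ([2, 3, 4, 1], [1075838977, -1296, 2207, -625, -1185, 4559, -2401, 1983, -11761, -256, -2401, -2224, -1296, 44240, 58415, -23440, -9904, -5184]),
    ([2, 4, 1, 3], [134479936, -1296, -2401, -625, -6561, -625, -2401, -6561, -14641, -256, -2401, -10000, -1296, -10000, -28561, -38416, -38416, 0]),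
    ([2, 4, 3, 1], [136314881, -1296, -2401, -625, -6561, -625, -2401, -6561, 6095, 320, 2207, -10000, -1296, 10736, -18193, -22864, -22864, 20736]),
    ([3, 1, 2, 4], [8589967872, -1296, -2401, -625, -6561, -625, -2401, 16767, -14641, -256, -2401, 5552, -1296, -10000, -7825, -22864, -38416, -20736]),
    ([3, 1, 4, 2], [1073774600, -1296, -2401, -625, -6561, -625, -2401, -6561, -14641, -256, -2401, -10000, -1296, -10000, -28561, -7312, -7312, -6912]),
    ([3, 2, 1, 4], [8590197248, 3888, -1825, -625, 6399, -625, 4511, -6561, 47, -64, 10655, -10000, 720, -10000, 5807, -38416, -2128, 1536]),
    ([3, 2, 4, 1], [1075838977, -1296, -2401, -625, -6561, -625, -2401, -6561, 8687, 320, 2207, -10000, -1296, -10000, 61295, -38416, -38416, 0]),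
    ([3, 4, 1, 2], [134479880, -1296, 4511, -625, 10719, -625, -2401, 5103, 9983, 320, -2401, 1664, -1296, 1664, -13009, -2128, -22864, 12096]),
    ([3, 4, 2, 1], [136314881, -1296, 2207, -625, 4383, 4559, -2401, -5985, -14641, 320, 2207, -10000, -1296, 32048, 101039, -38416, -11200, -13824]),
    ([4, 1, 2, 3], [16810048, -1296, 2207, 4559, 3807, -625, -2401, 1215, 1103, -256, -2401, 44240, -1296, -2224, -28561, 109040, -38416, 20256]),
    ([4, 1, 3, 2], [16809992, -1296, -2401, -625, 12447, -625, -2401, -6561, -14641, 320, -2401, -10000, 1008, -10000, -18193, 47120, -28048, 0]),
    ([4, 2, 1, 3], [17039424, -1296, -2401, -625, 19359, -625, -2401, -6561, -14641, 320, -2401, 10736, 1008, -10000, -13009, -7312, -22864, 1152]),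
    ([4, 2, 3, 1], [18874369, -1296, 2207, -625, -6561, -625, -2401, -6561, -12913, -256, -2401, 5552, -1296, 5552, 2543, 13424, -38416, -5184]),
    ([4, 3, 1, 2], [17039368, -1296, 2207, 4559, -6561, -625, -2401, -6561, 7967, 320, -2401, 32048, -144, -10000, -28561, 149504, -38416, 39312]),
    ([4, 3, 2, 1], [18874369, 1032, -2377, 2063, 7911, 2063, -1249, -6345, 2375, 1184, 9503, 6896, 2592, 6896, 111215, 98960, -11392, 30072])]"

lemma map_fst_certificate: "map fst certificate = perms4"
  by code_simp

lemma klein_test_sum:
  "sum_list (map (\<lambda>(p, w). if p \<in> {[1, 2, 3, 4], [2, 1, 4, 3], [3, 4, 1, 2], [4, 3, 2, 1]} then w else 0) (test_tuples klein_test)) = 134592"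
  by code_simp

lemma certificate_columns:
  "map (\<lambda>k. map (\<lambda>(p, v). v ! (k + 1)) certificate) [0..<17] = map test_column tests"
  by code_simp

text \<open>For distinct values the filtered list has the length of the set whose cardinality
  \<open>std\<close> takes.\<close>

lemma ranks_eq_std:
  assumes "distinct vs"
  shows "ranks vs = std vs"
proof -
  have "length (filter (\<lambda>y. y \<le> x) vs) = card {y \<in> set vs. y \<le> x}" for x
    using assms by (simp add: distinct_length_filter Int_def conj_commute)
  then show ?thesis by (simp add: ranks_def std_def)
qed

text \<open>No tie of a test is broken at random, so the order \<open>r\<close> has no influence.
  Sorting the letters places the points from left to right, and equal letters keep the order of
  their indices, which is what the tie in \<open>test_key\<close> needs.\<close>

lemma test_pattern_eq_spat:
  assumes c: "length c = 4" and inj: "\<And>a b. a \<in> set c \<Longrightarrow> b \<in> set c \<Longrightarrow> ys ! a = ys ! b \<Longrightarrow> a = b"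
    and kind: "\<And>a. a \<in> set c \<Longrightarrow> ks ! (ys ! a) < 2" and r: "r \<in> perms 4"
  shows "test_pattern (ys, ks, ws) c = spat (\<lambda>x. x) (\<lambda>_. 0) ((!) ys) ((!) ks) c r"
proof -
  let ?kx = "key 5 (\<lambda>x. x) (\<lambda>_. 0) ((!) c) ((!) r)" and ?ky = "key 5 ((!) ys) ((!) ks) ((!) c) ((!) r)"
  define q where "q = sort_key ?kx [0..<4]"
  have q: "set q = {..<4}" "length q = 4" "distinct q" "sorted (map ?kx q)"
    by (auto simp: q_def)
  have qn: "q ! i < 4" if "i < 4" for i using q that nth_mem[of i q] by auto
  have cmem: "c ! (q ! i) \<in> set c" if "i < 4" for i using qn[OF that] c by simp
  have r5: "r ! i < 5" if "i < 4" for i using nth_perms[OF r that] by linarith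
  have kx: "?kx i < ?kx j \<longleftrightarrow> c ! i < c ! j \<or> c ! i = c ! j \<and> i < j" if "i < 4" "j < 4" for i j
    using key_less_iff[of i 5 j "(!) r" "\<lambda>x. x" "\<lambda>_. 0" "(!) c"] r5 that by simp
  have injx: "inj_on ?kx {..<4}" by (rule inj_on_key_perms[OF r]) simp
  have "mset (map ((!) c) q) = mset (map ((!) c) [0..<4])" unfolding q_def by simp
  also have "map ((!) c) [0..<4] = c" using c map_nth[of c] by simp
  finally have "mset (map ((!) c) q) = mset c" .
  moreover have "sorted (map ((!) c) q)"
    unfolding sorted_iff_nth_mono
  proof (intro allI impI)
    fix i j assume ij: "i \<le> j" "j < length (map ((!) c) q)"
    then have ij4: "i < 4" "j < 4" using q(2) by simp_all
    have "?kx (q ! i) \<le> ?kx (q ! j)" using sorted_nth_mono[OF q(4) ij(1)] ij4 q(2) by simp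
    then have "\<not> c ! (q ! j) < c ! (q ! i)"
      unfolding linorder_not_less[symmetric] kx[OF qn[OF ij4(2)] qn[OF ij4(1)]] by blast
    then show "map ((!) c) q ! i \<le> map ((!) c) q ! j" using ij4 q(2) by simp
  qed
  ultimately have s: "sort c = map ((!) c) q" by (rule properties_for_sort)
  have q_less: "?kx (q ! i) < ?kx (q ! j) \<longleftrightarrow> i < j" if "i < 4" "j < 4" for i j
  proof -
    have 1: "?kx (q ! i) < ?kx (q ! j)" if "i < j" "j < 4" for i j
    proof -
      have mem: "q ! i \<in> {..<4}" "q ! j \<in> {..<4}" using qn[of i] qn[of j] that by simp_all
      have "?kx (q ! i) \<le> ?kx (q ! j)" using sorted_nth_mono[OF q(4), of i j] that q(2) by simp
      moreover have "q ! i \<noteq> q ! j" using q(2,3) that by (simp add: nth_eq_iff_index_eq)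
      then have "?kx (q ! i) \<noteq> ?kx (q ! j)" using inj_onD[OF injx _ mem] by blast
      ultimately show ?thesis by simp
    qed
    show ?thesis using 1[of i j] 1[of j i] that by (cases i j rule: linorder_cases) auto
  qed
  let ?L = "map2 (test_key ys ks) [0, 1, 2, 3] (sort c)"
  have Ln: "?L ! i = test_key ys ks i (c ! (q ! i))" if "i < 4" for i
  proof -
    have "[0, 1, 2, 3] ! i = i" using that by (auto simp: less_Suc_eq numeral_eq_Suc)
    then show ?thesis using that by (simp add: s q(2))
  qed
  have lt: "?ky (q ! i) < ?ky (q ! j) \<longleftrightarrow> ?L ! i < ?L ! j" if ij: "i < 4" "j < 4" for i j
  proof -
    have tk: "test_key ys ks i a = int (ys ! a * 5 + (if ks ! (ys ! a) = 0 then i else 4 - i))" if "i < 4" for i a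
      using that by (simp add: test_key_def Let_def of_nat_diff)
    have q5: "q ! i < 5" "q ! j < 5" using qn[OF ij(1)] qn[OF ij(2)] by linarith+
    have kd: "ks ! (ys ! (c ! (q ! i))) = 0 \<or> ks ! (ys ! (c ! (q ! i))) = 1" using kind[OF cmem[OF ij(1)]] by linarith
    have "?ky (q ! i) < ?ky (q ! j) \<longleftrightarrow> ys ! (c ! (q ! i)) < ys ! (c ! (q ! j)) \<or>
        ys ! (c ! (q ! i)) = ys ! (c ! (q ! j)) \<and>
        (if ks ! (ys ! (c ! (q ! i))) = 0 then q ! i < q ! j else q ! j < q ! i)"
      unfolding key_less_iff[of "q ! i" 5 "q ! j" "(!) r" "(!) ys" "(!) ks" "(!) c", OF q5 r5[OF qn[OF ij(1)]] r5[OF qn[OF ij(2)]]]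
      using kd by (elim disjE) simp_all
    also have "\<dots> \<longleftrightarrow> ys ! (c ! (q ! i)) < ys ! (c ! (q ! j)) \<or>
        ys ! (c ! (q ! i)) = ys ! (c ! (q ! j)) \<and>
        (if ks ! (ys ! (c ! (q ! i))) = 0 then i < j else j < i)"
    proof (cases "ys ! (c ! (q ! i)) = ys ! (c ! (q ! j))")
      case True
      then have "c ! (q ! i) = c ! (q ! j)" using inj[OF cmem[OF ij(1)] cmem[OF ij(2)]] by blast
      then have "q ! i < q ! j \<longleftrightarrow> i < j" "q ! j < q ! i \<longleftrightarrow> j < i"
        using q_less[OF ij] q_less[OF ij(2,1)] unfolding kx[OF qn[OF ij(1)] qn[OF ij(2)]] kx[OF qn[OF ij(2)] qn[OF ij(1)]] by simp_all
      then show ?thesis by simp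
    qed simp
    also have "\<dots> \<longleftrightarrow> ?L ! i < ?L ! j"
      unfolding Ln[OF ij(1)] Ln[OF ij(2)] tk[OF ij(1)] tk[OF ij(2)] of_nat_less_iff
      by (subst mult_add_less_iff) (use ij in auto)
    finally show ?thesis .
  qed
  have len: "length ?L = 4" by (simp add: c)
  have "inj_on ?ky {..<4}" by (rule inj_on_key_perms[OF r]) simp
  then have dy: "distinct (map ?ky q)" using q by (simp add: distinct_map)
  have "distinct ?L"
    unfolding distinct_conv_nth len
  proof (intro allI impI)
    fix i j assume ij: "i < (4::nat)" "j < (4::nat)" "i \<noteq> j"
    then have "?ky (q ! i) \<noteq> ?ky (q ! j)" using dy q(2) nth_eq_iff_index_eq[of "map ?ky q" i j] by simp
    then show "?L ! i \<noteq> ?L ! j" using lt[of i j] lt[of j i] ij by (auto simp: neq_iff)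
  qed
  note dL = this
  then have "test_pattern (ys, ks, ws) c = std ?L" by (simp add: ranks_eq_std)
  also have "\<dots> = std (map ?ky q)"
  proof (rule std_cong[OF dL dy])
    show "length ?L = length (map ?ky q)" unfolding len by (simp add: q(2))
    fix i j assume "i < length ?L" "j < length ?L"
    then have ij: "i < 4" "j < 4" unfolding len .
    show "?L ! i < ?L ! j \<longleftrightarrow> map ?ky q ! i < map ?ky q ! j"
      using lt[OF ij] ij q(2) by (simp only: nth_map)
  qed
  finally show ?thesis by (simp add: spat_def q_def)
qed

fun valid_test :: "test \<Rightarrow> bool" where
  "valid_test (ys, ks, ws) \<longleftrightarrow> distinct ys \<and> length ys = length ws \<and> ws \<noteq> [] \<and> (\<forall>w\<in>set ws. 0 < w) \<and>
     (\<forall>y\<in>set ys. ks ! y < 2)"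

lemma sum_list_map_concat_map:
  fixes g :: "'b \<Rightarrow> 'c::comm_monoid_add"
  shows "sum_list (map g (concat (map h xs))) = sum_list (map (\<lambda>x. sum_list (map g (h x))) xs)"
  by (induction xs) auto

lemma sum_list_upt: "sum_list (map f [0..<m]) = sum f {..<m}"
  by (simp add: interv_sum_list_conv_sum_set_nat atLeast0LessThan)

text \<open>This is \<open>forcing_model_value_ge\<close> with the weights divided by their sum. As
  the pattern does not depend on \<open>r\<close>, the sum over \<open>r\<close> contributes the
  factor 24.\<close>

lemma test_sum_ge:
  assumes S: "S \<subseteq> perms 4" "[1, 2, 3, 4] \<in> S" "S \<noteq> perms 4" and forcing: "Sigma_forcing 4 S"
    and T: "valid_test T"
  shows "int (card S) * sum_list (snd (snd T)) ^ 4
    \<le> 24 * sum_list (map (\<lambda>(p, w). if p \<in> S then w else 0) (test_tuples T))"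
proof -
  obtain ys ks ws where Teq: "T = (ys, ks, ws)" by (cases T)
  define m where "m = length ws"
  define W where "W = real_of_int (sum_list ws)"
  define w where "w c = real_of_int (ws ! c) / W" for c
  have len: "length ys = m" "0 < m" and pos: "\<And>c. c < m \<Longrightarrow> 0 < ws ! c" and kind: "\<And>c. c < m \<Longrightarrow> ks ! (ys ! c) < 2"
    using T by (auto simp: Teq m_def)
  have Wsum: "W = (\<Sum>c<m. real_of_int (ws ! c))"
    unfolding W_def m_def by (simp add: sum_list_sum_nth atLeast0LessThan)
  have W0: "0 < W" unfolding Wsum by (rule sum_pos) (use len pos in auto)
  let ?P = "spat (\<lambda>x. x) (\<lambda>_. 0) ((!) ys) ((!) ks)"
  have ind: "?P [a, b, c, d] r = test_pattern T [a, b, c, d]"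
    if "a < m" "b < m" "c < m" "d < m" "r \<in> perms 4" for a b c d r
  proof -
    have "distinct ys" using T by (simp add: Teq)
    then show ?thesis
      unfolding Teq using that len kind
      by (intro test_pattern_eq_spat[symmetric]) (auto simp: nth_eq_iff_index_eq)
  qed
  let ?f = "\<lambda>a b c d. real_of_int (ws ! a * ws ! b * ws ! c * ws ! d) * of_bool (test_pattern T [a, b, c, d] \<in> S)"
  have "real (card S) \<le> model_value m w ?P S"
  proof (rule forcing_model_value_ge[OF S forcing])
    show "(\<Sum>c<m. w c) = 1" unfolding w_def sum_divide_distrib[symmetric] Wsum[symmetric] using W0 by simp
    show "0 \<le> w c" if "c < m" for c using pos[OF that] W0 by (simp add: w_def)
  qed
  also have "\<dots> = (\<Sum>a<m. \<Sum>b<m. \<Sum>c<m. \<Sum>d<m. 24 / W ^ 4 * ?f a b c d)"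
    unfolding model_value_def
  proof (intro sum.cong refl)
    fix a b c d assume abcd: "a \<in> {..<m}" "b \<in> {..<m}" "c \<in> {..<m}" "d \<in> {..<m}"
    have "(\<Sum>r\<in>perms 4. of_bool (?P [a, b, c, d] r \<in> S)) = (\<Sum>r\<in>perms 4. of_bool (test_pattern T [a, b, c, d] \<in> S) :: real)"
      by (rule sum.cong[OF refl]) (use ind abcd in simp)
    also have "\<dots> = 24 * of_bool (test_pattern T [a, b, c, d] \<in> S)" by (simp add: fact_numeral)
    finally show "w a * w b * w c * w d * (\<Sum>r\<in>perms 4. of_bool (?P [a, b, c, d] r \<in> S)) = 24 / W ^ 4 * ?f a b c d"
      by (simp add: w_def power4_eq_xxxx)
  qed
  also have "\<dots> = 24 / W ^ 4 * (\<Sum>a<m. \<Sum>b<m. \<Sum>c<m. \<Sum>d<m. ?f a b c d)"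
    unfolding sum_distrib_left ..
  also have "(\<Sum>a<m. \<Sum>b<m. \<Sum>c<m. \<Sum>d<m. ?f a b c d) =
      real_of_int (sum_list (map (\<lambda>(p, w). if p \<in> S then w else 0) (test_tuples T)))" (is "_ = real_of_int ?v")
    unfolding Teq test_tuples.simps Let_def sum_list_map_concat_map map_map sum_list_upt m_def[symmetric] of_int_sum
    by (intro sum.cong refl) simp
  finally have "real (card S) * W ^ 4 \<le> 24 * real_of_int ?v"
    using W0 by (simp add: field_simps)
  then have "real_of_int (int (card S) * sum_list ws ^ 4) \<le> real_of_int (24 * ?v)"
    by (simp add: W_def)
  then show ?thesis unfolding of_int_le_iff Teq by simp
qed

lemma sum_list_bump:
  assumes "p \<in> set (map fst xs)" "distinct (map fst xs)"
  shows "sum_list (map (\<lambda>(q, v). if q \<in> S then v else 0) (bump p w xs)) =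
    (if p \<in> S then w else 0) + sum_list (map (\<lambda>(q, v). if q \<in> S then v else 0) xs)"
  using assms
proof (induction p w xs rule: bump.induct)
  case (2 p w q v xs)
  show ?case
  proof (cases "p = q")
    case False
    then have "p \<in> set (map fst xs)" "distinct (map fst xs)" using 2(2,3) by simp_all
    then show ?thesis using 2(1)[OF False] False by (simp only: bump.simps if_False list.map prod.case sum_list.Cons add.left_commute)
  qed simp
qed simp

lemma map_fst_bump: "map fst (bump p w xs) = map fst xs"
  by (induction p w xs rule: bump.induct) auto

lemma map_fst_tally: "map fst (tally L) = perms4"
  by (induction L rule: tally.induct) (simp_all add: map_fst_bump o_def)

lemma sum_list_tally:
  assumes "\<And>p w. (p, w) \<in> set L \<Longrightarrow> p \<in> perms 4"
  shows "sum_list (map (\<lambda>(q, v). if q \<in> S then v else 0) (tally L)) =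
    sum_list (map (\<lambda>(q, v). if q \<in> S then v else 0) L)"
  using assms
proof (induction L rule: tally.induct)
  case 1
  have "sum_list (map (\<lambda>q. if q \<in> S then 0 else 0 :: int) xs) = 0" for xs :: "nat list list" by (induction xs) auto
  then show ?case by (simp add: o_def)
next
  case (2 p w L)
  have "p \<in> set perms4" using 2(2) by (auto simp: perms_4[symmetric])
  moreover have "distinct perms4" by (simp add: perms4_def)
  moreover have "sum_list (map (\<lambda>(q, v). if q \<in> S then v else 0) (tally L)) =
      sum_list (map (\<lambda>(q, v). if q \<in> S then v else 0) L)"
    by (rule 2(1)) (use 2(2) in auto)
  ultimately show ?case by (simp add: sum_list_bump map_fst_tally)
qed

lemma test_tuples_in_perms:
  assumes T: "valid_test T" and p: "(p, w) \<in> set (test_tuples T)"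
  shows "p \<in> perms 4"
proof -
  obtain ys ks ws where Teq: "T = (ys, ks, ws)" by (cases T)
  have r: "[1, 2, 3, 4] \<in> perms 4" by (simp add: perms_4 perms4_def)
  obtain a b c d where abcd: "{a, b, c, d} \<subseteq> {..<length ws}" and peq: "p = test_pattern T [a, b, c, d]"
    using p unfolding Teq by (auto simp: Let_def simp del: test_pattern.simps)
  have "p = spat (\<lambda>x. x) (\<lambda>_. 0) ((!) ys) ((!) ks) [a, b, c, d] [1, 2, 3, 4]"
    unfolding peq Teq by (rule test_pattern_eq_spat[OF _ _ _ r]) (use T abcd in \<open>auto simp: Teq nth_eq_iff_index_eq\<close>)
  then show ?thesis using spat_in_perms[OF r] by simp
qed

lemma card_conv_sum_list: "S \<subseteq> perms 4 \<Longrightarrow> int (card S) = sum_list (map (\<lambda>q. if q \<in> S then 1 else 0) perms4)"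
proof -
  assume S: "S \<subseteq> perms 4"
  have "distinct perms4" by (simp add: perms4_def)
  then have "sum_list (map (\<lambda>q. if q \<in> S then 1 else 0 :: int) perms4) = (\<Sum>q\<in>perms 4. if q \<in> S then 1 else 0)"
    by (simp add: perms_4 sum_list_distinct_conv_sum_set)
  also have "\<dots> = int (card S)" using S by (simp add: sum.If_cases Int_absorb1)
  finally show ?thesis by simp
qed

text \<open>Subtracting \<open>W\<close> in each of the \<open>card S\<close> selected entries moves
  the bound of \<open>test_sum_ge\<close> to one side.\<close>

lemma test_column_nonneg:
  assumes S: "S \<subseteq> perms 4" "[1, 2, 3, 4] \<in> S" "S \<noteq> perms 4" and forcing: "Sigma_forcing 4 S"
    and T: "valid_test T"
  shows "0 \<le> sum_list (map (\<lambda>(q, v). if q \<in> S then v else 0) (zip perms4 (test_column T)))"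
proof -
  define W where "W = sum_list (snd (snd T)) ^ 4"
  have zip: "sum_list (map (\<lambda>(q, v). if q \<in> S then v else 0) (zip (map fst xs) (map (\<lambda>(q, v). 24 * v - W) xs))) =
      24 * sum_list (map (\<lambda>(q, v). if q \<in> S then v else 0) xs) - W * sum_list (map (\<lambda>q. if q \<in> S then 1 else 0) (map fst xs))"
    for xs :: "(nat list \<times> int) list"
    by (induction xs) (auto simp: algebra_simps)
  have "sum_list (map (\<lambda>(q, v). if q \<in> S then v else 0) (zip perms4 (test_column T))) =
      24 * sum_list (map (\<lambda>(q, v). if q \<in> S then v else 0) (test_tuples T)) - W * int (card S)"
    using zip[of "tally (test_tuples T)"] sum_list_tally[of "test_tuples T" S, OF test_tuples_in_perms[OF T]]
    by (simp add: map_fst_tally test_column_def W_def card_conv_sum_list[OF S(1)])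
  then show ?thesis using test_sum_ge[OF S forcing T] by (simp add: W_def mult.commute)
qed

section \<open>Exhaustive search\<close>

fun vadd :: "int list \<Rightarrow> int list \<Rightarrow> int list" where
  "vadd (x # xs) (y # ys) = (x + y) # vadd xs ys"
| "vadd _ _ = []"

text \<open>A certificate row has 18 entries: the packed number and 17 test excesses. All of them
  are additive over the members of a set.\<close>

definition vsum :: "int list list \<Rightarrow> int list" where
  "vsum vs = foldr vadd vs (replicate 18 0)"

lemma length_vadd: "length (vadd u v) = min (length u) (length v)"
  by (induction u v rule: vadd.induct) auto

lemma vadd_nth: "k < length u \<Longrightarrow> k < length v \<Longrightarrow> vadd u v ! k = u ! k + v ! k"
  by (induction u v arbitrary: k rule: vadd.induct) (auto simp: nth_Cons split: nat.split)

lemma vsum_nth: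
  assumes "\<And>v. v \<in> set vs \<Longrightarrow> length v = 18"
  shows "length (vsum vs) = 18 \<and> (\<forall>k<18. vsum vs ! k = sum_list (map (\<lambda>v. v ! k) vs))"
  using assms by (induction vs) (auto simp: vsum_def length_vadd vadd_nth)

text \<open>First entries are equidistributed, so \<open>S\<close> has the same number
  \<open>t\<close> of members with each first entry \<open>j\<close>; these are the candidates for
  one \<open>j\<close>, with their vectors added up.\<close>

definition row_choices :: "nat \<Rightarrow> nat \<Rightarrow> (nat list list \<times> int list) list" where
  "row_choices j t = map (\<lambda>ys. (map fst ys, vsum (map snd ys)))
     (filter (\<lambda>ys. length ys = t) (subseqs (filter (\<lambda>(p, v). hd p = j) certificate)))"

definition exceptional :: "nat list list list" where
  "exceptional = [
    [[1, 2, 3, 4], [2, 1, 4, 3], [3, 4, 1, 2], [4, 3, 2, 1]],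
    [[1, 2, 3, 4], [1, 2, 4, 3], [2, 1, 3, 4], [2, 1, 4, 3], [3, 4, 1, 2], [3, 4, 2, 1], [4, 3, 1, 2], [4, 3, 2, 1]],
    [[1, 2, 3, 4], [1, 4, 3, 2], [2, 1, 4, 3], [2, 3, 4, 1], [3, 2, 1, 4], [3, 4, 1, 2], [4, 1, 2, 3], [4, 3, 2, 1]],
    [[1, 2, 3, 4], [1, 2, 4, 3], [1, 4, 3, 2], [2, 1, 3, 4], [2, 1, 4, 3], [2, 3, 4, 1], [3, 2, 1, 4], [3, 4, 1, 2], [3, 4, 2, 1], [4, 1, 2, 3], [4, 3, 1, 2], [4, 3, 2, 1]],
    [[1, 2, 3, 4], [1, 2, 4, 3], [1, 3, 4, 2], [1, 4, 3, 2], [2, 1, 3, 4], [2, 1, 4, 3], [2, 3, 4, 1], [2, 4, 3, 1], [3, 1, 2, 4], [3, 2, 1, 4], [3, 4, 1, 2], [3, 4, 2, 1], [4, 1, 2, 3], [4, 2, 1, 3], [4, 3, 1, 2], [4, 3, 2, 1]],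
    [[1, 2, 3, 4], [1, 2, 4, 3], [1, 4, 2, 3], [1, 4, 3, 2], [2, 1, 3, 4], [2, 1, 4, 3], [2, 3, 1, 4], [2, 3, 4, 1], [3, 2, 1, 4], [3, 2, 4, 1], [3, 4, 1, 2], [3, 4, 2, 1], [4, 1, 2, 3], [4, 1, 3, 2], [4, 3, 1, 2], [4, 3, 2, 1]]]"

text \<open>The tail drops the packed number, so a negative entry is a test violated by the
  selection \<open>ps\<close>. A selection that violates no test has to be listed in
  \<open>exceptional\<close>.\<close>

definition refuted :: "nat list list \<Rightarrow> int list \<Rightarrow> bool" where
  "refuted ps u = (if list_ex (\<lambda>x. x < 0) (tl u) then True else ps \<in> set exceptional)"

lemma refutedD: "refuted ps u \<Longrightarrow> \<not> list_ex (\<lambda>x. x < 0) (tl u) \<Longrightarrow> ps \<in> set exceptional"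
  unfolding refuted_def by (simp split: if_splits)

text \<open>(8^12 - 1)/7, the number whose twelve digits in base 8 are all 1; its multiple by
  \<open>t\<close> encodes twelve counts equal to \<open>t\<close>.\<close>

definition packed_unit :: int where
  "packed_unit = 9817068105"

text \<open>Matching on the Boolean keeps the final concatenations and vector sums from being
  evaluated when the packed numbers do not fit.\<close>

fun hit :: "bool \<Rightarrow> nat list list \<Rightarrow> int list \<Rightarrow> nat list list \<Rightarrow> int list \<Rightarrow> nat list list \<Rightarrow> int list \<Rightarrow> bool" where
  "hit True p u q v r w = refuted (p @ q @ r) (vadd u (vadd v w))"
| "hit False p u q v r w = True"

type_synonym choices = "(nat list list \<times> int list) list"

text \<open>Here \<open>x\<close> is the packed number still missing. It decreases with each row
  chosen, so that equidistribution of the whole selection is decided by one comparison of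
  integers.\<close>

fun scan4 :: "int \<Rightarrow> nat list list \<Rightarrow> int list \<Rightarrow> nat list list \<Rightarrow> int list \<Rightarrow> (int \<times> nat list list \<times> int list) list \<Rightarrow> bool" where
  "scan4 x p u q v [] = True"
| "scan4 x p u q v ((c, r, w) # D) = (hit (c = x) p u q v r w \<and> scan4 x p u q v D)"

fun scan3 :: "int \<Rightarrow> nat list list \<Rightarrow> int list \<Rightarrow> choices \<Rightarrow> (int \<times> nat list list \<times> int list) list \<Rightarrow> bool" where
  "scan3 x p u [] D = True"
| "scan3 x p u ((q, v) # C) D = (scan4 (x - hd v) p u q v D \<and> scan3 x p u C D)"

fun scan2 :: "int \<Rightarrow> nat list list \<Rightarrow> int list \<Rightarrow> choices \<Rightarrow> choices \<Rightarrow> (int \<times> nat list list \<times> int list) list \<Rightarrow> bool" where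
  "scan2 x p u [] C D = True"
| "scan2 x p u ((q, v) # B) C D = (scan3 (x - hd v) (p @ q) (vadd u v) C D \<and> scan2 x p u B C D)"

fun scan1 :: "int \<Rightarrow> choices \<Rightarrow> choices \<Rightarrow> choices \<Rightarrow> (int \<times> nat list list \<times> int list) list \<Rightarrow> bool" where
  "scan1 x [] B C D = True"
| "scan1 x ((p, u) # A) B C D = (scan2 (x - hd u) p u B C D \<and> scan1 x A B C D)"

lemma scan4D: "scan4 x p u q v D \<Longrightarrow> (x, r, w) \<in> set D \<Longrightarrow> refuted (p @ q @ r) (vadd u (vadd v w))"
  by (induction x p u q v D rule: scan4.induct) auto

lemma scan3D: "scan3 x p u C D \<Longrightarrow> (q, v) \<in> set C \<Longrightarrow> scan4 (x - hd v) p u q v D"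
  by (induction x p u C D rule: scan3.induct) auto

lemma scan2D: "scan2 x p u B C D \<Longrightarrow> (q, v) \<in> set B \<Longrightarrow> scan3 (x - hd v) (p @ q) (vadd u v) C D"
  by (induction x p u B C D rule: scan2.induct) auto

lemma scan1D: "scan1 x A B C D \<Longrightarrow> (p, u) \<in> set A \<Longrightarrow> scan2 (x - hd u) p u B C D"
  by (induction x A B C D rule: scan1.induct) auto

text \<open>The lexicographic order puts 1234 first in its row and 4321 last in its row, so looking
  at \<open>hd\<close> and \<open>last\<close> restricts the search to sets that contain
  both.\<close>

definition check :: "nat \<Rightarrow> bool" where
  "check t = scan1 (int t * packed_unit)
     (filter (\<lambda>(p, u). hd p = [1, 2, 3, 4]) (row_choices 1 t)) (row_choices 2 t) (row_choices 3 t)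
     (map (\<lambda>(q, v). (hd v, q, v)) (filter (\<lambda>(p, u). last p = [4, 3, 2, 1]) (row_choices 4 t)))"

lemma check_1: "check 1"
  by code_simp

lemma check_2: "check 2"
  by code_simp

lemma check_3: "check 3"
  by code_simp

lemma check_4: "check 4"
  by code_simp

lemma check_5: "check 5"
  by code_simp

lemma check: "t \<in> {1, 2, 3, 4, 5} \<Longrightarrow> check t"
  using check_1 check_2 check_3 check_4 check_5 by blast

text \<open>Base 8 digits for the last entry, the position of 1 and the position of 4. Each of these
  twelve classes has six members, so adding over a set of patterns causes no carry.\<close>

fun packed :: "nat list \<Rightarrow> int" where
  "packed p = sum_list (map (\<lambda>l. of_bool (p ! 3 = l + 1) * 8 ^ l + of_bool (p ! l = 1) * 8 ^ (4 + l) +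
     of_bool (p ! l = 4) * 8 ^ (8 + l)) [0, 1, 2, 3])"

lemma certificate_packed: "list_all (\<lambda>(p, v). length v = 18 \<and> v ! 0 = packed p) certificate"
  by code_simp

lemma tests_valid: "list_all valid_test tests \<and> valid_test klein_test \<and> valid_test ([0], [1], [1])"
  by code_simp

lemma test_tuples_decreasing: "test_tuples ([0], [1], [1]) = [([4, 3, 2, 1], 1)]"
  by code_simp

lemma filter_in_subseqs: "filter P xs \<in> set (subseqs xs)"
  by (induction xs) (auto simp: Let_def)

text \<open>A single decreasing block contains only the pattern 4321, so without it the value of
  this model would be 0.\<close>

lemma forcing_decreasing:
  assumes S: "S \<subseteq> perms 4" "[1, 2, 3, 4] \<in> S" "S \<noteq> perms 4" and forcing: "Sigma_forcing 4 S"
  shows "[4, 3, 2, 1] \<in> S"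
proof -
  have "finite S" using S(1) finite_perms[of 4] by (rule finite_subset)
  then have "0 < card S" using S(2) by (auto simp: card_gt_0_iff)
  moreover have "int (card S) * 1 ^ 4 \<le> 24 * (if [4, 3, 2, 1] \<in> S then 1 else 0)"
    using test_sum_ge[OF S forcing, of "([0], [1], [1])", unfolded test_tuples_decreasing] tests_valid by simp
  ultimately show ?thesis by (auto split: if_splits)
qed

text \<open>By equidistribution the members of \<open>S\<close>, split by first entry, form a
  selection with the packed number sought by \<open>check\<close>. None of its test sums is
  negative, so \<open>check\<close> can have accepted it only as exceptional.\<close>

lemma forcing_exceptional:
  assumes S: "S \<subseteq> perms 4" "[1, 2, 3, 4] \<in> S" "S \<noteq> perms 4" and forcing: "Sigma_forcing 4 S"
  shows "filter (\<lambda>p. p \<in> S) perms4 \<in> set exceptional"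
proof -
  have dist: "distinct perms4" by (simp add: perms4_def)
  have D1: "(\<Sum>l<4. of_bool (q ! i = l + 1)) = (1 :: real)" if "q \<in> perms 4" "i < 4" for q i
  proof -
    have q: "1 \<le> q ! i" "q ! i \<le> 4" using nth_perms[OF that] by auto
    then have "{l \<in> {..<4}. q ! i = l + 1} = {q ! i - 1}" by auto
    then show ?thesis by (simp add: sum_of_bool_eq Int_def)
  qed
  have D2: "(\<Sum>l<4. of_bool (q ! l = v)) = (1 :: real)" if q: "q \<in> perms 4" and v: "1 \<le> v" "v \<le> 4" for q v
  proof -
    have "v \<in> set q" using q v by (auto simp: perms_def permutations_of_set_def)
    then obtain i where i: "i < 4" "q ! i = v" using length_perms[OF q] by (auto simp: in_set_conv_nth)
    have "{l \<in> {..<4}. q ! l = v} = {i}"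
      using inj_on_nth_perms[OF q] i by (auto simp: inj_on_def)
    then show ?thesis by (simp add: sum_of_bool_eq Int_def)
  qed
  note left = edge_counts_eq[OF S forcing edge_ok_left D1]
  note right = edge_counts_eq[OF S forcing edge_ok_right D1]
  note bottom = edge_counts_eq[OF S forcing edge_ok_bottom D2]
  note top = edge_counts_eq[OF S forcing edge_ok_top D2]
  define rows where "rows j = filter (\<lambda>(p, v). hd p = j) certificate" for j :: nat
  define A where "A j = filter (\<lambda>(p, v). p \<in> S) (rows j)" for j
  define t where "t = length (A 1)"
  have hd: "hd p = p ! 0" if "p \<in> set perms4" for p using that by (auto simp: perms4_def)
  have fstA: "map fst (A j) = filter (\<lambda>p. p \<in> S) (filter (\<lambda>p. hd p = j) perms4)" for j
    unfolding A_def rows_def map_fst_certificate[symmetric] filter_map by (simp add: o_def case_prod_beta')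
  have fin: "finite S" using S(1) finite_perms[of 4] by (rule finite_subset)
  have lenA: "real (length (A (Suc l))) = real (card S) / 4" if "l < 4" for l
  proof -
    have "length (A (Suc l)) = length (map fst (A (Suc l)))" by simp
    also have "\<dots> = card {p \<in> perms 4. p ! 0 = l + 1 \<and> p \<in> S}"
      unfolding fstA filter_filter perms_4 distinct_length_filter[OF dist]
      by (rule arg_cong[of _ _ card]) (auto simp: hd)
    also have "real \<dots> = edge_count (\<lambda>l q. q ! 0 = l + 1) S l"
      unfolding edge_count_def of_bool_conj[symmetric] by (simp add: sum_of_bool_eq Int_def conj_commute)
    finally show ?thesis using left[OF _ _ that] by simp
  qed
  have t: "real t = real (card S) / 4" "length (A 1) = t" "length (A 2) = t" "length (A 3) = t" "length (A 4) = t"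
    using lenA[of 0] lenA[of 1] lenA[of 2] lenA[of 3] by (simp_all add: t_def numeral_eq_Suc)
  have "card S < card (perms 4)" using S by (intro psubset_card_mono) auto
  then have "real (card S) < 24" by (simp add: fact_numeral)
  moreover have "0 < card S" using S(2) fin by (auto simp: card_gt_0_iff)
  ultimately have "t < 6" "0 < t" using t(1) by simp_all
  then have "t = 1 \<or> t = 2 \<or> t = 3 \<or> t = 4 \<or> t = 5" by linarith
  then have chk: "check t" by (intro check) auto
  note S4321 = forcing_decreasing[OF S forcing]
  define e where "e ys = (map fst ys, vsum (map snd ys))" for ys :: "(nat list \<times> int list) list"
  have row_choices: "row_choices j t' = map e (filter (\<lambda>ys. length ys = t') (subseqs (rows j)))" for j t'
    unfolding row_choices_def rows_def by (rule map_cong) (simp_all add: e_def)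
  have choice: "e (A j) \<in> set (row_choices j (length (A j)))" for j
    unfolding row_choices set_map set_filter A_def using filter_in_subseqs[of "\<lambda>(p, v). p \<in> S" "rows j"]
    by (intro imageI) simp
  have hdA: "hd (fst (e (A 1))) = [1, 2, 3, 4]"
    unfolding e_def fst_conv fstA using S(2) by (simp add: perms4_def)
  have "filter (\<lambda>p. hd p = 4) perms4 = filter (\<lambda>p. hd p = 4) (butlast perms4) @ [[4, 3, 2, 1]]"
    by (simp add: perms4_def)
  then have lastA: "last (fst (e (A 4))) = [4, 3, 2, 1]"
    unfolding e_def fst_conv fstA using S4321 by simp
  have len18: "length v = 18" "v ! 0 = packed p" if "(p, v) \<in> set certificate" for p v
    using certificate_packed that by (auto simp: list_all_iff)
  define tot where "tot k xs = sum_list (map (\<lambda>v. v ! k) (map snd xs))" for k and xs :: "(nat list \<times> int list) list"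
  have eA: "length (snd (e (A j))) = 18" "k < 18 \<Longrightarrow> snd (e (A j)) ! k = tot k (A j)" for j k
  proof -
    have "length v = 18" if "v \<in> set (map snd (A j))" for v using that len18 by (auto simp: A_def rows_def)
    then have "length (vsum (map snd (A j))) = 18 \<and> (\<forall>k<18. vsum (map snd (A j)) ! k = tot k (A j))"
      unfolding tot_def by (rule vsum_nth)
    then show "length (snd (e (A j))) = 18" "k < 18 \<Longrightarrow> snd (e (A j)) ! k = tot k (A j)"
      by (simp_all add: e_def)
  qed
  let ?U = "vadd (snd (e (A 1))) (snd (e (A 2)))" and ?V = "vadd (snd (e (A 3))) (snd (e (A 4)))"
  have cert_split: "certificate = rows 1 @ rows 2 @ rows 3 @ rows 4" unfolding rows_def by code_simp
  have sum_tot: "tot k (A 1) + tot k (A 2) + (tot k (A 3) + tot k (A 4)) =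
      sum_list (map (\<lambda>(p, v). if p \<in> S then v ! k else 0) certificate)" for k
  proof -
    have 1: "tot k (filter (\<lambda>(p, v). p \<in> S) xs) = sum_list (map (\<lambda>(p, v). if p \<in> S then v ! k else 0) xs)" for xs
      by (induction xs) (auto simp: tot_def)
    show ?thesis unfolding A_def 1 by (subst cert_split) simp
  qed
  \<comment> \<open>The packed numbers of the members are summed digit by digit; each digit collects
    one boundary count, and all twelve counts equal \<open>t\<close>.\<close>
  have hdUV: "hd ?U + hd ?V = int t * packed_unit"
  proof -
    have hd0: "hd xs = xs ! 0" if "length xs = 18" for xs :: "int list" using that by (cases xs) auto
    have "hd ?U + hd ?V = sum_list (map (\<lambda>(p, v). if p \<in> S then v ! 0 else 0) certificate)"
      using sum_tot[of 0] by (simp add: hd0 length_vadd vadd_nth eA)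
    also have "map (\<lambda>(p, v). if p \<in> S then v ! 0 else 0) certificate = map (\<lambda>(p, v). if p \<in> S then packed p else 0) certificate"
      by (rule map_cong[OF refl]) (use len18 in auto)
    also have "\<dots> = map (\<lambda>p. if p \<in> S then packed p else 0) perms4"
      unfolding map_fst_certificate[symmetric] by (simp add: o_def case_prod_beta' del: packed.simps)
    also have "sum_list \<dots> = (\<Sum>p\<in>perms 4. if p \<in> S then packed p else 0)"
      using dist by (simp add: perms_4 sum_list_distinct_conv_sum_set del: packed.simps)
    finally have sumeq: "hd ?U + hd ?V = (\<Sum>p\<in>perms 4. if p \<in> S then packed p else 0)" .
    have s4: "(\<Sum>l<4. f l) = f 0 + f 1 + f 2 + f 3" for f :: "nat \<Rightarrow> real" by (simp add: eval_nat_numeral)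
    have "real_of_int (hd ?U + hd ?V) = (\<Sum>p\<in>perms 4. \<Sum>l<4.
        8 ^ l * (of_bool (p ! 3 = l + 1) * of_bool (p \<in> S)) + 8 ^ (4 + l) * (of_bool (p ! l = 1) * of_bool (p \<in> S)) +
        8 ^ (8 + l) * (of_bool (p ! l = 4) * of_bool (p \<in> S)))" (is "_ = (\<Sum>p\<in>_. \<Sum>l<4. ?g p l)")
      unfolding sumeq of_int_sum
    proof (rule sum.cong[OF refl])
      show "real_of_int (if p \<in> S then packed p else 0) = (\<Sum>l<4. ?g p l)" for p
        unfolding s4 by (cases "p \<in> S") (simp_all add: algebra_simps)
    qed
    also have "\<dots> = (\<Sum>l<4. \<Sum>p\<in>perms 4. ?g p l)" by (rule sum.swap)
    also have "\<dots> = (\<Sum>l<4. 8 ^ l * edge_count (\<lambda>l q. q ! 3 = l + 1) S l + 8 ^ (4 + l) * edge_count (\<lambda>l q. q ! l = 1) S l +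
        8 ^ (8 + l) * edge_count (\<lambda>l q. q ! l = 4) S l)"
      unfolding edge_count_def sum_distrib_left sum.distrib ..
    also have "\<dots> = (\<Sum>l<4. 8 ^ l * real t + 8 ^ (4 + l) * real t + 8 ^ (8 + l) * real t)"
    proof (rule sum.cong[OF refl])
      fix l assume "l \<in> {..<4::nat}"
      then have l: "l < 4" by simp
      have "edge_count (\<lambda>l q. q ! 3 = l + 1) S l = real t" using right[OF _ _ l] t(1) by simp
      moreover have "edge_count (\<lambda>l q. q ! l = 1) S l = real t" using bottom[OF _ _ _ l] t(1) by simp
      moreover have "edge_count (\<lambda>l q. q ! l = 4) S l = real t" using top[OF _ _ _ l] t(1) by simp
      ultimately show "8 ^ l * edge_count (\<lambda>l q. q ! 3 = l + 1) S l + 8 ^ (4 + l) * edge_count (\<lambda>l q. q ! l = 1) S l +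
        8 ^ (8 + l) * edge_count (\<lambda>l q. q ! l = 4) S l = 8 ^ l * real t + 8 ^ (4 + l) * real t + 8 ^ (8 + l) * real t"
        by (simp only:)
    qed
    also have "\<dots> = real t * real_of_int packed_unit" by (simp add: packed_unit_def eval_nat_numeral)
    finally have "real_of_int (hd ?U + hd ?V) = real_of_int (int t * packed_unit)" by simp
    then show ?thesis by (simp only: of_int_eq_iff)
  qed
  \<comment> \<open>Coordinate k + 1 of the total is the sum of the members' entries in column k of
    the tests, the packed number being coordinate 0.\<close>
  have tl: "\<not> list_ex (\<lambda>x. x < 0) (tl (vadd ?U ?V))"
  proof -
    have "0 \<le> tl (vadd ?U ?V) ! k" if k: "k < 17" for k
    proof -
      have k17: "k < length [0..<17]" using k unfolding length_upt diff_zero .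
      have k_upt: "[0..<17] ! k = k" by (rule nth_upt[of 0 k 17, unfolded add_0, OF k])
      have kt: "k < length tests" using k by (simp add: tests_def)
      have "tl (vadd ?U ?V) ! k = vadd ?U ?V ! (k + 1)" by (rule trans[OF nth_tl]) (use k in \<open>simp_all add: length_vadd eA\<close>)
      also have "\<dots> = sum_list (map (\<lambda>(p, v). if p \<in> S then v ! (k + 1) else 0) certificate)"
        using sum_tot[of "k + 1"] k by (simp add: length_vadd vadd_nth eA)
      also have "\<dots> = sum_list (map (\<lambda>(p, v). if p \<in> S then v else 0) (zip perms4 (map (\<lambda>(p, v). v ! (k + 1)) certificate)))"
      proof -
        have "sum_list (map (\<lambda>(p, v). if p \<in> S then v ! (k + 1) else 0) xs) =
          sum_list (map (\<lambda>(p, v). if p \<in> S then v else 0) (zip (map fst xs) (map (\<lambda>(p, v). v ! (k + 1)) xs)))"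
          for xs :: "(nat list \<times> int list) list"
          by (induction xs) auto
        from this[of certificate] show ?thesis unfolding map_fst_certificate .
      qed
      also have "map (\<lambda>(p, v). v ! (k + 1)) certificate = test_column (tests ! k)"
        using arg_cong[OF certificate_columns, of "\<lambda>xs. xs ! k"] unfolding nth_map[OF k17] nth_map[OF kt] k_upt .
      also have "0 \<le> sum_list (map (\<lambda>(p, v). if p \<in> S then v else 0) (zip perms4 (test_column (tests ! k))))"
        by (rule test_column_nonneg[OF S forcing])
          (rule tests_valid[THEN conjunct1, unfolded list_all_length, rule_format, OF kt])
      finally show ?thesis .
    qed
    then have "0 \<le> x" if "x \<in> set (tl (vadd ?U ?V))" for x
      using that by (auto simp: in_set_conv_nth length_vadd eA)
    then show ?thesis by (force simp: list_ex_iff)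
  qed
  have hd_vadd: "hd (vadd u v) = hd u + hd v" if "length u = 18" "length v = 18" for u v
    using that by (cases u; cases v) auto
  have e_eq: "(fst (e ys), snd (e ys)) = e ys" for ys by simp
  have A1: "(fst (e (A 1)), snd (e (A 1))) \<in> set (filter (\<lambda>(p, u). hd p = [1, 2, 3, 4]) (row_choices 1 t))"
    using choice[of 1] hdA t(2) by (simp add: case_prod_beta')
  have A2: "(fst (e (A 2)), snd (e (A 2))) \<in> set (row_choices 2 t)" using choice[of 2] t(3) by simp
  have A3: "(fst (e (A 3)), snd (e (A 3))) \<in> set (row_choices 3 t)" using choice[of 3] t(4) by simp
  have x: "hd (snd (e (A 4))) = int t * packed_unit - hd (snd (e (A 1))) - hd (snd (e (A 2))) - hd (snd (e (A 3)))"
    using hdUV unfolding hd_vadd[OF eA(1) eA(1)] by linarith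
  have "e (A 4) \<in> set (filter (\<lambda>(p, u). last p = [4, 3, 2, 1]) (row_choices 4 t))"
    using choice[of 4] lastA t(5) by (simp add: case_prod_beta')
  then have A4: "(hd (snd (e (A 4))), fst (e (A 4)), snd (e (A 4))) \<in> set (map (\<lambda>(q, v). (hd v, q, v))
      (filter (\<lambda>(p, u). last p = [4, 3, 2, 1]) (row_choices 4 t)))"
    unfolding set_map by (rule rev_image_eqI) (simp add: case_prod_beta')
  have "refuted ((fst (e (A 1)) @ fst (e (A 2))) @ (fst (e (A 3)) @ fst (e (A 4)))) (vadd ?U ?V)"
    using scan4D[OF scan3D[OF scan2D[OF scan1D[OF chk[unfolded check_def] A1] A2] A3] A4[unfolded x]] .
  then have "(fst (e (A 1)) @ fst (e (A 2))) @ (fst (e (A 3)) @ fst (e (A 4))) \<in> set exceptional"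
    using tl by (rule refutedD)
  moreover have "(fst (e (A 1)) @ fst (e (A 2))) @ (fst (e (A 3)) @ fst (e (A 4))) = filter (\<lambda>p. p \<in> S) perms4"
  proof -
    have "perms4 = map fst (rows 1) @ map fst (rows 2) @ map fst (rows 3) @ map fst (rows 4)"
      unfolding map_append[symmetric] cert_split[symmetric] map_fst_certificate ..
    from arg_cong[OF this, of "filter (\<lambda>p. p \<in> S)"]
    have "filter (\<lambda>p. p \<in> S) perms4 = filter (\<lambda>p. p \<in> S) (map fst (rows 1)) @ filter (\<lambda>p. p \<in> S) (map fst (rows 2)) @
      filter (\<lambda>p. p \<in> S) (map fst (rows 3)) @ filter (\<lambda>p. p \<in> S) (map fst (rows 4))"
      by (simp only: filter_append)
    then show ?thesis by (simp add: e_def A_def filter_map o_def case_prod_beta')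
  qed
  ultimately show ?thesis by (simp only:)
qed

section \<open>Conclusion\<close>

lemma exceptional_sets:
  "map set exceptional = [klein, S_aa, S_bb, S_aa \<union> S_bb, set perms4 - S_ba, set perms4 - S_ab]"
  by code_simp

text \<open>The separate test has total weight 30 and gives the set weight 134592; as 24 * 134592 =
  3230208 is less than 4 * 30^4 = 3240000, its density falls short of 1/6.\<close>

lemma klein_not_forcing: "\<not> Sigma_forcing 4 klein"
proof
  assume forcing: "Sigma_forcing 4 klein"
  have "[1, 3, 2, 4] \<in> perms 4" "[1, 3, 2, 4] \<notin> klein" by (simp_all add: perms_4 perms4_def klein_def)
  moreover have "klein \<subseteq> perms 4" by (simp add: perms_4 perms4_def klein_def)
  moreover have "[1, 2, 3, 4] \<in> klein" by (simp add: klein_def)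
  ultimately have S: "klein \<subseteq> perms 4" "[1, 2, 3, 4] \<in> klein" "klein \<noteq> perms 4" by metis+
  have W: "sum_list (snd (snd klein_test)) = 30" by (simp add: klein_test_def)
  have "valid_test klein_test" using tests_valid by blast
  from test_sum_ge[OF S forcing this] have "int (card klein) * 30 ^ 4 \<le> 24 * 134592"
    unfolding W klein_test_sum[folded klein_def] .
  moreover have "card klein = 4" by (simp add: klein_def)
  ultimately show False by simp
qed

lemma forcing_cases:
  assumes S: "S \<subseteq> perms 4" "[1, 2, 3, 4] \<in> S" "S \<noteq> perms 4" and forcing: "Sigma_forcing 4 S"
  shows "S \<in> {S_aa, S_bb, S_aa \<union> S_bb, perms 4 - S_ab, perms 4 - S_ba}"
proof -
  have "S = set (filter (\<lambda>p. p \<in> S) perms4)" using S(1) by (auto simp: perms_4)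
  then have "S \<in> set (map set exceptional)"
    unfolding set_map using forcing_exceptional[OF S forcing] by (rule image_eqI)
  then have "S \<in> {klein, S_aa, S_bb, S_aa \<union> S_bb, perms 4 - S_ba, perms 4 - S_ab}"
    unfolding exceptional_sets by (simp add: perms_4)
  then show ?thesis using klein_not_forcing forcing by blast
qed

text \<open>If the empty set were forcing, then every sequence would be quasirandom and every set forcing.\<close>

lemma not_Sigma_forcing_empty: "\<not> Sigma_forcing 4 {}"
proof
  assume empty: "Sigma_forcing 4 {}"
  have q: "quasirandom X" if "perm_seq X" for X
    using empty that unfolding Sigma_forcing_def by simp
  have S: "{[1, 2, 3, 4]} \<subseteq> perms 4" "[1, 2, 3, 4] \<in> {[1, 2, 3, 4]}" "{[1, 2, 3, 4]} \<noteq> perms 4"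
    unfolding perms_4 by (auto simp: perms4_def)
  have "Sigma_forcing 4 {[1, 2, 3, 4]}"
    unfolding Sigma_forcing_def using q quasirandom_sum_tendsto[OF q S(1)] by blast
  from forcing_decreasing[OF S this] show False by simp
qed

theorem theorem2:
  fixes S :: "nat list set"
  assumes "S \<subseteq> perms 4"
  shows "Sigma_forcing 4 S \<longleftrightarrow>
    (\<exists>T \<in>
       {{[1,2,3,4], [1,2,4,3], [2,1,3,4], [2,1,4,3],
         [3,4,1,2], [3,4,2,1], [4,3,1,2], [4,3,2,1]},
        {[1,2,3,4], [1,4,3,2], [2,1,4,3], [2,3,4,1],
         [3,2,1,4], [3,4,1,2], [4,1,2,3], [4,3,2,1]},
        {[1,3,2,4], [1,3,4,2], [2,4,1,3], [2,4,3,1],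
         [3,1,2,4], [3,1,4,2], [4,2,1,3], [4,2,3,1]},
        {[1,3,2,4], [1,4,2,3], [2,3,1,4], [2,4,1,3],
         [3,1,4,2], [3,2,4,1], [4,1,3,2], [4,2,3,1]},
        {[1,2,3,4], [1,2,4,3], [1,4,3,2], [2,1,3,4],
         [2,1,4,3], [2,3,4,1], [3,2,1,4], [3,4,1,2],
         [3,4,2,1], [4,1,2,3], [4,3,1,2], [4,3,2,1]}}.
       S = T \<or> S = perms 4 - T)"
proof -
  have U: "{[1,2,3,4], [1,2,4,3], [1,4,3,2], [2,1,3,4], [2,1,4,3], [2,3,4,1], [3,2,1,4], [3,4,1,2],
      [3,4,2,1], [4,1,2,3], [4,3,1,2], [4,3,2,1 :: nat]} = S_aa \<union> S_bb"
    unfolding S_aa_def S_bb_def by auto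
  let ?F = "{S_aa, S_bb, S_ab, S_ba, S_aa \<union> S_bb}"
  have sub: "T \<subseteq> perms 4" if "T \<in> ?F" for T using that S_subset_perms4 by auto
  have "Sigma_forcing 4 S \<longleftrightarrow> (\<exists>T\<in>?F. S = T \<or> S = perms 4 - T)"
  proof
    assume forcing: "Sigma_forcing 4 S"
    show "\<exists>T\<in>?F. S = T \<or> S = perms 4 - T"
    proof (cases "[1, 2, 3, 4] \<in> S")
      case True
      \<comment> \<open>The complement of the full set is empty, and complements of forcing sets are
        forcing.\<close>
      have "S \<noteq> perms 4"
        using Sigma_forcing_complement[OF assms forcing] not_Sigma_forcing_empty by auto
      from forcing_cases[OF assms True this forcing] show ?thesis by blast
    next
      case False
      let ?C = "perms 4 - S"
      have C: "S = perms 4 - ?C" using assms by blast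
      have "[1, 2, 3, 4] \<in> ?C" using False by (simp add: perms_4 perms4_def)
      moreover have "?C \<noteq> perms 4" using forcing not_Sigma_forcing_empty C by force
      ultimately have "?C \<in> {S_aa, S_bb, S_aa \<union> S_bb, perms 4 - S_ab, perms 4 - S_ba}"
        using Sigma_forcing_complement[OF assms forcing] by (intro forcing_cases) auto
      moreover have "perms 4 - (perms 4 - T) = T" if "T \<in> ?F" for T using sub[OF that] by blast
      ultimately show ?thesis using C by (elim insertE emptyE) (metis insertI1 insertI2)+
    qed
  next
    assume "\<exists>T\<in>?F. S = T \<or> S = perms 4 - T"
    then obtain T where T: "T \<in> ?F" "S = T \<or> S = perms 4 - T" by blast
    have "Sigma_forcing 4 T" using T(1) Sigma_forcing_sets by auto
    then show "Sigma_forcing 4 S" using T(2) Sigma_forcing_complement[OF sub[OF T(1)]] by blast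
  qed
  then show ?thesis unfolding U S_aa_def[symmetric] S_bb_def[symmetric] S_ab_def[symmetric] S_ba_def[symmetric] .
qed

end
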